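(* Let $n\ge1$, $\sigma>0$, and let $\nu_1=\nu_1(\omega,\varepsilon)$, $\nu_2=\nu_2(\omega,\varepsilon)$ be real frequencies, $C^1$ in $\omega\in(0,2\pi]^n$, satisfying for some positive constants $c,C$ $$c\le|\nu_1|\le C,\qquad c\varepsilon^2\le|\nu_2|\le C\varepsilon^2,\qquad |\partial_\omega\nu_1|,|\partial_\omega\nu_2|\le C\varepsilon^2 .$$ Let $\mathbb{T}^n\times\mathbb{C}^4\ni(\theta,\xi,\eta)\mapsto q(\theta,\xi,\eta)\in\mathbb{C}$ be a polynomial in $(\xi_1,\eta_1,\xi_2,\eta_2)$ homogeneous of degree 2, with coefficients analytic in $\theta\in\mathbb{T}^n_\sigma$, taking real values when $\theta\in\mathbb{T}^n$ and $\eta=\bar\xi$. Consider $$h_\varepsilon(t,\xi,\eta)=\nu_1\xi_1\eta_1+\nu_2\xi_2\eta_2+\varepsilon^3q(\omega t,\xi_1,\eta_1,\xi_2,\eta_2).$$ Then there exist $\varepsilon_*>0$ and $C'>0$ such that for $|\varepsilon|<\varepsilon_*$: there exists a set $\mathcal{E}_\varepsilon\subset(0,2\pi]^n$ with $\mathrm{meas}((0,2\pi]^n\setminus\mathcal{E}_\varepsilon)\le C'\varepsilon^{1/9}$, and for any $\omega\in\mathcal{E}_\varepsilon$ there exists an analytic map $\theta\mapsto A_\omega(\theta)$ with values in Hamiltonian (infinitesimally symplectic) linear maps of $\mathbb{C}^4$ such that the change of coordinates $(\xi',\eta')=e^{A_\omega(\omega t)}(\xi,\eta)$ conjugates the Hamiltonian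 equations of $h_\varepsilon$ to the Hamiltonian equations of $$h_\infty(\xi,\eta)=\tilde\nu_1(\varepsilon)\xi_1\eta_1+\tilde\nu_2(\varepsilon)\xi_2\eta_2,$$ with $|\tilde\nu_j(\varepsilon)-\nu_j|\le C'\varepsilon^3$, $j=1,2$. Finally $A_\omega$ is $\varepsilon$-close to zero.
   Context: $\mathbb{T}^n_\sigma=\{x+\mathrm{i}y: x\in\mathbb{T}^n, y\in\mathbb{R}^n, |y|\le\sigma\}$. The phase space $\mathbb{C}^4\ni(\xi_1,\eta_1,\xi_2,\eta_2)$ carries the symplectic form $\mathrm{i}\,d\xi\wedge d\eta$, with Hamiltonian equations $\dot\xi_j=-\mathrm{i}\partial h/\partial\eta_j$, $\dot\eta_j=\mathrm{i}\partial h/\partial\xi_j$. *)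

theory Defs
  imports "HOL-Analysis.Analysis"
begin

datatype coord = Xi1 | Eta1 | Xi2 | Eta2

lemma UNIV_coord: "(UNIV :: coord set) = {Xi1, Eta1, Xi2, Eta2}"
  using coord.exhaust by blast

instance coord :: finite
  by standard (simp add: UNIV_coord)

type_synonym phase = "complex ^ coord"

definition strip :: "real \<Rightarrow> (complex ^ 'n) set" where
  "strip s = {z. \<forall>i. \<bar>Im (z $ i)\<bar> < s}"

definition cvec :: "real ^ 'n \<Rightarrow> complex ^ 'n" where
  "cvec x = (\<chi> i. complex_of_real (x $ i))"

definition torus_periodic :: "(complex ^ 'n \<Rightarrow> 'a) \<Rightarrow> bool" where
  "torus_periodic f \<longleftrightarrow>
     (\<forall>z i. f (z + (\<chi> j. if j = i then complex_of_real (2 * pi) else 0)) = f z)"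

definition holo_on :: "(complex ^ 'n \<Rightarrow> complex) \<Rightarrow> (complex ^ 'n) set \<Rightarrow> bool" where
  "holo_on f U \<longleftrightarrow> open U \<and>
     (\<forall>z\<in>U. \<exists>c :: complex ^ 'n. (f has_derivative (\<lambda>h. \<Sum>i\<in>UNIV. c $ i * h $ i)) (at z))"

definition freq_box :: "(real ^ 'n) set" where
  "freq_box = {w. \<forall>i. 0 < w $ i \<and> w $ i \<le> 2 * pi}"

definition pderiv_c :: "(phase \<Rightarrow> complex) \<Rightarrow> phase \<Rightarrow> coord \<Rightarrow> complex" where
  "pderiv_c h z k = deriv (\<lambda>w. h (\<chi> j. if j = k then w else z $ j)) (z $ k)"

text \<open>Hamiltonian vector field for the symplectic form i dxi/\deta:
  dxi_j/dt = -i dh/deta_j, deta_j/dt = i dh/dxi_j.\<close>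
definition ham_field :: "(phase \<Rightarrow> complex) \<Rightarrow> phase \<Rightarrow> phase" where
  "ham_field h z = (\<chi> k. case k of
       Xi1 \<Rightarrow> - \<i> * pderiv_c h z Eta1
     | Eta1 \<Rightarrow> \<i> * pderiv_c h z Xi1
     | Xi2 \<Rightarrow> - \<i> * pderiv_c h z Eta2
     | Eta2 \<Rightarrow> \<i> * pderiv_c h z Xi2)"

definition ham_solution :: "(real \<Rightarrow> phase \<Rightarrow> complex) \<Rightarrow> (real \<Rightarrow> phase) \<Rightarrow> bool" where
  "ham_solution h x \<longleftrightarrow> (\<forall>t. (x has_vector_derivative ham_field (h t) (x t)) (at t))"

text \<open>Symplectic form (up to the constant factor i, irrelevant below).\<close>
definition symp :: "phase \<Rightarrow> phase \<Rightarrow> complex" where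
  "symp u v = u $ Xi1 * v $ Eta1 - u $ Eta1 * v $ Xi1 + u $ Xi2 * v $ Eta2 - u $ Eta2 * v $ Xi2"

definition hamiltonian_matrix :: "complex ^ coord ^ coord \<Rightarrow> bool" where
  "hamiltonian_matrix A \<longleftrightarrow> (\<forall>u v. symp (A *v u) v + symp u (A *v v) = 0)"

primrec matpow :: "complex ^ 'n ^ 'n \<Rightarrow> nat \<Rightarrow> complex ^ 'n ^ 'n" where
  "matpow A 0 = mat 1"
| "matpow A (Suc k) = A ** matpow A k"

definition mexp :: "complex ^ 'n ^ 'n \<Rightarrow> complex ^ 'n ^ 'n" where
  "mexp A = (\<Sum>k. (1 / fact k) *\<^sub>R matpow A k)"

end

theory Submission
  imports Defs "HOL-Complex_Analysis.Cauchy_Integral_Formula"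
begin

text \<open>KAM reducibility. For a fixed \<open>\<omega>\<close> the equations are \<open>x' = (D + Q) x\<close> with \<open>D\<close> diagonal and \<open>Q\<close> a
  quasi-periodic matrix of size \<open>\<epsilon>\<^sup>3\<close>. Let \<open>A\<close> solve the homological equation
  \<open>2 (A' + [A, D]) = diag(mean Q) - Q\<close>; its small divisors are controlled off a set of \<open>\<omega>\<close> of small measure,
  and the constant off-diagonal terms by the gap of order \<open>\<epsilon>\<^sup>2\<close> between the eigenvalues of \<open>D\<close>. The Cayley
  transform of \<open>A\<close>, which is symplectic and respects the real structure because \<open>A\<close> is Hamiltonian and real,
  replaces \<open>D\<close> by \<open>D + diag(mean Q)\<close> and \<open>Q\<close> by a remainder of size \<open>R |Q|\<^sup>2\<close>, where \<open>R\<close> is of order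
  \<open>\<epsilon>\<^sup>-\<^sup>2\<close>. With \<open>N\<close> frequencies, the
  divisors of the \<open>n\<close>-th step are kept above a threshold proportional to \<open>\<epsilon> 2\<^sup>-\<^sup>(\<^sup>N\<^sup>+\<^sup>1\<^sup>)\<^sup>n exp (- d\<^sub>n |k|)\<close>, which
  loses a set of \<open>\<omega>\<close> of total measure \<open>O(\<epsilon>)\<close>. Since
  \<open>R |Q| = O(\<epsilon>)\<close>, the product of the transformations converges, to a map at distance \<open>O(\<epsilon>)\<close> from the identity,
  and the logarithm of that map is the generator sought.

  Throughout, quasi-periodic functions of \<open>t\<close> are represented by absolutely summable families of exponentials
  with coefficients that are Lipschitz in \<open>\<omega>\<close> on a set which shrinks at each step; only at the end is the
  limit extended to a holomorphic function of \<open>\<theta>\<close> for each single \<open>\<omega>\<close>.\<close>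

section \<open>Series and the logarithm in Banach algebras\<close>

text \<open>Why the scheme closes: a Lipschitz bound in \<omega> for an inverse divisor costs the
  square of the divisor. For nonzero wave vectors, divisors kept above order \<epsilon> therefore
  have inverses of order \<epsilon>^-2. For the zero wave vector the divisor is an eigenvalue gap of
  order \<epsilon>^2, whose square alone would cost \<epsilon>^-4; it is multiplied by the Lipschitz
  constant of the eigenvalues, of order \<epsilon>^2 by the hypothesis on the derivatives of the
  frequencies. Both cases agree, and \<epsilon>^-2 against a perturbation of order \<epsilon>^3
  leaves O(\<epsilon>). The corrected eigenvalues must vary with \<omega> more slowly than k .
  \<omega>, or the resonant sets of the next step could not be measured. Lipschitz bounds are
  carried along for this, since the remaining parameter sets are merely measurable and have no
  derivatives on them. No Fourier series is truncated: the thresholds decay exponentially in |k|,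
  and the width of analyticity pays for the growth of their inverses. Real and symplectic structure
  together keep the diagonal of the normal form imaginary, so the corrected frequencies are
  real.\<close>

lemma has_derivative_suminf_M:
  fixes f :: "nat \<Rightarrow> 'a::real_normed_vector \<Rightarrow> 'b::banach"
  assumes S: "convex S" and x: "x \<in> S"
    and f': "\<And>n x. x \<in> S \<Longrightarrow> (f n has_derivative f' n x) (at x within S)"
    and M: "\<And>n x h. x \<in> S \<Longrightarrow> norm (f' n x h) \<le> M n * norm h"
    and sM: "summable M"
    and sf: "\<And>x. x \<in> S \<Longrightarrow> summable (\<lambda>n. f n x)"
  shows "((\<lambda>x. \<Sum>n. f n x) has_derivative (\<lambda>h. \<Sum>n. f' n x h)) (at x within S)"
proof -
  have sh: "summable (\<lambda>n. f' n y h)" if "y \<in> S" for y and h :: 'a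
    by (rule summable_comparison_test'[where g = "\<lambda>n. M n * norm h" and N = 0])
       (use M that sM in \<open>auto intro: summable_mult2\<close>)
  have "\<exists>g. \<forall>x\<in>S. (\<lambda>n. f n x) sums (g x) \<and> (g has_derivative (\<lambda>h. \<Sum>n. f' n x h)) (at x within S)"
  proof (rule has_derivative_series[OF S f' _ x])
    fix e :: real assume e: "e > 0"
    have "(\<lambda>n. \<Sum>i<n. M i) \<longlonglongrightarrow> suminf M"
      using sM by (simp add: summable_LIMSEQ)
    then have "\<forall>\<^sub>F n in sequentially. dist (\<Sum>i<n. M i) (suminf M) < e"
      using e tendstoD by blast
    then show "\<forall>\<^sub>F n in sequentially. \<forall>x\<in>S. \<forall>h. norm ((\<Sum>i<n. f' i x h) - (\<Sum>n. f' n x h)) \<le> e * norm h"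
    proof eventually_elim
      case (elim n)
      show ?case
      proof (intro ballI allI)
        fix y and h :: 'a assume y: "y \<in> S"
        have s1: "summable (\<lambda>i. M (i + n) * norm h)"
          using sM by (intro summable_mult2) (simp add: summable_iff_shift)
        have "(\<Sum>n. f' n y h) - (\<Sum>i<n. f' i y h) = (\<Sum>i. f' (i + n) y h)"
          using suminf_minus_initial_segment[OF sh[OF y], of n h] by simp
        then have "norm ((\<Sum>i<n. f' i y h) - (\<Sum>n. f' n y h)) = norm (\<Sum>i. f' (i + n) y h)"
          by (metis norm_minus_commute)
        also have "\<dots> \<le> (\<Sum>i. M (i + n) * norm h)"
          by (rule norm_suminf_le[OF _ s1]) (use M y in auto)
        also have "\<dots> = (\<Sum>i. M (i + n)) * norm h"
          using sM by (simp add: suminf_mult2 summable_iff_shift)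
        also have "(\<Sum>i. M (i + n)) = suminf M - (\<Sum>i<n. M i)"
          by (rule suminf_minus_initial_segment[OF sM])
        also have "(suminf M - (\<Sum>i<n. M i)) * norm h \<le> e * norm h"
          using elim by (intro mult_right_mono) (auto simp: dist_real_def)
        finally show "norm ((\<Sum>i<n. f' i y h) - (\<Sum>n. f' n y h)) \<le> e * norm h" .
      qed
    qed
  next
    show "(\<lambda>n. f n x) sums (\<Sum>n. f n x)" using sf[OF x] by (rule summable_sums)
  qed
  then obtain g where g: "\<And>x. x \<in> S \<Longrightarrow> (\<lambda>n. f n x) sums (g x)"
    "\<And>x. x \<in> S \<Longrightarrow> (g has_derivative (\<lambda>h. \<Sum>n. f' n x h)) (at x within S)" by blast
  show ?thesis
    by (rule has_derivative_transform[OF x _ g(2)[OF x]]) (use g(1) sums_unique in force)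
qed

text \<open>A crude Taylor remainder, from \<open>(n + 2)! >= n!\<close>. It gives both the
  derivative of \<open>exp\<close> at 0 in a noncommutative algebra and the isolation of 0 among the
  solutions of \<open>exp Z = 1\<close>.\<close>

lemma norm_exp_minus_one_minus_id:
  fixes h :: "'a::{real_normed_algebra_1,banach}"
  shows "norm (exp h - 1 - h) \<le> (norm h)\<^sup>2 * exp (norm h)"
proof -
  have s: "summable (\<lambda>n. h ^ n /\<^sub>R fact n)" by (rule summable_exp_generic)
  have "(\<Sum>n. h ^ (n + 2) /\<^sub>R fact (n + 2)) = exp h - (\<Sum>n<2. h ^ n /\<^sub>R fact n)"
    unfolding exp_def by (rule suminf_minus_initial_segment[OF s])
  also have "\<dots> = exp h - 1 - h" by (simp add: numeral_2_eq_2 diff_diff_eq)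
  finally have "norm (exp h - 1 - h) = norm (\<Sum>n. h ^ (n + 2) /\<^sub>R fact (n + 2))" by simp
  also have "\<dots> \<le> (\<Sum>n. (norm h)\<^sup>2 * (norm h ^ n /\<^sub>R fact n))"
  proof (rule norm_suminf_le)
    fix n
    have "norm (h ^ (n + 2) /\<^sub>R fact (n + 2)) \<le> norm h ^ (n + 2) / fact (n + 2)"
      by (simp add: divide_right_mono divide_inverse_commute norm_power_ineq mult_left_mono del: fact_Suc power_Suc power_add)
    also have "\<dots> \<le> norm h ^ (n + 2) / fact n"
      by (intro divide_left_mono fact_mono) auto
    finally show "norm (h ^ (n + 2) /\<^sub>R fact (n + 2)) \<le> (norm h)\<^sup>2 * (norm h ^ n /\<^sub>R fact n)"
      by (simp add: power_add field_simps power2_eq_square)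
  qed (intro summable_mult summable_exp_generic)
  also have "\<dots> = (norm h)\<^sup>2 * exp (norm h)"
    unfolding exp_def by (intro suminf_mult summable_exp_generic)
  finally show ?thesis .
qed

text \<open>If \<open>exp Z = 1\<close>, the remainder estimated above is \<open>- Z\<close>, so a
  nonzero \<open>Z\<close> satisfies 1 <= |Z| exp |Z|; for |Z| <= 1/2 this contradicts exp (1/2) <
  2. This is what turns the product relation of a symplectic matrix near 1 into the sum relation of
  its logarithm.\<close>

lemma exp_eq_one_imp_zero:
  fixes Z :: "'a::{real_normed_algebra_1,banach}"
  assumes "exp Z = 1" "norm Z \<le> 1/2"
  shows "Z = 0"
proof (rule ccontr)
  assume "Z \<noteq> 0"
  have "norm Z \<le> (norm Z)\<^sup>2 * exp (norm Z)"
    using norm_exp_minus_one_minus_id[of Z] assms by simp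
  also have "\<dots> \<le> (norm Z)\<^sup>2 * exp (1/2)" using assms by (intro mult_left_mono) auto
  finally have "1 \<le> norm Z * exp (1/2)" using \<open>Z \<noteq> 0\<close> by (simp add: power2_eq_square)
  also have "\<dots> \<le> 1/2 * exp (1/2)" using assms by (intro mult_right_mono) auto
  finally have "2 \<le> exp (1/2::real)" by simp
  then have "2 * 2 \<le> exp (1/2::real) * exp (1/2)" by (intro mult_mono) auto
  also have "\<dots> = exp 1" by (simp flip: exp_add)
  finally show False using exp_le by linarith
qed

section \<open>The logarithm of \<open>1 + X\<close>\<close>

definition lnp :: "'a::{real_normed_algebra_1,banach} \<Rightarrow> 'a" where
  "lnp X = (\<Sum>k. ((-1) ^ k / real (Suc k)) *\<^sub>R X ^ Suc k)"

lemma norm_lnp_term: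
  fixes X :: "'a::{real_normed_algebra_1,banach}"
  shows "norm (((-1) ^ k / real (Suc k)) *\<^sub>R X ^ Suc k) \<le> norm X ^ Suc k"
proof -
  have "norm (((-1) ^ k / real (Suc k)) *\<^sub>R X ^ Suc k) = (1 / real (Suc k)) * norm (X ^ Suc k)"
    by (simp add: abs_mult power_abs del: power_Suc)
  also have "\<dots> \<le> 1 * norm X ^ Suc k"
    by (intro mult_mono norm_power_ineq) auto
  finally show ?thesis by simp
qed

lemma summable_lnp:
  fixes X :: "'a::{real_normed_algebra_1,banach}"
  assumes "norm X < 1"
  shows "summable (\<lambda>k. ((-1) ^ k / real (Suc k)) *\<^sub>R X ^ Suc k)"
proof (rule summable_comparison_test'[where g = "\<lambda>k. norm X ^ Suc k" and N = 0])
  show "summable (\<lambda>k. norm X ^ Suc k)"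
    using assms by (subst summable_Suc_iff) (auto intro: summable_geometric)
qed (rule norm_lnp_term)

lemma commute_suminf:
  fixes f :: "nat \<Rightarrow> 'a::real_normed_algebra"
  assumes "summable f" "\<And>n. a * f n = f n * a"
  shows "a * suminf f = suminf f * a"
  using suminf_mult[OF assms(1), of a] suminf_mult2[OF assms(1), of a] assms(2) by simp

lemma lnp_commute:
  fixes X :: "'a::{real_normed_algebra_1,banach}"
  assumes "norm X < 1" "a * X = X * a"
  shows "a * lnp X = lnp X * a"
  unfolding lnp_def
proof (rule commute_suminf[OF summable_lnp[OF assms(1)]])
  fix k
  show "a * (((-1) ^ k / real (Suc k)) *\<^sub>R X ^ Suc k) = (((-1) ^ k / real (Suc k)) *\<^sub>R X ^ Suc k) * a"
    using power_commuting_commutes[OF assms(2)[symmetric], of "Suc k"] by (simp del: power_Suc)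
qed

lemma has_derivative_exp_at_zero:
  "(exp has_derivative (\<lambda>h. h)) (at (0::'a::{real_normed_algebra_1,banach}))"
  unfolding has_derivative_at
proof
  have "((\<lambda>h::'a. norm h * exp (norm h)) \<longlongrightarrow> norm (0::'a) * exp (norm (0::'a))) (at 0)"
    by (intro tendsto_intros)
  then have lim: "((\<lambda>h::'a. norm h * exp (norm h)) \<longlongrightarrow> 0) (at 0)" by simp
  show "(\<lambda>h::'a. norm (exp (0 + h) - exp 0 - h) / norm h) \<midarrow>0\<rightarrow> 0"
  proof (rule tendsto_sandwich[OF _ _ tendsto_const lim])
    show "\<forall>\<^sub>F h::'a in at 0. norm (exp (0 + h) - exp 0 - h) / norm h \<le> norm h * exp (norm h)"
      using norm_exp_minus_one_minus_id
      by (intro always_eventually allI) (auto simp: divide_simps power2_eq_square mult_ac)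
  qed auto
qed auto

text \<open>Commutation gives exp (l s) = exp (l t) exp (l s - l t), so that only the derivative of
  \<open>exp\<close> at 0 enters. For noncommuting values the formula fails in general.\<close>

lemma has_vector_derivative_exp_commuting:
  fixes l :: "real \<Rightarrow> 'a::{real_normed_algebra_1,banach}"
  assumes d: "(l has_vector_derivative l') (at t within S)" and t: "t \<in> S"
    and c: "\<And>s. s \<in> S \<Longrightarrow> l s * l t = l t * l s"
  shows "((\<lambda>s. exp (l s)) has_vector_derivative exp (l t) * l') (at t within S)"
proof -
  have 1: "((\<lambda>s. l s - l t) has_derivative (\<lambda>h. h *\<^sub>R l')) (at t within S)"
    using d unfolding has_vector_derivative_def by (auto intro!: derivative_eq_intros)
  have "((\<lambda>s. exp (l s - l t)) has_derivative (\<lambda>h. h *\<^sub>R l')) (at t within S)"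
    by (rule has_derivative_compose[OF 1, where g = exp and g' = "\<lambda>h. h"]) (simp add: has_derivative_exp_at_zero)
  then have 2: "((\<lambda>s. exp (l t) * exp (l s - l t)) has_derivative (\<lambda>h. exp (l t) * (h *\<^sub>R l'))) (at t within S)"
    by (rule has_derivative_mult_right)
  have "exp (l s) = exp (l t) * exp (l s - l t)" if "s \<in> S" for s
    by (subst exp_add_commuting[symmetric]) (auto simp: algebra_simps c that)
  with t have "((\<lambda>s. exp (l s)) has_derivative (\<lambda>h. exp (l t) * (h *\<^sub>R l'))) (at t within S)"
    by (intro has_derivative_transform[OF _ _ 2])
  then show ?thesis unfolding has_vector_derivative_def by simp
qed

text \<open>Along the ray from 0 to \<open>X\<close> the product of 1 + tX and exp (- log (1 + tX))
  is constant: the logarithm has derivative (1 + tX)^-1 X and all factors commute. Comparing the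
  ends of the ray avoids composing the two power series.\<close>

theorem exp_lnp:
  fixes X :: "'a::{real_normed_algebra_1,banach}"
  assumes X: "norm X < 1"
  shows "exp (lnp X) = 1 + X"
proof -
  define l where "l t = lnp (t *\<^sub>R X)" for t :: real
  \<comment> \<open>Neumann series of the inverse of \<open>1 + t *\<^sub>R X\<close>;
    differentiating the logarithm term by term produces \<open>R t * X\<close>.\<close>
  define R where "R t = (\<Sum>k. (- (t *\<^sub>R X)) ^ k)" for t :: real
  have nt: "norm (t *\<^sub>R X) < 1" if "t \<in> {0..1}" for t :: real
  proof -
    have "\<bar>t\<bar> * norm X \<le> 1 * norm X" using that by (intro mult_right_mono) auto
    then show ?thesis using X by simp
  qed
  have lX: "l t * X = X * l t" if "t \<in> {0..1}" for t
    unfolding l_def using lnp_commute[OF nt[OF that], of X] by simp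
  have comm: "l s * l t = l t * l s" if "s \<in> {0..1}" "t \<in> {0..1}" for s t
    using lnp_commute[OF nt[OF that(2)], of "l s"] lX[OF that(1)] by (simp add: l_def)
  have sR: "summable (\<lambda>k. (- (t *\<^sub>R X)) ^ k)" if "t \<in> {0..1}" for t
    using complete_algebra_summable_geometric[of "- (t *\<^sub>R X)"] nt[OF that] by simp
  have R: "(1 + t *\<^sub>R X) * R t = 1" if "t \<in> {0..1}" for t
  proof -
    have "(- (t *\<^sub>R X)) * R t = (\<Sum>k. (- (t *\<^sub>R X)) ^ Suc k)"
      unfolding R_def using suminf_mult[OF sR[OF that], of "- (t *\<^sub>R X)"] by simp
    also have "\<dots> = R t - 1"
      unfolding R_def using suminf_split_head[OF sR[OF that]] by simp
    finally show ?thesis by (simp add: algebra_simps)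
  qed
  have ld: "(l has_vector_derivative R t * X) (at t within {0..1})" if t: "t \<in> {0..1}" for t
  proof -
    have "((\<lambda>s. \<Sum>k. ((-1) ^ k / real (Suc k)) *\<^sub>R (s *\<^sub>R X) ^ Suc k) has_derivative
        (\<lambda>h. \<Sum>k. (h * (- t) ^ k) *\<^sub>R X ^ Suc k)) (at t within {0..1})"
    proof (rule has_derivative_suminf_M[where M = "\<lambda>k. norm X ^ Suc k"])
      fix n and x :: real
      have "((\<lambda>s. ((-1) ^ n / real (Suc n) * s ^ Suc n) *\<^sub>R X ^ Suc n) has_derivative
        (\<lambda>h. (h * (- x) ^ n) *\<^sub>R X ^ Suc n)) (at x within {0..1})"
        by (rule derivative_eq_intros refl | simp)+
           (auto simp: field_simps power_minus[of x])
      moreover have "((-1) ^ n / real (Suc n) * s ^ Suc n) *\<^sub>R X ^ Suc n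
          = ((-1) ^ n / real (Suc n)) *\<^sub>R (s *\<^sub>R X) ^ Suc n" for s
        by (simp add: scaleR_power del: power_Suc)
      ultimately show "((\<lambda>s. ((-1) ^ n / real (Suc n)) *\<^sub>R (s *\<^sub>R X) ^ Suc n) has_derivative
        (\<lambda>h. (h * (- x) ^ n) *\<^sub>R X ^ Suc n)) (at x within {0..1})" by (simp only:)
    next
      fix n and x h :: real assume x: "x \<in> {0..1}"
      have "norm ((h * (- x) ^ n) *\<^sub>R X ^ Suc n) = \<bar>h\<bar> * \<bar>x\<bar> ^ n * norm (X ^ Suc n)"
        by (simp add: abs_mult power_abs del: power_Suc)
      also have "\<dots> \<le> \<bar>h\<bar> * 1 * norm X ^ Suc n"
        using x by (intro mult_mono norm_power_ineq power_le_one) auto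
      finally show "norm ((h * (- x) ^ n) *\<^sub>R X ^ Suc n) \<le> norm X ^ Suc n * norm h"
        by (simp add: mult_ac)
    next
      show "summable (\<lambda>k. norm X ^ Suc k)"
        using X by (subst summable_Suc_iff) (auto intro: summable_geometric)
    qed (use t summable_lnp[OF nt] in auto)
    moreover have "(\<Sum>k. (h * (- t) ^ k) *\<^sub>R X ^ Suc k) = h *\<^sub>R (R t * X)" for h
    proof -
      have "(\<Sum>k. h *\<^sub>R ((- (t *\<^sub>R X)) ^ k * X)) = h *\<^sub>R (R t * X)"
        unfolding R_def using sR[OF t]
        by (subst suminf_scaleR_right[symmetric]) (auto intro: summable_mult2 simp: suminf_mult2)
      moreover have "h *\<^sub>R ((- (t *\<^sub>R X)) ^ k * X) = (h * (- t) ^ k) *\<^sub>R X ^ Suc k" for k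
      proof -
        have "- (t *\<^sub>R X) = (- t) *\<^sub>R X" by simp
        then have "(- (t *\<^sub>R X)) ^ k = (- t) ^ k *\<^sub>R X ^ k" by (simp only: scaleR_power)
        then show ?thesis by (simp add: power_commutes)
      qed
      ultimately show ?thesis by simp
    qed
    ultimately show ?thesis
      unfolding has_vector_derivative_def l_def lnp_def by simp
  qed
  define g where "g t = (1 + t *\<^sub>R X) * exp (- l t)" for t
  have gd: "(g has_vector_derivative 0) (at t within {0..1})" if t: "t \<in> {0..1}" for t
  proof -
    have "((\<lambda>t. exp (- l t)) has_vector_derivative exp (- l t) * (- (R t * X))) (at t within {0..1})"
      using t comm ld[OF t] by (intro has_vector_derivative_exp_commuting) (auto intro!: derivative_eq_intros)
    then have "(g has_vector_derivative (1 + t *\<^sub>R X) * (exp (- l t) * (- (R t * X))) + X * exp (- l t)) (at t within {0..1})"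
      unfolding g_def by (auto intro!: derivative_eq_intros)
    moreover have "(1 + t *\<^sub>R X) * (exp (- l t) * (- (R t * X))) + X * exp (- l t) = 0"
    proof -
      have c1: "exp (- l t) * X = X * exp (- l t)" 
        unfolding exp_def
        by (rule sym, rule commute_suminf[OF summable_exp_generic])
           (use power_commuting_commutes[of "- l t" X] lX[OF t] in auto)
      have "(1 + t *\<^sub>R X) * exp (- l t) = exp (- l t) * (1 + t *\<^sub>R X)"
        using c1 by (simp add: algebra_simps)
      then have "(1 + t *\<^sub>R X) * (exp (- l t) * (- (R t * X))) = - (exp (- l t) * ((1 + t *\<^sub>R X) * R t) * X)"
        by (metis mult.assoc mult_minus_right)
      also have "\<dots> = - (exp (- l t) * X)" using R[OF t] by simp
      finally show ?thesis using c1 by simp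
    qed
    ultimately show ?thesis by simp
  qed
  obtain c where c: "\<And>t. t \<in> {0..1} \<Longrightarrow> g t = c"
    using has_vector_derivative_zero_constant[of "{0..1}" g] gd by auto
  have "lnp 0 = (0::'a)" unfolding lnp_def by simp
  then have "g 0 = 1" by (simp add: g_def l_def)
  then have "g 1 = 1" using c[of 0] c[of 1] by simp
  then have "(1 + X) * exp (- lnp X) = 1" by (simp add: g_def l_def)
  then have "(1 + X) * (exp (- lnp X) * exp (lnp X)) = exp (lnp X)" by (metis mult.assoc mult_1)
  then show ?thesis using exp_minus_inverse[of "- lnp X"] by simp
qed

section \<open>The Banach algebra of complex square matrices\<close>

text \<open>The library type \<open>complex ^ 'm ^ 'm\<close> carries neither the matrix product as its multiplication nor a
  submultiplicative norm, hence a separate type.\<close>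
typedef 'm sqmat = "UNIV :: ('m::finite \<Rightarrow> 'm \<Rightarrow> complex) set"
  morphisms ent Mat by simp

lemma ent_Mat [simp]: "ent (Mat f) = f"
  by (simp add: Mat_inverse)

lemma sqmat_eqI: "(\<And>i j. ent A i j = ent B i j) \<Longrightarrow> A = B"
  by (metis ent_inverse ext)

instantiation sqmat :: (finite) ring_1
begin
definition "0 = Mat (\<lambda>i j. 0)"
definition "1 = Mat (\<lambda>i j. if i = j then 1 else 0)"
definition "A + B = Mat (\<lambda>i j. ent A i j + ent B i j)"
definition "A - B = Mat (\<lambda>i j. ent A i j - ent B i j)"
definition "- A = Mat (\<lambda>i j. - ent A i j)"
definition "A * B = Mat (\<lambda>i j. \<Sum>k\<in>UNIV. ent A i k * ent B k j)"

lemma ent_simps0: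
  "ent 0 i j = 0" "ent 1 i j = (if i = j then 1 else 0)" "ent (A + B) i j = ent A i j + ent B i j"
  "ent (A - B) i j = ent A i j - ent B i j" "ent (- A) i j = - ent A i j"
  "ent (A * B) i j = (\<Sum>k\<in>UNIV. ent A i k * ent B k j)"
  by (simp_all add: zero_sqmat_def one_sqmat_def plus_sqmat_def minus_sqmat_def uminus_sqmat_def times_sqmat_def)

instance
proof
  fix A B C :: "'a sqmat"
  show "A * B * C = A * (B * C)"
  proof (rule sqmat_eqI)
    fix i j
    have "ent (A * B * C) i j = (\<Sum>k\<in>UNIV. \<Sum>l\<in>UNIV. ent A i l * ent B l k * ent C k j)"
      by (simp add: ent_simps0 sum_distrib_right)
    also have "\<dots> = (\<Sum>l\<in>UNIV. \<Sum>k\<in>UNIV. ent A i l * ent B l k * ent C k j)"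
      by (rule sum.swap)
    also have "\<dots> = ent (A * (B * C)) i j"
      by (simp add: ent_simps0 sum_distrib_left mult.assoc)
    finally show "ent (A * B * C) i j = ent (A * (B * C)) i j" .
  qed
  have "ent (0::'a sqmat) undefined undefined \<noteq> ent 1 undefined undefined" by (simp add: ent_simps0)
  then show "(0::'a sqmat) \<noteq> 1" by metis
qed (auto intro!: sqmat_eqI simp: ent_simps0 sum.distrib algebra_simps if_distrib if_distribR cong: if_cong)
end

instantiation sqmat :: (finite) real_algebra_1
begin
definition "r *\<^sub>R A = Mat (\<lambda>i j. r *\<^sub>R ent A i j)"

lemma ent_scaleR: "ent (r *\<^sub>R A) i j = r *\<^sub>R ent A i j"
  by (simp add: scaleR_sqmat_def)

instance
  by standard (auto intro!: sqmat_eqI simp: ent_simps0 ent_scaleR algebra_simps sum_distrib_left scaleR_sum_right)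
end

instantiation sqmat :: (finite) real_normed_algebra_1
begin
text \<open>The operator norm for the supremum norm on vectors, hence submultiplicative with
  \<open>norm 1 = 1\<close>. The Euclidean norm of the entries would give the square root of the
  dimension for the identity.\<close>

definition "norm A = (MAX i. \<Sum>j\<in>UNIV. norm (ent A i j))"
definition "dist A B = norm (A - B :: 'a sqmat)"
definition "sgn A = A /\<^sub>R norm (A :: 'a sqmat)"
definition "uniformity = (INF e\<in>{0<..}. principal {(A, B :: 'a sqmat). dist A B < e})"
definition "open U = (\<forall>x\<in>U. eventually (\<lambda>(x', y). x' = x \<longrightarrow> (y :: 'a sqmat) \<in> U) uniformity)"

lemma sqmat_row_sum_le_norm: "(\<Sum>j\<in>UNIV. norm (ent A i j)) \<le> norm A"
  unfolding norm_sqmat_def by (rule Max_ge) auto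

lemma sqmat_norm_le_iff: "norm A \<le> r \<longleftrightarrow> (\<forall>i. (\<Sum>j\<in>UNIV. norm (ent A i j)) \<le> r)"
  unfolding norm_sqmat_def by (subst Max_le_iff) auto

lemma norm_ent_le: "norm (ent A i j) \<le> norm A"
  using member_le_sum[of j UNIV "\<lambda>j. norm (ent A i j)"] sqmat_row_sum_le_norm[of A i] by auto

instance
proof
  fix A B :: "'a sqmat" and r s :: real
  show tri: "norm (A + B) \<le> norm A + norm B"
    unfolding sqmat_norm_le_iff[of "A + B"]
  proof
    fix i
    have "(\<Sum>j\<in>UNIV. norm (ent (A + B) i j)) \<le> (\<Sum>j\<in>UNIV. norm (ent A i j)) + (\<Sum>j\<in>UNIV. norm (ent B i j))"
      unfolding sum.distrib[symmetric] by (intro sum_mono) (auto simp: ent_simps0 norm_triangle_ineq)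
    also have "\<dots> \<le> norm A + norm B" by (intro add_mono sqmat_row_sum_le_norm)
    finally show "(\<Sum>j\<in>UNIV. norm (ent (A + B) i j)) \<le> norm A + norm B" .
  qed
  show "norm (A * B) \<le> norm A * norm B"
    unfolding sqmat_norm_le_iff[of "A * B"]
  proof
    fix i
    have "(\<Sum>j\<in>UNIV. norm (ent (A * B) i j)) \<le> (\<Sum>j\<in>UNIV. \<Sum>k\<in>UNIV. norm (ent A i k) * norm (ent B k j))"
      by (intro sum_mono sum_norm_le) (auto simp: ent_simps0 norm_mult intro!: order_trans[OF norm_sum])
    also have "\<dots> = (\<Sum>k\<in>UNIV. norm (ent A i k) * (\<Sum>j\<in>UNIV. norm (ent B k j)))"
      by (subst sum.swap) (simp add: sum_distrib_left)
    also have "\<dots> \<le> (\<Sum>k\<in>UNIV. norm (ent A i k) * norm B)"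
      by (intro sum_mono mult_left_mono sqmat_row_sum_le_norm) auto
    also have "\<dots> \<le> norm A * norm B"
      unfolding sum_distrib_right[symmetric]
      by (intro mult_right_mono sqmat_row_sum_le_norm) (metis norm_ent_le norm_ge_zero order_trans)
    finally show "(\<Sum>j\<in>UNIV. norm (ent (A * B) i j)) \<le> norm A * norm B" .
  qed
  show "norm (1 :: 'a sqmat) = 1"
    unfolding norm_sqmat_def by (simp add: ent_simps0 if_distrib cong: if_cong)
  have "norm A = 0 \<Longrightarrow> ent A i j = 0" for i j
    using norm_ent_le[of A i j] by simp
  then show "(norm A = 0) = (A = 0)"
    by (auto intro!: sqmat_eqI simp: ent_simps0) (simp add: norm_sqmat_def ent_simps0 image_constant_conv)
  have sc: "norm (r *\<^sub>R A) \<le> \<bar>r\<bar> * norm A" for r and A :: "'a sqmat"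
    unfolding sqmat_norm_le_iff[of "r *\<^sub>R A"]
    by (auto simp: ent_scaleR norm_mult sum_distrib_left[symmetric] intro!: mult_left_mono sqmat_row_sum_le_norm)
  show "norm (r *\<^sub>R A) = \<bar>r\<bar> * norm A"
  proof (cases "r = 0")
    case True
    have "norm (0 :: 'a sqmat) = 0" by (simp add: norm_sqmat_def ent_simps0 image_constant_conv)
    with True show ?thesis by simp
  next
    case False
    have "norm A \<le> \<bar>1 / r\<bar> * norm (r *\<^sub>R A)"
      using sc[of "1 / r" "r *\<^sub>R A"] False by simp
    then show ?thesis using sc[of r A] False by (simp add: field_simps abs_if split: if_splits)
  qed
qed (auto simp: dist_sqmat_def sgn_sqmat_def uniformity_sqmat_def open_sqmat_def)
end

lemmas ent_simps = ent_simps0 ent_scaleR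

lemma ent_sum: "ent (\<Sum>x\<in>S. f x) i j = (\<Sum>x\<in>S. ent (f x) i j)"
  by (induction S rule: infinite_finite_induct) (auto simp: ent_simps)

lemma bounded_linear_ent: "bounded_linear (\<lambda>A. ent A i j)"
  by (rule bounded_linear_intro[where K = 1]) (auto simp: ent_simps norm_ent_le)

lemma sqmat_norm_le_sum: "norm A \<le> (\<Sum>i\<in>UNIV. \<Sum>j\<in>UNIV. norm (ent A i j))"
  unfolding sqmat_norm_le_iff
  by (auto intro!: member_le_sum[where f = "\<lambda>i. \<Sum>j\<in>UNIV. norm (ent A i j)"] sum_nonneg)

instance sqmat :: (finite) banach
proof
  fix X :: "nat \<Rightarrow> 'a sqmat"
  assume X: "Cauchy X"
  have "Cauchy (\<lambda>n. ent (X n) i j)" for i j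
    using bounded_linear.Cauchy[OF bounded_linear_ent X] .
  then have "\<exists>l. (\<lambda>n. ent (X n) i j) \<longlonglongrightarrow> l" for i j
    using Cauchy_convergent convergent_def by blast
  then obtain l where l: "\<And>i j. (\<lambda>n. ent (X n) i j) \<longlonglongrightarrow> l i j" by metis
  have "(\<lambda>n. \<Sum>i\<in>UNIV. \<Sum>j\<in>UNIV. norm (ent (X n) i j - l i j)) \<longlonglongrightarrow> (\<Sum>i\<in>UNIV. \<Sum>j\<in>(UNIV::'a set). norm (l i j - l i j))"
    by (intro tendsto_intros l)
  then have lim: "(\<lambda>n. \<Sum>i\<in>UNIV. \<Sum>j\<in>UNIV. norm (ent (X n) i j - l i j)) \<longlonglongrightarrow> 0" by simp
  have "(\<lambda>n. X n - Mat l) \<longlonglongrightarrow> 0"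
    by (rule Lim_null_comparison[OF _ lim])
       (use sqmat_norm_le_sum[of "X _ - Mat l"] in \<open>auto simp: ent_simps\<close>)
  then show "convergent X"
    unfolding convergent_def using LIM_zero_cancel by blast
qed

lemma ent_suminf: "summable f \<Longrightarrow> ent (suminf f) i j = (\<Sum>n. ent (f n) i j)"
  by (rule bounded_linear.suminf[OF bounded_linear_ent])

text \<open>Expanding in the finite real basis of the matrix units \<open>U i j\<close> and
  \<open>V i j\<close> leaves real coefficient functions times fixed matrices.\<close>

lemma sqmat_has_vector_derivativeI:
  assumes "\<And>i j. ((\<lambda>t. ent (F t) i j) has_vector_derivative ent F' i j) (at t within S)"
  shows "(F has_vector_derivative F') (at t within S)"
proof -
  define U where "U i j = (Mat (\<lambda>k l. if k = i \<and> l = j then 1 else 0) :: 'a sqmat)" for i j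
  define V where "V i j = (Mat (\<lambda>k l. if k = i \<and> l = j then \<i> else 0) :: 'a sqmat)" for i j
  have rep: "A = (\<Sum>i\<in>UNIV. \<Sum>j\<in>UNIV. Re (ent A i j) *\<^sub>R U i j + Im (ent A i j) *\<^sub>R V i j)" for A :: "'a sqmat"
  proof (rule sqmat_eqI)
    fix k l
    have "ent (Re a *\<^sub>R U i j + Im a *\<^sub>R V i j) k l = (if k = i then if l = j then a else 0 else 0)" for a i j
      by (simp add: ent_simps U_def V_def complex_eq_iff)
    then have "ent (\<Sum>i\<in>UNIV. \<Sum>j\<in>UNIV. Re (ent A i j) *\<^sub>R U i j + Im (ent A i j) *\<^sub>R V i j) k l
      = (\<Sum>i\<in>UNIV. \<Sum>j\<in>UNIV. if k = i then if l = j then ent A i j else 0 else 0)"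
      by (simp only: ent_sum)
    also have "\<dots> = (\<Sum>i\<in>UNIV. if k = i then (\<Sum>j\<in>UNIV. if l = j then ent A i j else 0) else 0)"
      by (intro sum.cong refl) auto
    also have "\<dots> = ent A k l" by (simp only: sum.delta' finite UNIV_I if_True)
    finally show "ent A k l = ent (\<Sum>i\<in>UNIV. \<Sum>j\<in>UNIV. Re (ent A i j) *\<^sub>R U i j + Im (ent A i j) *\<^sub>R V i j) k l" by simp
  qed
  have "((\<lambda>t. \<Sum>i\<in>UNIV. \<Sum>j\<in>UNIV. Re (ent (F t) i j) *\<^sub>R U i j + Im (ent (F t) i j) *\<^sub>R V i j) has_vector_derivative
     (\<Sum>i\<in>UNIV. \<Sum>j\<in>UNIV. Re (ent F' i j) *\<^sub>R U i j + Im (ent F' i j) *\<^sub>R V i j)) (at t within S)"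
  proof (intro has_vector_derivative_sum has_vector_derivative_add)
    fix i j
    have "((\<lambda>t. Re (ent (F t) i j)) has_vector_derivative Re (ent F' i j)) (at t within S)"
      by (rule bounded_linear.has_vector_derivative[OF bounded_linear_Re assms])
    from bounded_linear.has_vector_derivative[OF bounded_linear_scaleR_left[of "U i j"] this]
    show "((\<lambda>t. Re (ent (F t) i j) *\<^sub>R U i j) has_vector_derivative Re (ent F' i j) *\<^sub>R U i j) (at t within S)" .
    have "((\<lambda>t. Im (ent (F t) i j)) has_vector_derivative Im (ent F' i j)) (at t within S)"
      by (rule bounded_linear.has_vector_derivative[OF bounded_linear_Im assms])
    from bounded_linear.has_vector_derivative[OF bounded_linear_scaleR_left[of "V i j"] this]
    show "((\<lambda>t. Im (ent (F t) i j) *\<^sub>R V i j) has_vector_derivative Im (ent F' i j) *\<^sub>R V i j) (at t within S)" .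
  qed
  then show ?thesis by (simp only: rep[symmetric])
qed

text \<open>Everything rests on the resolvent identity g s - g t = - g s (f s - f t) g t. The
  uniform bound \<open>B\<close> on the inverses first yields continuity of \<open>g\<close>, and
  continuity then identifies the derivative.\<close>

lemma has_vector_derivative_inverse_algebra:
  fixes f g :: "real \<Rightarrow> 'a::real_normed_algebra_1"
  assumes f: "(f has_vector_derivative f') (at t)"
    and inv: "\<And>s. f s * g s = 1" "\<And>s. g s * f s = 1"
    and bd: "\<And>s. norm (g s) \<le> B"
  shows "(g has_vector_derivative - (g t * f' * g t)) (at t)"
proof -
  have diff: "g s - g t = - (g s * (f s - f t) * g t)" for s
  proof -
    have "g s * (f s - f t) * g t = g s * f s * g t - g s * (f t * g t)" by (simp add: algebra_simps)
    then show ?thesis by (simp add: inv)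
  qed
  have cf: "(f \<longlongrightarrow> f t) (at t)"
    using f has_vector_derivative_continuous continuous_within by blast
  have "((\<lambda>s. B * norm (f s - f t) * norm (g t)) \<longlongrightarrow> B * norm (f t - f t) * norm (g t)) (at t)"
    by (intro tendsto_intros cf)
  then have l0: "((\<lambda>s. B * norm (f s - f t) * norm (g t)) \<longlongrightarrow> 0) (at t)" by simp
  have "((\<lambda>s. g s - g t) \<longlongrightarrow> 0) (at t)"
  proof (rule Lim_null_comparison[OF _ l0], intro always_eventually allI)
    fix s
    have "norm (g s - g t) \<le> norm (g s) * norm (f s - f t) * norm (g t)"
      unfolding diff norm_minus_cancel
      by (intro order_trans[OF norm_mult_ineq] mult_right_mono norm_mult_ineq) auto
    also have "\<dots> \<le> B * norm (f s - f t) * norm (g t)"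
      by (intro mult_right_mono bd) auto
    finally show "norm (g s - g t) \<le> B * norm (f s - f t) * norm (g t)" .
  qed
  then have cg: "(g \<longlongrightarrow> g t) (at t)" by (rule LIM_zero_cancel)
  have cg0: "((\<lambda>h. g (t + h)) \<longlongrightarrow> g t) (at 0)" using cg by (rule LIM_offset_zero)
  have fd: "((\<lambda>h. norm (f (t + h) - f t - h *\<^sub>R f') / norm h) \<longlongrightarrow> 0) (at 0)"
    using f unfolding has_vector_derivative_def has_derivative_at by blast
  have "((\<lambda>h. B * (norm (f (t + h) - f t - h *\<^sub>R f') / norm h) * norm (g t)
      + norm (g (t + h) - g t) * norm (f' * g t)) \<longlongrightarrow> B * 0 * norm (g t) + norm (g t - g t) * norm (f' * g t)) (at 0)"
    by (intro tendsto_intros fd cg0)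
  then have l1: "((\<lambda>h. B * (norm (f (t + h) - f t - h *\<^sub>R f') / norm h) * norm (g t)
      + norm (g (t + h) - g t) * norm (f' * g t)) \<longlongrightarrow> 0) (at 0)" by simp
  show ?thesis
    unfolding has_vector_derivative_def has_derivative_at
  proof
    show "bounded_linear (\<lambda>h. h *\<^sub>R - (g t * f' * g t))" by (rule bounded_linear_scaleR_left)
    show "((\<lambda>h. norm (g (t + h) - g t - h *\<^sub>R - (g t * f' * g t)) / norm h) \<longlongrightarrow> 0) (at 0)"
    proof (rule Lim_null_comparison[OF _ l1], intro always_eventually allI)
      fix h :: real
      define d where "d = f (t + h) - f t"
      have e: "g (t + h) - g t = - (g (t + h) * d * g t)" unfolding d_def by (rule diff)
      have "g (t + h) - g t - h *\<^sub>R - (g t * f' * g t) = - (g (t + h) * d * g t) - h *\<^sub>R - (g t * f' * g t)"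
        by (simp only: e)
      also have "\<dots> = - (g (t + h) * (f (t + h) - f t - h *\<^sub>R f') * g t) - h *\<^sub>R ((g (t + h) - g t) * (f' * g t))"
        unfolding d_def[symmetric] by (simp add: algebra_simps)
      finally have "norm (g (t + h) - g t - h *\<^sub>R - (g t * f' * g t)) = norm (- (g (t + h) * (f (t + h) - f t - h *\<^sub>R f') * g t) - h *\<^sub>R ((g (t + h) - g t) * (f' * g t)))"
        by (rule arg_cong)
      also have "\<dots> \<le> norm (g (t + h) * (f (t + h) - f t - h *\<^sub>R f') * g t) + norm (h *\<^sub>R ((g (t + h) - g t) * (f' * g t)))"
        by (metis norm_minus_cancel norm_triangle_ineq4)
      also have "\<dots> \<le> B * norm (f (t + h) - f t - h *\<^sub>R f') * norm (g t) + \<bar>h\<bar> * (norm (g (t + h) - g t) * norm (f' * g t))"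
        unfolding norm_scaleR
        by (intro add_mono mult_left_mono norm_mult_ineq order_trans[OF norm_mult_ineq] mult_right_mono
            order_trans[OF norm_mult_ineq mult_right_mono[OF bd]]) auto
      finally have n: "norm (g (t + h) - g t - h *\<^sub>R - (g t * f' * g t))
        \<le> B * norm (f (t + h) - f t - h *\<^sub>R f') * norm (g t) + \<bar>h\<bar> * (norm (g (t + h) - g t) * norm (f' * g t))" .
      show "norm (norm (g (t + h) - g t - h *\<^sub>R - (g t * f' * g t)) / norm h)
        \<le> B * (norm (f (t + h) - f t - h *\<^sub>R f') / norm h) * norm (g t) + norm (g (t + h) - g t) * norm (f' * g t)"
      proof (cases "h = 0")
        case False
        then show ?thesis using divide_right_mono[OF n, of "\<bar>h\<bar>"] by (simp add: add_divide_distrib)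
      qed simp
    qed
  qed
qed

section \<open>Quasi-periodic functions depending on parameters\<close>

text \<open>The best constant \<open>m\<close>, pointwise norm plus Lipschitz constant, is submultiplicative.\<close>
definition bl :: "'w::metric_space set \<Rightarrow> real \<Rightarrow> ('w \<Rightarrow> complex) \<Rightarrow> bool" where
  "bl E m a \<longleftrightarrow> 0 \<le> m \<and> (\<forall>\<omega>\<in>E. norm (a \<omega>) \<le> m) \<and>
     (\<forall>\<omega>\<in>E. \<forall>\<omega>'\<in>E. norm (a \<omega>) * dist \<omega> \<omega>' + dist (a \<omega>) (a \<omega>') \<le> m * dist \<omega> \<omega>')"

lemma blI:
  assumes "0 \<le> m" "\<And>\<omega>. \<omega> \<in> E \<Longrightarrow> norm (a \<omega>) \<le> m"
    "\<And>\<omega> \<omega>'. \<omega> \<in> E \<Longrightarrow> \<omega>' \<in> E \<Longrightarrow> norm (a \<omega>) * dist \<omega> \<omega>' + dist (a \<omega>) (a \<omega>') \<le> m * dist \<omega> \<omega>'"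
  shows "bl E m a"
  using assms unfolding bl_def by blast

lemma blI_lipschitz:
  assumes "0 \<le> b" "0 \<le> L" "\<And>\<omega>. \<omega> \<in> E \<Longrightarrow> norm (a \<omega>) \<le> b"
    "\<And>\<omega> \<omega>'. \<omega> \<in> E \<Longrightarrow> \<omega>' \<in> E \<Longrightarrow> dist (a \<omega>) (a \<omega>') \<le> L * dist \<omega> \<omega>'"
  shows "bl E (b + L) a"
proof (rule blI)
  fix \<omega> \<omega>' assume w: "\<omega> \<in> E" "\<omega>' \<in> E"
  have "norm (a \<omega>) * dist \<omega> \<omega>' \<le> b * dist \<omega> \<omega>'" using assms w by (intro mult_right_mono) auto
  then show "norm (a \<omega>) * dist \<omega> \<omega>' + dist (a \<omega>) (a \<omega>') \<le> (b + L) * dist \<omega> \<omega>'"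
    using assms(4)[OF w] by (simp add: distrib_right)
next
  fix \<omega> assume "\<omega> \<in> E" then show "norm (a \<omega>) \<le> b + L" using assms(2,3) by fastforce
qed (use assms in auto)

lemma bl_nonneg: "bl E m a \<Longrightarrow> 0 \<le> m"
  and bl_norm: "bl E m a \<Longrightarrow> \<omega> \<in> E \<Longrightarrow> norm (a \<omega>) \<le> m"
  and bl_lip: "bl E m a \<Longrightarrow> \<omega> \<in> E \<Longrightarrow> \<omega>' \<in> E \<Longrightarrow> norm (a \<omega>) * dist \<omega> \<omega>' + dist (a \<omega>) (a \<omega>') \<le> m * dist \<omega> \<omega>'"
  by (auto simp: bl_def)

lemma bl_dist: "bl E m a \<Longrightarrow> \<omega> \<in> E \<Longrightarrow> \<omega>' \<in> E \<Longrightarrow> dist (a \<omega>) (a \<omega>') \<le> m * dist \<omega> \<omega>'"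
  using bl_lip[of E m a \<omega> \<omega>'] by (smt (verit) mult_nonneg_nonneg norm_ge_zero zero_le_dist)

lemma bl_mono:
  assumes "bl E m a" "E' \<subseteq> E" "m \<le> m'"
  shows "bl E' m' a"
proof (rule blI)
  fix \<omega> \<omega>' assume w: "\<omega> \<in> E'" "\<omega>' \<in> E'"
  have "m * dist \<omega> \<omega>' \<le> m' * dist \<omega> \<omega>'" using assms by (intro mult_right_mono) auto
  then show "norm (a \<omega>) * dist \<omega> \<omega>' + dist (a \<omega>) (a \<omega>') \<le> m' * dist \<omega> \<omega>'"
    using bl_lip[OF assms(1), of \<omega> \<omega>'] w assms(2) by fastforce
next
  show "0 \<le> m'" using bl_nonneg[OF assms(1)] assms(3) by simp
next
  fix \<omega> assume "\<omega> \<in> E'" then show "norm (a \<omega>) \<le> m'"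
    using bl_norm[OF assms(1), of \<omega>] assms(2,3) by fastforce
qed

lemma bl_cong: "bl E m a \<Longrightarrow> (\<And>\<omega>. \<omega> \<in> E \<Longrightarrow> a \<omega> = b \<omega>) \<Longrightarrow> bl E m b"
  unfolding bl_def by force

lemma bl_const: "norm c \<le> m \<Longrightarrow> bl E m (\<lambda>_. c)"
  by (intro blI) (use norm_ge_zero[of c] in \<open>auto intro: mult_right_mono simp del: norm_ge_zero\<close>)

lemma bl_cnj: "bl E m a \<Longrightarrow> bl E m (\<lambda>\<omega>. cnj (a \<omega>))"
  unfolding bl_def dist_norm complex_cnj_diff[symmetric] complex_mod_cnj .

lemma bl_uminus: "bl E m a \<Longrightarrow> bl E m (\<lambda>\<omega>. - a \<omega>)"
  unfolding bl_def by (simp add: dist_minus)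

text \<open>The product rule leaves |a| (|b| d + |b - b'|) + |a - a'| |b'|, at most (|a| d + |a -
  a'|) n, which the bound for \<open>a\<close> closes. This works because \<open>bl\<close> bounds
  value and increment jointly; separate bounds would lose a constant in each product, fatal for
  power series and infinitely many steps.\<close>

lemma bl_mult:
  assumes a: "bl E m a" and b: "bl E n b"
  shows "bl E (m * n) (\<lambda>\<omega>. a \<omega> * b \<omega>)"
proof (rule blI)
  show "0 \<le> m * n" using bl_nonneg[OF a] bl_nonneg[OF b] by simp
  show "norm (a \<omega> * b \<omega>) \<le> m * n" if "\<omega> \<in> E" for \<omega>
    unfolding norm_mult using that bl_norm[OF a] bl_norm[OF b] bl_nonneg[OF a]
    by (intro mult_mono) auto
  fix \<omega> \<omega>' assume w: "\<omega> \<in> E" "\<omega>' \<in> E"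
  define d where "d = dist \<omega> \<omega>'"
  have "dist (a \<omega> * b \<omega>) (a \<omega>' * b \<omega>') \<le> norm (a \<omega>) * dist (b \<omega>) (b \<omega>') + dist (a \<omega>) (a \<omega>') * norm (b \<omega>')"
  proof -
    have "a \<omega> * b \<omega> - a \<omega>' * b \<omega>' = a \<omega> * (b \<omega> - b \<omega>') + (a \<omega> - a \<omega>') * b \<omega>'"
      by (simp add: algebra_simps)
    then show ?thesis unfolding dist_norm by (metis norm_mult norm_triangle_ineq)
  qed
  moreover have "norm (a \<omega>) * (norm (b \<omega>) * d + dist (b \<omega>) (b \<omega>')) \<le> norm (a \<omega>) * (n * d)"
    using bl_lip[OF b w] by (intro mult_left_mono) (auto simp: d_def)
  moreover have "dist (a \<omega>) (a \<omega>') * norm (b \<omega>') \<le> dist (a \<omega>) (a \<omega>') * n"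
    using bl_norm[OF b w(2)] by (intro mult_left_mono) auto
  moreover have "(norm (a \<omega>) * d + dist (a \<omega>) (a \<omega>')) * n \<le> (m * d) * n"
    using bl_lip[OF a w] bl_nonneg[OF b] by (intro mult_right_mono) (auto simp: d_def)
  ultimately show "norm (a \<omega> * b \<omega>) * dist \<omega> \<omega>' + dist (a \<omega> * b \<omega>) (a \<omega>' * b \<omega>') \<le> m * n * dist \<omega> \<omega>'"
    unfolding d_def[symmetric] norm_mult by (simp add: algebra_simps)
qed

lemma bl_summable:
  assumes "\<And>j. bl E (m j) (a j)" "summable m" "\<omega> \<in> E"
  shows "summable (\<lambda>j. norm (a j \<omega>))" "summable (\<lambda>j. a j \<omega>)"
proof -
  show "summable (\<lambda>j. norm (a j \<omega>))"
    by (rule summable_comparison_test'[OF assms(2), of 0]) (use bl_norm[OF assms(1,3)] in auto)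
  then show "summable (\<lambda>j. a j \<omega>)" by (rule summable_norm_cancel)
qed

lemma bl_suminf:
  assumes a: "\<And>j. bl E (m j) (a j)" and m: "summable m"
  shows "bl E (suminf m) (\<lambda>\<omega>. \<Sum>j. a j \<omega>)"
proof (rule blI)
  show "0 \<le> suminf m" using bl_nonneg[OF a] m by (intro suminf_nonneg) auto
  show "norm (\<Sum>j. a j \<omega>) \<le> suminf m" if "\<omega> \<in> E" for \<omega>
    by (rule norm_suminf_le[OF _ m]) (use bl_norm[OF a that] in auto)
  fix \<omega> \<omega>' assume w: "\<omega> \<in> E" "\<omega>' \<in> E"
  note s = bl_summable[OF a m w(1)] bl_summable[OF a m w(2)]
  have d: "dist (a j \<omega>) (a j \<omega>') \<le> m j * dist \<omega> \<omega>'" for j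
    using bl_dist[OF a w] .
  have sd: "summable (\<lambda>j. dist (a j \<omega>) (a j \<omega>'))"
    by (rule summable_comparison_test'[OF summable_mult2[OF m], of 0]) (use d in auto)
  have "dist (\<Sum>j. a j \<omega>) (\<Sum>j. a j \<omega>') = norm (\<Sum>j. a j \<omega> - a j \<omega>')"
    unfolding dist_norm using s by (simp add: suminf_diff)
  also have "\<dots> \<le> (\<Sum>j. dist (a j \<omega>) (a j \<omega>'))"
    using sd unfolding dist_norm by (rule summable_norm)
  finally have 1: "dist (\<Sum>j. a j \<omega>) (\<Sum>j. a j \<omega>') \<le> (\<Sum>j. dist (a j \<omega>) (a j \<omega>'))" .
  have "norm (\<Sum>j. a j \<omega>) * dist \<omega> \<omega>' \<le> (\<Sum>j. norm (a j \<omega>)) * dist \<omega> \<omega>'"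
    using s by (intro mult_right_mono summable_norm) auto
  also have "\<dots> = (\<Sum>j. norm (a j \<omega>) * dist \<omega> \<omega>')" using s by (simp add: suminf_mult2)
  finally have "norm (\<Sum>j. a j \<omega>) * dist \<omega> \<omega>' + dist (\<Sum>j. a j \<omega>) (\<Sum>j. a j \<omega>')
     \<le> (\<Sum>j. norm (a j \<omega>) * dist \<omega> \<omega>') + (\<Sum>j. dist (a j \<omega>) (a j \<omega>'))"
    using 1 by linarith
  also have "\<dots> = (\<Sum>j. norm (a j \<omega>) * dist \<omega> \<omega>' + dist (a j \<omega>) (a j \<omega>'))"
    using s sd by (intro suminf_add summable_mult2) auto
  also have "\<dots> \<le> (\<Sum>j. m j * dist \<omega> \<omega>')"
    using s sd m bl_lip[OF a w] by (intro suminf_le summable_add summable_mult2) auto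
  also have "\<dots> = suminf m * dist \<omega> \<omega>'" using m by (simp add: suminf_mult2)
  finally show "norm (\<Sum>j. a j \<omega>) * dist \<omega> \<omega>' + dist (\<Sum>j. a j \<omega>) (\<Sum>j. a j \<omega>') \<le> suminf m * dist \<omega> \<omega>'" .
qed

text \<open>Expansions are indexed by \<open>nat\<close>, so a series of expansions must be
  rearranged into one sequence. The first sum controls the weights, the second gives the
  values.\<close>

lemma double_series_nat:
  fixes f :: "nat \<Rightarrow> nat \<Rightarrow> 'a::banach"
  assumes fg: "\<And>j i. norm (f j i) \<le> g j i"
    and g1: "\<And>j. summable (g j)" and g2: "summable (\<lambda>j. \<Sum>i. g j i)"
  shows "(\<lambda>p. case prod_decode p of (j, i) \<Rightarrow> g j i) sums (\<Sum>j. \<Sum>i. g j i)"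
    and "(\<lambda>p. case prod_decode p of (j, i) \<Rightarrow> f j i) sums (\<Sum>j. \<Sum>i. f j i)"
proof -
  have g0: "0 \<le> g j i" for j i using fg[of j i] norm_ge_zero order_trans by blast
  have bij: "bij_betw prod_decode UNIV (UNIV \<times> UNIV)" using bij_prod_decode by simp
  have gi: "((\<lambda>i. g j i) has_sum (\<Sum>i. g j i)) UNIV" for j
    by (rule norm_summable_imp_has_sum[OF _ summable_sums[OF g1]]) (use g1 g0 in simp)
  have gj: "((\<lambda>j. \<Sum>i. g j i) has_sum (\<Sum>j. \<Sum>i. g j i)) UNIV"
    by (rule norm_summable_imp_has_sum[OF _ summable_sums[OF g2]]) (use g2 suminf_nonneg[OF g1 g0] in simp)
  have gs: "(\<lambda>(j, i). g j i) summable_on UNIV \<times> UNIV"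
    by (rule summable_on_SigmaI[where g = "\<lambda>j. \<Sum>i. g j i"])
       (use gi gj g0 has_sum_imp_summable in auto)
  have gh: "((\<lambda>(j, i). g j i) has_sum (\<Sum>j. \<Sum>i. g j i)) (UNIV \<times> UNIV)"
    by (rule has_sum_SigmaI[where g = "\<lambda>j. \<Sum>i. g j i"]) (use gi gj gs in auto)
  then show "(\<lambda>p. case prod_decode p of (j, i) \<Rightarrow> g j i) sums (\<Sum>j. \<Sum>i. g j i)"
    by (intro has_sum_imp_sums) (simp only: has_sum_reindex_bij_betw[OF bij])
  have f1: "summable (\<lambda>i. norm (f j i))" for j
    by (rule summable_comparison_test'[OF g1[of j], of 0]) (use fg in auto)
  have fi: "((\<lambda>i. f j i) has_sum (\<Sum>i. f j i)) UNIV" for j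
    by (rule norm_summable_imp_has_sum[OF f1 summable_sums[OF summable_norm_cancel[OF f1]]])
  have f2: "summable (\<lambda>j. norm (\<Sum>i. f j i))"
    by (rule summable_comparison_test'[OF g2, of 0]) (use norm_suminf_le[OF fg g1] in simp)
  have fj: "((\<lambda>j. \<Sum>i. f j i) has_sum (\<Sum>j. \<Sum>i. f j i)) UNIV"
    by (rule norm_summable_imp_has_sum[OF f2 summable_sums[OF summable_norm_cancel[OF f2]]])
  have "(\<lambda>x. norm (case x of (j, i) \<Rightarrow> f j i)) summable_on UNIV \<times> UNIV"
    by (rule Infinite_Sum.abs_summable_on_comparison_test'[OF gs]) (use fg in auto)
  then have fs: "(\<lambda>(j, i). f j i) summable_on UNIV \<times> UNIV"
    by (rule abs_summable_summable)
  have "((\<lambda>(j, i). f j i) has_sum (\<Sum>j. \<Sum>i. f j i)) (UNIV \<times> UNIV)"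
    by (rule has_sum_SigmaI[where g = "\<lambda>j. \<Sum>i. f j i"]) (use fi fj fs in auto)
  then show "(\<lambda>p. case prod_decode p of (j, i) \<Rightarrow> f j i) sums (\<Sum>j. \<Sum>i. f j i)"
    by (intro has_sum_imp_sums) (simp only: has_sum_reindex_bij_betw[OF bij])
qed

section \<open>Absolutely summable families of exponentials and their algebra\<close>

definition kdot :: "('n::finite \<Rightarrow> int) \<Rightarrow> real ^ 'n \<Rightarrow> real" where
  "kdot k \<omega> = (\<Sum>i\<in>UNIV. of_int (k i) * \<omega> $ i)"

definition knorm :: "('n::finite \<Rightarrow> int) \<Rightarrow> real" where
  "knorm k = (\<Sum>i\<in>UNIV. \<bar>of_int (k i)\<bar>)"

lemma knorm_nonneg [simp]: "0 \<le> knorm k" by (simp add: knorm_def sum_nonneg)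
lemma knorm_zero [simp]: "knorm (\<lambda>_. 0) = 0" by (simp add: knorm_def)
lemma kdot_zero [simp]: "kdot (\<lambda>_. 0) \<omega> = 0" by (simp add: kdot_def)
lemma knorm_uminus [simp]: "knorm (\<lambda>i. - k i) = knorm k" by (simp add: knorm_def)
lemma kdot_uminus: "kdot (\<lambda>i. - k i) \<omega> = - kdot k \<omega>" by (simp add: kdot_def sum_negf)
lemma kdot_add: "kdot (\<lambda>i. k i + l i) \<omega> = kdot k \<omega> + kdot l \<omega>"
  by (simp add: kdot_def sum.distrib distrib_right)
lemma knorm_add: "knorm (\<lambda>i. k i + l i) \<le> knorm k + knorm l"
  unfolding knorm_def sum.distrib[symmetric] by (intro sum_mono) auto

text \<open>The wave vectors \<open>k i\<close> may repeat, so sums and products of expansions are again expansions and no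
  uniqueness of Fourier coefficients is needed. Here \<open>s\<close> plays the part of the width of analyticity.\<close>
definition qp :: "(real ^ 'n::finite) set \<Rightarrow> real \<Rightarrow> real \<Rightarrow> (real ^ 'n \<Rightarrow> real \<Rightarrow> complex) \<Rightarrow> bool" where
  "qp E s M F \<longleftrightarrow> (\<exists>(a :: nat \<Rightarrow> real ^ 'n \<Rightarrow> complex) (k :: nat \<Rightarrow> 'n \<Rightarrow> int) m.
     (\<forall>i. bl E (m i) (a i)) \<and> summable (\<lambda>i. m i * exp (s * knorm (k i))) \<and>
     (\<Sum>i. m i * exp (s * knorm (k i))) \<le> M \<and>
     (\<forall>\<omega>\<in>E. \<forall>t. F \<omega> t = (\<Sum>i. a i \<omega> * cis (kdot (k i) \<omega> * t))))"

lemma qpE: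
  assumes "qp E s M F"
  obtains a k m where "\<And>i. bl E (m i) (a i)" "summable (\<lambda>i. m i * exp (s * knorm (k i)))"
     "(\<Sum>i. m i * exp (s * knorm (k i))) \<le> M"
     "\<And>\<omega> t. \<omega> \<in> E \<Longrightarrow> F \<omega> t = (\<Sum>i. a i \<omega> * cis (kdot (k i) \<omega> * t))"
  using assms unfolding qp_def by blast

lemma qpI:
  assumes "\<And>i. bl E (m i) (a i)" "summable (\<lambda>i. m i * exp (s * knorm (k i)))"
     "(\<Sum>i. m i * exp (s * knorm (k i))) \<le> M"
     "\<And>\<omega> t. \<omega> \<in> E \<Longrightarrow> F \<omega> t = (\<Sum>i. a i \<omega> * cis (kdot (k i) \<omega> * t))"
  shows "qp E s M F"
  using assms unfolding qp_def by blast

lemma qp_nonneg: "qp E s M F \<Longrightarrow> 0 \<le> M"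
proof (erule qpE)
  fix a :: "nat \<Rightarrow> real ^ 'a \<Rightarrow> complex" and k :: "nat \<Rightarrow> 'a \<Rightarrow> int" and m
  assume m: "\<And>i. bl E (m i) (a i)" and s: "summable (\<lambda>i. m i * exp (s * knorm (k i)))"
    and "(\<Sum>i. m i * exp (s * knorm (k i))) \<le> M"
  moreover have "0 \<le> (\<Sum>i. m i * exp (s * knorm (k i)))"
    using bl_nonneg[OF m] by (intro suminf_nonneg[OF s]) auto
  ultimately show "0 \<le> M" by linarith
qed

lemma qp_mono:
  assumes "qp E s M F" "E' \<subseteq> E" "s' \<le> s" "M \<le> M'"
  shows "qp E' s' M' F"
proof -
  obtain a k m where m: "\<And>i. bl E (m i) (a i)" and s: "summable (\<lambda>i. m i * exp (s * knorm (k i)))"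
     and M: "(\<Sum>i. m i * exp (s * knorm (k i))) \<le> M"
     and F: "\<And>\<omega> t. \<omega> \<in> E \<Longrightarrow> F \<omega> t = (\<Sum>i. a i \<omega> * cis (kdot (k i) \<omega> * t))"
    using assms(1) by (rule qpE) (rule that)
  have le: "m i * exp (s' * knorm (k i)) \<le> m i * exp (s * knorm (k i))" for i
    using bl_nonneg[OF m] assms(3) by (intro mult_left_mono) (auto intro: mult_right_mono)
  have s': "summable (\<lambda>i. m i * exp (s' * knorm (k i)))"
    by (rule summable_comparison_test'[OF s, of 0]) (use le bl_nonneg[OF m] in auto)
  show ?thesis
  proof (rule qpI[OF _ s'])
    show "bl E' (m i) (a i)" for i using bl_mono[OF m assms(2)] by simp
    show "(\<Sum>i. m i * exp (s' * knorm (k i))) \<le> M'"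
      using suminf_le[OF le s' s] M assms(4) by simp
  qed (use F assms(2) in auto)
qed

lemma qp_cong: "qp E s M F \<Longrightarrow> (\<And>\<omega> t. \<omega> \<in> E \<Longrightarrow> F \<omega> t = G \<omega> t) \<Longrightarrow> qp E s M G"
  unfolding qp_def by simp

lemma qp_monomial:
  assumes "bl E m a" "m * exp (s * knorm k) \<le> M"
  shows "qp E s M (\<lambda>\<omega> t. a \<omega> * cis (kdot k \<omega> * t))"
proof (rule qpI)
  let ?m = "\<lambda>i::nat. if i = 0 then m else 0" and ?a = "\<lambda>i::nat. if i = 0 then a else (\<lambda>_. 0)"
  show "bl E (?m i) (?a i)" for i using assms bl_const[of 0 0 E] by simp
  have s: "(\<lambda>i. ?m i * exp (s * knorm k)) sums (m * exp (s * knorm k))"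
    using sums_single[of 0 "\<lambda>i. m * exp (s * knorm k)"] by (simp add: if_distrib if_distribR cong: if_cong)
  show "summable (\<lambda>i. ?m i * exp (s * knorm k))" using s sums_summable by blast
  show "(\<Sum>i. ?m i * exp (s * knorm k)) \<le> M" using sums_unique[OF s] assms by simp
  fix \<omega> t
  have "(\<lambda>i. ?a i \<omega> * cis (kdot k \<omega> * t)) sums (a \<omega> * cis (kdot k \<omega> * t))"
    using sums_single[of 0 "\<lambda>i. a \<omega> * cis (kdot k \<omega> * t)"] by (simp add: if_distrib if_distribR cong: if_cong)
  then show "a \<omega> * cis (kdot k \<omega> * t) = (\<Sum>i. ?a i \<omega> * cis (kdot k \<omega> * t))" by (simp add: sums_iff)
qed

lemma qp_param: "bl E m a \<Longrightarrow> qp E s m (\<lambda>\<omega> t. a \<omega>)"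
  using qp_monomial[of E m a s "\<lambda>_. 0" m] by simp

lemma qp_const: "norm c \<le> m \<Longrightarrow> qp E s m (\<lambda>\<omega> t. c)"
  by (intro qp_param bl_const)

text \<open>The doubly indexed family of exponentials is flattened by \<open>prod_decode\<close>.
  Sums, products and power series are all reduced to this closure property.\<close>

lemma qp_suminf:
  assumes F: "\<And>j. qp E s (M j) (F j)" and M: "summable M" "suminf M \<le> B" and s0: "0 \<le> s"
  shows "qp E s B (\<lambda>\<omega> t. \<Sum>j. F j \<omega> t)"
proof -
  define Q where "Q j a k m \<longleftrightarrow> (\<forall>i. bl E (m i) (a i)) \<and> summable (\<lambda>i. m i * exp (s * knorm (k i))) \<and>
     (\<Sum>i. m i * exp (s * knorm (k i))) \<le> M j \<and>
     (\<forall>\<omega>\<in>E. \<forall>t. F j \<omega> t = (\<Sum>i. a i \<omega> * cis (kdot (k i) \<omega> * t)))" for j and a k m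
  have "\<forall>j. \<exists>a k m. Q j a k m"
    using F unfolding qp_def Q_def by blast
  then obtain a where "\<forall>j. \<exists>k m. Q j (a j) k m" by (rule exE[OF choice])
  then obtain k where "\<forall>j. \<exists>m. Q j (a j) (k j) m" by (rule exE[OF choice])
  then obtain m where Q: "\<forall>j. Q j (a j) (k j) (m j)" by (rule exE[OF choice])
  have m: "\<And>j i. bl E (m j i) (a j i)"
    and s: "\<And>j. summable (\<lambda>i. m j i * exp (s * knorm (k j i)))"
    and MM: "\<And>j. (\<Sum>i. m j i * exp (s * knorm (k j i))) \<le> M j"
    and FF: "\<And>j \<omega> t. \<omega> \<in> E \<Longrightarrow> F j \<omega> t = (\<Sum>i. a j i \<omega> * cis (kdot (k j i) \<omega> * t))"
    using Q unfolding Q_def by auto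
  let ?g = "\<lambda>j i. m j i * exp (s * knorm (k j i))"
  have g0: "0 \<le> ?g j i" for j i using bl_nonneg[OF m] by simp
  have s2: "summable (\<lambda>j. \<Sum>i. ?g j i)"
    by (rule summable_comparison_test'[OF M(1), of 0]) (use MM suminf_nonneg[OF s g0] in auto)
  have "norm (of_real (?g j i) :: complex) \<le> ?g j i" for j i using g0[of j i] by (simp only: norm_of_real abs_of_nonneg order_refl)
  from double_series_nat(1)[of "\<lambda>j i. of_real (?g j i) :: complex", OF this s s2]
  have gs: "(\<lambda>p. case prod_decode p of (j, i) \<Rightarrow> ?g j i) sums (\<Sum>j. \<Sum>i. ?g j i)" .
  have nn: "0 \<le> knorm k" for k :: "'a \<Rightarrow> int" by simp
  show ?thesis
  proof (rule qpI)
    let ?D = "\<lambda>f p. case prod_decode p of (j, i) \<Rightarrow> f j i"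
    have eq: "?D m p * exp (s * knorm (?D k p)) = ?D ?g p" for p by (simp split: prod.split)
    show "bl E (?D m p) (?D a p)" for p using m by (simp split: prod.split)
    show "summable (\<lambda>p. ?D m p * exp (s * knorm (?D k p)))"
      unfolding eq using gs sums_summable by blast
    have "(\<Sum>j. \<Sum>i. ?g j i) \<le> suminf M" by (rule suminf_le[OF MM s2 M(1)])
    then show "(\<Sum>p. ?D m p * exp (s * knorm (?D k p))) \<le> B"
      unfolding eq using sums_unique[OF gs] M(2) by simp
    fix \<omega> t assume w: "\<omega> \<in> E"
    have "norm (a j i \<omega> * cis (kdot (k j i) \<omega> * t)) \<le> ?g j i" for j i
    proof -
      have "norm (a j i \<omega>) * 1 \<le> m j i * exp (s * knorm (k j i))"
        using bl_norm[OF m w] bl_nonneg[OF m] s0 by (intro mult_mono) auto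
      then show ?thesis by (simp add: norm_mult)
    qed
    from double_series_nat(2)[of "\<lambda>j i. a j i \<omega> * cis (kdot (k j i) \<omega> * t)", OF this s s2]
    have "(\<lambda>p. ?D a p \<omega> * cis (kdot (?D k p) \<omega> * t)) sums (\<Sum>j. F j \<omega> t)"
      by (simp only: FF[OF w] case_prod_beta)
    then show "(\<Sum>j. F j \<omega> t) = (\<Sum>p. ?D a p \<omega> * cis (kdot (?D k p) \<omega> * t))"
      by (rule sums_unique)
  qed
qed

lemma qp_zero: "qp E s 0 (\<lambda>\<omega> t. 0)"
  by (rule qp_const) simp

lemma qp_add:
  assumes F: "qp E s M F" and G: "qp E s N G" and s: "0 \<le> s"
  shows "qp E s (M + N) (\<lambda>\<omega> t. F \<omega> t + G \<omega> t)"
proof -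
  \<comment> \<open>A sum of two functions is treated as a series with two nonzero terms.\<close>
  let ?c = "\<lambda>x y z j. if j = (0::nat) then x else if j = 1 then y else z"
  have sm: "(\<lambda>j. ?c x y 0 j) sums (x + y)" for x y :: "'b::real_normed_vector"
    using sums_finite[of "{0,1}" "?c x y 0"] by simp
  have "qp E s (M + N) (\<lambda>\<omega> t. \<Sum>j. ?c F G (\<lambda>\<omega> t. 0) j \<omega> t)"
  proof (rule qp_suminf[where M = "?c M N 0"])
    show "qp E s (?c M N 0 j) (?c F G (\<lambda>\<omega> t. 0) j)" for j
      using F G qp_zero[of E s] by simp
  qed (use sm[of M N] s in \<open>auto simp: sums_iff\<close>)
  then show ?thesis
  proof (rule qp_cong)
    fix \<omega> t
    have "?c F G (\<lambda>\<omega> t. 0) j \<omega> t = ?c (F \<omega> t) (G \<omega> t) 0 j" for j by simp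
    then show "(\<Sum>j. ?c F G (\<lambda>\<omega> t. 0) j \<omega> t) = F \<omega> t + G \<omega> t"
      using sums_unique[OF sm[of "F \<omega> t" "G \<omega> t"]] by simp
  qed
qed

text \<open>Multiplication by one exponential translates every wave vector by \<open>l\<close>, and
  the triangle inequality for \<open>knorm\<close> bounds the change of the weights by exp (s |l|).
  Summing over the monomials of a second factor yields the submultiplicativity of a weighted Wiener
  algebra.\<close>

lemma qp_mult_monomial:
  assumes G: "qp E s N G" and a: "bl E m a" and s0: "0 \<le> s"
  shows "qp E s (m * exp (s * knorm l) * N) (\<lambda>\<omega> t. a \<omega> * cis (kdot l \<omega> * t) * G \<omega> t)"
proof -
  obtain b k n where n: "\<And>i. bl E (n i) (b i)" and s: "summable (\<lambda>i. n i * exp (s * knorm (k i)))"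
     and N: "(\<Sum>i. n i * exp (s * knorm (k i))) \<le> N"
     and GG: "\<And>\<omega> t. \<omega> \<in> E \<Longrightarrow> G \<omega> t = (\<Sum>i. b i \<omega> * cis (kdot (k i) \<omega> * t))"
    using G by (rule qpE) (rule that)
  let ?k = "\<lambda>i x. l x + k i x"
  have le: "m * n i * exp (s * knorm (?k i)) \<le> m * exp (s * knorm l) * (n i * exp (s * knorm (k i)))" for i
  proof -
    have "exp (s * knorm (?k i)) \<le> exp (s * knorm l) * exp (s * knorm (k i))"
      unfolding exp_add[symmetric] using s0 knorm_add[of l "k i"]
      by (simp add: distrib_left[symmetric] mult_left_mono)
    then have "m * n i * exp (s * knorm (?k i)) \<le> m * n i * (exp (s * knorm l) * exp (s * knorm (k i)))"
      using bl_nonneg[OF a] bl_nonneg[OF n] by (intro mult_left_mono) auto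
    then show ?thesis by (simp add: mult_ac)
  qed
  have sm: "summable (\<lambda>i. m * n i * exp (s * knorm (?k i)))"
    by (rule summable_comparison_test'[OF summable_mult[OF s, of "m * exp (s * knorm l)"], of 0])
       (use le bl_nonneg[OF a] bl_nonneg[OF n] in auto)
  show ?thesis
  proof (rule qpI[OF _ sm])
    show "bl E (m * n i) (\<lambda>\<omega>. a \<omega> * b i \<omega>)" for i by (rule bl_mult[OF a n])
    have "(\<Sum>i. m * n i * exp (s * knorm (?k i))) \<le> (\<Sum>i. m * exp (s * knorm l) * (n i * exp (s * knorm (k i))))"
      by (rule suminf_le[OF le sm summable_mult[OF s]])
    also have "\<dots> = m * exp (s * knorm l) * (\<Sum>i. n i * exp (s * knorm (k i)))"
      by (rule suminf_mult[OF s])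
    also have "\<dots> \<le> m * exp (s * knorm l) * N"
      using N bl_nonneg[OF a] by (intro mult_left_mono) auto
    finally show "(\<Sum>i. m * n i * exp (s * knorm (?k i))) \<le> m * exp (s * knorm l) * N" .
    fix \<omega> t assume w: "\<omega> \<in> E"
    have "summable (\<lambda>i. b i \<omega> * cis (kdot (k i) \<omega> * t))"
    proof (rule summable_comparison_test'[OF s, of 0])
      fix i
      have "norm (b i \<omega>) * 1 \<le> n i * exp (s * knorm (k i))"
        using bl_norm[OF n w] bl_nonneg[OF n] s0 by (intro mult_mono) auto
      then show "norm (b i \<omega> * cis (kdot (k i) \<omega> * t)) \<le> n i * exp (s * knorm (k i))"
        by (simp add: norm_mult)
    qed
    then have "a \<omega> * cis (kdot l \<omega> * t) * G \<omega> t
      = (\<Sum>i. a \<omega> * cis (kdot l \<omega> * t) * (b i \<omega> * cis (kdot (k i) \<omega> * t)))"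
      unfolding GG[OF w] by (rule suminf_mult[symmetric])
    also have "\<dots> = (\<Sum>i. a \<omega> * b i \<omega> * cis (kdot (?k i) \<omega> * t))"
    proof (intro arg_cong[of _ _ suminf] ext)
      fix i
      have "cis (kdot (?k i) \<omega> * t) = cis (kdot l \<omega> * t) * cis (kdot (k i) \<omega> * t)"
        by (simp add: kdot_add distrib_right cis_mult)
      then show "a \<omega> * cis (kdot l \<omega> * t) * (b i \<omega> * cis (kdot (k i) \<omega> * t)) = a \<omega> * b i \<omega> * cis (kdot (?k i) \<omega> * t)"
        by (simp only: mult_ac)
    qed
    finally show "a \<omega> * cis (kdot l \<omega> * t) * G \<omega> t = (\<Sum>i. a \<omega> * b i \<omega> * cis (kdot (?k i) \<omega> * t))" .
  qed
qed

lemma qp_mult: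
  assumes F: "qp E s M F" and G: "qp E s N G" and s0: "0 \<le> s"
  shows "qp E s (M * N) (\<lambda>\<omega> t. F \<omega> t * G \<omega> t)"
proof -
  obtain a k m where m: "\<And>i. bl E (m i) (a i)" and s: "summable (\<lambda>i. m i * exp (s * knorm (k i)))"
     and M: "(\<Sum>i. m i * exp (s * knorm (k i))) \<le> M"
     and FF: "\<And>\<omega> t. \<omega> \<in> E \<Longrightarrow> F \<omega> t = (\<Sum>i. a i \<omega> * cis (kdot (k i) \<omega> * t))"
    using F by (rule qpE) (rule that)
  have "qp E s (M * N) (\<lambda>\<omega> t. \<Sum>i. a i \<omega> * cis (kdot (k i) \<omega> * t) * G \<omega> t)"
  proof (rule qp_suminf[OF qp_mult_monomial[OF G m s0] _ _ s0])
    show "summable (\<lambda>i. m i * exp (s * knorm (k i)) * N)" by (rule summable_mult2[OF s])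
    show "(\<Sum>i. m i * exp (s * knorm (k i)) * N) \<le> M * N"
      unfolding suminf_mult2[OF s, symmetric] using M qp_nonneg[OF G] by (rule mult_right_mono)
  qed
  then show ?thesis
  proof (rule qp_cong)
    fix \<omega> t assume w: "\<omega> \<in> E"
    have "summable (\<lambda>i. a i \<omega> * cis (kdot (k i) \<omega> * t))"
    proof (rule summable_comparison_test'[OF s, of 0])
      fix i
      have "norm (a i \<omega>) * 1 \<le> m i * exp (s * knorm (k i))"
        using bl_norm[OF m w] bl_nonneg[OF m] s0 by (intro mult_mono) auto
      then show "norm (a i \<omega> * cis (kdot (k i) \<omega> * t)) \<le> m i * exp (s * knorm (k i))"
        by (simp add: norm_mult)
    qed
    then show "(\<Sum>i. a i \<omega> * cis (kdot (k i) \<omega> * t) * G \<omega> t) = F \<omega> t * G \<omega> t"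
      unfolding FF[OF w] by (rule suminf_mult2[symmetric])
  qed
qed

lemma qp_cmult:
  assumes "qp E s M F" "norm c \<le> C" "0 \<le> s"
  shows "qp E s (C * M) (\<lambda>\<omega> t. c * F \<omega> t)"
  using qp_mult[OF qp_const[OF assms(2)] assms(1,3)] .

lemma qp_uminus:
  assumes "qp E s M F" "0 \<le> s"
  shows "qp E s M (\<lambda>\<omega> t. - F \<omega> t)"
  using qp_cmult[OF assms(1), of "-1" 1] assms(2) by simp

lemma qp_diff:
  assumes F: "qp E s M F" and G: "qp E s N G" and s: "0 \<le> s"
  shows "qp E s (M + N) (\<lambda>\<omega> t. F \<omega> t - G \<omega> t)"
  using qp_add[OF F qp_uminus[OF G s] s] by simp

lemma qp_sum:
  assumes "finite S" "\<And>x. x \<in> S \<Longrightarrow> qp E s (M x) (F x)" "0 \<le> s"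
  shows "qp E s (\<Sum>x\<in>S. M x) (\<lambda>\<omega> t. \<Sum>x\<in>S. F x \<omega> t)"
  using assms by (induction S rule: finite_induct) (auto simp: qp_zero intro!: qp_add)

lemma qp_cnj:
  assumes "qp E s M F" "0 \<le> s"
  shows "qp E s M (\<lambda>\<omega> t. cnj (F \<omega> t))"
proof -
  obtain a k m where m: "\<And>i. bl E (m i) (a i)" and s: "summable (\<lambda>i. m i * exp (s * knorm (k i)))"
     and M: "(\<Sum>i. m i * exp (s * knorm (k i))) \<le> M"
     and FF: "\<And>\<omega> t. \<omega> \<in> E \<Longrightarrow> F \<omega> t = (\<Sum>i. a i \<omega> * cis (kdot (k i) \<omega> * t))"
    using assms(1) by (rule qpE) (rule that)
  show ?thesis
  proof (rule qpI[where a = "\<lambda>i \<omega>. cnj (a i \<omega>)" and m = m and k = "\<lambda>i x. - k i x"])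
    show "bl E (m i) (\<lambda>\<omega>. cnj (a i \<omega>))" for i by (rule bl_cnj[OF m])
    fix \<omega> t assume w: "\<omega> \<in> E"
    have "summable (\<lambda>i. a i \<omega> * cis (kdot (k i) \<omega> * t))"
    proof (rule summable_comparison_test'[OF s, of 0])
      fix i
      have "norm (a i \<omega>) * 1 \<le> m i * exp (s * knorm (k i))"
        using bl_norm[OF m w] bl_nonneg[OF m] assms(2) by (intro mult_mono) auto
      then show "norm (a i \<omega> * cis (kdot (k i) \<omega> * t)) \<le> m i * exp (s * knorm (k i))"
        by (simp add: norm_mult)
    qed
    from bounded_linear.suminf[OF bounded_linear_cnj this]
    show "cnj (F \<omega> t) = (\<Sum>i. cnj (a i \<omega>) * cis (kdot (\<lambda>x. - k i x) \<omega> * t))"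
      unfolding FF[OF w] by (simp add: cis_cnj kdot_uminus)
  qed (use s M in auto)
qed

lemma qp_bound:
  assumes "qp E s M F" "0 \<le> s" "\<omega> \<in> E"
  shows "norm (F \<omega> t) \<le> M"
proof -
  obtain a k m where m: "\<And>i. bl E (m i) (a i)" and s: "summable (\<lambda>i. m i * exp (s * knorm (k i)))"
     and M: "(\<Sum>i. m i * exp (s * knorm (k i))) \<le> M"
     and FF: "\<And>\<omega> t. \<omega> \<in> E \<Longrightarrow> F \<omega> t = (\<Sum>i. a i \<omega> * cis (kdot (k i) \<omega> * t))"
    using assms(1) by (rule qpE) (rule that)
  have "norm (F \<omega> t) \<le> (\<Sum>i. m i * exp (s * knorm (k i)))"
    unfolding FF[OF assms(3)]
  proof (rule norm_suminf_le[OF _ s])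
    fix i
    have "norm (a i \<omega>) * 1 \<le> m i * exp (s * knorm (k i))"
      using bl_norm[OF m assms(3)] bl_nonneg[OF m] assms(2) by (intro mult_mono) auto
    then show "norm (a i \<omega> * cis (kdot (k i) \<omega> * t)) \<le> m i * exp (s * knorm (k i))"
      by (simp add: norm_mult)
  qed
  with M show ?thesis by simp
qed

text \<open>Solves X' + i \<mu> X = F - c one exponential at a time, dividing by i (k . \<omega> +
  \<mu>). The predicate \<open>P\<close> selects the wave vectors to divide by; all others are 0 by
  \<open>Z\<close>, so their terms are constant in time and make up \<open>c\<close>. The growth exp
  (\<delta> |k|) granted to the inverse divisors is paid for by the width
  \<open>\<delta>\<close>.\<close>

lemma qp_homological:
  fixes F :: "real ^ 'n::finite \<Rightarrow> real \<Rightarrow> complex" and P :: "('n \<Rightarrow> int) \<Rightarrow> bool"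
  assumes F: "qp E s M F" and E': "E' \<subseteq> E" and d: "0 \<le> \<delta>" "\<delta> \<le> s" and R: "0 \<le> R"
    and inv: "\<And>k. P k \<Longrightarrow> bl E' (R * exp (\<delta> * knorm k)) (\<lambda>\<omega>. 1 / (\<i> * of_real (kdot k \<omega> + \<mu> \<omega>)))"
    and nz: "\<And>k \<omega>. P k \<Longrightarrow> \<omega> \<in> E' \<Longrightarrow> kdot k \<omega> + \<mu> \<omega> \<noteq> 0"
    and Z: "\<And>k. \<not> P k \<Longrightarrow> k = (\<lambda>_. 0)"
  shows "\<exists>X c. qp E' (s - \<delta>) (R * M) X \<and> bl E' M c \<and> ((\<forall>k. P k) \<longrightarrow> c = (\<lambda>\<omega>. 0)) \<and>
    (\<forall>\<omega>\<in>E'. \<forall>t. ((\<lambda>t. X \<omega> t) has_vector_derivative F \<omega> t - c \<omega> - \<i> * of_real (\<mu> \<omega>) * X \<omega> t) (at t))"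
proof -
  obtain a k m where m: "\<And>i. bl E (m i) (a i)" and s: "summable (\<lambda>i. m i * exp (s * knorm (k i)))"
     and M: "(\<Sum>i. m i * exp (s * knorm (k i))) \<le> M"
     and FF: "\<And>\<omega> t. \<omega> \<in> E \<Longrightarrow> F \<omega> t = (\<Sum>i. a i \<omega> * cis (kdot (k i) \<omega> * t))"
    using F by (rule qpE) (rule that)
  have m': "bl E' (m i) (a i)" for i using bl_mono[OF m E'] by simp
  have m0: "0 \<le> m i" for i by (rule bl_nonneg[OF m])
  define x where "x i \<omega> = (if P (k i) then a i \<omega> * (1 / (\<i> * of_real (kdot (k i) \<omega> + \<mu> \<omega>))) else 0)" for i \<omega>
  define n where "n i = m i * (R * exp (\<delta> * knorm (k i)))" for i
  define c where "c \<omega> = (\<Sum>i. if P (k i) then 0 else a i \<omega>)" for \<omega>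
  define X where "X \<omega> t = (\<Sum>i. x i \<omega> * cis (kdot (k i) \<omega> * t))" for \<omega> t
  have n: "bl E' (n i) (x i)" for i
  proof (cases "P (k i)")
    case True
    then show ?thesis unfolding n_def x_def using bl_mult[OF m' inv[OF True]] by simp
  next
    case False
    then show ?thesis unfolding n_def x_def using bl_const[of 0 "m i * (R * exp (\<delta> * knorm (k i)))" E'] m0[of i] R by simp
  qed
  have ne: "n i * exp ((s - \<delta>) * knorm (k i)) = R * (m i * exp (s * knorm (k i)))" for i
    unfolding n_def by (simp add: algebra_simps flip: exp_add)
  have nle: "n i \<le> R * (m i * exp (s * knorm (k i)))" for i
  proof -
    have "n i * 1 \<le> n i * exp ((s - \<delta>) * knorm (k i))"
      using d m0[of i] R by (intro mult_left_mono) (auto simp: n_def)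
    then show ?thesis unfolding ne by simp
  qed
  have sn: "summable n"
    by (rule summable_comparison_test'[OF summable_mult[OF s, of R], of 0]) (use nle m0 R n_def in auto)
  have mle: "m i \<le> m i * exp (s * knorm (k i))" for i
  proof -
    have "m i * 1 \<le> m i * exp (s * knorm (k i))"
      using m0[of i] d by (intro mult_left_mono) auto
    then show ?thesis by simp
  qed
  have sm: "summable m"
    by (rule summable_comparison_test'[OF s, of 0]) (use mle m0 in auto)
  have qX: "qp E' (s - \<delta>) (R * M) X"
  proof (rule qpI[OF n])
    show "summable (\<lambda>i. n i * exp ((s - \<delta>) * knorm (k i)))"
      unfolding ne by (rule summable_mult[OF s])
    show "(\<Sum>i. n i * exp ((s - \<delta>) * knorm (k i))) \<le> R * M"
      unfolding ne using suminf_mult[OF s, of R] M R by (simp add: mult_left_mono)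
  qed (simp add: X_def)
  have cm: "bl E' (m i) (\<lambda>\<omega>. if P (k i) then 0 else a i \<omega>)" for i
    using m'[of i] bl_const[of 0 "m i" E'] m0[of i] by (cases "P (k i)") simp_all
  have "bl E' (suminf m) c" unfolding c_def by (rule bl_suminf[OF cm sm])
  then have bc: "bl E' M c"
    by (rule bl_mono) (use suminf_le[OF mle sm s] M in auto)
  have c0: "c = (\<lambda>\<omega>. 0)" if "\<forall>k. P k" using that by (auto simp: c_def)
  have der: "(X \<omega> has_vector_derivative F \<omega> t - c \<omega> - \<i> * of_real (\<mu> \<omega>) * X \<omega> t) (at t)" if w: "\<omega> \<in> E'" for \<omega> t
  proof -
    let ?e = "\<lambda>i t. cis (kdot (k i) \<omega> * t)"
    have xi: "\<i> * of_real (kdot (k i) \<omega>) * x i \<omega> = a i \<omega> - (if P (k i) then 0 else a i \<omega>) - \<i> * of_real (\<mu> \<omega>) * x i \<omega>" for i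
    proof (cases "P (k i)")
      case True
      have "of_real (kdot (k i) \<omega> + \<mu> \<omega>) \<noteq> (0::complex)" using nz[OF True w] by (metis of_real_eq_0_iff)
      then have "\<i> * of_real (kdot (k i) \<omega> + \<mu> \<omega>) * x i \<omega> = a i \<omega>" using True by (simp add: x_def)
      then show ?thesis using True by (simp add: algebra_simps)
    qed (simp add: x_def)
    \<comment> \<open>The equation for the coefficients itself bounds the differentiated terms, so
      no further width is spent on the factor k . \<omega>.\<close>
    have bnd: "norm (\<i> * of_real (kdot (k i) \<omega>) * x i \<omega> * ?e i t) \<le> 2 * m i + \<bar>\<mu> \<omega>\<bar> * n i" for i t
    proof -
      have "norm (\<i> * of_real (kdot (k i) \<omega>) * x i \<omega> * ?e i t) = norm (a i \<omega> - (if P (k i) then 0 else a i \<omega>) - \<i> * of_real (\<mu> \<omega>) * x i \<omega>)"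
        unfolding xi norm_mult[of _ "?e i t"] by simp
      also have "\<dots> \<le> norm (a i \<omega>) + norm (if P (k i) then 0 else a i \<omega>) + norm (\<i> * of_real (\<mu> \<omega>) * x i \<omega>)"
        by (intro norm_triangle_le_diff add_mono norm_triangle_ineq4 order_refl)
      also have "\<dots> \<le> m i + m i + \<bar>\<mu> \<omega>\<bar> * n i"
        using bl_norm[OF m' w, of i] bl_norm[OF n w, of i] m0[of i]
        by (intro add_mono) (auto simp: norm_mult intro!: mult_left_mono)
      finally show ?thesis by simp
    qed
    have sa: "summable (\<lambda>i. a i \<omega> * ?e i t)" for t
      by (rule summable_comparison_test'[OF sm, of 0]) (use bl_norm[OF m' w] in \<open>auto simp: norm_mult\<close>)
    have sx: "summable (\<lambda>i. x i \<omega> * ?e i t)" for t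
      by (rule summable_comparison_test'[OF sn, of 0]) (use bl_norm[OF n w] in \<open>auto simp: norm_mult\<close>)
    have sc: "summable (\<lambda>i. if P (k i) then 0 else a i \<omega>)"
      by (rule bl_summable[OF cm sm w])
    have "((\<lambda>t. \<Sum>i. x i \<omega> * ?e i t) has_derivative
        (\<lambda>h. \<Sum>i. h *\<^sub>R (\<i> * of_real (kdot (k i) \<omega>) * x i \<omega> * ?e i t))) (at t within UNIV)"
    proof (rule has_derivative_suminf_M[where M = "\<lambda>i. 2 * m i + \<bar>\<mu> \<omega>\<bar> * n i"])
      fix i and t :: real
      have "((\<lambda>t. x i \<omega> * ?e i t) has_vector_derivative \<i> * of_real (kdot (k i) \<omega>) * x i \<omega> * ?e i t) (at t within UNIV)"
        unfolding has_vector_derivative_complex_iff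
        by (auto intro!: derivative_eq_intros simp: algebra_simps)
      then show "((\<lambda>t. x i \<omega> * ?e i t) has_derivative
        (\<lambda>h. h *\<^sub>R (\<i> * of_real (kdot (k i) \<omega>) * x i \<omega> * ?e i t))) (at t within UNIV)"
        unfolding has_vector_derivative_def .
    next
      fix i and t h :: real
      show "norm (h *\<^sub>R (\<i> * of_real (kdot (k i) \<omega>) * x i \<omega> * ?e i t)) \<le> (2 * m i + \<bar>\<mu> \<omega>\<bar> * n i) * norm h"
        using mult_left_mono[OF bnd[of i t], of "\<bar>h\<bar>"] by (simp only: norm_scaleR real_norm_def mult.commute abs_ge_zero)
    next
      show "summable (\<lambda>i. 2 * m i + \<bar>\<mu> \<omega>\<bar> * n i)"
        by (intro summable_add summable_mult sm sn)
    qed (use sx in auto)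
    moreover have "(\<Sum>i. h *\<^sub>R (\<i> * of_real (kdot (k i) \<omega>) * x i \<omega> * ?e i t)) = h *\<^sub>R (F \<omega> t - c \<omega> - \<i> * of_real (\<mu> \<omega>) * X \<omega> t)" for h
    proof -
      \<comment> \<open>Where no division takes place the exponential is identically 1, so these
        terms add up to \<open>c\<close>.\<close>
      have z: "(if P (k i) then 0 else a i \<omega>) * ?e i t = (if P (k i) then 0 else a i \<omega>)" for i
        using Z[of "k i"] by auto
      have "\<i> * of_real (kdot (k i) \<omega>) * x i \<omega> * ?e i t
        = a i \<omega> * ?e i t - (if P (k i) then 0 else a i \<omega>) - \<i> * of_real (\<mu> \<omega>) * (x i \<omega> * ?e i t)" for i
        unfolding xi using z[of i] by (simp add: algebra_simps)
      then have "(\<lambda>i. \<i> * of_real (kdot (k i) \<omega>) * x i \<omega> * ?e i t) sums (F \<omega> t - c \<omega> - \<i> * of_real (\<mu> \<omega>) * X \<omega> t)"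
        unfolding X_def c_def using FF E' w
        by (auto intro!: sums_diff sums_mult simp: sa sx sc summable_sums subset_iff)
      then show ?thesis by (intro sums_unique[symmetric] sums_scaleR_right)
    qed
    ultimately show ?thesis unfolding has_vector_derivative_def X_def by simp
  qed
  show ?thesis using qX bc c0 der by blast
qed

text \<open>The division by the dimension m makes the matrix product submultiplicative: an entry of
  it is a sum of m products of size (M/m) (N/m), that is MN/m. The same normalisation makes
  \<open>M\<close> a bound for the maximal row sum.\<close>

definition qpm :: "(real ^ 'n::finite) set \<Rightarrow> real \<Rightarrow> real \<Rightarrow> (real ^ 'n \<Rightarrow> real \<Rightarrow> 'm::finite sqmat) \<Rightarrow> bool" where
  "qpm E s M F \<longleftrightarrow> (\<forall>i j. qp E s (M / real CARD('m)) (\<lambda>\<omega> t. ent (F \<omega> t) i j))"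

lemma qpmD: "qpm E s M F \<Longrightarrow> qp E s (M / real CARD('m)) (\<lambda>\<omega> t. ent (F \<omega> t :: 'm::finite sqmat) i j)"
  by (simp add: qpm_def)

lemma qpm_mono: "qpm E s M F \<Longrightarrow> E' \<subseteq> E \<Longrightarrow> s' \<le> s \<Longrightarrow> M \<le> M' \<Longrightarrow> qpm E' s' M' F"
  unfolding qpm_def by (intro allI) (rule qp_mono, auto intro: divide_right_mono)

lemma qpm_nonneg: "qpm E s M F \<Longrightarrow> 0 \<le> M"
proof -
  assume "qpm E s M (F :: _ \<Rightarrow> _ \<Rightarrow> 'b sqmat)"
  then have "0 \<le> M / real CARD('b)" unfolding qpm_def using qp_nonneg by blast
  then show "0 \<le> M" by (simp add: zero_le_divide_iff)
qed

lemma qpm_add: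
  "qpm E s M F \<Longrightarrow> qpm E s N G \<Longrightarrow> 0 \<le> s \<Longrightarrow> qpm E s (M + N) (\<lambda>\<omega> t. F \<omega> t + G \<omega> t)"
  unfolding qpm_def ent_simps add_divide_distrib by (intro allI qp_add) auto

lemma qpm_diff:
  "qpm E s M F \<Longrightarrow> qpm E s N G \<Longrightarrow> 0 \<le> s \<Longrightarrow> qpm E s (M + N) (\<lambda>\<omega> t. F \<omega> t - G \<omega> t)"
  unfolding qpm_def ent_simps add_divide_distrib by (intro allI qp_diff) auto

lemma qpm_uminus: "qpm E s M F \<Longrightarrow> 0 \<le> s \<Longrightarrow> qpm E s M (\<lambda>\<omega> t. - F \<omega> t)"
  unfolding qpm_def ent_simps by (intro allI qp_uminus) auto

lemma qpm_scaleR: "qpm E s M F \<Longrightarrow> 0 \<le> s \<Longrightarrow> qpm E s (\<bar>r\<bar> * M) (\<lambda>\<omega> t. r *\<^sub>R F \<omega> t)"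
  unfolding qpm_def ent_simps scaleR_conv_of_real[where 'a = complex] times_divide_eq_right[symmetric]
  by (intro allI qp_cmult) auto

lemma qpm_mult:
  fixes F G :: "real ^ 'n::finite \<Rightarrow> real \<Rightarrow> 'm::finite sqmat"
  assumes "qpm E s M F" "qpm E s N G" "0 \<le> s"
  shows "qpm E s (M * N) (\<lambda>\<omega> t. F \<omega> t * G \<omega> t)"
  unfolding qpm_def
proof (intro allI)
  fix i j
  have "qp E s (\<Sum>l\<in>(UNIV::'m set). (M / CARD('m)) * (N / CARD('m))) (\<lambda>\<omega> t. \<Sum>l\<in>UNIV. ent (F \<omega> t) i l * ent (G \<omega> t) l j)"
    using assms by (intro qp_sum qp_mult qpmD) auto
  then show "qp E s (M * N / CARD('m)) (\<lambda>\<omega> t. ent (F \<omega> t * G \<omega> t) i j)"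
    by (simp add: ent_simps field_simps)
qed

lemma qpm_bound:
  fixes F :: "real ^ 'n::finite \<Rightarrow> real \<Rightarrow> 'm::finite sqmat"
  assumes "qpm E s M F" "0 \<le> s" "\<omega> \<in> E"
  shows "norm (F \<omega> t) \<le> M"
  unfolding sqmat_norm_le_iff
proof
  fix i
  have "(\<Sum>j\<in>UNIV. norm (ent (F \<omega> t) i j)) \<le> (\<Sum>j\<in>(UNIV::'m set). M / CARD('m))"
    by (intro sum_mono qp_bound[OF qpmD[OF assms(1)] assms(2,3)])
  then show "(\<Sum>j\<in>UNIV. norm (ent (F \<omega> t) i j)) \<le> M" by simp
qed

lemma qpm_suminf:
  fixes F :: "nat \<Rightarrow> real ^ 'n::finite \<Rightarrow> real \<Rightarrow> 'm::finite sqmat"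
  assumes F: "\<And>j. qpm E s (M j) (F j)" and M: "summable M" "suminf M \<le> B" and s0: "0 \<le> s"
  shows "qpm E s B (\<lambda>\<omega> t. \<Sum>j. F j \<omega> t)"
  unfolding qpm_def
proof (intro allI)
  fix a b
  have "qp E s (B / CARD('m)) (\<lambda>\<omega> t. \<Sum>j. ent (F j \<omega> t) a b)"
    by (rule qp_suminf[OF qpmD[OF F] _ _ s0]) (use M in \<open>auto simp: suminf_divide divide_right_mono intro: summable_divide\<close>)
  then show "qp E s (B / CARD('m)) (\<lambda>\<omega> t. ent (\<Sum>j. F j \<omega> t) a b)"
  proof (rule qp_cong)
    fix \<omega> t assume w: "\<omega> \<in> E"
    have "summable (\<lambda>j. F j \<omega> t)"
      by (rule summable_norm_cancel, rule summable_comparison_test'[OF M(1), of 0])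
         (use qpm_bound[OF F s0 w] in auto)
    then show "(\<Sum>j. ent (F j \<omega> t) a b) = ent (\<Sum>j. F j \<omega> t) a b"
      by (simp add: ent_suminf)
  qed
qed

lemma qpm_power:
  assumes "qpm E s M F" "0 \<le> s"
  shows "qpm E s (M ^ Suc n) (\<lambda>\<omega> t. F \<omega> t ^ Suc n)"
proof (induction n)
  case (Suc n)
  show ?case using qpm_mult[OF assms(1) Suc assms(2)] by simp
qed (use assms in simp)

section \<open>Power series of small quasi-periodic matrices\<close>

lemma geometric_tail_sums:
  fixes M :: real assumes "0 \<le> M" "M \<le> 1/2"
  shows "summable (\<lambda>n. M ^ Suc n)" "(\<Sum>n. M ^ Suc n) \<le> 2 * M"
proof -
  have s: "summable (\<lambda>n. M ^ n)" using assms by (intro summable_geometric) auto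
  then show "summable (\<lambda>n. M ^ Suc n)" by (simp add: summable_mult)
  have "(\<Sum>n. M ^ Suc n) = M * (\<Sum>n. M ^ n)" using suminf_mult[OF s, of M] by simp
  also have "(\<Sum>n. M ^ n) = 1 / (1 - M)" using assms by (intro suminf_geometric) auto
  also have "M * (1 / (1 - M)) \<le> M * 2" using assms by (intro mult_left_mono) (auto simp: field_simps)
  finally show "(\<Sum>n. M ^ Suc n) \<le> 2 * M" by simp
qed

lemma qpm_lnp:
  assumes F: "qpm E s M F" and s: "0 \<le> s" and M: "M \<le> 1/2"
  shows "qpm E s (2 * M) (\<lambda>\<omega> t. lnp (F \<omega> t))"
  unfolding lnp_def
proof (rule qpm_suminf[where M = "\<lambda>n. M ^ Suc n"])
  fix n
  have "\<bar>(- 1) ^ n / real (Suc n)\<bar> * M ^ Suc n \<le> 1 * M ^ Suc n"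
    using qpm_nonneg[OF F] by (intro mult_right_mono) (auto simp: power_abs)
  then show "qpm E s (M ^ Suc n) (\<lambda>\<omega> t. ((- 1) ^ n / real (Suc n)) *\<^sub>R F \<omega> t ^ Suc n)"
    by (intro qpm_mono[OF qpm_scaleR[OF qpm_power[OF F s] s]]) auto
qed (use s M geometric_tail_sums qpm_nonneg[OF F] in auto)

text \<open>The series starts at the first power because the identity is not small in
  \<open>qpm\<close>: its diagonal entries force \<open>M\<close> to be at least the dimension. For
  the same reason every transformation is kept in the form 1 plus a small part.\<close>

lemma qpm_geometric:
  assumes F: "qpm E s M F" and s: "0 \<le> s" and M: "M \<le> 1/2"
  shows "qpm E s (2 * M) (\<lambda>\<omega> t. \<Sum>n. F \<omega> t ^ Suc n)"
  by (rule qpm_suminf[where M = "\<lambda>n. M ^ Suc n"])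
     (use s M geometric_tail_sums qpm_nonneg[OF F] qpm_power[OF F s] in auto)

lemma neumann_inverse:
  fixes A :: "'a::{real_normed_algebra_1,banach}"
  assumes "norm A < 1"
  shows "(1 - A) * (1 + (\<Sum>n. A ^ Suc n)) = 1" "(1 + (\<Sum>n. A ^ Suc n)) * (1 - A) = 1"
proof -
  have s: "summable (\<lambda>n. A ^ n)" by (rule complete_algebra_summable_geometric[OF assms])
  have 1: "(\<Sum>n. A ^ Suc n) = A * (\<Sum>n. A ^ n)" using suminf_mult[OF s, of A] by simp
  have 2: "(\<Sum>n. A ^ Suc n) = (\<Sum>n. A ^ n) * A" using suminf_mult2[OF s, of A] by (simp add: power_commutes)
  have 3: "1 + (\<Sum>n. A ^ Suc n) = (\<Sum>n. A ^ n)" using suminf_split_head[OF s] by simp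
  show "(1 - A) * (1 + (\<Sum>n. A ^ Suc n)) = 1" unfolding 3 using 1 3 by (simp add: algebra_simps)
  show "(1 + (\<Sum>n. A ^ Suc n)) * (1 - A) = 1" unfolding 3 using 2 3 by (simp add: algebra_simps)
qed

section \<open>Symplectic and real structure\<close>

text \<open>With \<open>bar\<close> and \<open>sg\<close> the symplectic form
  \<open>symp u v\<close> is the sum over \<open>i\<close> of
  \<open>sg i * u $ i * v $ bar i\<close>; on the real form, \<open>bar\<close> also describes
  complex conjugation of the coordinates.\<close>

fun bar :: "coord \<Rightarrow> coord" where
  "bar Xi1 = Eta1" | "bar Eta1 = Xi1" | "bar Xi2 = Eta2" | "bar Eta2 = Xi2"

fun sg :: "coord \<Rightarrow> complex" where
  "sg Xi1 = 1" | "sg Eta1 = -1" | "sg Xi2 = 1" | "sg Eta2 = -1"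

lemma bar_bar [simp]: "bar (bar i) = i" by (cases i) auto
lemma sg_bar [simp]: "sg (bar i) = - sg i" by (cases i) auto
lemma sg_sq [simp]: "sg i * sg i = 1" by (cases i) auto
lemma cnj_sg [simp]: "cnj (sg i) = sg i" by (cases i) auto
lemma norm_sg [simp]: "norm (sg i) = 1" by (cases i) auto
lemma bar_eq_iff [simp]: "bar i = bar j \<longleftrightarrow> i = j" by (metis bar_bar)
lemma sum_bar: "(\<Sum>i\<in>UNIV. f (bar i)) = (\<Sum>i\<in>UNIV. f i)"
  by (rule sum.reindex_bij_witness[of _ bar bar]) auto

text \<open>The adjoint for the form \<open>symp\<close>, and the complex conjugation for the real form \<open>\<eta> = cnj \<xi>\<close>: a matrix is
  Hamiltonian iff \<open>star A = - A\<close>, symplectic iff \<open>A * star A = 1\<close>, and real iff \<open>cj A = A\<close>.\<close>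
definition star :: "coord sqmat \<Rightarrow> coord sqmat" where
  "star A = Mat (\<lambda>i j. sg i * sg j * ent A (bar j) (bar i))"

definition cj :: "coord sqmat \<Rightarrow> coord sqmat" where
  "cj A = Mat (\<lambda>i j. cnj (ent A (bar i) (bar j)))"

lemma ent_star: "ent (star A) i j = sg i * sg j * ent A (bar j) (bar i)" by (simp add: star_def)
lemma ent_cj: "ent (cj A) i j = cnj (ent A (bar i) (bar j))" by (simp add: cj_def)

lemma star_simps [simp]:
  "star 0 = 0" "star 1 = 1" "star (A + B) = star A + star B" "star (A - B) = star A - star B"
  "star (- A) = - star A" "star (r *\<^sub>R A) = r *\<^sub>R star A" "star (star A) = A"
  by (auto intro!: sqmat_eqI simp: ent_star ent_simps algebra_simps)

lemma cj_simps [simp]: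
  "cj 0 = 0" "cj 1 = 1" "cj (A + B) = cj A + cj B" "cj (A - B) = cj A - cj B"
  "cj (- A) = - cj A" "cj (r *\<^sub>R A) = r *\<^sub>R cj A" "cj (cj A) = A"
  by (auto intro!: sqmat_eqI simp: ent_cj ent_simps)

lemma star_mult: "star (A * B) = star B * star A"
proof (rule sqmat_eqI)
  fix i j
  have "ent (star B * star A) i j = (\<Sum>k\<in>UNIV. sg i * sg j * (ent A (bar j) (bar k) * ent B (bar k) (bar i)))"
    unfolding ent_simps ent_star
  proof (rule sum.cong[OF refl])
    fix k
    have "sg i * sg k * ent B (bar k) (bar i) * (sg k * sg j * ent A (bar j) (bar k))
       = (sg k * sg k) * (sg i * sg j * (ent A (bar j) (bar k) * ent B (bar k) (bar i)))" by (simp only: mult_ac)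
    then show "sg i * sg k * ent B (bar k) (bar i) * (sg k * sg j * ent A (bar j) (bar k))
       = sg i * sg j * (ent A (bar j) (bar k) * ent B (bar k) (bar i))" by simp
  qed
  also have "\<dots> = ent (star (A * B)) i j"
    using sum_bar[of "\<lambda>k. sg i * sg j * (ent A (bar j) k * ent B k (bar i))"]
    by (simp add: ent_star ent_simps sum_distrib_left)
  finally show "ent (star (A * B)) i j = ent (star B * star A) i j" by simp
qed

lemma cj_mult: "cj (A * B) = cj A * cj B"
proof (rule sqmat_eqI)
  fix i j
  show "ent (cj (A * B)) i j = ent (cj A * cj B) i j"
    using sum_bar[of "\<lambda>k. cnj (ent A (bar i) k * ent B k (bar j))"] by (simp add: ent_cj ent_simps)
qed

lemma star_cj: "star (cj A) = cj (star A)"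
  by (auto intro!: sqmat_eqI simp: ent_cj ent_star)

lemma bounded_linear_star: "bounded_linear star"
proof (rule bounded_linear_intro[where K = 4])
  fix A
  have "(\<Sum>j\<in>UNIV. norm (ent (star A) i j)) \<le> (\<Sum>j\<in>(UNIV::coord set). norm A)" for i
    by (intro sum_mono) (auto simp: ent_star norm_mult norm_ent_le)
  then show "norm (star A) \<le> norm A * 4" unfolding sqmat_norm_le_iff by (simp add: UNIV_coord mult.commute)
qed auto

lemma bounded_linear_cj: "bounded_linear cj"
proof (rule bounded_linear_intro[where K = 4])
  fix A
  have "(\<Sum>j\<in>UNIV. norm (ent (cj A) i j)) \<le> (\<Sum>j\<in>(UNIV::coord set). norm A)" for i
    by (intro sum_mono) (auto simp: ent_cj norm_ent_le)
  then show "norm (cj A) \<le> norm A * 4" unfolding sqmat_norm_le_iff by (simp add: UNIV_coord mult.commute)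
qed auto

lemma qpm_star: "qpm E s M F \<Longrightarrow> 0 \<le> s \<Longrightarrow> qpm E s M (\<lambda>\<omega> t. star (F \<omega> t))"
  unfolding qpm_def ent_star
proof (intro allI)
  fix i j
  assume "\<forall>i j. qp E s (M / real CARD(coord)) (\<lambda>\<omega> t. ent (F \<omega> t) i j)" "0 \<le> s"
  then show "qp E s (M / real CARD(coord)) (\<lambda>\<omega> t. sg i * sg j * ent (F \<omega> t) (bar j) (bar i))"
    using qp_cmult[of E s "M / real CARD(coord)" "\<lambda>\<omega> t. ent (F \<omega> t) (bar j) (bar i)" "sg i * sg j" 1]
    by (simp add: norm_mult)
qed

lemma qpm_cj: "qpm E s M F \<Longrightarrow> 0 \<le> s \<Longrightarrow> qpm E s M (\<lambda>\<omega> t. cj (F \<omega> t))"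
  unfolding qpm_def ent_cj by (intro allI qp_cnj) auto

definition Dg :: "(coord \<Rightarrow> real) \<Rightarrow> coord sqmat" where
  "Dg l = Mat (\<lambda>i j. if i = j then \<i> * of_real (l i) else 0)"

lemma ent_Dg: "ent (Dg l) i j = (if i = j then \<i> * of_real (l i) else 0)" by (simp add: Dg_def)

lemma star_Dg: "(\<And>i. l (bar i) = - l i) \<Longrightarrow> star (Dg l) = - Dg l"
  by (auto intro!: sqmat_eqI simp: ent_star ent_Dg ent_simps)

lemma cj_Dg: "(\<And>i. l (bar i) = - l i) \<Longrightarrow> cj (Dg l) = Dg l"
  by (auto intro!: sqmat_eqI simp: ent_cj ent_Dg ent_simps)

lemma ent_mult_Dg: "ent (A * Dg l) i j = ent A i j * (\<i> * of_real (l j))"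
proof -
  have "ent (A * Dg l) i j = (\<Sum>k\<in>UNIV. if k = j then ent A i j * (\<i> * of_real (l j)) else 0)"
    unfolding ent_simps ent_Dg by (intro sum.cong) auto
  then show ?thesis by simp
qed

lemma ent_Dg_mult: "ent (Dg l * A) i j = \<i> * of_real (l i) * ent A i j"
proof -
  have "ent (Dg l * A) i j = (\<Sum>k\<in>UNIV. if i = k then \<i> * of_real (l i) * ent A i j else 0)"
    unfolding ent_simps ent_Dg by (intro sum.cong) auto
  then show ?thesis by simp
qed

text \<open>\<open>P * (1 + A)\<close> is the Cayley transform of \<open>A\<close>, and \<open>P * A' * P * (1 + A) + P * A'\<close> its derivative. Unlike an
  exponential it gives the new remainder \<open>P * W * P'\<close> in closed form.\<close>
lemma cayley_conjugation:
  fixes A A' c D Q P P' W :: "'a::ring_1"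
  assumes P: "(1 - A) * P = 1" "P * (1 - A) = 1" and P': "(1 + A) * P' = 1" "P' * (1 + A) = 1"
    and A': "A' + A' = - (Q - c) - 2 * (A * D - D * A)"
    and W: "W = A * (Q + c) - (Q + c) * A - A * (Q - c) * A"
  shows "P * A' * P * (1 + A) + P * A' = (D + c + P * W * P') * (P * (1 + A)) - P * (1 + A) * (D + Q)"
proof -
  \<comment> \<open>Since \<open>1 - A\<close> is invertible, the identity may be tested after
    multiplying by it on both sides; this removes \<open>P\<close> and \<open>P'\<close> and leaves
    a polynomial identity.\<close>
  have cancel: "X = Y" if "(1 - A) * X * (1 - A) = (1 - A) * Y * (1 - A)" for X Y
  proof -
    have "P * ((1 - A) * X * (1 - A)) * P = P * ((1 - A) * Y * (1 - A)) * P" using that by simp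
    then have "(P * (1 - A)) * X * ((1 - A) * P) = (P * (1 - A)) * Y * ((1 - A) * P)" by (simp only: mult.assoc)
    then show ?thesis by (simp add: P)
  qed
  have k: "P * (1 + A) * (1 - A) = 1 + A"
  proof -
    have "P * (1 + A) * (1 - A) = P * (1 - A) * (1 + A)" by (simp add: algebra_simps)
    then show ?thesis by (simp add: P)
  qed
  have expand: "b * ((x + p * w * p') * (p * a) - p * a * y) * b
      = b * x * (p * a * b) + (b * p) * w * (p' * (p * a * b)) - (b * p) * a * y * b" for a b p p' w x y :: 'a
    by (simp add: algebra_simps)
  show ?thesis
  proof (rule cancel)
    have "(1 - A) * (P * A' * P * (1 + A) + P * A') * (1 - A)
       = ((1 - A) * P) * A' * (P * (1 + A) * (1 - A)) + ((1 - A) * P) * A' * (1 - A)"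
      by (simp only: distrib_left distrib_right mult.assoc)
    also have "\<dots> = A' * (1 + A) + A' * (1 - A)" by (simp only: k P mult_1)
    also have "\<dots> = A' + A'" by (simp add: algebra_simps)
    finally have L: "(1 - A) * (P * A' * P * (1 + A) + P * A') * (1 - A) = A' + A'" .
    have "(1 - A) * ((D + c + P * W * P') * (P * (1 + A)) - P * (1 + A) * (D + Q)) * (1 - A)
      = (1 - A) * (D + c) * (P * (1 + A) * (1 - A)) + ((1 - A) * P) * W * (P' * (P * (1 + A) * (1 - A)))
         - ((1 - A) * P) * (1 + A) * (D + Q) * (1 - A)"
      by (rule expand)
    also have "\<dots> = (1 - A) * (D + c) * (1 + A) + W - (1 + A) * (D + Q) * (1 - A)"
      by (simp only: k P P' mult_1 mult_1_right)
    \<comment> \<open>The terms without \<open>A\<close> and the commutator with \<open>D\<close>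
      form \<open>A' + A'\<close>. Every other term has a factor \<open>A\<close> and a factor
      \<open>Q\<close> or \<open>c\<close>; together they are cancelled by \<open>W\<close>, which
      is thus quadratic in the perturbation.\<close>
    also have "\<dots> = A' + A'" unfolding A' W by (simp add: algebra_simps mult_2)
    finally show "(1 - A) * (P * A' * P * (1 + A) + P * A') * (1 - A) =
      (1 - A) * ((D + c + P * W * P') * (P * (1 + A)) - P * (1 + A) * (D + Q)) * (1 - A)" using L by simp
  qed
qed

section \<open>One step of the iteration\<close>

lemma bl_add:
  assumes a: "bl E m a" and b: "bl E n b"
  shows "bl E (m + n) (\<lambda>\<omega>. a \<omega> + b \<omega>)"
proof (rule blI)
  show "0 \<le> m + n" using bl_nonneg[OF a] bl_nonneg[OF b] by simp
  show n: "norm (a \<omega> + b \<omega>) \<le> m + n" if "\<omega> \<in> E" for \<omega>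
    using bl_norm[OF a that] bl_norm[OF b that] norm_triangle_le add_mono by blast
  fix \<omega> \<omega>' assume w: "\<omega> \<in> E" "\<omega>' \<in> E"
  have "norm (a \<omega> + b \<omega>) * dist \<omega> \<omega>' \<le> (norm (a \<omega>) + norm (b \<omega>)) * dist \<omega> \<omega>'"
    by (intro mult_right_mono norm_triangle_ineq) auto
  moreover have "dist (a \<omega> + b \<omega>) (a \<omega>' + b \<omega>') \<le> dist (a \<omega>) (a \<omega>') + dist (b \<omega>) (b \<omega>')"
    by (rule dist_triangle_add)
  ultimately show "norm (a \<omega> + b \<omega>) * dist \<omega> \<omega>' + dist (a \<omega> + b \<omega>) (a \<omega>' + b \<omega>') \<le> (m + n) * dist \<omega> \<omega>'"
    using bl_lip[OF a w] bl_lip[OF b w] by (simp add: distrib_right)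
qed

text \<open>The commutator of \<open>A\<close> with \<open>Dg l\<close> multiplies entry (i, j) by i
  (l j - l i), so the matrix equation decouples. Only the mean of a diagonal entry has divisor 0,
  hence the restriction on \<open>i\<close>, \<open>j\<close>, \<open>k\<close> and the diagonal
  \<open>c\<close>. The factor 1/2 stems from the Cayley transform, which is 1 + 2A to first
  order.\<close>

lemma homological_matrix:
  fixes Q :: "real ^ 'n::finite \<Rightarrow> real \<Rightarrow> coord sqmat" and l :: "real ^ 'n \<Rightarrow> coord \<Rightarrow> real"
  assumes Q: "qpm E s M Q" and E': "E' \<subseteq> E" and d: "0 \<le> \<delta>" "\<delta> \<le> s" and R: "0 \<le> R"
    and inv: "\<And>i j k. i \<noteq> j \<or> k \<noteq> (\<lambda>_. 0) \<Longrightarrow>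
       bl E' (R * exp (\<delta> * knorm k)) (\<lambda>\<omega>. 1 / (\<i> * of_real (kdot k \<omega> + (l \<omega> j - l \<omega> i))))"
    and nz: "\<And>i j k \<omega>. i \<noteq> j \<or> k \<noteq> (\<lambda>_. 0) \<Longrightarrow> \<omega> \<in> E' \<Longrightarrow> kdot k \<omega> + (l \<omega> j - l \<omega> i) \<noteq> 0"
  shows "\<exists>A c. qpm E' (s - \<delta>) (R * M) (A :: real ^ 'n \<Rightarrow> real \<Rightarrow> coord sqmat) \<and>
    (\<forall>i j. bl E' (M / 4) (\<lambda>\<omega>. ent (c \<omega> :: coord sqmat) i j)) \<and>
    (\<forall>\<omega> i j. i \<noteq> j \<longrightarrow> ent (c \<omega>) i j = 0) \<and>
    (\<forall>\<omega>\<in>E'. \<forall>t. ((\<lambda>t. A \<omega> t) has_vector_derivative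
        (- (1/2)) *\<^sub>R (Q \<omega> t - c \<omega>) - (A \<omega> t * Dg (l \<omega>) - Dg (l \<omega>) * A \<omega> t)) (at t))"
proof -
  have s: "0 \<le> s" using d by simp
  have card: "real CARD(coord) = 4" by (simp add: UNIV_coord)
  define H where "H i j X c \<longleftrightarrow> qp E' (s - \<delta>) (R * (M / 8)) X \<and> bl E' (M / 8) c \<and> (i \<noteq> j \<longrightarrow> c = (\<lambda>\<omega>. 0)) \<and>
      (\<forall>\<omega>\<in>E'. \<forall>t. ((\<lambda>t. X \<omega> t) has_vector_derivative - (1/2) * ent (Q \<omega> t) i j - c \<omega> - \<i> * of_real (l \<omega> j - l \<omega> i) * X \<omega> t) (at t))"
    for i j X c
  have "\<exists>X c. H i j X c"
    for i j
  proof -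
    have "qp E s (M / 8) (\<lambda>\<omega> t. - (1/2) * ent (Q \<omega> t) i j)"
      using qp_cmult[OF qpmD[OF Q, of i j] _ s, of "- (1/2)" "1/2"] by (simp add: card)
    from qp_homological[OF this E' d R, where P = "\<lambda>k. i \<noteq> j \<or> k \<noteq> (\<lambda>_. 0)" and \<mu> = "\<lambda>\<omega>. l \<omega> j - l \<omega> i", OF inv nz]
    obtain X c where "qp E' (s - \<delta>) (R * (M / 8)) X" "bl E' (M / 8) c"
      "(\<forall>k::'n \<Rightarrow> int. i \<noteq> j \<or> k \<noteq> (\<lambda>_. 0)) \<longrightarrow> c = (\<lambda>\<omega>. 0)"
      "\<forall>\<omega>\<in>E'. \<forall>t. ((\<lambda>t. X \<omega> t) has_vector_derivative - (1/2) * ent (Q \<omega> t) i j - c \<omega> - \<i> * of_real (l \<omega> j - l \<omega> i) * X \<omega> t) (at t)"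
      by blast
    then show ?thesis unfolding H_def by blast
  qed
  then obtain X c where "\<And>i j. H i j (X i j) (c i j)" by metis
  then have X: "\<And>i j. qp E' (s - \<delta>) (R * (M / 8)) (X i j)" and c: "\<And>i j. bl E' (M / 8) (c i j)"
    and c0: "\<And>i j \<omega>. i \<noteq> j \<Longrightarrow> c i j \<omega> = 0"
    and der: "\<And>i j \<omega> t. \<omega> \<in> E' \<Longrightarrow> ((\<lambda>t. X i j \<omega> t) has_vector_derivative - (1/2) * ent (Q \<omega> t) i j - c i j \<omega> - \<i> * of_real (l \<omega> j - l \<omega> i) * X i j \<omega> t) (at t)"
    unfolding H_def by (blast, blast, metis, blast)
  define A where "A \<omega> t = Mat (\<lambda>i j. X i j \<omega> t)" for \<omega> t
  \<comment> \<open>The scalar equations subtract \<open>c i j\<close>, the matrix equation adds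
    half of \<open>C\<close>; hence the factor -2, which also turns the bound M / 8 into M /
    4.\<close>
  define C where "C \<omega> = Mat (\<lambda>i j. - 2 * c i j \<omega>)" for \<omega>
  have "0 \<le> R * M" using R qpm_nonneg[OF Q] by simp
  then have "qpm E' (s - \<delta>) (R * M) A"
    unfolding qpm_def A_def card ent_Mat by (intro allI qp_mono[OF X]) (auto simp: mult.commute)
  moreover have "bl E' (M / 4) (\<lambda>\<omega>. ent (C \<omega>) i j)" for i j
    using bl_mult[OF bl_const[of "-2" 2] c[of i j]] by (simp add: C_def)
  moreover have "ent (C \<omega>) i j = 0" if "i \<noteq> j" for i j \<omega> using c0[OF that] by (simp add: C_def)
  moreover have "((\<lambda>t. A \<omega> t) has_vector_derivative
        (- (1/2)) *\<^sub>R (Q \<omega> t - C \<omega>) - (A \<omega> t * Dg (l \<omega>) - Dg (l \<omega>) * A \<omega> t)) (at t)" if "\<omega> \<in> E'" for \<omega> t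
  proof (rule sqmat_has_vector_derivativeI)
    fix i j
    have "ent ((- (1/2)) *\<^sub>R (Q \<omega> t - C \<omega>) - (A \<omega> t * Dg (l \<omega>) - Dg (l \<omega>) * A \<omega> t)) i j
      = - (1/2) * ent (Q \<omega> t) i j - c i j \<omega> - \<i> * of_real (l \<omega> j - l \<omega> i) * X i j \<omega> t"
      unfolding ent_simps(4,7) ent_mult_Dg ent_Dg_mult A_def C_def ent_Mat
      by (simp add: algebra_simps scaleR_conv_of_real)
    then show "((\<lambda>t. ent (A \<omega> t) i j) has_vector_derivative
       ent ((- (1/2)) *\<^sub>R (Q \<omega> t - C \<omega>) - (A \<omega> t * Dg (l \<omega>) - Dg (l \<omega>) * A \<omega> t)) i j) (at t)"
      using der[OF that, of i j t] unfolding A_def ent_Mat by simp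
  qed
  ultimately show ?thesis by blast
qed

text \<open>Expansions are not unique, so a solution read off from one need not inherit the
  symmetries of \<open>Q\<close>. It is averaged by \<open>sy\<close>, the projection onto real
  Hamiltonian matrices, which fixes \<open>Q\<close>, commutes with the commutator with
  \<open>Dg l\<close> and does not enlarge the bounds.\<close>

lemma homological_symmetric:
  fixes Q :: "real ^ 'n::finite \<Rightarrow> real \<Rightarrow> coord sqmat" and l :: "real ^ 'n \<Rightarrow> coord \<Rightarrow> real"
  assumes Q: "qpm E s M Q" and E': "E' \<subseteq> E" and d: "0 \<le> \<delta>" "\<delta> \<le> s" and R: "0 \<le> R"
    and inv: "\<And>i j k. i \<noteq> j \<or> k \<noteq> (\<lambda>_. 0) \<Longrightarrow>
       bl E' (R * exp (\<delta> * knorm k)) (\<lambda>\<omega>. 1 / (\<i> * of_real (kdot k \<omega> + (l \<omega> j - l \<omega> i))))"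
    and nz: "\<And>i j k \<omega>. i \<noteq> j \<or> k \<noteq> (\<lambda>_. 0) \<Longrightarrow> \<omega> \<in> E' \<Longrightarrow> kdot k \<omega> + (l \<omega> j - l \<omega> i) \<noteq> 0"
    and Qs: "\<And>\<omega> t. \<omega> \<in> E' \<Longrightarrow> star (Q \<omega> t) = - Q \<omega> t" "\<And>\<omega> t. \<omega> \<in> E' \<Longrightarrow> cj (Q \<omega> t) = Q \<omega> t"
    and l: "\<And>\<omega> i. \<omega> \<in> E' \<Longrightarrow> l \<omega> (bar i) = - l \<omega> i"
  shows "\<exists>A g. qpm E' (s - \<delta>) (R * M) (A :: real ^ 'n \<Rightarrow> real \<Rightarrow> coord sqmat) \<and>
    (\<forall>i. bl E' (M / 4) (\<lambda>\<omega>. of_real (g \<omega> i))) \<and> (\<forall>\<omega> i. g \<omega> (bar i) = - g \<omega> i) \<and>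
    (\<forall>\<omega>\<in>E'. \<forall>t. star (A \<omega> t) = - A \<omega> t \<and> cj (A \<omega> t) = A \<omega> t \<and>
      ((\<lambda>t. A \<omega> t) has_vector_derivative
        (- (1/2)) *\<^sub>R (Q \<omega> t - Dg (g \<omega>)) - (A \<omega> t * Dg (l \<omega>) - Dg (l \<omega>) * A \<omega> t)) (at t))"
proof -
  obtain A0 :: "real ^ 'n \<Rightarrow> real \<Rightarrow> coord sqmat" and c0 where A0: "qpm E' (s - \<delta>) (R * M) A0"
    and c0: "\<And>i j. bl E' (M / 4) (\<lambda>\<omega>. ent (c0 \<omega>) i j)" and c0d: "\<And>\<omega> i j. i \<noteq> j \<Longrightarrow> ent (c0 \<omega>) i j = 0"
    and der: "\<And>\<omega> t. \<omega> \<in> E' \<Longrightarrow> ((\<lambda>t. A0 \<omega> t) has_vector_derivative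
        (- (1/2)) *\<^sub>R (Q \<omega> t - c0 \<omega>) - (A0 \<omega> t * Dg (l \<omega>) - Dg (l \<omega>) * A0 \<omega> t)) (at t)"
    using homological_matrix[where l = l, OF Q E' d R inv nz] by blast
  have sd: "0 \<le> s - \<delta>" using d by simp
  define sy where "sy X = (1/4) *\<^sub>R ((X - star X) + cj (X - star X))" for X
  have sy_star: "star (sy X) = - sy X" and sy_cj: "cj (sy X) = sy X" for X
    by (simp_all add: sy_def star_cj algebra_simps)
  have bsy: "bounded_linear sy" unfolding sy_def
    by (intro bounded_linear_const_scaleR bounded_linear_add bounded_linear_sub bounded_linear_ident bounded_linear_star
        bounded_linear_compose[OF bounded_linear_cj])
  define A where "A \<omega> t = sy (A0 \<omega> t)" for \<omega> t
  define g where "g \<omega> i = Im (ent (sy (c0 \<omega>)) i i)" for \<omega> i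
  \<comment> \<open>\<open>star\<close> relates the diagonal entries at \<open>i\<close> and
    \<open>bar i\<close> by a sign, \<open>cj\<close> by conjugation. Together they make these
    entries imaginary, so taking imaginary parts in \<open>g\<close> loses nothing.\<close>
  have syc: "ent (sy (c0 \<omega>)) i j = (if i = j then \<i> * of_real (g \<omega> i) else 0)" and g: "g \<omega> (bar i) = - g \<omega> i" for \<omega> i j
  proof -
    have s1: "- ent (sy (c0 \<omega>)) i i = ent (sy (c0 \<omega>)) (bar i) (bar i)" for i
      using arg_cong[OF sy_star[of "c0 \<omega>"], of "\<lambda>X. ent X i i"] by (simp add: ent_star ent_simps)
    have s2: "ent (sy (c0 \<omega>)) i i = cnj (ent (sy (c0 \<omega>)) (bar i) (bar i))" for i
      using arg_cong[OF sy_cj[of "c0 \<omega>"], of "\<lambda>X. ent X i i"] by (simp add: ent_cj)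
    have "ent (sy (c0 \<omega>)) i j = 0" if "i \<noteq> j"
      using that by (simp add: sy_def ent_simps ent_star ent_cj c0d)
    moreover have "Re (ent (sy (c0 \<omega>)) i i) = 0"
      using arg_cong[OF s1[of i], of Re] arg_cong[OF s2[of i], of Re] by simp
    ultimately show "ent (sy (c0 \<omega>)) i j = (if i = j then \<i> * of_real (g \<omega> i) else 0)"
      unfolding g_def by (auto simp: complex_eq_iff)
    show "g \<omega> (bar i) = - g \<omega> i" unfolding g_def s1[symmetric] by simp
  qed
  have Dgg: "sy (c0 \<omega>) = Dg (g \<omega>)" for \<omega>
    by (rule sqmat_eqI) (simp add: syc ent_Dg)
  have "qpm E' (s - \<delta>) (\<bar>1/4\<bar> * ((R * M + R * M) + (R * M + R * M))) (\<lambda>\<omega> t. (1/4) *\<^sub>R ((A0 \<omega> t - star (A0 \<omega> t)) + cj (A0 \<omega> t - star (A0 \<omega> t))))"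
    by (intro qpm_scaleR qpm_add qpm_diff qpm_cj qpm_star A0 sd)
  then have qA: "qpm E' (s - \<delta>) (R * M) A" unfolding A_def sy_def by (simp add: mult.commute)
  have blg: "bl E' (M / 4) (\<lambda>\<omega>. of_real (g \<omega> i))" for i
  proof -
    have "bl E' (1/4 * ((M/4 + M/4) + (M/4 + M/4)))
      (\<lambda>\<omega>. - \<i> / 4 * ((ent (c0 \<omega>) i i + - ent (c0 \<omega>) (bar i) (bar i)) + cnj (ent (c0 \<omega>) (bar i) (bar i) + - ent (c0 \<omega>) i i)))"
      by (intro bl_mult bl_add bl_uminus bl_cnj c0 bl_const) simp
    moreover have "- \<i> / 4 * ((ent (c0 \<omega>) i i + - ent (c0 \<omega>) (bar i) (bar i)) + cnj (ent (c0 \<omega>) (bar i) (bar i) + - ent (c0 \<omega>) i i)) = of_real (g \<omega> i)" for \<omega>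
    proof -
      have "- \<i> / 4 * ((ent (c0 \<omega>) i i + - ent (c0 \<omega>) (bar i) (bar i)) + cnj (ent (c0 \<omega>) (bar i) (bar i) + - ent (c0 \<omega>) i i)) = - \<i> * ent (sy (c0 \<omega>)) i i"
        by (simp add: sy_def ent_simps ent_star ent_cj scaleR_conv_of_real[where 'a = complex])
      also have "\<dots> = of_real (g \<omega> i)" by (simp add: syc)
      finally show ?thesis .
    qed
    ultimately show ?thesis by simp
  qed
  have syQ: "sy (Q \<omega> t) = Q \<omega> t" if "\<omega> \<in> E'" for \<omega> t
    using Qs[OF that] by (simp add: sy_def) (simp add: scaleR_2[symmetric] scaleR_add_right[symmetric])
  have sycomm: "sy (X * Dg (l \<omega>) - Dg (l \<omega>) * X) = sy X * Dg (l \<omega>) - Dg (l \<omega>) * sy X" if "\<omega> \<in> E'" for X \<omega>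
    by (simp add: sy_def star_mult cj_mult star_Dg[of "l \<omega>", OF l[OF that]] cj_Dg[of "l \<omega>", OF l[OF that]] algebra_simps)
  have "((\<lambda>t. A \<omega> t) has_vector_derivative
        (- (1/2)) *\<^sub>R (Q \<omega> t - Dg (g \<omega>)) - (A \<omega> t * Dg (l \<omega>) - Dg (l \<omega>) * A \<omega> t)) (at t)" if w: "\<omega> \<in> E'" for \<omega> t
  proof -
    interpret bounded_linear sy by (rule bsy)
    have "sy ((- (1/2)) *\<^sub>R (Q \<omega> t - c0 \<omega>) - (A0 \<omega> t * Dg (l \<omega>) - Dg (l \<omega>) * A0 \<omega> t))
      = (- (1/2)) *\<^sub>R (Q \<omega> t - Dg (g \<omega>)) - (A \<omega> t * Dg (l \<omega>) - Dg (l \<omega>) * A \<omega> t)"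
      unfolding diff[of "_ *\<^sub>R _"] scaleR sycomm[OF w] diff[of "Q \<omega> t"] syQ[OF w] Dgg A_def ..
    then show ?thesis
      using bounded_linear.has_vector_derivative[OF bsy der[OF w, of t]] unfolding A_def by simp
  qed
  then show ?thesis using qA blg g sy_star sy_cj unfolding A_def by blast
qed

lemma inverse_unique_ring: "(a::'a::ring_1) * b = 1 \<Longrightarrow> c * a = 1 \<Longrightarrow> c = b"
  by (metis mult.assoc mult_1 mult_1_right)

text \<open>With a = R M <= 1/8 the remainder \<open>W\<close> has size at most 5 a M. The two
  inverses around it contribute (1 + 2a)^2 <= (5/4)^2 <= 2, whence 10 R M^2; the Cayley transform
  differs from 1 by at most 2a + a + 2a^2 <= 4a.\<close>

theorem kam_step:
  fixes Q :: "real ^ 'n::finite \<Rightarrow> real \<Rightarrow> coord sqmat" and l :: "real ^ 'n \<Rightarrow> coord \<Rightarrow> real"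
  assumes Q: "qpm E s M Q" and E': "E' \<subseteq> E" and d: "0 \<le> \<delta>" "\<delta> \<le> s" and R: "0 \<le> R"
    and inv: "\<And>i j k. i \<noteq> j \<or> k \<noteq> (\<lambda>_. 0) \<Longrightarrow>
       bl E' (R * exp (\<delta> * knorm k)) (\<lambda>\<omega>. 1 / (\<i> * of_real (kdot k \<omega> + (l \<omega> j - l \<omega> i))))"
    and nz: "\<And>i j k \<omega>. i \<noteq> j \<or> k \<noteq> (\<lambda>_. 0) \<Longrightarrow> \<omega> \<in> E' \<Longrightarrow> kdot k \<omega> + (l \<omega> j - l \<omega> i) \<noteq> 0"
    and Qs: "\<And>\<omega> t. \<omega> \<in> E' \<Longrightarrow> star (Q \<omega> t) = - Q \<omega> t" "\<And>\<omega> t. \<omega> \<in> E' \<Longrightarrow> cj (Q \<omega> t) = Q \<omega> t"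
    and l: "\<And>\<omega> i. \<omega> \<in> E' \<Longrightarrow> l \<omega> (bar i) = - l \<omega> i"
    and small: "R * M \<le> 1/8"
  shows "\<exists>g Q' Z. (\<forall>i. bl E' M (\<lambda>\<omega>. of_real (g \<omega> i))) \<and> (\<forall>\<omega> i. g \<omega> (bar i) = - g \<omega> i) \<and>
    qpm E' (s - \<delta>) (10 * R * M\<^sup>2) Q' \<and> qpm E' (s - \<delta>) (4 * R * M) Z \<and>
    (\<forall>\<omega>\<in>E'. \<forall>t. star (Q' \<omega> t) = - Q' \<omega> t \<and> cj (Q' \<omega> t) = Q' \<omega> t \<and>
      (1 + Z \<omega> t) * star (1 + Z \<omega> t) = 1 \<and> star (1 + Z \<omega> t) * (1 + Z \<omega> t) = 1 \<and>
      ((\<lambda>t. 1 + Z \<omega> t) has_vector_derivative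
        (Dg (\<lambda>i. l \<omega> i + g \<omega> i) + Q' \<omega> t) * (1 + Z \<omega> t) - (1 + Z \<omega> t) * (Dg (l \<omega>) + Q \<omega> t)) (at t))"
proof -
  obtain A :: "real ^ 'n \<Rightarrow> real \<Rightarrow> coord sqmat" and g where qA: "qpm E' (s - \<delta>) (R * M) A"
    and blg: "\<And>i. bl E' (M / 4) (\<lambda>\<omega>. of_real (g \<omega> i))" and g: "\<And>\<omega> i. g \<omega> (bar i) = - g \<omega> i"
    and As: "\<And>\<omega> t. \<omega> \<in> E' \<Longrightarrow> star (A \<omega> t) = - A \<omega> t" and Ac: "\<And>\<omega> t. \<omega> \<in> E' \<Longrightarrow> cj (A \<omega> t) = A \<omega> t"
    and der: "\<And>\<omega> t. \<omega> \<in> E' \<Longrightarrow> ((\<lambda>t. A \<omega> t) has_vector_derivative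
        (- (1/2)) *\<^sub>R (Q \<omega> t - Dg (g \<omega>)) - (A \<omega> t * Dg (l \<omega>) - Dg (l \<omega>) * A \<omega> t)) (at t)"
    using homological_symmetric[where l = l, OF Q E' d R inv nz Qs l] by blast
  define a where "a = R * M"
  have M0: "0 \<le> M" using qpm_nonneg[OF Q] .
  have a: "0 \<le> a" "a \<le> 1/8" using R M0 small by (auto simp: a_def)
  have sd: "0 \<le> s - \<delta>" using d by simp
  note qA = qA[folded a_def]
  have QM: "qpm E' (s - \<delta>) M Q" using qpm_mono[OF Q E'] d by simp
  have qc: "qpm E' (s - \<delta>) M (\<lambda>\<omega> t. Dg (g \<omega>))"
    unfolding qpm_def
  proof (intro allI qp_param)
    fix i j :: coord
    have "bl E' (1 * (M / 4)) (\<lambda>\<omega>. \<i> * of_real (g \<omega> i))" by (intro bl_mult blg bl_const) simp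
    then show "bl E' (M / real CARD(coord)) (\<lambda>\<omega>. ent (Dg (g \<omega>)) i j)"
      using bl_const[of 0 "M / 4" E'] M0 by (cases "i = j") (simp_all add: ent_Dg UNIV_coord)
  qed
  define Y where "Y \<omega> t = (\<Sum>n. A \<omega> t ^ Suc n)" for \<omega> t
  define Y' where "Y' \<omega> t = (\<Sum>n. (- A \<omega> t) ^ Suc n)" for \<omega> t
  have qY: "qpm E' (s - \<delta>) (2 * a) Y" and qY': "qpm E' (s - \<delta>) (2 * a) Y'"
    unfolding Y_def Y'_def using a by (intro qpm_geometric qpm_uminus qA sd; simp)+
  define W where "W \<omega> t = A \<omega> t * (Q \<omega> t + Dg (g \<omega>)) - (Q \<omega> t + Dg (g \<omega>)) * A \<omega> t - A \<omega> t * (Q \<omega> t - Dg (g \<omega>)) * A \<omega> t" for \<omega> t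
  have qW: "qpm E' (s - \<delta>) (a * (M + M) + (M + M) * a + a * (M + M) * a) W"
    unfolding W_def by (intro qpm_diff qpm_mult qpm_add qA QM qc sd)
  define w where "w = a * (M + M) + (M + M) * a + a * (M + M) * a"
  have w: "0 \<le> w" "w \<le> 5 * a * M"
  proof -
    have "a * (M + M) * a = (2 * a) * (a * M)" by simp
    also have "\<dots> \<le> 1 * (a * M)" using a M0 by (intro mult_right_mono) auto
    finally show "w \<le> 5 * a * M" unfolding w_def by (simp add: mult.commute)
  qed (use a M0 in \<open>simp add: w_def\<close>)
  \<comment> \<open>This is \<open>(1 + Y) * W * (1 + Y')\<close> multiplied out, so that no
    identity matrix has to be estimated. Likewise \<open>Z\<close> below is
    \<open>(1 + Y) * (1 + A) - 1\<close>.\<close>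
  define Q' where "Q' \<omega> t = W \<omega> t + W \<omega> t * Y' \<omega> t + Y \<omega> t * W \<omega> t + Y \<omega> t * W \<omega> t * Y' \<omega> t" for \<omega> t
  have "qpm E' (s - \<delta>) (w + w * (2 * a) + (2 * a) * w + (2 * a) * w * (2 * a)) Q'"
    unfolding Q'_def w_def by (intro qpm_mult qpm_add qW qY qY' sd)
  moreover have "w + w * (2 * a) + (2 * a) * w + (2 * a) * w * (2 * a) \<le> 10 * R * M\<^sup>2"
  proof -
    have "w + w * (2 * a) + (2 * a) * w + (2 * a) * w * (2 * a) = w * (1 + 2 * a) * (1 + 2 * a)" by (simp add: algebra_simps)
    also have "\<dots> \<le> w * (5/4) * (5/4)" using w a by (intro mult_mono) auto
    also have "\<dots> \<le> 2 * w" using w by simp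
    also have "\<dots> \<le> 10 * R * M\<^sup>2" using w by (simp add: a_def power2_eq_square mult_ac)
    finally show ?thesis .
  qed
  ultimately have qQ': "qpm E' (s - \<delta>) (10 * R * M\<^sup>2) Q'" using qpm_mono by blast
  define Z where "Z \<omega> t = Y \<omega> t + A \<omega> t + Y \<omega> t * A \<omega> t" for \<omega> t
  have "qpm E' (s - \<delta>) (2 * a + a + 2 * a * a) Z"
    unfolding Z_def by (intro qpm_mult qpm_add qA qY sd)
  moreover have "2 * a + a + 2 * a * a \<le> 4 * R * M"
  proof -
    have "2 * a * a \<le> 1 * a" using a by (intro mult_right_mono) auto
    then show ?thesis by (simp add: a_def mult_ac)
  qed
  ultimately have qZ: "qpm E' (s - \<delta>) (4 * R * M) Z" using qpm_mono by blast
  have "bl E' M (\<lambda>\<omega>. of_real (g \<omega> i))" for i using bl_mono[OF blg[of i]] M0 by simp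
  moreover have "star (Q' \<omega> t) = - Q' \<omega> t \<and> cj (Q' \<omega> t) = Q' \<omega> t \<and>
      (1 + Z \<omega> t) * star (1 + Z \<omega> t) = 1 \<and> star (1 + Z \<omega> t) * (1 + Z \<omega> t) = 1 \<and>
      ((\<lambda>t. 1 + Z \<omega> t) has_vector_derivative
        (Dg (\<lambda>i. l \<omega> i + g \<omega> i) + Q' \<omega> t) * (1 + Z \<omega> t) - (1 + Z \<omega> t) * (Dg (l \<omega>) + Q \<omega> t)) (at t)"
    if om: "\<omega> \<in> E'" for \<omega> t
  proof -
    have nA: "norm (A \<omega> t) < 1" for t using qpm_bound[OF qA sd om, of t] a by simp
    note P = neumann_inverse[OF nA, folded Y_def]
    have nA': "norm (- A \<omega> t) < 1" for t using nA[of t] by simp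
    have P': "(1 + A \<omega> t) * (1 + Y' \<omega> t) = 1" "(1 + Y' \<omega> t) * (1 + A \<omega> t) = 1" for t
      using neumann_inverse[OF nA'[of t]] unfolding Y'_def by simp_all
    have Z1: "1 + Z \<omega> t = (1 + Y \<omega> t) * (1 + A \<omega> t)" for t by (simp add: Z_def algebra_simps)
    have Q1: "Q' \<omega> t = (1 + Y \<omega> t) * W \<omega> t * (1 + Y' \<omega> t)" by (simp add: Q'_def algebra_simps)
    \<comment> \<open>\<open>star\<close> maps \<open>1 - A\<close> to \<open>1 + A\<close> and
      therefore exchanges their inverses; \<open>cj\<close> fixes both matrices and therefore both
      inverses.\<close>
    have sP: "star (1 + Y \<omega> t) = 1 + Y' \<omega> t"
    proof (rule inverse_unique_ring[OF P'(1)])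
      have "star ((1 - A \<omega> t) * (1 + Y \<omega> t)) = 1" by (simp only: P star_simps)
      then show "star (1 + Y \<omega> t) * (1 + A \<omega> t) = 1" by (simp add: star_mult As[OF om])
    qed
    have sP': "star (1 + Y' \<omega> t) = 1 + Y \<omega> t" using arg_cong[OF sP, of star] by (simp del: star_simps(2,3))
    have cP: "cj (1 + Y \<omega> t) = 1 + Y \<omega> t"
    proof (rule inverse_unique_ring[OF P(1)])
      have "cj ((1 + Y \<omega> t) * (1 - A \<omega> t)) = 1" by (simp only: P cj_simps)
      then show "cj (1 + Y \<omega> t) * (1 - A \<omega> t) = 1" by (simp add: cj_mult Ac[OF om])
    qed
    have cP': "cj (1 + Y' \<omega> t) = 1 + Y' \<omega> t"
    proof (rule inverse_unique_ring[OF P'(1)])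
      have "cj ((1 + Y' \<omega> t) * (1 + A \<omega> t)) = 1" by (simp only: P' cj_simps)
      then show "cj (1 + Y' \<omega> t) * (1 + A \<omega> t) = 1" by (simp add: cj_mult Ac[OF om])
    qed
    have sW: "star (W \<omega> t) = - W \<omega> t"
      by (simp add: W_def star_mult As[OF om] Qs(1)[OF om] star_Dg[of "g \<omega>", OF g] algebra_simps)
    have cW: "cj (W \<omega> t) = W \<omega> t"
      by (simp add: W_def cj_mult Ac[OF om] Qs(2)[OF om] cj_Dg[of "g \<omega>", OF g])
    have "star (Q' \<omega> t) = - Q' \<omega> t" unfolding Q1 star_mult sP sP' sW by (simp add: mult.assoc)
    moreover have "cj (Q' \<omega> t) = Q' \<omega> t" unfolding Q1 cj_mult cP cP' cW ..
    moreover have sZ: "star (1 + Z \<omega> t) = (1 - A \<omega> t) * (1 + Y' \<omega> t)"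
      unfolding Z1 star_mult sP by (simp add: As[OF om])
    moreover have "(1 + Z \<omega> t) * star (1 + Z \<omega> t) = 1"
    proof -
      have "(1 + Z \<omega> t) * star (1 + Z \<omega> t) = (1 + Y \<omega> t) * ((1 + A \<omega> t) * (1 - A \<omega> t)) * (1 + Y' \<omega> t)"
        unfolding sZ unfolding Z1 by (simp only: mult.assoc)
      also have "(1 + A \<omega> t) * (1 - A \<omega> t) = (1 - A \<omega> t) * (1 + A \<omega> t)" by (simp add: algebra_simps)
      also have "(1 + Y \<omega> t) * ((1 - A \<omega> t) * (1 + A \<omega> t)) * (1 + Y' \<omega> t) = ((1 + Y \<omega> t) * (1 - A \<omega> t)) * ((1 + A \<omega> t) * (1 + Y' \<omega> t))"
        by (simp only: mult.assoc)
      finally show ?thesis by (simp only: P P' mult_1)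
    qed
    moreover have "star (1 + Z \<omega> t) * (1 + Z \<omega> t) = 1"
    proof -
      have 1: "(1 + Y \<omega> t) * (1 + A \<omega> t) = (1 + A \<omega> t) * (1 + Y \<omega> t)"
      proof -
        have "(1 - A \<omega> t) * (1 + A \<omega> t) = (1 + A \<omega> t) * (1 - A \<omega> t)" by (simp add: algebra_simps)
        then have "(1 + Y \<omega> t) * ((1 - A \<omega> t) * (1 + A \<omega> t)) * (1 + Y \<omega> t) = (1 + Y \<omega> t) * ((1 + A \<omega> t) * (1 - A \<omega> t)) * (1 + Y \<omega> t)" by simp
        then have "((1 + Y \<omega> t) * (1 - A \<omega> t)) * (1 + A \<omega> t) * (1 + Y \<omega> t) = (1 + Y \<omega> t) * (1 + A \<omega> t) * ((1 - A \<omega> t) * (1 + Y \<omega> t))" by (simp only: mult.assoc)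
        then show ?thesis by (simp only: P mult_1 mult_1_right)
      qed
      have "star (1 + Z \<omega> t) * (1 + Z \<omega> t) = (1 - A \<omega> t) * ((1 + Y' \<omega> t) * (1 + A \<omega> t)) * (1 + Y \<omega> t)"
        unfolding sZ unfolding Z1 unfolding 1 by (simp only: mult.assoc)
      then show ?thesis by (simp only: P P' mult_1_right)
    qed
    moreover have "((\<lambda>t. 1 + Z \<omega> t) has_vector_derivative
        (Dg (\<lambda>i. l \<omega> i + g \<omega> i) + Q' \<omega> t) * (1 + Z \<omega> t) - (1 + Z \<omega> t) * (Dg (l \<omega>) + Q \<omega> t)) (at t)"
    proof -
      define A' where "A' = (- (1/2)) *\<^sub>R (Q \<omega> t - Dg (g \<omega>)) - (A \<omega> t * Dg (l \<omega>) - Dg (l \<omega>) * A \<omega> t)"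
      have dA: "((\<lambda>t. A \<omega> t) has_vector_derivative A') (at t)" unfolding A'_def by (rule der[OF om])
      have d1: "((\<lambda>t. 1 - A \<omega> t) has_vector_derivative - A') (at t)"
        using has_vector_derivative_diff[OF has_vector_derivative_const dA] by simp
      have bd: "norm (1 + Y \<omega> t) \<le> 1 + 2 * a" for t
        using qpm_bound[OF qY sd om, of t] norm_triangle_ineq[of 1 "Y \<omega> t"] by simp
      have "((\<lambda>t. 1 + Y \<omega> t) has_vector_derivative - ((1 + Y \<omega> t) * (- A') * (1 + Y \<omega> t))) (at t)"
        by (rule has_vector_derivative_inverse_algebra[OF d1 P bd])
      then have dP: "((\<lambda>t. 1 + Y \<omega> t) has_vector_derivative (1 + Y \<omega> t) * A' * (1 + Y \<omega> t)) (at t)" by simp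
      have d2: "((\<lambda>t. 1 + A \<omega> t) has_vector_derivative A') (at t)"
        using has_vector_derivative_add[OF has_vector_derivative_const dA] by simp
      have "((\<lambda>t. (1 + Y \<omega> t) * (1 + A \<omega> t)) has_vector_derivative
          (1 + Y \<omega> t) * A' + (1 + Y \<omega> t) * A' * (1 + Y \<omega> t) * (1 + A \<omega> t)) (at t)"
        by (rule has_vector_derivative_mult[OF dP d2])
      moreover have "A' + A' = - (Q \<omega> t - Dg (g \<omega>)) - 2 * (A \<omega> t * Dg (l \<omega>) - Dg (l \<omega>) * A \<omega> t)"
        unfolding A'_def by (simp add: mult_2 algebra_simps flip: scaleR_2 scaleR_left_distrib) 
      note cayley_conjugation[OF P[of t] P'[of t] this refl[of "W \<omega> t", unfolded W_def[of \<omega> t]]]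
      moreover have "Dg (\<lambda>i. l \<omega> i + g \<omega> i) = Dg (l \<omega>) + Dg (g \<omega>)"
        by (rule sqmat_eqI) (simp add: ent_Dg ent_simps algebra_simps)
      ultimately show ?thesis unfolding Z1 Q1 W_def by (simp add: add.commute)
    qed
    ultimately show ?thesis by blast
  qed
  ultimately show ?thesis using g qQ' qZ by blast
qed

section \<open>Measure of the resonant sets\<close>

lemma kdot_lipschitz: "\<bar>kdot k x - kdot k y\<bar> \<le> knorm k * dist x y"
proof -
  have "kdot k x - kdot k y = (\<Sum>i\<in>UNIV. of_int (k i) * (x $ i - y $ i))"
    by (simp add: kdot_def sum_subtractf right_diff_distrib)
  also have "\<bar>\<dots>\<bar> \<le> (\<Sum>i\<in>UNIV. \<bar>of_int (k i)\<bar> * dist x y)"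
  proof (rule order_trans[OF sum_abs sum_mono])
    fix i
    have "\<bar>x $ i - y $ i\<bar> \<le> dist x y"
      using component_le_norm_cart[of "x - y" i] by (simp add: dist_norm)
    then show "\<bar>of_int (k i) * (x $ i - y $ i)\<bar> \<le> \<bar>of_int (k i)\<bar> * dist x y"
      by (simp add: abs_mult mult_left_mono)
  qed
  finally show ?thesis by (simp add: knorm_def sum_distrib_right)
qed

lemma resonant_set_measurable:
  fixes E :: "(real ^ 'n::finite) set" and f :: "real ^ 'n \<Rightarrow> real"
  assumes E: "E \<in> sets lebesgue" and f: "continuous_on E f"
  shows "{\<omega> \<in> E. \<bar>f \<omega>\<bar> < g} \<in> sets lebesgue"
proof -
  have "openin (top_of_set E) (E \<inter> f -` {-g<..<g})"
    by (rule continuous_openin_preimage_gen[OF f]) simp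
  then obtain U where U: "open U" "E \<inter> f -` {-g<..<g} = E \<inter> U" unfolding openin_open by blast
  have "{\<omega> \<in> E. \<bar>f \<omega>\<bar> < g} = E \<inter> U" unfolding U(2)[symmetric] by auto
  then show ?thesis using E U(1) by auto
qed

text \<open>The translates of the resonant set by multiples of \<open>4 g\<close> in a direction in which \<open>k\<close>
  does not vanish are disjoint, and about \<open>1 / (4 g)\<close> of them fit into a slightly larger box.\<close>
lemma measure_resonant_set:
  fixes E :: "(real ^ 'n::finite) set" and f :: "real ^ 'n \<Rightarrow> real"
  assumes box: "E \<subseteq> freq_box" and E: "E \<in> sets lebesgue"
    and lip: "\<And>x y. x \<in> E \<Longrightarrow> y \<in> E \<Longrightarrow> \<bar>f x - f y\<bar> \<le> 1/2 * dist x y"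
    and k: "k \<noteq> (\<lambda>_. 0)" and g: "0 < g"
  shows "{\<omega> \<in> E. \<bar>kdot k \<omega> + f \<omega>\<bar> < g} \<in> lmeasurable"
    and "measure lebesgue {\<omega> \<in> E. \<bar>kdot k \<omega> + f \<omega>\<bar> < g} \<le> 4 * g * (2 * pi + 1) ^ CARD('n)"
proof -
  define S where "S = {\<omega> \<in> E. \<bar>kdot k \<omega> + f \<omega>\<bar> < g}"
  have "(knorm k + 1/2)-lipschitz_on E (\<lambda>\<omega>. kdot k \<omega> + f \<omega>)"
  proof (rule lipschitz_onI)
    fix x y assume "x \<in> E" "y \<in> E"
    then show "dist (kdot k x + f x) (kdot k y + f y) \<le> (knorm k + 1/2) * dist x y"
      using kdot_lipschitz[of k x y] lip[of x y] unfolding dist_real_def distrib_right by linarith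
  qed (simp add: add_nonneg_nonneg)
  then have cont: "continuous_on E (\<lambda>\<omega>. kdot k \<omega> + f \<omega>)"
    by (rule lipschitz_on_continuous_on)
  have Sm: "S \<in> sets lebesgue" unfolding S_def by (rule resonant_set_measurable[OF E cont])
  have Sb: "S \<subseteq> cbox 0 (\<chi> i. 2 * pi)"
    using box unfolding S_def freq_box_def by (auto simp: mem_box_cart subset_iff less_imp_le)
  have "S \<inter> cbox 0 (\<chi> i. 2 * pi) \<in> lmeasurable"
    by (rule fmeasurable_Int_fmeasurable[OF lmeasurable_cbox Sm, unfolded Int_commute[of _ S]])
  then have Sl: "S \<in> lmeasurable" using Sb by (simp add: Int_absorb2)
  then show "{\<omega> \<in> E. \<bar>kdot k \<omega> + f \<omega>\<bar> < g} \<in> lmeasurable" unfolding S_def .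
  obtain i where i: "k i \<noteq> 0" using k by blast
  \<comment> \<open>The N + 1 translates move by at most 1, so they stay in a box of side 2 pi + 1;
    conversely (N + 1) 4g >= 1 turns their number into the factor \<open>4 * g\<close> of the
    estimate.\<close>
  define N where "N = nat \<lfloor>1 / (4 * g)\<rfloor>"
  define v where "v m = (real m * (4 * g)) *\<^sub>R (axis i 1 :: real ^ 'n)" for m
  have N: "real N * (4 * g) \<le> 1" "1 \<le> (real N + 1) * (4 * g)"
  proof -
    have "real N = of_int \<lfloor>1 / (4 * g)\<rfloor>" unfolding N_def using g by simp
    then have "real N \<le> 1 / (4 * g)" "1 / (4 * g) \<le> real N + 1" by linarith+
    then show "real N * (4 * g) \<le> 1" "1 \<le> (real N + 1) * (4 * g)" using g by (simp_all add: field_simps)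
  qed
  have disj: "disjnt ((+) (v m) ` S) ((+) (v m') ` S)" if mm: "m \<noteq> m'" for m m'
  proof (rule ccontr)
    assume "\<not> ?thesis"
    then obtain x y where x: "x \<in> S" and y: "y \<in> S" and xy: "v m + x = v m' + y"
      unfolding disjnt_def by blast
    \<comment> \<open>A common point would give resonant \<open>x\<close>, \<open>y\<close> with x -
      y = r e_i and |r| >= 4g. Since \<open>k i\<close> is a nonzero integer, k . x and k . y differ
      by at least |r|, but resonance and the Lipschitz bound allow less than 2g + |r|/2 <=
      |r|.\<close>
    define r where "r = (real m' - real m) * (4 * g)"
    have d: "x = y + r *\<^sub>R axis i 1"
      using xy unfolding v_def r_def by (simp add: algebra_simps)
    have "1 \<le> \<bar>real m' - real m\<bar>" using mm by linarith
    then have r: "4 * g \<le> \<bar>r\<bar>" using g by (simp add: r_def abs_mult)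
    have "kdot k x - kdot k y = of_int (k i) * r"
    proof -
      have "kdot k x = kdot k y + (\<Sum>j\<in>UNIV. if j = i then of_int (k i) * r else 0)"
        unfolding kdot_def d sum.distrib[symmetric]
        by (intro sum.cong) (auto simp: axis_def algebra_simps)
      then show ?thesis by simp
    qed
    moreover have "1 * \<bar>r\<bar> \<le> \<bar>of_int (k i)\<bar> * \<bar>r\<bar>" using i by (intro mult_right_mono) (auto simp: less_imp_le)
    ultimately have "\<bar>r\<bar> \<le> \<bar>kdot k x - kdot k y\<bar>" by (simp add: abs_mult)
    moreover have "dist x y = \<bar>r\<bar>" unfolding d by (simp add: dist_norm)
    moreover have "\<bar>f x - f y\<bar> \<le> 1/2 * dist x y" using x y by (intro lip) (auto simp: S_def)
    moreover have "\<bar>kdot k x + f x\<bar> < g" "\<bar>kdot k y + f y\<bar> < g" using x y by (auto simp: S_def)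
    ultimately show False using r g by linarith
  qed
  have "(real N + 1) * measure lebesgue S = (\<Sum>m\<in>{..N}. measure lebesgue ((+) (v m) ` S))"
    by (simp add: measure_translation)
  also have "\<dots> = measure lebesgue (\<Union>m\<in>{..N}. (+) (v m) ` S)"
    by (rule measure_UNION'[symmetric])
       (use Sl disj in \<open>auto simp: pairwise_def measurable_translation\<close>)
  also have "\<dots> \<le> measure lebesgue (cbox 0 (\<chi> i. 2 * pi + 1) :: (real ^ 'n) set)"
  proof (rule measure_mono_fmeasurable)
    show "(\<Union>m\<in>{..N}. (+) (v m) ` S) \<subseteq> cbox 0 (\<chi> i. 2 * pi + 1)"
    proof
      fix z assume "z \<in> (\<Union>m\<in>{..N}. (+) (v m) ` S)"
      then obtain m x where m: "m \<le> N" and x: "x \<in> S" and z: "z = v m + x" by blast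
      have "real m * (4 * g) \<le> real N * (4 * g)" using m g by (intro mult_right_mono) auto
      then have mb: "0 \<le> real m * (4 * g)" "real m * (4 * g) \<le> 1" using N(1) g by (simp, linarith)
      have xb: "0 \<le> x $ j \<and> x $ j \<le> 2 * pi" for j using x Sb by (auto simp: mem_box_cart)
      have "z $ j = x $ j + (if j = i then real m * (4 * g) else 0)" for j
        unfolding z v_def by (simp add: axis_def)
      then show "z \<in> cbox 0 (\<chi> i. 2 * pi + 1)"
        unfolding mem_box_cart using mb xb by (auto simp: add_mono add_increasing2)
    qed
    show "(\<Union>m\<in>{..N}. (+) (v m) ` S) \<in> sets lebesgue"
      using Sl measurable_translation by (intro sets.finite_UN) auto
  qed auto
  also have "\<dots> = (2 * pi + 1) ^ CARD('n)"
  proof -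
    have "(0 :: real ^ 'n) \<in> cbox 0 (\<chi> i. 2 * pi + 1)" by (simp add: mem_box_cart add_nonneg_nonneg)
    then have "cbox (0 :: real ^ 'n) (\<chi> i. 2 * pi + 1) \<noteq> {}" by blast
    then show ?thesis by (simp add: measure_completion content_cbox_cart)
  qed
  finally have 1: "(real N + 1) * measure lebesgue S \<le> (2 * pi + 1) ^ CARD('n)" .
  have "measure lebesgue S = 1 * measure lebesgue S" by simp
  also have "\<dots> \<le> ((real N + 1) * (4 * g)) * measure lebesgue S"
    using N by (intro mult_right_mono) auto
  also have "\<dots> = 4 * g * ((real N + 1) * measure lebesgue S)" by simp
  also have "\<dots> \<le> 4 * g * (2 * pi + 1) ^ CARD('n)" using g 1 by (intro mult_left_mono) auto
  finally show "measure lebesgue {\<omega> \<in> E. \<bar>kdot k \<omega> + f \<omega>\<bar> < g} \<le> 4 * g * (2 * pi + 1) ^ CARD('n)"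
    unfolding S_def .
qed

text \<open>Twice the geometric series over the nonnegative integers, with 0 counted twice; exp d >=
  1 + d bounds 1 / (1 - exp (- d)) by 1 + 1/d.\<close>

lemma sum_exp_abs_le:
  assumes d: "0 < (d::real)"
  shows "(\<Sum>m\<in>{- int N..int N}. exp (- d * \<bar>of_int m\<bar>)) \<le> 2 + 2 / d"
proof -
  have split: "{- int N..int N} \<subseteq> int ` {..N} \<union> (\<lambda>m. - int m) ` {..N}"
  proof
    fix m assume m: "m \<in> {- int N..int N}"
    show "m \<in> int ` {..N} \<union> (\<lambda>m. - int m) ` {..N}"
    proof (cases "0 \<le> m")
      case True
      then have "m = int (nat m)" "nat m \<le> N" using m by auto
      then show ?thesis by blast
    next
      case False
      then have "m = - int (nat (- m))" "nat (- m) \<le> N" using m by auto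
      then show ?thesis by blast
    qed
  qed
  have e1: "exp (- d) < 1" using d by simp
  have geo: "(\<Sum>m\<le>N. exp (- d * real m)) \<le> 1 + 1 / d"
  proof -
    have "(\<Sum>m\<le>N. exp (- d * real m)) = (\<Sum>m\<le>N. exp (- d) ^ m)"
      by (simp add: exp_of_nat_mult[symmetric] mult.commute)
    also have "\<dots> \<le> (\<Sum>m. exp (- d) ^ m)" using e1 by (intro sum_le_suminf summable_geometric) auto
    also have "\<dots> = 1 / (1 - exp (- d))" using e1 by (intro suminf_geometric) auto
    also have "\<dots> \<le> 1 + 1 / d"
    proof -
      have "exp (- d) = 1 / exp d" by (simp add: exp_minus inverse_eq_divide)
      also have "\<dots> \<le> 1 / (1 + d)" using d exp_ge_add_one_self[of d] by (intro divide_left_mono) auto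
      finally have "d / (1 + d) \<le> 1 - exp (- d)" using d by (simp add: field_simps)
      then have "1 / (1 - exp (- d)) \<le> 1 / (d / (1 + d))" using d e1 by (intro divide_left_mono) auto
      then show ?thesis using d by (simp add: field_simps)
    qed
    finally show ?thesis .
  qed
  have "(\<Sum>m\<in>{- int N..int N}. exp (- d * \<bar>of_int m\<bar>)) \<le> (\<Sum>m\<in>int ` {..N} \<union> (\<lambda>m. - int m) ` {..N}. exp (- d * \<bar>of_int m\<bar>))"
    by (rule sum_mono2[OF _ split]) auto
  also have "\<dots> \<le> (\<Sum>m\<in>int ` {..N}. exp (- d * \<bar>of_int m\<bar>)) + (\<Sum>m\<in>(\<lambda>m. - int m) ` {..N}. exp (- d * \<bar>of_int m\<bar>))"
    by (subst sum_Un) (auto intro: sum_nonneg)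
  also have "\<dots> = (\<Sum>m\<le>N. exp (- d * real m)) + (\<Sum>m\<le>N. exp (- d * real m))"
    by (subst (1 2) sum.reindex) (auto simp: inj_on_def)
  finally show ?thesis using geo by simp
qed

text \<open>A finite set of wave vectors lies in a cube, and over a cube the exponential of the l^1
  norm factorises into one-dimensional sums.\<close>

lemma sum_exp_knorm_le:
  fixes K :: "('n::finite \<Rightarrow> int) set"
  assumes d: "0 < d" and K: "finite K"
  shows "(\<Sum>k\<in>K. exp (- d * knorm k)) \<le> (2 + 2 / d) ^ CARD('n)"
proof -
  define N where "N = Max (insert 0 ((\<lambda>(k, i). nat \<bar>k i\<bar>) ` (K \<times> (UNIV :: 'n set))))"
  have N: "nat \<bar>k i\<bar> \<le> N" if "k \<in> K" for k i
    unfolding N_def using K that by (intro Max_ge) (auto intro: rev_image_eqI)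
  have sub: "K \<subseteq> PiE UNIV (\<lambda>_. {- int N..int N})"
  proof
    fix k assume k: "k \<in> K"
    show "k \<in> PiE UNIV (\<lambda>_. {- int N..int N})"
      using N[OF k] by (auto simp: PiE_UNIV_domain) (smt (verit) nat_le_iff)+
  qed
  have "(\<Sum>k\<in>K. exp (- d * knorm k)) \<le> (\<Sum>k\<in>PiE UNIV (\<lambda>_::'n. {- int N..int N}). exp (- d * knorm k))"
    by (rule sum_mono2[OF _ sub]) (auto intro: finite_PiE)
  also have "\<dots> = (\<Sum>k\<in>PiE UNIV (\<lambda>_::'n. {- int N..int N}). \<Prod>i\<in>UNIV. exp (- d * \<bar>of_int (k i)\<bar>))"
    by (simp add: knorm_def sum_distrib_left exp_sum)
  also have "\<dots> = (\<Prod>i\<in>(UNIV::'n set). \<Sum>m\<in>{- int N..int N}. exp (- d * \<bar>of_int m\<bar>))"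
    by (subst prod_sum_PiE) auto
  also have "\<dots> \<le> (\<Prod>i\<in>(UNIV::'n set). 2 + 2 / d)"
    by (intro prod_mono conjI sum_nonneg sum_exp_abs_le[OF d]) auto
  finally show ?thesis by simp
qed

text \<open>One resonant set is removed for each nonzero wave vector and each of the 16 ordered
  pairs of eigenvalues, at a cost of 4 times its threshold; hence the factor 64. The exponential in
  the threshold makes the total finite.\<close>

lemma nonresonant_subset:
  fixes E :: "(real ^ 'n::finite) set" and l :: "real ^ 'n \<Rightarrow> coord \<Rightarrow> real"
  assumes box: "E \<subseteq> freq_box" and E: "E \<in> sets lebesgue"
    and lip: "\<And>x y i j. x \<in> E \<Longrightarrow> y \<in> E \<Longrightarrow> \<bar>(l x j - l x i) - (l y j - l y i)\<bar> \<le> 1/2 * dist x y"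
    and kap: "0 < \<kappa>" and d: "0 < d"
  shows "\<exists>E'\<subseteq>E. E' \<in> sets lebesgue \<and> measure lebesgue (E - E') \<le> 64 * \<kappa> * (2 + 2 / d) ^ CARD('n) * (2 * pi + 1) ^ CARD('n) \<and>
    (\<forall>\<omega>\<in>E'. \<forall>i j k. k \<noteq> (\<lambda>_. 0) \<longrightarrow> \<kappa> * exp (- d * knorm k) \<le> \<bar>kdot k \<omega> + (l \<omega> j - l \<omega> i)\<bar>)"
proof -
  define I where "I = {k :: 'n \<Rightarrow> int. k \<noteq> (\<lambda>_. 0)} \<times> (UNIV :: (coord \<times> coord) set)"
  define S where "S = (\<lambda>(k, i, j). {\<omega> \<in> E. \<bar>kdot k \<omega> + (l \<omega> j - l \<omega> i)\<bar> < \<kappa> * exp (- d * knorm k)})"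
  have SI: "S x \<in> lmeasurable" "measure lebesgue (S x) \<le> 4 * (\<kappa> * exp (- d * knorm (fst x))) * (2 * pi + 1) ^ CARD('n)" if "x \<in> I" for x
  proof -
    obtain k i j where x: "x = (k, i, j)" by (cases x) auto
    then have k: "k \<noteq> (\<lambda>_. 0)" using that by (simp add: I_def)
    show "S x \<in> lmeasurable" "measure lebesgue (S x) \<le> 4 * (\<kappa> * exp (- d * knorm (fst x))) * (2 * pi + 1) ^ CARD('n)"
      unfolding S_def x using measure_resonant_set[OF box E lip k, of "\<kappa> * exp (- d * knorm k)"] kap by auto
  qed
  let ?B = "64 * \<kappa> * (2 + 2 / d) ^ CARD('n) * (2 * pi + 1) ^ CARD('n)"
  have fin: "measure lebesgue (\<Union>x\<in>I'. S x) \<le> ?B" if I': "I' \<subseteq> I" "finite I'" for I'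
  proof -
    have "measure lebesgue (\<Union>x\<in>I'. S x) \<le> (\<Sum>x\<in>I'. measure lebesgue (S x))"
      using I' SI(1) by (intro measure_UNION_le) (auto simp: fmeasurableD)
    also have "\<dots> \<le> (\<Sum>x\<in>I'. 4 * (\<kappa> * exp (- d * knorm (fst x))) * (2 * pi + 1) ^ CARD('n))"
      using I' SI(2) by (intro sum_mono) auto
    also have "\<dots> \<le> (\<Sum>x\<in>fst ` I' \<times> (UNIV :: (coord \<times> coord) set). 4 * (\<kappa> * exp (- d * knorm (fst x))) * (2 * pi + 1) ^ CARD('n))"
      using I' kap by (intro sum_mono2) (auto intro: rev_image_eqI simp: add_nonneg_nonneg)
    also have "\<dots> = (\<Sum>k\<in>fst ` I'. \<Sum>p\<in>(UNIV :: (coord \<times> coord) set). 4 * (\<kappa> * exp (- d * knorm k)) * (2 * pi + 1) ^ CARD('n))"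
      by (subst sum.cartesian_product) (auto intro: sum.cong)
    also have "\<dots> = 64 * \<kappa> * (2 * pi + 1) ^ CARD('n) * (\<Sum>k\<in>fst ` I'. exp (- d * knorm k))"
      by (simp add: UNIV_coord card_cartesian_product sum_distrib_left mult_ac flip: UNIV_Times_UNIV)
    also have "\<dots> \<le> 64 * \<kappa> * (2 * pi + 1) ^ CARD('n) * (2 + 2 / d) ^ CARD('n)"
      using kap I' by (intro mult_left_mono sum_exp_knorm_le[OF d]) (auto simp: add_nonneg_nonneg)
    finally show ?thesis by (simp add: mult_ac)
  qed
  have U: "(\<Union>x\<in>I. S x) \<in> lmeasurable" "measure lebesgue (\<Union>x\<in>I. S x) \<le> ?B"
    using fmeasurable_UN_bound[of I S lebesgue ?B] measure_UN_bound[of I S lebesgue ?B] SI(1) fin by auto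
  define E' where "E' = E - (\<Union>x\<in>I. S x)"
  have "E - E' = (\<Union>x\<in>I. S x)" unfolding E'_def S_def by auto
  moreover have "\<kappa> * exp (- d * knorm k) \<le> \<bar>kdot k \<omega> + (l \<omega> j - l \<omega> i)\<bar>" if "\<omega> \<in> E'" "k \<noteq> (\<lambda>_. 0)" for \<omega> i j k
  proof (rule ccontr)
    assume "\<not> ?thesis"
    then have "\<omega> \<in> S (k, i, j)" "(k, i, j) \<in> I" using that unfolding E'_def S_def I_def by auto
    then show False using that(1) unfolding E'_def by blast
  qed
  moreover have "E' \<in> sets lebesgue" "E' \<subseteq> E" unfolding E'_def using E U(1) by (auto simp: fmeasurableD)
  ultimately show ?thesis using U(2) by (intro exI[of _ E']) auto
qed

text \<open>The increments of 1/f involve 1/f^2, so the square of the lower bound enters through the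
  Lipschitz part only, multiplied by \<open>L\<close>. That is the origin of both lower bounds on
  \<open>R\<close> in the next lemma.\<close>

lemma bl_inverse:
  fixes f :: "'w::metric_space \<Rightarrow> real"
  assumes g: "0 < g" and L: "0 \<le> L" and lo: "\<And>x. x \<in> E \<Longrightarrow> g \<le> \<bar>f x\<bar>"
    and lip: "\<And>x y. x \<in> E \<Longrightarrow> y \<in> E \<Longrightarrow> \<bar>f x - f y\<bar> \<le> L * dist x y"
  shows "bl E (1 / g + L / g\<^sup>2) (\<lambda>x. 1 / (\<i> * of_real (f x)))"
proof (rule blI_lipschitz)
  show "norm (1 / (\<i> * of_real (f x)) :: complex) \<le> 1 / g" if "x \<in> E" for x
    using lo[OF that] g by (simp add: norm_divide norm_mult frac_le)
  fix x y assume xy: "x \<in> E" "y \<in> E"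
  have nz: "f x \<noteq> 0" "f y \<noteq> 0" using lo[OF xy(1)] lo[OF xy(2)] g by auto
  have "1 / (\<i> * of_real (f x)) - 1 / (\<i> * of_real (f y)) = - \<i> * of_real ((f y - f x) / (f x * f y))"
    using nz by (simp add: field_simps)
  then have "dist (1 / (\<i> * of_real (f x))) (1 / (\<i> * of_real (f y)) :: complex) = \<bar>f x - f y\<bar> / (\<bar>f x\<bar> * \<bar>f y\<bar>)"
    unfolding dist_norm by (simp add: norm_mult abs_mult abs_minus_commute del: of_real_divide of_real_mult of_real_diff)
  also have "\<dots> \<le> (L * dist x y) / (g * g)"
    using lip[OF xy] lo[OF xy(1)] lo[OF xy(2)] g L by (intro frac_le mult_mono) auto
  finally show "dist (1 / (\<i> * of_real (f x))) (1 / (\<i> * of_real (f y)) :: complex) \<le> L / g\<^sup>2 * dist x y"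
    by (simp add: power2_eq_square)
qed (use g L in auto)

text \<open>For nonzero \<open>k\<close> the squared inverse threshold contributes exp (2 d |k|),
  and the Lipschitz constant |k| of k . \<omega> is absorbed by exp (d |k|) / d; hence the loss
  \<open>3 * d\<close> of width and the bound \<open>(2 + 1 / d) / \<kappa>\<^sup>2\<close>. For k =
  0 the divisor is an eigenvalue gap, at least \<open>\<eta>\<close>.\<close>

lemma kam_step_sets:
  fixes Q :: "real ^ 'n::finite \<Rightarrow> real \<Rightarrow> coord sqmat" and l :: "real ^ 'n \<Rightarrow> coord \<Rightarrow> real"
  assumes box: "E \<subseteq> freq_box" and E: "E \<in> sets lebesgue"
    and L: "0 \<le> L" "L \<le> 1/2"
    and lip: "\<And>x y i j. x \<in> E \<Longrightarrow> y \<in> E \<Longrightarrow> \<bar>(l x j - l x i) - (l y j - l y i)\<bar> \<le> L * dist x y"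
    and gap: "0 < \<eta>" "\<And>\<omega> i j. \<omega> \<in> E \<Longrightarrow> i \<noteq> j \<Longrightarrow> \<eta> \<le> \<bar>l \<omega> j - l \<omega> i\<bar>"
    and Q: "qpm E s M Q"
    and Qs: "\<And>\<omega> t. \<omega> \<in> E \<Longrightarrow> star (Q \<omega> t) = - Q \<omega> t" "\<And>\<omega> t. \<omega> \<in> E \<Longrightarrow> cj (Q \<omega> t) = Q \<omega> t"
    and l: "\<And>\<omega> i. \<omega> \<in> E \<Longrightarrow> l \<omega> (bar i) = - l \<omega> i"
    and kap: "0 < \<kappa>" "\<kappa> \<le> 1" and d: "0 < d" "3 * d \<le> s"
    and R: "(2 + 1 / d) / \<kappa>\<^sup>2 \<le> R" "1 / \<eta> + L / \<eta>\<^sup>2 \<le> R" and small: "R * M \<le> 1/8"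
  shows "\<exists>E' g Q' Z. E' \<subseteq> E \<and> E' \<in> sets lebesgue \<and>
    measure lebesgue (E - E') \<le> 64 * \<kappa> * (2 + 2 / d) ^ CARD('n) * (2 * pi + 1) ^ CARD('n) \<and>
    (\<forall>i. bl E' M (\<lambda>\<omega>. of_real (g \<omega> i))) \<and> (\<forall>\<omega> i. g \<omega> (bar i) = - g \<omega> i) \<and>
    qpm E' (s - 3 * d) (10 * R * M\<^sup>2) Q' \<and> qpm E' (s - 3 * d) (4 * R * M) Z \<and>
    (\<forall>\<omega>\<in>E'. \<forall>t. star (Q' \<omega> t) = - Q' \<omega> t \<and> cj (Q' \<omega> t) = Q' \<omega> t \<and>
      (1 + Z \<omega> t) * star (1 + Z \<omega> t) = 1 \<and> star (1 + Z \<omega> t) * (1 + Z \<omega> t) = 1 \<and>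
      ((\<lambda>t. 1 + Z \<omega> t) has_vector_derivative
        (Dg (\<lambda>i. l \<omega> i + g \<omega> i) + Q' \<omega> t) * (1 + Z \<omega> t) - (1 + Z \<omega> t) * (Dg (l \<omega>) + Q \<omega> t)) (at t))"
proof -
  have "\<bar>(l x j - l x i) - (l y j - l y i)\<bar> \<le> 1/2 * dist x y" if "x \<in> E" "y \<in> E" for x y i j
    using lip[OF that, of j i] mult_right_mono[OF L(2), of "dist x y"] by simp
  from nonresonant_subset[where l = l, OF box E this kap(1) d(1)]
  obtain E' where E': "E' \<subseteq> E" "E' \<in> sets lebesgue"
    and meas: "measure lebesgue (E - E') \<le> 64 * \<kappa> * (2 + 2 / d) ^ CARD('n) * (2 * pi + 1) ^ CARD('n)"
    and nr: "\<And>\<omega> i j k. \<omega> \<in> E' \<Longrightarrow> k \<noteq> (\<lambda>_. 0) \<Longrightarrow> \<kappa> * exp (- d * knorm k) \<le> \<bar>kdot k \<omega> + (l \<omega> j - l \<omega> i)\<bar>"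
    by blast
  have pos: "0 < \<kappa> * exp (- d * knorm k)" for k :: "'n \<Rightarrow> int" using kap by simp
  have R0: "0 \<le> R" using R(2) gap(1) L(1) by (meson add_nonneg_nonneg divide_nonneg_nonneg order_trans zero_le_one zero_le_power2 less_imp_le)
  have inv: "bl E' (R * exp (3 * d * knorm k)) (\<lambda>\<omega>. 1 / (\<i> * of_real (kdot k \<omega> + (l \<omega> j - l \<omega> i))))"
    if ijk: "i \<noteq> j \<or> k \<noteq> (\<lambda>_. 0)" for i j k
  proof (cases "k = (\<lambda>_. 0)")
    case True
    then have "i \<noteq> j" using ijk by simp
    have "bl E' (1 / \<eta> + L / \<eta>\<^sup>2) (\<lambda>\<omega>. 1 / (\<i> * of_real (l \<omega> j - l \<omega> i)))"
      using E'(1) gap L lip \<open>i \<noteq> j\<close> by (intro bl_inverse) (auto simp: subset_iff)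
    then show ?thesis using bl_mono[OF _ order_refl R(2)] True by simp
  next
    case False
    define g where "g = \<kappa> * exp (- d * knorm k)"
    define e where "e = exp (d * knorm k)"
    have dk: "0 \<le> d * knorm k" using d by simp
    have e1: "1 \<le> e" "d * knorm k \<le> e" unfolding e_def using dk exp_ge_add_one_self[of "d * knorm k"] by linarith+
    have "bl E' (1 / g + (knorm k + L) / g\<^sup>2) (\<lambda>\<omega>. 1 / (\<i> * of_real (kdot k \<omega> + (l \<omega> j - l \<omega> i))))"
    proof (rule bl_inverse)
      show "0 < g" unfolding g_def by (rule pos)
      show "0 \<le> knorm k + L" using L by simp
      fix x assume "x \<in> E'" then show "g \<le> \<bar>kdot k x + (l x j - l x i)\<bar>" unfolding g_def using nr[OF _ False] by blast
    next
      fix x y assume "x \<in> E'" "y \<in> E'"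
      then have "x \<in> E" "y \<in> E" using E'(1) by auto
      from lip[OF this, of j i] kdot_lipschitz[of k x y]
      show "\<bar>kdot k x + (l x j - l x i) - (kdot k y + (l y j - l y i))\<bar> \<le> (knorm k + L) * dist x y"
        unfolding distrib_right by linarith
    qed
    moreover have "1 / g + (knorm k + L) / g\<^sup>2 \<le> R * exp (3 * d * knorm k)"
    proof -
      have ig: "1 / g = e / \<kappa>" unfolding g_def e_def by (simp add: exp_minus field_simps)
      have "1 / g + (knorm k + L) / g\<^sup>2 = (1 / g) + (knorm k + L) * (1 / g)\<^sup>2" by (simp add: power_divide)
      also have "\<dots> = (e * \<kappa> + (knorm k + L) * e\<^sup>2) / \<kappa>\<^sup>2" unfolding ig using kap by (simp add: field_simps power2_eq_square)
      also have "\<dots> \<le> ((2 + 1 / d) * e ^ 3) / \<kappa>\<^sup>2"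
      proof (rule divide_right_mono)
        have "e * \<kappa> \<le> e * e\<^sup>2" using e1 kap by (intro mult_left_mono) (auto intro: order_trans[OF _ one_le_power])
        moreover have "knorm k * e\<^sup>2 \<le> (e / d) * e\<^sup>2" using e1 d by (intro mult_right_mono) (auto simp: field_simps)
        moreover have "L * e\<^sup>2 \<le> e * e\<^sup>2" using e1 L by (intro mult_right_mono) auto
        ultimately have "e * \<kappa> + (knorm k + L) * e\<^sup>2 \<le> e * e\<^sup>2 + ((e / d) * e\<^sup>2 + e * e\<^sup>2)"
          unfolding distrib_right by linarith
        also have "\<dots> = (2 + 1 / d) * e ^ 3" by (simp add: power2_eq_square power3_eq_cube algebra_simps)
        finally show "e * \<kappa> + (knorm k + L) * e\<^sup>2 \<le> (2 + 1 / d) * e ^ 3" .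
      qed simp
      also have "\<dots> = ((2 + 1 / d) / \<kappa>\<^sup>2) * e ^ 3" by simp
      also have "\<dots> \<le> R * e ^ 3" using R(1) e1 by (intro mult_right_mono) auto
      also have "e ^ 3 = exp (3 * d * knorm k)" unfolding e_def by (simp add: exp_of_nat_mult[symmetric] mult.assoc)
      finally show ?thesis .
    qed
    ultimately show ?thesis by (rule bl_mono[OF _ order_refl])
  qed
  have nz: "kdot k \<omega> + (l \<omega> j - l \<omega> i) \<noteq> 0" if "i \<noteq> j \<or> k \<noteq> (\<lambda>_. 0)" "\<omega> \<in> E'" for i j k \<omega>
  proof (cases "k = (\<lambda>_. 0)")
    case True
    then show ?thesis using gap(2)[of \<omega> i j] that E'(1) gap(1) by auto
  next
    case False
    then show ?thesis using nr[OF that(2) False, of j i] pos[of k] by auto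
  qed
  have d3: "0 \<le> 3 * d" using d by simp
  have sub: "\<omega> \<in> E" if "\<omega> \<in> E'" for \<omega> using that E'(1) by auto
  from kam_step[where l = l, OF Q E'(1) d3 d(2) R0 inv nz Qs[OF sub] l[OF sub] small]
  obtain g Q' Z where "(\<forall>i. bl E' M (\<lambda>\<omega>. of_real (g \<omega> i)))" "(\<forall>\<omega> i. g \<omega> (bar i) = - g \<omega> i)"
    "qpm E' (s - 3 * d) (10 * R * M\<^sup>2) Q'" "qpm E' (s - 3 * d) (4 * R * M) Z"
    "\<forall>\<omega>\<in>E'. \<forall>t. star (Q' \<omega> t) = - Q' \<omega> t \<and> cj (Q' \<omega> t) = Q' \<omega> t \<and>
      (1 + Z \<omega> t) * star (1 + Z \<omega> t) = 1 \<and> star (1 + Z \<omega> t) * (1 + Z \<omega> t) = 1 \<and>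
      ((\<lambda>t. 1 + Z \<omega> t) has_vector_derivative
        (Dg (\<lambda>i. l \<omega> i + g \<omega> i) + Q' \<omega> t) * (1 + Z \<omega> t) - (1 + Z \<omega> t) * (Dg (l \<omega>) + Q \<omega> t)) (at t)"
    by blast
  with E' meas show ?thesis by blast
qed

section \<open>The iteration\<close>

lemma freq_box_sets: "(freq_box :: (real ^ 'n::finite) set) \<in> sets lebesgue"
  and freq_box_lmeasurable: "(freq_box :: (real ^ 'n::finite) set) \<in> lmeasurable"
proof -
  have "freq_box = (\<Inter>i\<in>UNIV. {\<omega> :: real ^ 'n. 0 < \<omega> $ i} \<inter> {\<omega>. \<omega> $ i \<le> 2 * pi})"
    by (auto simp: freq_box_def)
  also have "\<dots> \<in> sets borel"
    by (intro sets.finite_INT sets.Int borel_open borel_closed open_halfspace_component_gt_cart closed_halfspace_component_le_cart) auto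
  finally show 1: "(freq_box :: (real ^ 'n) set) \<in> sets lebesgue" by simp
  have "freq_box \<inter> cbox (0 :: real ^ 'n) (\<chi> i. 2 * pi) \<in> lmeasurable"
    by (rule fmeasurable_Int_fmeasurable[OF lmeasurable_cbox 1, unfolded Int_commute[of _ freq_box]])
  moreover have "freq_box \<subseteq> cbox (0 :: real ^ 'n) (\<chi> i. 2 * pi)"
    by (auto simp: mem_box_cart freq_box_def less_imp_le)
  ultimately show "(freq_box :: (real ^ 'n) set) \<in> lmeasurable" by (simp add: Int_absorb2)
qed

text \<open>Besides the limit it gives a rate, which for the transformations is uniform in time;
  that uniformity lets the time derivative pass to the limit.\<close>

lemma geometric_increments:
  fixes a :: "nat \<Rightarrow> 'a::banach"
  assumes inc: "\<And>n. norm (a (Suc n) - a n) \<le> C * (1/2) ^ n"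
  shows "\<exists>L. a \<longlonglongrightarrow> L \<and> (\<forall>n. norm (a n - L) \<le> 2 * C * (1/2) ^ n)"
proof -
  have g: "summable (\<lambda>n. (1/2 :: real) ^ n)" by (rule summable_geometric) simp
  have s: "summable (\<lambda>n. a (Suc n) - a n)"
    by (rule summable_comparison_test'[OF summable_mult[OF g, of C], of 0]) (use inc in auto)
  have part: "(\<Sum>i<n. a (Suc i) - a i) = a n - a 0" for n
    by (rule sum_lessThan_telescope)
  define L where "L = a 0 + (\<Sum>n. a (Suc n) - a n)"
  have "(\<lambda>n. a 0 + (\<Sum>i<n. a (Suc i) - a i)) \<longlonglongrightarrow> L"
    unfolding L_def by (intro tendsto_intros summable_LIMSEQ s)
  then have lim: "a \<longlonglongrightarrow> L" unfolding part by simp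
  have "norm (a n - L) \<le> 2 * C * (1/2) ^ n" for n
  proof -
    have "L - a n = (\<Sum>i. a (Suc (i + n)) - a (i + n))"
      using suminf_minus_initial_segment[OF s, of n] part[of n] by (simp add: L_def)
    then have "norm (a n - L) = norm (\<Sum>i. a (Suc (i + n)) - a (i + n))" by (metis norm_minus_commute)
    also have "\<dots> \<le> (\<Sum>i. C * (1/2) ^ n * (1/2) ^ i)"
    proof (rule norm_suminf_le)
      show "norm (a (Suc (i + n)) - a (i + n)) \<le> C * (1/2) ^ n * (1/2) ^ i" for i
        using inc[of "i + n"] by (simp only: power_add mult_ac)
    qed (rule summable_mult[OF g])
    also have "\<dots> = C * (1/2) ^ n * 2" using suminf_mult[OF g, of "C * (1/2) ^ n"] suminf_geometric[of "1/2::real"] by simp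
    finally show ?thesis by (simp add: mult_ac)
  qed
  with lim show ?thesis by blast
qed

lemma norm_Dg_diff_le:
  assumes "\<And>i. \<bar>l i - l' i\<bar> \<le> r"
  shows "norm (Dg l - Dg l') \<le> r"
  unfolding sqmat_norm_le_iff
proof
  fix i
  have "(\<Sum>j\<in>UNIV. norm (ent (Dg l - Dg l') i j)) = (\<Sum>j\<in>UNIV. if i = j then norm (\<i> * of_real (l i) - \<i> * of_real (l' i)) else 0)"
    by (intro sum.cong) (auto simp: ent_simps ent_Dg)
  also have "\<dots> = \<bar>l i - l' i\<bar>" by (simp add: right_diff_distrib[symmetric] norm_mult flip: of_real_diff)
  finally show "(\<Sum>j\<in>UNIV. norm (ent (Dg l - Dg l') i j)) \<le> r" using assms[of i] by simp
qed

text \<open>\<open>\<beta>\<close> is the size of the perturbation relative to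
  \<open>\<epsilon>\<^sup>2\<close>, the order of the gap; it is O(\<epsilon>) in the application.
  \<open>K / \<epsilon>\<^sup>2\<close> bounds the inverse divisors of the first step: the first
  summand of \<open>K\<close> serves the nonzero wave vectors, the other two the zero wave vector,
  whose gap stays above \<open>c * \<epsilon>\<^sup>2\<close>.\<close>

theorem kam_iteration:
  fixes Q0 :: "real ^ 'n::finite \<Rightarrow> real \<Rightarrow> coord sqmat" and l0 :: "real ^ 'n \<Rightarrow> coord \<Rightarrow> real"
    and s c \<Lambda> \<epsilon> \<beta> K B :: real
  assumes s: "0 < s" and c: "0 < c" and \<Lambda>: "0 \<le> \<Lambda>" and eps: "0 < \<epsilon>" "\<epsilon> \<le> 1" "4 * (\<Lambda> + 1) * \<epsilon>\<^sup>2 \<le> 1"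
    and K: "K = 16 * (2 + 12 / s) + 1 / c + 2 * (\<Lambda> + 1) / c\<^sup>2" and B: "B = 4 * 4 ^ (CARD('n) + 1)"
    and beta: "0 \<le> \<beta>" "80 * K * B * \<beta> \<le> 1" "4 * \<beta> \<le> c"
    and l0: "\<And>\<omega> i. \<omega> \<in> freq_box \<Longrightarrow> l0 \<omega> (bar i) = - l0 \<omega> i"
    and l0_lip: "\<And>x y i. x \<in> freq_box \<Longrightarrow> y \<in> freq_box \<Longrightarrow> \<bar>l0 x i - l0 y i\<bar> \<le> \<Lambda> * \<epsilon>\<^sup>2 * dist x y"
    and gap: "\<And>\<omega> i j. \<omega> \<in> freq_box \<Longrightarrow> i \<noteq> j \<Longrightarrow> 2 * c * \<epsilon>\<^sup>2 \<le> \<bar>l0 \<omega> j - l0 \<omega> i\<bar>"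
    and Q0: "qpm freq_box s (\<epsilon>\<^sup>2 * \<beta>) Q0"
    and Q0s: "\<And>\<omega> t. \<omega> \<in> freq_box \<Longrightarrow> star (Q0 \<omega> t) = - Q0 \<omega> t" "\<And>\<omega> t. \<omega> \<in> freq_box \<Longrightarrow> cj (Q0 \<omega> t) = Q0 \<omega> t"
  shows "\<exists>E X l. E \<subseteq> freq_box \<and> E \<in> sets lebesgue \<and>
    measure lebesgue (freq_box - E) \<le> 32 * (2 + 24 / s) ^ CARD('n) * (2 * pi + 1) ^ CARD('n) * \<epsilon> \<and>
    qpm E (s / 2) (16 * K * \<beta>) X \<and>
    (\<forall>\<omega>\<in>E. (\<forall>i. \<bar>l \<omega> i - l0 \<omega> i\<bar> \<le> 2 * \<epsilon>\<^sup>2 * \<beta>) \<and> (\<forall>i. l \<omega> (bar i) = - l \<omega> i) \<and>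
      (\<forall>t. (1 + X \<omega> t) * star (1 + X \<omega> t) = 1 \<and> star (1 + X \<omega> t) * (1 + X \<omega> t) = 1 \<and>
        ((\<lambda>t. 1 + X \<omega> t) has_vector_derivative
          Dg (l \<omega>) * (1 + X \<omega> t) - (1 + X \<omega> t) * (Dg (l0 \<omega>) + Q0 \<omega> t)) (at t)))"
proof -
  define N where "N = CARD('n)"
  \<comment> \<open>Growth of the inverse divisors per step: 2 from \<open>1 / dn n\<close> and
    \<open>4 ^ (N + 1)\<close> from the inverse square of \<open>\<kappa>n n\<close>.\<close>
  define b where "b = (2::real) * 4 ^ (N + 1)"
  have K0: "32 \<le> K" "0 < K" and Kc: "1 / c + 2 * (\<Lambda> + 1) / c\<^sup>2 \<le> K" "16 * (2 + 12 / s) \<le> K"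
  proof -
    have "0 < 12 / s" "0 < 1 / c" "0 \<le> 2 * (\<Lambda> + 1) / c\<^sup>2" using s c \<Lambda> by auto
    moreover have "32 \<le> K \<and> 0 < K \<and> q + r \<le> K \<and> 16 * (2 + p) \<le> K"
      if "0 < p" "0 < q" "0 \<le> r" "K = 16 * (2 + p) + q + r" for p q r :: real using that by auto
    ultimately show "32 \<le> K" "0 < K" "1 / c + 2 * (\<Lambda> + 1) / c\<^sup>2 \<le> K" "16 * (2 + 12 / s) \<le> K"
      using K by blast+
  qed
  have b4: "4 \<le> b"
  proof -
    have "1 \<le> (4::real) ^ N" by (rule one_le_power) simp
    moreover have "b = 8 * 4 ^ N" by (simp add: b_def)
    ultimately show ?thesis by linarith
  qed
  have b: "1 \<le> b" "B = 2 * b" using b4 by (simp_all add: B b_def N_def)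
  have Kb: "K * \<beta> \<le> 1/640"
  proof -
    have "K * \<beta> * 640 \<le> K * \<beta> * (80 * B)" using b4 b(2) K0 beta(1) by (intro mult_left_mono) auto
    then show ?thesis using beta(2) by (simp add: mult_ac)
  qed
  have be1: "\<beta> \<le> 1/2"
  proof -
    have "32 * \<beta> \<le> K * \<beta>" using K0 beta(1) by (intro mult_right_mono) auto
    then show ?thesis using Kb by simp
  qed
  define h where "h n = (1/2 :: real) ^ n" for n :: nat
  have h: "0 < h n" "h n \<le> 1" "h (Suc n) = h n / 2" for n by (simp_all add: h_def power_le_one)
  \<comment> \<open>Bound for the total drift of the eigenvalues: step \<open>n\<close> moves them
    by at most \<open>Mn n\<close>, hence by at most
    \<open>\<epsilon>\<^sup>2 * \<beta> * h n\<close>.\<close>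
  define \<rho> where "\<rho> = 2 * \<epsilon>\<^sup>2 * \<beta>"
  \<comment> \<open>The widths decrease from \<open>s\<close> towards \<open>s / 2\<close>. As a
    step spends three times \<open>dn n\<close>, the latter is a third of the decrement
    \<open>s / 4 * h n\<close>.\<close>
  define sn where "sn n = s / 2 * (1 + h n)" for n
  define dn where "dn n = s / 12 * h n" for n
  \<comment> \<open>Geometric decay of \<open>Mn\<close> is enough, since \<open>B\<close> exceeds the growth factor \<open>b\<close> of \<open>Rn\<close>.\<close>
  define Mn where "Mn n = \<epsilon>\<^sup>2 * \<beta> * (1 / B) ^ n" for n
  define Rn where "Rn n = K / \<epsilon>\<^sup>2 * b ^ n" for n
  \<comment> \<open>As \<open>dn\<close> halves at each step, the sum over the wave vectors grows
    like \<open>2 ^ (N * n)\<close>. One more factor 1/2 per step makes the lost measure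
    summable.\<close>
  define \<kappa>n where "\<kappa>n n = \<epsilon> / 4 * (1 / 2 ^ (N + 1)) ^ n" for n
  define Cm where "Cm = 16 * (2 + 24 / s) ^ N * (2 * pi + 1) ^ N * \<epsilon>"
  define \<zeta> where "\<zeta> = 4 * K * \<beta>"
  have e2: "0 < \<epsilon>\<^sup>2" using eps by simp
  have \<rho>: "0 \<le> \<rho>" "\<rho> \<le> \<epsilon>\<^sup>2" "2 * \<rho> \<le> c * \<epsilon>\<^sup>2"
  proof -
    show "0 \<le> \<rho>" using beta(1) by (simp add: \<rho>_def)
    have "\<epsilon>\<^sup>2 * (2 * \<beta>) \<le> \<epsilon>\<^sup>2 * 1" using be1 by (intro mult_left_mono) auto
    then show "\<rho> \<le> \<epsilon>\<^sup>2" by (simp add: \<rho>_def mult_ac)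
    have "\<epsilon>\<^sup>2 * (4 * \<beta>) \<le> \<epsilon>\<^sup>2 * c" using beta(3) by (intro mult_left_mono) auto
    then show "2 * \<rho> \<le> c * \<epsilon>\<^sup>2" by (simp add: \<rho>_def mult_ac)
  qed
  have \<zeta>: "0 \<le> \<zeta>" "4 * \<zeta> \<le> 1/8" using Kb K0 beta(1) by (simp_all add: \<zeta>_def)
  have snd: "sn n - 3 * dn n = sn (Suc n)" "s / 2 \<le> sn n" "3 * dn n \<le> sn n" "0 < dn n" for n
    using s h[of n] by (simp_all add: sn_def dn_def field_simps)
  have Bh: "(1 / B) ^ n \<le> h n" for n
    unfolding h_def using b4 b(2) by (intro power_mono) (auto simp: field_simps)
  have Mh: "Mn n \<le> \<epsilon>\<^sup>2 * \<beta> * h n" "0 \<le> Mn n" for n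
    unfolding Mn_def using Bh[of n] beta(1) b4 b(2) by (auto intro!: mult_left_mono)
  have RM: "Rn n * Mn n = K * \<beta> * h n" for n
  proof -
    have "Rn n * Mn n = K * \<beta> * (b ^ n * (1 / B) ^ n)" unfolding Rn_def Mn_def using e2 by (simp add: field_simps)
    also have "b ^ n * (1 / B) ^ n = h n" unfolding power_mult_distrib[symmetric] h_def using b b4 by simp
    finally show ?thesis .
  qed
  \<comment> \<open>The relative gain \<open>10 * Rn n * Mn n\<close> of the quadratic estimate
    stays below the fixed number \<open>1 / B\<close>, because \<open>Rn n * Mn n\<close> never
    exceeds \<open>K * \<beta>\<close>.\<close>
  have MM: "10 * Rn n * (Mn n)\<^sup>2 \<le> Mn (Suc n)" for n
  proof -
    have "10 * Rn n * (Mn n)\<^sup>2 = 10 * (K * \<beta> * h n) * Mn n" unfolding RM[symmetric] by (simp add: power2_eq_square)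
    also have "\<dots> \<le> (1 / B) * Mn n"
    proof (rule mult_right_mono[OF _ Mh(2)])
      have "K * \<beta> * h n \<le> K * \<beta> * 1" using h[of n] K0 beta(1) by (intro mult_left_mono) auto
      then have "K * \<beta> * h n * B \<le> K * \<beta> * 1 * B" using b4 b(2) by (intro mult_right_mono) auto
      moreover have "K * \<beta> * 1 * B = K * B * \<beta>" by simp
      moreover have "0 \<le> K * B * \<beta>" using K0 b4 b(2) beta(1) by simp
      ultimately have "10 * (K * \<beta> * h n) * B \<le> 1" using beta(2) by linarith
      then show "10 * (K * \<beta> * h n) \<le> 1 / B" using b4 b(2) by (simp add: pos_le_divide_eq)
    qed
    also have "\<dots> = Mn (Suc n)" unfolding Mn_def by simp
    finally show ?thesis .
  qed
  have R1: "(2 + 1 / dn n) / (\<kappa>n n)\<^sup>2 \<le> Rn n" for n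
  proof -
    have le: "2 + 1 / dn n \<le> (2 + 12 / s) * 2 ^ n"
      using s one_le_power[of "2::real" n] by (simp add: dn_def h_def power_one_over field_simps)
    have k2: "(\<kappa>n n)\<^sup>2 = \<epsilon>\<^sup>2 / 16 * (1 / 4 ^ (N + 1)) ^ n"
    proof -
      have "((1 / 2 ^ (N + 1)) ^ n)\<^sup>2 = (((1::real) / 2 ^ (N + 1))\<^sup>2) ^ n" by (simp only: power_mult[symmetric] mult.commute)
      also have "((1::real) / 2 ^ (N + 1))\<^sup>2 = 1 / 4 ^ (N + 1)"
        by (simp add: power_divide power_mult_distrib power2_eq_square flip: power_mult_distrib)
      finally show ?thesis unfolding \<kappa>n_def power_mult_distrib by (simp add: power_divide)
    qed
    have "(2 + 1 / dn n) / (\<kappa>n n)\<^sup>2 \<le> ((2 + 12 / s) * 2 ^ n) / (\<epsilon>\<^sup>2 / 16 * (1 / 4 ^ (N + 1)) ^ n)"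
      unfolding k2 using le by (rule divide_right_mono) simp
    also have "\<dots> = 16 * (2 + 12 / s) / \<epsilon>\<^sup>2 * b ^ n"
      unfolding b_def power_mult_distrib by (simp add: power_one_over field_simps)
    also have "\<dots> \<le> Rn n" unfolding Rn_def using Kc(2) e2 b by (intro mult_right_mono divide_right_mono) auto
    finally show ?thesis .
  qed
  \<comment> \<open>A difference involves two eigenvalues, each with Lipschitz constant
    \<open>\<Lambda> * \<epsilon>\<^sup>2\<close> from \<open>l0\<close> plus at most
    \<open>\<epsilon>\<^sup>2\<close> from its drift. The factor \<open>\<epsilon>\<^sup>2\<close>
    compensates half of the squared gap in \<open>R2\<close>.\<close>
  define L where "L = 2 * (\<Lambda> + 1) * \<epsilon>\<^sup>2"
  have L: "0 \<le> L" "L \<le> 1/2"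
  proof -
    show "0 \<le> L" unfolding L_def using \<Lambda> by simp
    show "L \<le> 1/2" unfolding L_def using eps(3) by linarith
  qed
  have R2: "1 / (c * \<epsilon>\<^sup>2) + L / (c * \<epsilon>\<^sup>2)\<^sup>2 \<le> Rn n" for n
  proof -
    have "1 / (c * \<epsilon>\<^sup>2) + L / (c * \<epsilon>\<^sup>2)\<^sup>2 = (1 / c + 2 * (\<Lambda> + 1) / c\<^sup>2) / \<epsilon>\<^sup>2 * 1"
    proof -
      have "1 / (c * e) + 2 * (\<Lambda> + 1) * e / (c * e)\<^sup>2 = (1 / c + 2 * (\<Lambda> + 1) / c\<^sup>2) / e * 1" if "0 < e" for e :: real
        using c that by (simp add: field_simps power2_eq_square)
      then show ?thesis unfolding L_def using e2 by blast
    qed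
    also have "\<dots> \<le> K / \<epsilon>\<^sup>2 * b ^ n"
      using Kc(1) e2 b K0 by (intro mult_mono divide_right_mono one_le_power) auto
    finally show ?thesis unfolding Rn_def .
  qed
  have kap: "0 < \<kappa>n n" "\<kappa>n n \<le> 1" for n
  proof -
    show "0 < \<kappa>n n" using eps by (simp add: \<kappa>n_def)
    have "1 \<le> (2::real) ^ (N + 1)" by (rule one_le_power) simp
    then have "(1 / 2 ^ (N + 1)) ^ n \<le> (1::real)" by (intro power_le_one) (simp_all add: divide_le_eq)
    then have "\<epsilon> / 4 * (1 / 2 ^ (N + 1)) ^ n \<le> 1/4 * 1" using eps by (intro mult_mono) auto
    then show "\<kappa>n n \<le> 1" by (simp add: \<kappa>n_def)
  qed
  have meas_n: "64 * \<kappa>n n * (2 + 2 / dn n) ^ N * (2 * pi + 1) ^ N \<le> Cm * h n" for n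
  proof -
    have "2 + 2 / dn n \<le> (2 + 24 / s) * 2 ^ n"
      using s one_le_power[of "2::real" n] by (simp add: dn_def h_def power_one_over field_simps)
    then have "(2 + 2 / dn n) ^ N \<le> ((2 + 24 / s) * 2 ^ n) ^ N"
      using snd(4)[of n] by (intro power_mono) (auto simp: add_nonneg_nonneg less_imp_le)
    then have "64 * \<kappa>n n * (2 + 2 / dn n) ^ N * (2 * pi + 1) ^ N \<le> 64 * \<kappa>n n * ((2 + 24 / s) * 2 ^ n) ^ N * (2 * pi + 1) ^ N"
      using kap(1)[of n] by (intro mult_right_mono mult_left_mono) (auto simp: add_nonneg_nonneg)
    also have "\<dots> = Cm * ((1 / 2 ^ (N + 1)) ^ n * (2 ^ n) ^ N)"
      unfolding Cm_def \<kappa>n_def power_mult_distrib by (simp add: mult_ac)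
    also have "(1 / 2 ^ (N + 1)) ^ n * (2 ^ n) ^ N = h n"
    proof -
      have "((2::real) ^ n) ^ N = (2 ^ N) ^ n" by (simp only: power_mult[symmetric] mult.commute)
      moreover have "(1 / 2 ^ (N + 1)) * 2 ^ N = (1/2::real)" by simp
      ultimately show ?thesis unfolding h_def by (simp only: power_mult_distrib[symmetric])
    qed
    finally show ?thesis .
  qed
  \<comment> \<open>The clause for \<open>n = 0\<close> ties the chosen sequence to the given data.
    The bound \<open>(1 - h n) * \<rho>\<close> leaves room \<open>\<rho> * h n / 2\<close> for the
    next correction, and \<open>Mn n\<close> fits into it.\<close>
  define P where "P n x \<longleftrightarrow> (case x of (E, l, Q) \<Rightarrow> E \<subseteq> freq_box \<and> E \<in> sets lebesgue \<and>
      (n = 0 \<longrightarrow> E = freq_box \<and> l = l0 \<and> Q = Q0) \<and>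
      (\<forall>i. bl E ((1 - h n) * \<rho>) (\<lambda>\<omega>. of_real (l \<omega> i - l0 \<omega> i))) \<and> (\<forall>\<omega>\<in>E. \<forall>i. l \<omega> (bar i) = - l \<omega> i) \<and>
      qpm E (sn n) (Mn n) Q \<and> (\<forall>\<omega>\<in>E. \<forall>t. star (Q \<omega> t) = - Q \<omega> t \<and> cj (Q \<omega> t) = Q \<omega> t))"
    for n :: nat and x :: "(real ^ 'n) set \<times> (real ^ 'n \<Rightarrow> coord \<Rightarrow> real) \<times> (real ^ 'n \<Rightarrow> real \<Rightarrow> coord sqmat)"
  \<comment> \<open>The transformation of every step is recorded with the common width
    \<open>s / 2\<close>, so that all of them can be multiplied in one algebra.\<close>
  define T where "T n x y \<longleftrightarrow> (case x of (E, l, Q) \<Rightarrow> case y of (E', l', Q') \<Rightarrow> E' \<subseteq> E \<and>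
      measure lebesgue (E - E') \<le> Cm * h n \<and> (\<forall>\<omega>\<in>E'. \<forall>i. \<bar>l' \<omega> i - l \<omega> i\<bar> \<le> Mn n) \<and>
      (\<exists>Z. qpm E' (s / 2) (\<zeta> * h n) Z \<and> (\<forall>\<omega>\<in>E'. \<forall>t. 
        (1 + Z \<omega> t) * star (1 + Z \<omega> t) = 1 \<and> star (1 + Z \<omega> t) * (1 + Z \<omega> t) = 1 \<and>
        ((\<lambda>t. 1 + Z \<omega> t) has_vector_derivative
          (Dg (l' \<omega>) + Q' \<omega> t) * (1 + Z \<omega> t) - (1 + Z \<omega> t) * (Dg (l \<omega>) + Q \<omega> t)) (at t))))"
    for n :: nat and x y :: "(real ^ 'n) set \<times> (real ^ 'n \<Rightarrow> coord \<Rightarrow> real) \<times> (real ^ 'n \<Rightarrow> real \<Rightarrow> coord sqmat)"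
  have "\<exists>f. \<forall>n. P n (f n) \<and> T n (f n) (f (Suc n))"
  proof (rule dependent_nat_choice)
    have "bl freq_box ((1 - h 0) * \<rho>) (\<lambda>\<omega>. of_real (l0 \<omega> i - l0 \<omega> i))" for i
      using bl_const[of 0 0 freq_box] by (simp add: h_def)
    then have "P 0 (freq_box, l0, Q0)"
      unfolding P_def using Q0 Q0s l0 freq_box_sets by (simp add: sn_def Mn_def h_def)
    then show "\<exists>x. P 0 x" by blast
  next
    fix x n assume Px: "P n x"
    obtain E l Q where x: "x = (E, l, Q)" by (cases x) auto
    have box: "E \<subseteq> freq_box" and E: "E \<in> sets lebesgue"
      and bll: "\<And>i. bl E ((1 - h n) * \<rho>) (\<lambda>\<omega>. of_real (l \<omega> i - l0 \<omega> i))"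
      and l: "\<And>\<omega> i. \<omega> \<in> E \<Longrightarrow> l \<omega> (bar i) = - l \<omega> i"
      and Q: "qpm E (sn n) (Mn n) Q"
      and Qs: "\<And>\<omega> t. \<omega> \<in> E \<Longrightarrow> star (Q \<omega> t) = - Q \<omega> t" "\<And>\<omega> t. \<omega> \<in> E \<Longrightarrow> cj (Q \<omega> t) = Q \<omega> t"
      using Px unfolding P_def x by auto
    have hr: "(1 - h n) * \<rho> \<le> \<rho>" using \<rho> h[of n] by (simp add: mult_left_le_one_le)
    have ll: "\<bar>l \<omega> i - l0 \<omega> i\<bar> \<le> \<rho>" if "\<omega> \<in> E" for \<omega> i
      using bl_norm[OF bll that, of i] hr by (simp flip: of_real_diff)
    have lip: "\<bar>(l x j - l x i) - (l y j - l y i)\<bar> \<le> L * dist x y" if xy: "x \<in> E" "y \<in> E" for x y i j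
    proof -
      have 1: "\<bar>(l x i - l0 x i) - (l y i - l0 y i)\<bar> \<le> \<epsilon>\<^sup>2 * dist x y" for i
      proof -
        have "\<bar>(l x i - l0 x i) - (l y i - l0 y i)\<bar> \<le> ((1 - h n) * \<rho>) * dist x y"
          using bl_dist[OF bll xy, of i] by (simp add: dist_norm flip: of_real_diff)
        also have "\<dots> \<le> \<epsilon>\<^sup>2 * dist x y" using hr \<rho> by (intro mult_right_mono) auto
        finally show ?thesis .
      qed
      have 2: "\<bar>l0 x i - l0 y i\<bar> \<le> \<Lambda> * \<epsilon>\<^sup>2 * dist x y" for i using l0_lip box xy by blast
      have "\<bar>(l x j - l x i) - (l y j - l y i)\<bar> \<le> 2 * (\<epsilon>\<^sup>2 * dist x y) + 2 * (\<Lambda> * \<epsilon>\<^sup>2 * dist x y)"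
        using 1[of i] 1[of j] 2[of i] 2[of j] by linarith
      also have "\<dots> = L * dist x y" by (simp add: L_def algebra_simps)
      finally show ?thesis .
    qed
    \<comment> \<open>Both eigenvalues drift by at most \<open>\<rho>\<close>, and
      \<open>2 * \<rho>\<close> is at most half of the initial gap.\<close>
    have gap': "c * \<epsilon>\<^sup>2 \<le> \<bar>l \<omega> j - l \<omega> i\<bar>" if "\<omega> \<in> E" "i \<noteq> j" for \<omega> i j
      using gap[OF subsetD[OF box that(1)] that(2)] ll[OF that(1), of i] ll[OF that(1), of j] \<rho>(3) by linarith
    have small: "Rn n * Mn n \<le> 1/8"
    proof -
      have "K * \<beta> * h n \<le> K * \<beta> * 1" using h[of n] K0 beta(1) by (intro mult_left_mono) auto
      then show ?thesis unfolding RM using Kb by simp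
    qed
    have ce: "0 < c * \<epsilon>\<^sup>2" using c e2 by simp
    obtain E' g Q' Z where E': "E' \<subseteq> E" "E' \<in> sets lebesgue"
      and m: "measure lebesgue (E - E') \<le> 64 * \<kappa>n n * (2 + 2 / dn n) ^ CARD('n) * (2 * pi + 1) ^ CARD('n)"
      and blg: "\<And>i. bl E' (Mn n) (\<lambda>\<omega>. of_real (g \<omega> i))" and g: "\<And>\<omega> i. g \<omega> (bar i) = - g \<omega> i"
      and Q': "qpm E' (sn n - 3 * dn n) (10 * Rn n * (Mn n)\<^sup>2) Q'" and Z: "qpm E' (sn n - 3 * dn n) (4 * Rn n * Mn n) Z"
      and pr: "\<And>\<omega> t. \<omega> \<in> E' \<Longrightarrow> star (Q' \<omega> t) = - Q' \<omega> t \<and> cj (Q' \<omega> t) = Q' \<omega> t \<and>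
        (1 + Z \<omega> t) * star (1 + Z \<omega> t) = 1 \<and> star (1 + Z \<omega> t) * (1 + Z \<omega> t) = 1 \<and>
        ((\<lambda>t. 1 + Z \<omega> t) has_vector_derivative
          (Dg (\<lambda>i. l \<omega> i + g \<omega> i) + Q' \<omega> t) * (1 + Z \<omega> t) - (1 + Z \<omega> t) * (Dg (l \<omega>) + Q \<omega> t)) (at t)"
      using kam_step_sets[where l = l, OF box E L lip ce gap' Q Qs l kap snd(4,3) R1 R2 small] by blast
    define l' where "l' \<omega> i = l \<omega> i + g \<omega> i" for \<omega> i
    have "bl E' ((1 - h (Suc n)) * \<rho>) (\<lambda>\<omega>. of_real (l' \<omega> i - l0 \<omega> i))" for i
    proof -
      have "bl E' ((1 - h n) * \<rho> + Mn n) (\<lambda>\<omega>. of_real (l \<omega> i - l0 \<omega> i) + of_real (g \<omega> i))"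
        by (intro bl_add blg bl_mono[OF bll E'(1)]) simp
      moreover have "(1 - h n) * \<rho> + Mn n \<le> (1 - h (Suc n)) * \<rho>"
        using Mh(1)[of n] by (simp add: h(3) \<rho>_def algebra_simps)
      ultimately have "bl E' ((1 - h (Suc n)) * \<rho>) (\<lambda>\<omega>. of_real (l \<omega> i - l0 \<omega> i) + of_real (g \<omega> i))"
        by (rule bl_mono[OF _ order_refl])
      then show ?thesis by (rule bl_cong) (simp add: l'_def)
    qed
    moreover have "qpm E' (sn (Suc n)) (Mn (Suc n)) Q'"
      using qpm_mono[OF Q' order_refl _ MM] by (simp add: snd(1))
    ultimately have "P (Suc n) (E', l', Q')"
      unfolding P_def using E' box pr g l by (auto simp: l'_def)
    moreover have "T n x (E', l', Q')"
    proof -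
      have "qpm E' (s / 2) (\<zeta> * h n) Z"
        using qpm_mono[OF Z order_refl, of "s / 2" "\<zeta> * h n"] snd(1,2) RM[of n] by (simp add: \<zeta>_def mult.assoc)
      moreover have "\<bar>l' \<omega> i - l \<omega> i\<bar> \<le> Mn n" if "\<omega> \<in> E'" for \<omega> i
        using bl_norm[OF blg that, of i] by (simp add: l'_def)
      moreover have "measure lebesgue (E - E') \<le> Cm * h n" using m meas_n[of n] unfolding N_def by linarith
      moreover have "Dg (\<lambda>i. l \<omega> i + g \<omega> i) = Dg (l' \<omega>)" for \<omega> unfolding l'_def ..
      ultimately show ?thesis unfolding T_def x using E'(1) pr by auto
    qed
    ultimately show "\<exists>y. P (Suc n) y \<and> T n x y" by blast
  qed
  then obtain f where f: "\<And>n. P n (f n)" "\<And>n. T n (f n) (f (Suc n))" by blast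
  define E where "E n = fst (f n)" for n
  define l where "l n = fst (snd (f n))" for n
  define Q where "Q n = snd (snd (f n))" for n
  have feq: "f n = (E n, l n, Q n)" for n by (simp add: E_def l_def Q_def)
  note fP = f(1)[unfolded feq P_def case_prod_conv] and fT = f(2)[unfolded feq T_def case_prod_conv]
  define Ei where "Ei = (\<Inter>n. E n)"
  have EiE: "\<omega> \<in> E n" if "\<omega> \<in> Ei" for \<omega> n using that by (simp add: Ei_def)
  have E0: "E 0 = freq_box" "l 0 = l0" "Q 0 = Q0" using fP[of 0] by auto
  have Eibox: "Ei \<subseteq> freq_box" using EiE[of _ 0] E0 by blast
  have Eim: "Ei \<in> sets lebesgue" unfolding Ei_def using fP by (intro sets.countable_INT) auto
  have measE: "measure lebesgue (freq_box - Ei) \<le> 2 * Cm"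
  proof -
    have dm: "E n - E (Suc n) \<in> lmeasurable" for n
    proof -
      have "freq_box \<inter> (E n - E (Suc n)) \<in> lmeasurable"
        using fP[of n] fP[of "Suc n"] by (intro fmeasurable_Int_fmeasurable[OF freq_box_lmeasurable]) auto
      moreover have "freq_box \<inter> (E n - E (Suc n)) = E n - E (Suc n)" using fP[of n] by blast
      ultimately show ?thesis by simp
    qed
    \<comment> \<open>A parameter that does not survive all steps is lost at a definite one, since
      the first set is the whole box.\<close>
    have "freq_box - Ei \<subseteq> (\<Union>n. E n - E (Suc n))"
    proof
      fix \<omega> assume w: "\<omega> \<in> freq_box - Ei"
      show "\<omega> \<in> (\<Union>n. E n - E (Suc n))"
      proof (rule ccontr)
        assume "\<not> ?thesis"
        then have "\<omega> \<in> E n \<Longrightarrow> \<omega> \<in> E (Suc n)" for n by blast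
        then have "\<omega> \<in> E n" for n using w E0 by (induction n) auto
        then show False using w by (simp add: Ei_def)
      qed
    qed
    moreover have "freq_box - Ei \<in> sets lebesgue" using Eim freq_box_sets by auto
    moreover have fin: "measure lebesgue (\<Union>n\<in>I. E n - E (Suc n)) \<le> 2 * Cm" if "finite I" for I
    proof -
      have Cm0: "0 \<le> Cm" unfolding Cm_def using s eps by (auto simp: add_nonneg_nonneg)
      have sg: "summable (\<lambda>n. Cm * h n)" unfolding h_def by (intro summable_mult summable_geometric) simp
      have "measure lebesgue (\<Union>n\<in>I. E n - E (Suc n)) \<le> (\<Sum>n\<in>I. measure lebesgue (E n - E (Suc n)))"
        using that dm by (intro measure_UNION_le) (auto simp: fmeasurableD)
      also have "\<dots> \<le> (\<Sum>n\<in>I. Cm * h n)" using fT by (intro sum_mono) auto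
      also have "\<dots> \<le> (\<Sum>n. Cm * h n)" using that Cm0 h by (intro sum_le_suminf[OF sg]) (auto simp: less_imp_le)
      also have "\<dots> = Cm * 2" unfolding h_def
        by (subst suminf_mult) (auto simp: suminf_geometric intro: summable_geometric)
      finally show ?thesis by simp
    qed
    moreover have "(\<Union>n. E n - E (Suc n)) \<in> lmeasurable" "measure lebesgue (\<Union>n. E n - E (Suc n)) \<le> 2 * Cm"
      using fmeasurable_UN_bound[of UNIV "\<lambda>n. E n - E (Suc n)" lebesgue "2 * Cm"]
        measure_UN_bound[of UNIV "\<lambda>n. E n - E (Suc n)" lebesgue "2 * Cm"] dm fin by auto
    ultimately show ?thesis
      using measure_mono_fmeasurable[of "freq_box - Ei" "\<Union>n. E n - E (Suc n)" lebesgue] by linarith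
  qed
  have "\<forall>n. \<exists>Z. qpm (E (Suc n)) (s / 2) (\<zeta> * h n) Z \<and> (\<forall>\<omega>\<in>E (Suc n). \<forall>t. 
        (1 + Z \<omega> t) * star (1 + Z \<omega> t) = 1 \<and> star (1 + Z \<omega> t) * (1 + Z \<omega> t) = 1 \<and>
        ((\<lambda>t. 1 + Z \<omega> t) has_vector_derivative
          (Dg (l (Suc n) \<omega>) + Q (Suc n) \<omega> t) * (1 + Z \<omega> t) - (1 + Z \<omega> t) * (Dg (l n \<omega>) + Q n \<omega> t)) (at t))"
    using fT by blast
  from choice[OF this] obtain Z where Zq: "\<And>n. qpm (E (Suc n)) (s / 2) (\<zeta> * h n) (Z n)"
    and Zp: "\<And>n \<omega> t. \<omega> \<in> E (Suc n) \<Longrightarrow> (1 + Z n \<omega> t) * star (1 + Z n \<omega> t) = 1 \<and> star (1 + Z n \<omega> t) * (1 + Z n \<omega> t) = 1 \<and>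
        ((\<lambda>t. 1 + Z n \<omega> t) has_vector_derivative
          (Dg (l (Suc n) \<omega>) + Q (Suc n) \<omega> t) * (1 + Z n \<omega> t) - (1 + Z n \<omega> t) * (Dg (l n \<omega>) + Q n \<omega> t)) (at t)"
    by auto
  have s2: "0 \<le> s / 2" using s by simp
  have Zi: "qpm Ei (s / 2) (\<zeta> * h n) (Z n)" for n
    by (rule qpm_mono[OF Zq]) (auto intro: EiE)
  \<comment> \<open>The recursion is \<open>1 + X (Suc n) = (1 + Z n) * (1 + X n)\<close> with the
    identity removed.\<close>
  define X where "X = rec_nat (\<lambda>\<omega> t. 0) (\<lambda>n X \<omega> t. X \<omega> t + (Z n \<omega> t + Z n \<omega> t * X \<omega> t))"
  have X0: "X 0 \<omega> t = 0" and XS: "X (Suc n) \<omega> t = X n \<omega> t + (Z n \<omega> t + Z n \<omega> t * X n \<omega> t)" for n \<omega> t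
    by (simp_all add: X_def)
  \<comment> \<open>As 4 \<zeta> <= 1, the product term is no larger than the bound for
    \<open>Z n\<close>, so the increment is at most \<open>2 * \<zeta> * h n\<close>. This is
    exactly the growth of the bound \<open>4 * \<zeta> * (1 - h n)\<close> from one step to the
    next.\<close>
  have inc: "qpm Ei (s / 2) (2 * \<zeta> * h n) (\<lambda>\<omega> t. Z n \<omega> t + Z n \<omega> t * X n \<omega> t)" 
    if "qpm Ei (s / 2) (4 * \<zeta> * (1 - h n)) (X n)" for n
  proof -
    have "qpm Ei (s / 2) (\<zeta> * h n + \<zeta> * h n * (4 * \<zeta> * (1 - h n))) (\<lambda>\<omega> t. Z n \<omega> t + Z n \<omega> t * X n \<omega> t)"
      by (intro qpm_add qpm_mult Zi that s2)
    moreover have "\<zeta> * h n * (4 * \<zeta> * (1 - h n)) \<le> \<zeta> * h n * 1"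
    proof (rule mult_left_mono)
      have "4 * \<zeta> * (1 - h n) \<le> 1 * 1" using \<zeta> h[of n] by (intro mult_mono) auto
      then show "4 * \<zeta> * (1 - h n) \<le> 1" by simp
    qed (use \<zeta> h[of n] in simp)
    ultimately show ?thesis using qpm_mono[OF _ order_refl order_refl] by fastforce
  qed
  have Xq: "qpm Ei (s / 2) (4 * \<zeta> * (1 - h n)) (X n)" for n
  proof (induction n)
    case 0
    have "qpm Ei (s / 2) 0 (X 0)" unfolding qpm_def X0 ent_simps by (simp add: qp_zero)
    then show ?case by (simp add: h_def)
  next
    case (Suc n)
    have "qpm Ei (s / 2) (4 * \<zeta> * (1 - h n) + 2 * \<zeta> * h n) (X (Suc n))"
      using qpm_add[OF Suc inc[OF Suc] s2] unfolding XS[abs_def] .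
    moreover have "4 * \<zeta> * (1 - h n) + 2 * \<zeta> * h n = 4 * \<zeta> * (1 - h (Suc n))" by (simp add: h(3) algebra_simps)
    ultimately show ?case by simp
  qed
  \<comment> \<open>The limit of \<open>X n\<close> is written as the series of its increments, so
    that closure under series supplies a single expansion for it.\<close>
  define Xi where "Xi \<omega> t = (\<Sum>n. Z n \<omega> t + Z n \<omega> t * X n \<omega> t)" for \<omega> t
  have Xiq: "qpm Ei (s / 2) (16 * K * \<beta>) Xi"
    unfolding Xi_def
  proof (rule qpm_suminf[OF inc[OF Xq] _ _ s2])
    show "summable (\<lambda>n. 2 * \<zeta> * h n)" unfolding h_def by (intro summable_mult summable_geometric) simp
    have "(\<Sum>n. 2 * \<zeta> * h n) = 2 * \<zeta> * 2" unfolding h_def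
      by (subst suminf_mult) (auto simp: suminf_geometric intro: summable_geometric)
    then show "(\<Sum>n. 2 * \<zeta> * h n) \<le> 16 * K * \<beta>" by (simp add: \<zeta>_def)
  qed
  have main: "\<exists>li. (\<forall>i. \<bar>li i - l0 \<omega> i\<bar> \<le> 2 * \<epsilon>\<^sup>2 * \<beta>) \<and> (\<forall>i. li (bar i) = - li i) \<and>
      (\<forall>t. (1 + Xi \<omega> t) * star (1 + Xi \<omega> t) = 1 \<and> star (1 + Xi \<omega> t) * (1 + Xi \<omega> t) = 1 \<and>
        ((\<lambda>t. 1 + Xi \<omega> t) has_vector_derivative
          Dg li * (1 + Xi \<omega> t) - (1 + Xi \<omega> t) * (Dg (l0 \<omega>) + Q0 \<omega> t)) (at t))"
    if w: "\<omega> \<in> Ei" for \<omega>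
  proof -
    note wE = EiE[OF w]
    have "\<exists>L. (\<lambda>n. l n \<omega> i) \<longlonglongrightarrow> L \<and> (\<forall>n. norm (l n \<omega> i - L) \<le> 2 * (\<epsilon>\<^sup>2 * \<beta>) * (1/2) ^ n)" for i
    proof (rule geometric_increments)
      fix n
      show "norm (l (Suc n) \<omega> i - l n \<omega> i) \<le> \<epsilon>\<^sup>2 * \<beta> * (1/2) ^ n"
      proof -
        have "\<bar>l (Suc n) \<omega> i - l n \<omega> i\<bar> \<le> Mn n" using fT[of n] wE[of "Suc n"] by blast
        then show ?thesis using Mh(1)[of n] unfolding h_def by simp
      qed
    qed
    then obtain li where li: "\<And>i. (\<lambda>n. l n \<omega> i) \<longlonglongrightarrow> li i"
      and lin: "\<And>i n. \<bar>l n \<omega> i - li i\<bar> \<le> 2 * (\<epsilon>\<^sup>2 * \<beta>) * (1/2) ^ n" by (metis real_norm_def)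
    have l1: "\<bar>li i - l0 \<omega> i\<bar> \<le> 2 * \<epsilon>\<^sup>2 * \<beta>" for i using lin[of 0 i] E0 by simp
    have l2: "li (bar i) = - li i" for i
    proof (rule LIMSEQ_unique[OF li])
      have "l n \<omega> (bar i) = - l n \<omega> i" for n using fP[of n] wE[of n] by blast
      then show "(\<lambda>n. l n \<omega> (bar i)) \<longlonglongrightarrow> - li i" using tendsto_minus[OF li[of i]] by simp
    qed
    define V where "V n t = 1 + X n \<omega> t" for n t
    define Vi where "Vi t = 1 + Xi \<omega> t" for t
    have VS: "V (Suc n) t = (1 + Z n \<omega> t) * V n t" for n t by (simp add: V_def XS algebra_simps)
    have part: "X n \<omega> t = (\<Sum>i<n. Z i \<omega> t + Z i \<omega> t * X i \<omega> t)" for n t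
      by (induction n) (auto simp: X0 XS)
    have incb: "norm (X (Suc n) \<omega> t - X n \<omega> t) \<le> 2 * \<zeta> * (1/2) ^ n" for n t
      using qpm_bound[OF inc[OF Xq] s2 w, of n t] by (simp add: XS h_def)
    have Vlim: "(\<lambda>n. V n t) \<longlonglongrightarrow> Vi t" and Vb: "norm (V n t - Vi t) \<le> 4 * \<zeta> * h n" for n t
    proof -
      obtain L where L: "(\<lambda>n. X n \<omega> t) \<longlonglongrightarrow> L" "\<And>n. norm (X n \<omega> t - L) \<le> 2 * (2 * \<zeta>) * (1/2) ^ n"
        using geometric_increments[of "\<lambda>n. X n \<omega> t", OF incb] by blast
      have "(\<lambda>i. Z i \<omega> t + Z i \<omega> t * X i \<omega> t) sums L"
        unfolding sums_def part[symmetric] by (rule L(1))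
      then have "L = Xi \<omega> t" unfolding Xi_def by (rule sums_unique)
      with L show "(\<lambda>n. V n t) \<longlonglongrightarrow> Vi t" "norm (V n t - Vi t) \<le> 4 * \<zeta> * h n"
        unfolding V_def Vi_def h_def by (auto intro!: tendsto_intros)
    qed
    have Vnorm: "norm (V n t) \<le> 2" for n t
    proof -
      have "norm (X n \<omega> t) \<le> 4 * \<zeta> * (1 - h n)" by (rule qpm_bound[OF Xq s2 w])
      also have "\<dots> \<le> 1 * 1" using \<zeta> h[of n] by (intro mult_mono) auto
      finally show ?thesis using norm_triangle_ineq[of 1 "X n \<omega> t"] by (simp add: V_def)
    qed
    have Vsym: "V n t * star (V n t) = 1 \<and> star (V n t) * V n t = 1" for n t
    proof (induction n)
      case (Suc n)
      have z: "(1 + Z n \<omega> t) * star (1 + Z n \<omega> t) = 1" "star (1 + Z n \<omega> t) * (1 + Z n \<omega> t) = 1"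
        using Zp[OF wE[of "Suc n"], of t] by auto
      have "V (Suc n) t * star (V (Suc n) t) = (1 + Z n \<omega> t) * (V n t * star (V n t)) * star (1 + Z n \<omega> t)"
        unfolding VS star_mult by (simp only: mult.assoc)
      moreover have "star (V (Suc n) t) * V (Suc n) t = star (V n t) * (star (1 + Z n \<omega> t) * (1 + Z n \<omega> t)) * V n t"
        unfolding VS star_mult by (simp only: mult.assoc)
      ultimately show ?case using Suc z by (simp only: mult_1_right mult_1_left)
    qed (simp add: V_def X0)
    have slim: "(\<lambda>n. star (V n t)) \<longlonglongrightarrow> star (Vi t)" for t
      by (rule bounded_linear.tendsto[OF bounded_linear_star Vlim])
    have sym1: "Vi t * star (Vi t) = 1" for t
    proof (rule LIMSEQ_unique[OF tendsto_mult[OF Vlim slim]])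
      show "(\<lambda>n. V n t * star (V n t)) \<longlonglongrightarrow> 1" using Vsym by simp
    qed
    have sym2: "star (Vi t) * Vi t = 1" for t
    proof (rule LIMSEQ_unique[OF tendsto_mult[OF slim Vlim]])
      show "(\<lambda>n. star (V n t) * V n t) \<longlonglongrightarrow> 1" using Vsym by simp
    qed
    define M0 where "M0 t = Dg (l0 \<omega>) + Q0 \<omega> t" for t
    \<comment> \<open>The derivative of the product of the first \<open>n\<close> transformations:
      it conjugates the original system to that of stage \<open>n\<close>. As \<open>Q n\<close>
      tends to 0, the formal limit is \<open>Wi\<close>.\<close>
    define W where "W n t = (Dg (l n \<omega>) + Q n \<omega> t) * V n t - V n t * M0 t" for n t
    define Wi where "Wi t = Dg li * Vi t - Vi t * M0 t" for t
    have Vder: "(V n has_vector_derivative W n t) (at t)" for n t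
    proof (induction n)
      case 0
      have "V 0 = (\<lambda>t. 1)" by (simp add: V_def[abs_def] X0)
      moreover have "W 0 t = 0" by (simp add: W_def V_def X0 M0_def E0)
      ultimately show ?case by simp
    next
      case (Suc n)
      have "((\<lambda>t. 1 + Z n \<omega> t) has_vector_derivative
          (Dg (l (Suc n) \<omega>) + Q (Suc n) \<omega> t) * (1 + Z n \<omega> t) - (1 + Z n \<omega> t) * (Dg (l n \<omega>) + Q n \<omega> t)) (at t)"
        using Zp[OF wE[of "Suc n"], of t] by blast
      from has_vector_derivative_mult[OF this Suc]
      have "(V (Suc n) has_vector_derivative (1 + Z n \<omega> t) * W n t + ((Dg (l (Suc n) \<omega>) + Q (Suc n) \<omega> t) * (1 + Z n \<omega> t) - (1 + Z n \<omega> t) * (Dg (l n \<omega>) + Q n \<omega> t)) * V n t) (at t)"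
        unfolding VS[abs_def, symmetric] .
      moreover have "(1 + z) * (d * v - v * m) + (d' * (1 + z) - (1 + z) * d) * v = d' * ((1 + z) * v) - (1 + z) * v * m" for z d v m d' :: "coord sqmat"
        by (simp add: algebra_simps)
      ultimately show ?case unfolding W_def VS by simp
    qed
    \<comment> \<open>Sum of the coefficients in \<open>n1\<close> to \<open>n4\<close>: the
      eigenvalues and the remainder multiplied by \<open>V n\<close>, of norm at most 2, and the
      error of \<open>V n\<close> multiplied by the two fixed matrices.\<close>
    define KK where "KK = 4 * \<epsilon>\<^sup>2 * \<beta> + 2 * \<epsilon>\<^sup>2 * \<beta> + norm (Dg li) * (4 * \<zeta>) + 4 * \<zeta> * (norm (Dg (l0 \<omega>)) + \<epsilon>\<^sup>2 * \<beta>)"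
    have KK0: "0 \<le> KK" unfolding KK_def using beta(1) \<zeta> by simp
    have Wb: "norm (W n t - Wi t) \<le> KK * h n" for n t
    proof -
      have eq: "W n t - Wi t = (Dg (l n \<omega>) - Dg li) * V n t + Q n \<omega> t * V n t + Dg li * (V n t - Vi t) - (V n t - Vi t) * M0 t"
        unfolding W_def Wi_def by (simp add: algebra_simps)
      have n1: "norm ((Dg (l n \<omega>) - Dg li) * V n t) \<le> 4 * \<epsilon>\<^sup>2 * \<beta> * h n"
      proof -
        have "norm (Dg (l n \<omega>) - Dg li) \<le> 2 * (\<epsilon>\<^sup>2 * \<beta>) * h n" unfolding h_def by (rule norm_Dg_diff_le[OF lin])
        then have "norm (Dg (l n \<omega>) - Dg li) * norm (V n t) \<le> 2 * (\<epsilon>\<^sup>2 * \<beta>) * h n * 2"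
          using Vnorm[of n t] h[of n] beta(1) by (intro mult_mono) (auto simp: less_imp_le)
        then show ?thesis using norm_mult_ineq[of "Dg (l n \<omega>) - Dg li" "V n t"] by simp
      qed
      have n2: "norm (Q n \<omega> t * V n t) \<le> 2 * \<epsilon>\<^sup>2 * \<beta> * h n"
      proof -
        have "qpm (E n) (sn n) (Mn n) (Q n)" using fP[of n] by blast
        then have "norm (Q n \<omega> t) \<le> Mn n" by (rule qpm_bound) (use snd(2)[of n] s wE in auto)
        then have "norm (Q n \<omega> t) * norm (V n t) \<le> (\<epsilon>\<^sup>2 * \<beta> * h n) * 2"
          using Vnorm[of n t] Mh[of n] h[of n] beta(1) by (intro mult_mono) (auto simp: less_imp_le)
        then show ?thesis using norm_mult_ineq[of "Q n \<omega> t" "V n t"] by simp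
      qed
      have n3: "norm (Dg li * (V n t - Vi t)) \<le> norm (Dg li) * (4 * \<zeta>) * h n"
      proof -
        have "norm (Dg li) * norm (V n t - Vi t) \<le> norm (Dg li) * (4 * \<zeta> * h n)"
          using Vb by (intro mult_left_mono) auto
        then show ?thesis using norm_mult_ineq[of "Dg li" "V n t - Vi t"] by simp
      qed
      have n4: "norm ((V n t - Vi t) * M0 t) \<le> 4 * \<zeta> * (norm (Dg (l0 \<omega>)) + \<epsilon>\<^sup>2 * \<beta>) * h n"
      proof -
        have "norm (Q0 \<omega> t) \<le> \<epsilon>\<^sup>2 * \<beta>" by (rule qpm_bound[OF Q0]) (use s w Eibox in auto)
        then have "norm (M0 t) \<le> norm (Dg (l0 \<omega>)) + \<epsilon>\<^sup>2 * \<beta>"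
          unfolding M0_def using norm_triangle_ineq[of "Dg (l0 \<omega>)" "Q0 \<omega> t"] by linarith
        then have "norm (V n t - Vi t) * norm (M0 t) \<le> (4 * \<zeta> * h n) * (norm (Dg (l0 \<omega>)) + \<epsilon>\<^sup>2 * \<beta>)"
          using Vb[of n t] \<zeta> h[of n] by (intro mult_mono) (auto simp: less_imp_le)
        then show ?thesis using norm_mult_ineq[of "V n t - Vi t" "M0 t"] by (simp add: mult_ac)
      qed
      have "norm (W n t - Wi t) \<le> norm ((Dg (l n \<omega>) - Dg li) * V n t) + norm (Q n \<omega> t * V n t) + norm (Dg li * (V n t - Vi t)) + norm ((V n t - Vi t) * M0 t)"
        unfolding eq by (intro order_trans[OF norm_triangle_ineq4] add_right_mono order_trans[OF norm_triangle_ineq] order_refl)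
      then show ?thesis using n1 n2 n3 n4 unfolding KK_def distrib_right by linarith
    qed
    have "\<exists>g. \<forall>t\<in>UNIV. (\<lambda>n. V n t) \<longlonglongrightarrow> g t \<and> (g has_derivative (\<lambda>r. r *\<^sub>R Wi t)) (at t within UNIV)"
    proof (rule has_derivative_sequence[where f' = "\<lambda>n t r. r *\<^sub>R W n t"])
      fix n t
      show "(V n has_derivative (\<lambda>r. r *\<^sub>R W n t)) (at t within UNIV)"
        using Vder[of n t] unfolding has_vector_derivative_def .
    next
      fix e :: real assume e: "0 < e"
      have "(\<lambda>n. KK * h n) \<longlonglongrightarrow> KK * 0" unfolding h_def by (intro tendsto_intros LIMSEQ_power_zero) simp
      then have "\<forall>\<^sub>F n in sequentially. KK * h n < e" using e by (simp add: order_tendsto_iff)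
      then show "\<forall>\<^sub>F n in sequentially. \<forall>t\<in>UNIV. \<forall>r. norm (r *\<^sub>R W n t - r *\<^sub>R Wi t) \<le> e * norm r"
      proof eventually_elim
        case (elim n)
        have "norm (r *\<^sub>R W n t - r *\<^sub>R Wi t) \<le> e * norm r" for r t
        proof -
          have "norm (r *\<^sub>R W n t - r *\<^sub>R Wi t) = \<bar>r\<bar> * norm (W n t - Wi t)" by (simp flip: scaleR_diff_right)
          also have "\<dots> \<le> \<bar>r\<bar> * e" using Wb[of n t] elim by (intro mult_left_mono) auto
          finally show ?thesis by (simp add: mult.commute)
        qed
        then show ?case by blast
      qed
    qed (use Vlim in auto)
    then obtain g where g: "\<And>t. (\<lambda>n. V n t) \<longlonglongrightarrow> g t" "\<And>t. (g has_derivative (\<lambda>r. r *\<^sub>R Wi t)) (at t)" by auto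
    have "g = Vi" using LIMSEQ_unique[OF g(1) Vlim] by blast
    then have "(Vi has_vector_derivative Wi t) (at t)" for t using g(2) unfolding has_vector_derivative_def by simp
    then show ?thesis using l1 l2 sym1 sym2 unfolding Wi_def Vi_def[abs_def] M0_def by blast
  qed
  then obtain li where "\<And>\<omega>. \<omega> \<in> Ei \<Longrightarrow> (\<forall>i. \<bar>li \<omega> i - l0 \<omega> i\<bar> \<le> 2 * \<epsilon>\<^sup>2 * \<beta>) \<and> (\<forall>i. li \<omega> (bar i) = - li \<omega> i) \<and>
      (\<forall>t. (1 + Xi \<omega> t) * star (1 + Xi \<omega> t) = 1 \<and> star (1 + Xi \<omega> t) * (1 + Xi \<omega> t) = 1 \<and>
        ((\<lambda>t. 1 + Xi \<omega> t) has_vector_derivative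
          Dg (li \<omega>) * (1 + Xi \<omega> t) - (1 + Xi \<omega> t) * (Dg (l0 \<omega>) + Q0 \<omega> t)) (at t))" by metis
  moreover have "measure lebesgue (freq_box - Ei) \<le> 32 * (2 + 24 / s) ^ CARD('n) * (2 * pi + 1) ^ CARD('n) * \<epsilon>"
    using measE by (simp add: Cm_def N_def)
  ultimately show ?thesis using Eibox Eim Xiq by blast
qed

section \<open>Fourier expansion of holomorphic functions on a strip\<close>

definition hstrip :: "real \<Rightarrow> complex set" where
  "hstrip \<sigma> = {z. \<bar>Im z\<bar> < \<sigma>}"

lemma open_hstrip: "open (hstrip \<sigma>)" and convex_hstrip: "convex (hstrip \<sigma>)"
proof -
  have eq: "hstrip \<sigma> = {z. Im z < \<sigma>} \<inter> {z. - \<sigma> < Im z}" by (auto simp: hstrip_def)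
  show "open (hstrip \<sigma>)" unfolding eq by (intro open_Int open_halfspace_Im_lt open_halfspace_Im_gt)
  show "convex (hstrip \<sigma>)" unfolding eq by (intro convex_Int convex_halfspace_Im_lt convex_halfspace_Im_gt)
qed

definition fcoeff :: "int \<Rightarrow> (complex \<Rightarrow> complex) \<Rightarrow> complex" where
  "fcoeff m g = integral {0..2*pi} (\<lambda>x. g (of_real x) * exp (- \<i> * of_int m * of_real x)) / (2 * pi)"

text \<open>A primitive of a periodic function changes by a constant over one period, so the integral over
  a horizontal segment of length one period does not depend on the height of the segment.\<close>
lemma integral_horizontal_shift:
  assumes F: "F holomorphic_on hstrip \<sigma>" and per: "\<And>z. z \<in> hstrip \<sigma> \<Longrightarrow> F (z + 2 * pi) = F z"
    and y: "\<bar>y\<bar> < \<sigma>"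
  shows "integral {0..2*pi} (\<lambda>x. F (of_real x + \<i> * of_real y)) = integral {0..2*pi} (\<lambda>x. F (of_real x))"
proof -
  obtain H where "\<And>z. z \<in> hstrip \<sigma> \<Longrightarrow> (H has_field_derivative F z) (at z within hstrip \<sigma>)"
    using holomorphic_convex_primitive'[OF convex_hstrip open_hstrip F] by blast
  then have H: "(H has_field_derivative F z) (at z)" if "z \<in> hstrip \<sigma>" for z
    using that at_within_open[OF that open_hstrip] by metis
  have sh: "z + 2 * pi \<in> hstrip \<sigma>" if "z \<in> hstrip \<sigma>" for z using that by (simp add: hstrip_def)
  have dz: "((\<lambda>z. H (z + 2 * pi) - H z) has_field_derivative 0) (at z within hstrip \<sigma>)" if z: "z \<in> hstrip \<sigma>" for z
  proof -
    have "((\<lambda>z. H (z + 2 * pi)) has_field_derivative F z) (at z)"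
      using H[OF sh[OF z]] per[OF z] by (simp add: DERIV_shift)
    from DERIV_diff[OF this H[OF z]] show ?thesis by (auto intro: has_field_derivative_at_within)
  qed
  obtain c where c: "\<And>z. z \<in> hstrip \<sigma> \<Longrightarrow> H (z + 2 * pi) - H z = c"
    using has_field_derivative_zero_constant[OF convex_hstrip dz] by blast
  have int: "integral {0..2*pi} (\<lambda>x. F (of_real x + \<i> * of_real r)) = c" if r: "\<bar>r\<bar> < \<sigma>" for r
  proof -
    have "((\<lambda>x. F (of_real x + \<i> * of_real r)) has_integral H (of_real (2*pi) + \<i> * of_real r) - H (of_real 0 + \<i> * of_real r)) {0..2*pi}"
    proof (rule fundamental_theorem_of_calculus)
      fix x assume "x \<in> {0..2*pi}"
      have zs: "of_real x + \<i> * of_real r \<in> hstrip \<sigma>" using r by (simp add: hstrip_def)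
      have "((\<lambda>x. of_real x + \<i> * of_real r) has_vector_derivative 1) (at x within {0..2*pi})"
        by (auto intro!: derivative_eq_intros)
      from field_vector_diff_chain_within[OF this has_field_derivative_at_within[OF H[OF zs]]]
      show "((\<lambda>x. H (of_real x + \<i> * of_real r)) has_vector_derivative F (of_real x + \<i> * of_real r)) (at x within {0..2*pi})"
        by (simp add: o_def)
    qed simp
    moreover have "H (of_real (2*pi) + \<i> * of_real r) - H (of_real 0 + \<i> * of_real r) = c"
      using c[of "\<i> * of_real r"] r by (simp add: hstrip_def add.commute)
    ultimately show ?thesis by (simp add: integral_unique)
  qed
  have "0 \<le> \<bar>y\<bar>" by simp
  then have "\<bar>0\<bar> < \<sigma>" using y by linarith
  then show ?thesis using int[OF y] int[of 0] by simp
qed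

lemma exp_periodic_int:
  fixes z :: complex
  shows "exp (- \<i> * of_int m * (z + 2 * pi)) = exp (- \<i> * of_int m * z)"
proof -
  have "exp (- \<i> * of_int m * (z + 2 * pi)) = exp (- \<i> * of_int m * z) * exp (2 * of_int (- m) * pi * \<i>)"
    unfolding exp_add[symmetric] by (simp add: algebra_simps)
  also have "exp (2 * of_int (- m) * pi * \<i>) = 1" using exp_integer_2pi[of "of_int (- m)"] by simp
  finally show ?thesis by simp
qed

lemma fcoeff_bound:
  assumes g: "g holomorphic_on hstrip \<sigma>" and per: "\<And>z. z \<in> hstrip \<sigma> \<Longrightarrow> g (z + 2 * pi) = g z"
    and \<rho>: "0 \<le> \<rho>" "\<rho> < \<sigma>" and M: "\<And>z. \<bar>Im z\<bar> \<le> \<rho> \<Longrightarrow> norm (g z) \<le> M"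
  shows "norm (fcoeff m g) \<le> M * exp (- \<rho> * \<bar>of_int m\<bar>)"
proof -
  \<comment> \<open>At height y the exponential has modulus exp (m y), so the line of integration is
    moved against the sign of \<open>m\<close>.\<close>
  define y where "y = (if 0 \<le> m then - \<rho> else \<rho>)"
  have y: "\<bar>y\<bar> < \<sigma>" "\<bar>y\<bar> \<le> \<rho>" "m * y = - \<rho> * \<bar>of_int m\<bar>" using \<rho> by (auto simp: y_def)
  have "(\<lambda>z. g z * exp (- \<i> * of_int m * z)) holomorphic_on hstrip \<sigma>" by (intro holomorphic_intros g)
  from integral_horizontal_shift[OF this _ y(1)]
  have "integral {0..2*pi} (\<lambda>x. g (of_real x) * exp (- \<i> * of_int m * of_real x))
    = integral {0..2*pi} (\<lambda>x. g (of_real x + \<i> * of_real y) * exp (- \<i> * of_int m * (of_real x + \<i> * of_real y)))"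
    using per exp_periodic_int[of m] by simp
  moreover have "norm (integral {0..2*pi} (\<lambda>x. g (of_real x + \<i> * of_real y) * exp (- \<i> * of_int m * (of_real x + \<i> * of_real y)))) \<le> M * exp (- \<rho> * \<bar>of_int m\<bar>) * (2 * pi - 0)"
  proof (rule integral_bound)
    have "continuous_on {0..2*pi} (\<lambda>x. g (of_real x + \<i> * of_real y))"
      by (rule continuous_on_compose2[OF holomorphic_on_imp_continuous_on[OF g]])
         (auto intro!: continuous_intros simp: hstrip_def y)
    then show "continuous_on {0..2*pi} (\<lambda>x. g (of_real x + \<i> * of_real y) * exp (- \<i> * of_int m * (of_real x + \<i> * of_real y)))"
      by (intro continuous_intros)
    fix x assume "x \<in> {0..2*pi}"
    have "norm (exp (- \<i> * of_int m * (of_real x + \<i> * of_real y))) = exp (- \<rho> * \<bar>of_int m\<bar>)"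
      unfolding norm_exp_eq_Re y(3)[symmetric] by simp
    then show "norm (g (of_real x + \<i> * of_real y) * exp (- \<i> * of_int m * (of_real x + \<i> * of_real y))) \<le> M * exp (- \<rho> * \<bar>of_int m\<bar>)"
      unfolding norm_mult using M[of "of_real x + \<i> * of_real y"] y by (simp add: mult_right_mono)
  qed simp
  ultimately show ?thesis unfolding fcoeff_def by (simp add: norm_divide field_simps)
qed

lemma periodic_strip_bounded:
  assumes g: "g holomorphic_on hstrip \<sigma>" and per: "\<And>z. z \<in> hstrip \<sigma> \<Longrightarrow> g (z + 2 * pi) = g z"
    and \<rho>: "0 \<le> \<rho>" "\<rho> < \<sigma>"
  shows "\<exists>M. \<forall>z. \<bar>Im z\<bar> \<le> \<rho> \<longrightarrow> norm (g z) \<le> M"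
proof -
  define K where "K = cbox (Complex 0 (- \<rho>)) (Complex (2 * pi) \<rho>)"
  have K: "z \<in> K \<longleftrightarrow> 0 \<le> Re z \<and> Re z \<le> 2 * pi \<and> \<bar>Im z\<bar> \<le> \<rho>" for z
    unfolding K_def in_cbox_complex_iff by auto
  have "continuous_on K g"
    by (rule continuous_on_subset[OF holomorphic_on_imp_continuous_on[OF g]]) (use \<rho> in \<open>auto simp: K hstrip_def\<close>)
  then have "compact (g ` K)" by (intro compact_continuous_image) (simp_all add: K_def)
  then obtain M where M: "\<And>z. z \<in> K \<Longrightarrow> norm (g z) \<le> M"
    using compact_imp_bounded bounded_iff by (metis imageI)
  have pern: "g (z + 2 * pi * of_nat n) = g z" if "z \<in> hstrip \<sigma>" for z n
  proof (induction n)
    case (Suc n)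
    have "z + 2 * pi * of_nat n \<in> hstrip \<sigma>" using that by (simp add: hstrip_def)
    from per[OF this] Suc show ?case by (simp add: algebra_simps)
  qed simp
  have peri: "g (z + 2 * pi * of_int k) = g z" if z: "z \<in> hstrip \<sigma>" for z k
  proof (cases "0 \<le> k")
    case True
    then show ?thesis using pern[OF z, of "nat k"] by simp
  next
    case False
    have "z + 2 * pi * of_int k \<in> hstrip \<sigma>" using z by (simp add: hstrip_def)
    from pern[OF this, of "nat (- k)"] False show ?thesis by simp
  qed
  have "norm (g z) \<le> M" if z: "\<bar>Im z\<bar> \<le> \<rho>" for z
  proof -
    define k where "k = - \<lfloor>Re z / (2 * pi)\<rfloor>"
    define f where "f = real_of_int \<lfloor>Re z / (2 * pi)\<rfloor>"
    have p: "0 < 2 * pi" by simp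
    have "f \<le> Re z / (2 * pi)" "Re z / (2 * pi) \<le> f + 1" unfolding f_def by linarith+
    then have "f * (2 * pi) \<le> Re z" "Re z \<le> (f + 1) * (2 * pi)"
      using pos_le_divide_eq[OF p] pos_divide_le_eq[OF p] by blast+
    moreover have "real_of_int k = - f" by (simp add: k_def f_def)
    ultimately have "0 \<le> Re z + 2 * pi * of_int k" "Re z + 2 * pi * of_int k \<le> 2 * pi"
      by (simp_all add: algebra_simps)
    then have "z + 2 * pi * of_int k \<in> K" unfolding K using z by simp
    from M[OF this] show ?thesis using peri[of z k] z \<rho> by (simp add: hstrip_def)
  qed
  then show ?thesis by blast
qed

lemma summable_on_exp_abs_int:
  assumes "0 < (\<rho>::real)"
  shows "(\<lambda>m::int. exp (- \<rho> * \<bar>of_int m\<bar>)) summable_on UNIV"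
proof (rule nonneg_bdd_above_summable_on)
  show "bdd_above (sum (\<lambda>m::int. exp (- \<rho> * \<bar>of_int m\<bar>)) ` {F. F \<subseteq> UNIV \<and> finite F})"
  proof (rule bdd_aboveI2)
    fix F :: "int set" assume "F \<in> {F. F \<subseteq> UNIV \<and> finite F}"
    then have F: "finite F" by simp
    define N where "N = nat (Max (insert 0 (abs ` F)))"
    have "F \<subseteq> {- int N..int N}"
    proof
      fix m assume "m \<in> F"
      then have "\<bar>m\<bar> \<le> Max (insert 0 (abs ` F))" "0 \<le> Max (insert 0 (abs ` F))" using F by (auto intro!: Max_ge)
      then show "m \<in> {- int N..int N}" unfolding N_def by auto
    qed
    then have "(\<Sum>m\<in>F. exp (- \<rho> * \<bar>of_int m\<bar>)) \<le> (\<Sum>m\<in>{- int N..int N}. exp (- \<rho> * \<bar>of_int m\<bar>))"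
      by (intro sum_mono2) auto
    also have "\<dots> \<le> 2 + 2 / \<rho>" by (rule sum_exp_abs_le[OF assms])
    finally show "(\<Sum>m\<in>F. exp (- \<rho> * \<bar>of_int m\<bar>)) \<le> 2 + 2 / \<rho>" .
  qed
qed simp

text \<open>Writing \<open>g z - g x\<^sub>0 = h z (exp (i (z - x\<^sub>0)) - 1)\<close> with a holomorphic periodic \<open>h\<close> turns the
  Fourier series of \<open>g\<close> at \<open>x\<^sub>0\<close> into a telescoping sum of the coefficients of \<open>h\<close>.\<close>
lemma fourier_has_sum:
  assumes g: "g holomorphic_on hstrip \<sigma>" and per: "\<And>z. z \<in> hstrip \<sigma> \<Longrightarrow> g (z + 2 * pi) = g z"
    and \<sigma>: "0 < \<sigma>"
  shows "((\<lambda>m. fcoeff m g * cis (of_int m * x0)) has_sum g (of_real x0)) UNIV"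
proof -
  define u where "u z = exp (\<i> * (z - of_real x0))" for z :: complex
  \<comment> \<open>At the zeros of \<open>u - 1\<close> the quotient is replaced by its limit, as
    the derivative of \<open>u\<close> there is \<i>. These zeros are the translates of
    \<open>x0\<close> by periods, where the numerator vanishes too.\<close>
  define h where "h z = (if u z = 1 then deriv g z / \<i> else (g z - g (of_real x0)) / (u z - 1))" for z
  have pern: "g (z + 2 * pi * of_int k) = g z" if z: "z \<in> hstrip \<sigma>" for z k
  proof -
    have pn: "g (z + 2 * pi * of_nat n) = g z" if "z \<in> hstrip \<sigma>" for z n
    proof (induction n)
      case (Suc n)
      have "z + 2 * pi * of_nat n \<in> hstrip \<sigma>" using that by (simp add: hstrip_def)
      from per[OF this] Suc show ?case by (simp add: algebra_simps)
    qed simp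
    show ?thesis
    proof (cases "0 \<le> k")
      case True
      then show ?thesis using pn[OF z, of "nat k"] by simp
    next
      case False
      have "z + 2 * pi * of_int k \<in> hstrip \<sigma>" using z by (simp add: hstrip_def)
      from pn[OF this, of "nat (- k)"] False show ?thesis by simp
    qed
  qed
  have u1: "\<exists>k::int. z = of_real x0 + 2 * pi * of_int k" if uz: "u z = 1" for z
  proof -
    obtain k :: int where "Re (\<i> * (z - of_real x0)) = 0" "Im (\<i> * (z - of_real x0)) = of_int (2 * k) * pi"
      using uz unfolding u_def exp_eq_1 by blast
    then have "Im z = 0" "Re z = x0 + 2 * pi * of_int k" by (auto simp: algebra_simps)
    then have "z = of_real x0 + 2 * pi * of_int k" by (auto simp: complex_eq_iff)
    then show ?thesis by blast
  qed
  have x0s: "of_real x0 \<in> hstrip \<sigma>" using \<sigma> by (simp add: hstrip_def)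
  have g1: "g z = g (of_real x0)" if "u z = 1" for z using u1[OF that] pern[OF x0s] by auto
  have uper: "u (z + 2 * pi) = u z" for z :: complex unfolding u_def using exp_periodic_int[of "-1" "z - of_real x0"] by (simp add: algebra_simps)
  have uhol: "u holomorphic_on S" for S unfolding u_def by (intro holomorphic_intros)
  have du: "deriv u z = \<i> * u z" for z
    unfolding u_def by (rule DERIV_imp_deriv) (auto intro!: derivative_eq_intros)
  have hhol: "h holomorphic_on hstrip \<sigma>"
  proof -
    have "h field_differentiable at z" if z: "z \<in> hstrip \<sigma>" for z
    proof (cases "u z = 1")
      case False
      define S where "S = hstrip \<sigma> \<inter> {w. u w \<noteq> 1}"
      have cu: "continuous_on UNIV u" by (rule holomorphic_on_imp_continuous_on[OF uhol])
      have "open {w. u w \<noteq> 1}" using open_Collect_neq[OF cu continuous_on_const] .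
      then have oS: "open S" unfolding S_def by (intro open_Int open_hstrip)
      have "(\<lambda>z. (g z - g (of_real x0)) / (u z - 1)) holomorphic_on S"
        by (intro holomorphic_intros holomorphic_on_subset[OF g] uhol) (auto simp: S_def)
      then have "h holomorphic_on S"
        by (rule holomorphic_transform) (auto simp: S_def h_def)
      then show ?thesis using False z oS holomorphic_on_imp_differentiable_at unfolding S_def by blast
    next
      case True
      define S where "S = hstrip \<sigma> \<inter> ball z 1"
      have oS: "open S" unfolding S_def by (intro open_Int open_hstrip open_ball)
      \<comment> \<open>Distinct zeros of \<open>u - 1\<close> are at least 2 pi apart, so a unit
        ball around one contains no other.\<close>
      have only: "w = z" if w: "w \<in> S" "u w = 1" for w
      proof -
        obtain k l where k: "z = of_real x0 + 2 * pi * of_int k" and l: "w = of_real x0 + 2 * pi * of_int l"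
          using u1[OF True] u1[OF w(2)] by blast
        have "dist z w < 1" using w(1) by (simp add: S_def)
        define t where "t = \<bar>real_of_int (k - l)\<bar>"
        have "dist z w = 2 * pi * t"
        proof -
          have "z - w = of_real (2 * pi * of_int (k - l))" unfolding k l by (simp add: algebra_simps)
          then show ?thesis unfolding dist_norm t_def by (simp add: abs_mult del: of_real_mult)
        qed
        moreover have "2 * 3 * t \<le> 2 * pi * t"
          using pi_gt3 by (intro mult_right_mono) (auto simp: t_def)
        ultimately have "t < 1" using \<open>dist z w < 1\<close> by linarith
        then have "\<bar>real_of_int (k - l)\<bar> < 1" unfolding t_def .
        then have "k = l" by linarith
        then show ?thesis using k l by simp
      qed
      \<comment> \<open>Near a zero of \<open>u - 1\<close>, \<open>h\<close> is the ratio of the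
        difference quotients of \<open>g\<close> and \<open>u\<close> with their removable
        singularities filled in; the denominator has no zero there.\<close>
      define \<phi> where "\<phi> w = (if w = z then deriv g z else (g w - g z) / (w - z))" for w
      define \<psi> where "\<psi> w = (if w = z then deriv u z else (u w - u z) / (w - z))" for w
      have "\<phi> holomorphic_on S" "\<psi> holomorphic_on S"
        unfolding \<phi>_def \<psi>_def by (intro pole_lemma_open oS uhol holomorphic_on_subset[OF g]; simp add: S_def)+
      moreover have "\<psi> w \<noteq> 0" if "w \<in> S" for w
      proof (cases "w = z")
        case False
        then have "u w \<noteq> 1" using only[OF that] by blast
        then show ?thesis using False True by (simp add: \<psi>_def)
      qed (use True in \<open>simp add: \<psi>_def du\<close>)
      ultimately have "(\<lambda>w. \<phi> w / \<psi> w) holomorphic_on S" by (intro holomorphic_intros) auto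
      then have "h holomorphic_on S"
      proof (rule holomorphic_transform)
        fix w assume w: "w \<in> S"
        show "\<phi> w / \<psi> w = h w"
        proof (cases "w = z")
          case False
          then have "u w \<noteq> 1" using only[OF w] by blast
          then show ?thesis using False True g1[OF True] by (simp add: \<phi>_def \<psi>_def h_def)
        qed (use True in \<open>simp add: \<phi>_def \<psi>_def h_def du\<close>)
      qed
      moreover have "z \<in> S" using z by (simp add: S_def)
      ultimately show ?thesis using oS holomorphic_on_imp_differentiable_at by blast
    qed
    then show ?thesis by (auto simp: holomorphic_on_def intro: field_differentiable_at_within)
  qed
  have dper: "deriv g (z + 2 * pi) = deriv g z" if z: "z \<in> hstrip \<sigma>" for z
  proof -
    have zz: "z + 2 * pi \<in> hstrip \<sigma>" using z by (simp add: hstrip_def)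
    have "(g has_field_derivative deriv g (z + 2 * pi)) (at (z + 2 * pi))"
      using holomorphic_derivI[OF g open_hstrip zz] .
    then have "((\<lambda>z. g (z + 2 * pi)) has_field_derivative deriv g (z + 2 * pi)) (at z)"
      by (simp add: DERIV_shift)
    moreover have "((\<lambda>z. g (z + 2 * pi)) has_field_derivative deriv g z) (at z)"
      by (rule has_field_derivative_transform_within_open[OF holomorphic_derivI[OF g open_hstrip z] open_hstrip z])
         (rule per[symmetric])
    ultimately show ?thesis by (rule DERIV_unique)
  qed
  have hper: "h (z + 2 * pi) = h z" if "z \<in> hstrip \<sigma>" for z
    unfolding h_def uper using per[OF that] dper[OF that] by simp
  have gh: "g z = g (of_real x0) + h z * (u z - 1)" for z
    unfolding h_def using g1 by auto
  define T where "T m = fcoeff m h * cis (of_int m * x0)" for m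
  have ci: "continuous_on {0..2*pi} (\<lambda>x. h (of_real x))"
    by (rule continuous_on_compose2[OF holomorphic_on_imp_continuous_on[OF hhol]])
       (use \<sigma> in \<open>auto intro!: continuous_intros simp: hstrip_def\<close>)
  have int1: "integral {0..2*pi} (\<lambda>x. exp (- \<i> * of_int m * of_real x)) = (if m = 0 then of_real (2 * pi) else 0)" for m
  proof (cases "m = 0")
    case False
    have "((\<lambda>x. exp (- \<i> * of_int m * of_real x)) has_integral
       (exp (- \<i> * of_int m * of_real (2 * pi)) / (- \<i> * of_int m) - exp (- \<i> * of_int m * of_real 0) / (- \<i> * of_int m))) {0..2*pi}"
    proof (rule fundamental_theorem_of_calculus)
      fix x assume "x \<in> {0..2*pi}"
      have "((\<lambda>z. exp (- \<i> * of_int m * z) / (- \<i> * of_int m)) has_field_derivative exp (- \<i> * of_int m * of_real x)) (at (of_real x))"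
        using False by (auto intro!: derivative_eq_intros)
      note d = this
      have "((\<lambda>x. complex_of_real x) has_vector_derivative 1) (at x within {0..2*pi})"
        by (auto intro!: derivative_eq_intros)
      from field_vector_diff_chain_within[OF this has_field_derivative_at_within[OF d]]
      show "((\<lambda>x. exp (- \<i> * of_int m * of_real x) / (- \<i> * of_int m)) has_vector_derivative exp (- \<i> * of_int m * of_real x)) (at x within {0..2*pi})"
        by (simp add: o_def)
    qed simp
    moreover have "exp (- \<i> * of_int m * of_real (2 * pi)) = 1"
      using exp_periodic_int[of m 0] by simp
    ultimately show ?thesis using False by (simp add: integral_unique)
  qed (simp add: scaleR_conv_of_real)
  \<comment> \<open>Multiplication by \<open>u\<close> shifts the Fourier index by one, with the
    phase that evaluation at \<open>x0\<close> needs. Hence each term is a difference of consecutive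
    \<open>T\<close>, plus the constant \<open>g x0\<close> at m = 0.\<close>
  have step: "fcoeff m g * cis (of_int m * x0) = (if m = 0 then g (of_real x0) else 0) + (T (m - 1) - T m)" for m
  proof -
    let ?e = "\<lambda>m x. exp (- \<i> * of_int m * of_real x)"
    have e1: "u (of_real x) * ?e m x = cis (- x0) * ?e (m - 1) x" for x
      unfolding u_def cis_conv_exp exp_add[symmetric] by (simp add: algebra_simps)
    have "(\<lambda>x. g (of_real x) * ?e m x) = (\<lambda>x. g (of_real x0) * ?e m x + (cis (- x0) * (h (of_real x) * ?e (m - 1) x) - h (of_real x) * ?e m x))"
    proof
      fix x :: real
      have "g (of_real x) * ?e m x = g (of_real x0) * ?e m x + (h (of_real x) * (u (of_real x) * ?e m x) - h (of_real x) * ?e m x)"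
        by (subst gh) (simp add: algebra_simps)
      then show "g (of_real x) * ?e m x = g (of_real x0) * ?e m x + (cis (- x0) * (h (of_real x) * ?e (m - 1) x) - h (of_real x) * ?e m x)"
        unfolding e1 by (simp only: mult_ac)
    qed
    then have "integral {0..2*pi} (\<lambda>x. g (of_real x) * ?e m x)
      = integral {0..2*pi} (\<lambda>x. g (of_real x0) * ?e m x + (cis (- x0) * (h (of_real x) * ?e (m - 1) x) - h (of_real x) * ?e m x))"
      by simp
    also have "\<dots> = integral {0..2*pi} (\<lambda>x. g (of_real x0) * ?e m x) +
       (integral {0..2*pi} (\<lambda>x. cis (- x0) * (h (of_real x) * ?e (m - 1) x)) - integral {0..2*pi} (\<lambda>x. h (of_real x) * ?e m x))"
      by (subst integral_add integral_diff; (intro integrable_continuous_interval continuous_intros ci)?)+ simp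
    also have "\<dots> = g (of_real x0) * (if m = 0 then of_real (2 * pi) else 0) +
       (cis (- x0) * integral {0..2*pi} (\<lambda>x. h (of_real x) * ?e (m - 1) x) - integral {0..2*pi} (\<lambda>x. h (of_real x) * ?e m x))"
      unfolding int1[symmetric] by simp
    finally have A: "fcoeff m g = (if m = 0 then g (of_real x0) else 0) + (cis (- x0) * fcoeff (m - 1) h - fcoeff m h)"
      unfolding fcoeff_def by (simp add: field_simps)
    have B: "cis (- x0) * cis (of_int m * x0) = cis (of_int (m - 1) * x0)"
      by (simp add: cis_mult algebra_simps)
    have "fcoeff m g * cis (of_int m * x0) = (if m = 0 then g (of_real x0) else 0) * cis (of_int m * x0)
        + (fcoeff (m - 1) h * (cis (- x0) * cis (of_int m * x0)) - fcoeff m h * cis (of_int m * x0))"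
    proof -
      have "(x + (c * y - w)) * e = x * e + (y * (c * e) - w * e)" for x c y w e :: complex
        by (simp add: algebra_simps)
      then show ?thesis unfolding A .
    qed
    also have "(if m = 0 then g (of_real x0) else 0) * cis (of_int m * x0) = (if m = 0 then g (of_real x0) else 0)"
      by simp
    finally show ?thesis unfolding B T_def .
  qed
  obtain M where M: "\<And>z. \<bar>Im z\<bar> \<le> \<sigma> / 2 \<Longrightarrow> norm (h z) \<le> M"
    using periodic_strip_bounded[OF hhol hper, of "\<sigma> / 2"] \<sigma> by auto
  have Tb: "norm (T m) \<le> M * exp (- (\<sigma> / 2) * \<bar>of_int m\<bar>)" for m
    unfolding T_def norm_mult using fcoeff_bound[OF hhol hper, of "\<sigma> / 2" M m] M \<sigma> by simp
  have "(\<lambda>m. norm (T m)) summable_on UNIV"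
    by (rule Infinite_Sum.abs_summable_on_comparison_test'[OF summable_on_cmult_right[OF summable_on_exp_abs_int[of "\<sigma> / 2"]]])
       (use Tb \<sigma> in auto)
  then have "T summable_on UNIV" by (rule abs_summable_summable)
  then obtain S where S: "(T has_sum S) UNIV" by (auto simp: summable_on_def)
  \<comment> \<open>A shift of the index does not change a sum over all integers, so the differences
    sum to 0 and only \<open>g x0\<close> remains.\<close>
  have S': "((\<lambda>m. T (m - 1)) has_sum S) UNIV"
    using S has_sum_reindex_bij_betw[of "\<lambda>m::int. m - 1" UNIV UNIV T S] by (simp add: bij_betw_def inj_on_def surj_def)
  have d0: "((\<lambda>m::int. if m = 0 then g (of_real x0) else 0) has_sum g (of_real x0)) UNIV"
    using has_sum_finite_neutralI[of "{0::int}" UNIV "\<lambda>m. if m = 0 then g (of_real x0) else 0" "g (of_real x0)"] by simp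
  have "((\<lambda>m. (if m = 0 then g (of_real x0) else 0) + (T (m - 1) + - T m)) has_sum (g (of_real x0) + (S + - S))) UNIV"
    by (intro has_sum_add d0 S' has_sum_uminusI S)
  then show ?thesis unfolding step by simp
qed

section \<open>Fourier expansion in several variables\<close>

definition upd :: "'a ^ 'n \<Rightarrow> 'n \<Rightarrow> 'a \<Rightarrow> 'a ^ 'n" where
  "upd z i w = (\<chi> j. if j = i then w else z $ j)"

lemma upd_nth: "upd z i w $ j = (if j = i then w else z $ j)" by (simp add: upd_def)
lemma upd_upd [simp]: "upd (upd z i a) i b = upd z i b" by (simp add: upd_def vec_eq_iff)
lemma upd_same [simp]: "upd z i (z $ i) = z" by (simp add: upd_def vec_eq_iff)
lemma upd_commute: "i \<noteq> j \<Longrightarrow> upd (upd z i a) j b = upd (upd z j b) i a" by (auto simp: upd_def vec_eq_iff)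
lemma upd_strip: "z \<in> strip \<sigma> \<Longrightarrow> w \<in> hstrip \<sigma> \<Longrightarrow> upd z i w \<in> strip \<sigma>"
  by (simp add: strip_def hstrip_def upd_nth)
lemma strip_nth: "z \<in> strip \<sigma> \<Longrightarrow> z $ i \<in> hstrip \<sigma>"
  by (simp add: strip_def hstrip_def)

text \<open>Holomorphy in each variable separately with jointly continuous partial derivatives.
  Unlike Frechet holomorphy this passes directly through an integral in one variable, by the Leibniz
  rule, and so survives the repeated extraction of coefficients.\<close>

definition holo_c1 :: "real \<Rightarrow> (complex ^ 'n::finite \<Rightarrow> complex) \<Rightarrow> bool" where
  "holo_c1 \<sigma> f \<longleftrightarrow> continuous_on (strip \<sigma>) f \<and>
     (\<forall>z\<in>strip \<sigma>. \<forall>i. f (upd z i (z $ i + 2 * pi)) = f z) \<and>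
     (\<forall>i. \<exists>f'. continuous_on (strip \<sigma>) f' \<and>
        (\<forall>z\<in>strip \<sigma>. ((\<lambda>w. f (upd z i w)) has_field_derivative f' z) (at (z $ i))))"

definition strip_bound :: "real \<Rightarrow> real \<Rightarrow> (complex ^ 'n::finite \<Rightarrow> complex) \<Rightarrow> bool" where
  "strip_bound \<rho> M f \<longleftrightarrow> (\<forall>z. (\<forall>j. \<bar>Im (z $ j)\<bar> \<le> \<rho>) \<longrightarrow> norm (f z) \<le> M)"

definition pcoeff :: "'n \<Rightarrow> int \<Rightarrow> (complex ^ 'n::finite \<Rightarrow> complex) \<Rightarrow> complex ^ 'n \<Rightarrow> complex" where
  "pcoeff i m f z = fcoeff m (\<lambda>w. f (upd z i w))"

lemma holo_c1_slice:
  assumes f: "holo_c1 \<sigma> f" and z: "z \<in> strip \<sigma>"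
  shows "(\<lambda>w. f (upd z i w)) holomorphic_on hstrip \<sigma>"
    and "\<And>w. w \<in> hstrip \<sigma> \<Longrightarrow> f (upd z i (w + 2 * pi)) = f (upd z i w)"
proof -
  obtain f' where f': "\<And>z. z \<in> strip \<sigma> \<Longrightarrow> ((\<lambda>w. f (upd z i w)) has_field_derivative f' z) (at (z $ i))"
    using f unfolding holo_c1_def by metis
  have "(\<lambda>w. f (upd z i w)) field_differentiable (at w within hstrip \<sigma>)" if w: "w \<in> hstrip \<sigma>" for w
    using f'[OF upd_strip[OF z w, of i]]
    by (auto simp: upd_nth field_differentiable_def intro: has_field_derivative_at_within)
  then show "(\<lambda>w. f (upd z i w)) holomorphic_on hstrip \<sigma>" by (simp add: holomorphic_on_def)
  show "f (upd z i (w + 2 * pi)) = f (upd z i w)" if w: "w \<in> hstrip \<sigma>" for w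
  proof -
    have "f (upd (upd z i w) i (upd z i w $ i + 2 * pi)) = f (upd z i w)"
      using f upd_strip[OF z w, of i] unfolding holo_c1_def by blast
    then show ?thesis by (simp add: upd_nth)
  qed
qed

lemma continuous_on_upd_integrand:
  assumes "continuous_on (strip \<sigma>) (f :: complex ^ 'n::finite \<Rightarrow> complex)" "0 < \<sigma>"
  shows "continuous_on (strip \<sigma> \<times> cbox 0 (2 * pi)) (\<lambda>(z, x). f (upd z i (of_real x)) * exp (- \<i> * of_int m * of_real x))"
  unfolding case_prod_beta
proof (intro continuous_intros)
  show "continuous_on (strip \<sigma> \<times> cbox 0 (2 * pi)) (\<lambda>p. f (upd (fst p) i (of_real (snd p))))"
  proof (rule continuous_on_compose2[OF assms(1)])
    show "continuous_on (strip \<sigma> \<times> cbox 0 (2 * pi)) (\<lambda>p. upd (fst p) i (of_real (snd p) :: complex))"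
      unfolding upd_def
    proof (intro continuous_on_vec_lambda)
      fix j
      show "continuous_on (strip \<sigma> \<times> cbox 0 (2 * pi)) (\<lambda>p. if j = i then of_real (snd p) else fst p $ j :: complex)"
        by (cases "j = i") (auto intro!: continuous_intros)
    qed
  qed (auto intro!: upd_strip simp: hstrip_def assms(2))
qed

lemma continuous_on_pcoeff:
  assumes "continuous_on (strip \<sigma>) f" "0 < \<sigma>"
  shows "continuous_on (strip \<sigma>) (pcoeff i m f)"
proof -
  have "continuous_on (strip \<sigma>) (\<lambda>z. integral (cbox 0 (2 * pi)) (\<lambda>x. f (upd z i (of_real x)) * exp (- \<i> * of_int m * of_real x)))"
    by (rule integral_continuous_on_param[OF continuous_on_upd_integrand[OF assms]])
  then have "continuous_on (strip \<sigma>) (\<lambda>z. integral (cbox 0 (2 * pi)) (\<lambda>x. f (upd z i (of_real x)) * exp (- \<i> * of_int m * of_real x)) / (2 * pi))"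
    by (intro continuous_intros) auto
  then show ?thesis unfolding pcoeff_def[abs_def] fcoeff_def cbox_interval .
qed

text \<open>The coefficient is constant in coordinate \<open>i\<close>; in every other coordinate it
  is differentiated under the integral, with the coefficient of the partial derivative as
  result.\<close>

lemma holo_c1_pcoeff:
  fixes f :: "complex ^ 'n::finite \<Rightarrow> complex"
  assumes f: "holo_c1 \<sigma> f" and \<sigma>: "0 < \<sigma>"
  shows "holo_c1 \<sigma> (pcoeff i m f)"
  unfolding holo_c1_def
proof (intro conjI ballI allI)
  have contf: "continuous_on (strip \<sigma>) f" using f by (simp add: holo_c1_def)
  show "continuous_on (strip \<sigma>) (pcoeff i m f)" by (rule continuous_on_pcoeff[OF contf \<sigma>])
  have rs: "of_real x \<in> hstrip \<sigma>" for x using \<sigma> by (simp add: hstrip_def)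
  show "pcoeff i m f (upd z j (z $ j + 2 * pi)) = pcoeff i m f z" if z: "z \<in> strip \<sigma>" for z j
  proof (cases "j = i")
    case False
    have "f (upd (upd z j (z $ j + 2 * pi)) i (of_real x)) = f (upd z i (of_real x))" for x
    proof -
      have "upd z i (of_real x) \<in> strip \<sigma>" by (rule upd_strip[OF z rs])
      then have "f (upd (upd z i (of_real x)) j (upd z i (of_real x) $ j + 2 * pi)) = f (upd z i (of_real x))"
        using f unfolding holo_c1_def by blast
      then show ?thesis using False by (simp add: upd_nth upd_commute[OF False])
    qed
    then show ?thesis by (simp add: pcoeff_def fcoeff_def)
  qed (simp add: pcoeff_def)
  fix j
  show "\<exists>f'. continuous_on (strip \<sigma>) f' \<and>
        (\<forall>z\<in>strip \<sigma>. ((\<lambda>w. pcoeff i m f (upd z j w)) has_field_derivative f' z) (at (z $ j)))"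
  proof (cases "j = i")
    case True
    then show ?thesis by (intro exI[of _ "\<lambda>_. 0"]) (simp add: pcoeff_def)
  next
    case False
    obtain f' where cf': "continuous_on (strip \<sigma>) f'"
      and f': "\<And>z. z \<in> strip \<sigma> \<Longrightarrow> ((\<lambda>w. f (upd z j w)) has_field_derivative f' z) (at (z $ j))"
      using f unfolding holo_c1_def by metis
    have "((\<lambda>w. pcoeff i m f (upd z j w)) has_field_derivative pcoeff i m f' z) (at (z $ j))" if z: "z \<in> strip \<sigma>" for z
    proof -
      let ?e = "\<lambda>x. exp (- \<i> * of_int m * complex_of_real x)"
      have "((\<lambda>w. integral (cbox 0 (2 * pi)) (\<lambda>x. f (upd (upd z j w) i (of_real x)) * ?e x)) has_field_derivative
         integral (cbox 0 (2 * pi)) (\<lambda>x. f' (upd (upd z j (z $ j)) i (of_real x)) * ?e x)) (at (z $ j) within hstrip \<sigma>)"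
      proof (rule leibniz_rule_field_derivative)
        fix w x assume w: "w \<in> hstrip \<sigma>"
        have "((\<lambda>w. f (upd (upd z i (of_real x)) j w)) has_field_derivative f' (upd (upd z i (of_real x)) j w)) (at w)"
          using f'[OF upd_strip[OF upd_strip[OF z rs] w], of i x j] by (simp add: upd_nth)
        then have "((\<lambda>w. f (upd (upd z j w) i (of_real x))) has_field_derivative f' (upd (upd z j w) i (of_real x))) (at w)"
          by (simp add: upd_commute[OF False])
        then show "((\<lambda>w. f (upd (upd z j w) i (of_real x)) * ?e x) has_field_derivative f' (upd (upd z j w) i (of_real x)) * ?e x) (at w within hstrip \<sigma>)"
          by (rule DERIV_cmult_right[OF has_field_derivative_at_within])
      next
        fix w assume w: "w \<in> hstrip \<sigma>"
        show "(\<lambda>x. f (upd (upd z j w) i (of_real x)) * ?e x) integrable_on cbox 0 (2 * pi)"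
          by (rule integrable_continuous, rule continuous_on_compose2[OF continuous_on_upd_integrand[OF contf \<sigma>, of i m], of _ "\<lambda>x. (upd z j w, x)", unfolded case_prod_conv])
             (auto intro!: continuous_intros upd_strip z w)
      next
        have "continuous_on (hstrip \<sigma> \<times> cbox 0 (2 * pi)) (\<lambda>p. upd z j (fst p))"
          unfolding upd_def
        proof (intro continuous_on_vec_lambda)
          fix k
          show "continuous_on (hstrip \<sigma> \<times> cbox 0 (2 * pi)) (\<lambda>p. if k = j then fst p else z $ k)"
            by (cases "k = j") (auto intro!: continuous_intros)
        qed
        then have "continuous_on (hstrip \<sigma> \<times> cbox 0 (2 * pi)) (\<lambda>p. (upd z j (fst p), snd p))"
          by (intro continuous_intros)
        moreover have "(\<lambda>p. (upd z j (fst p), snd p)) ` (hstrip \<sigma> \<times> cbox 0 (2 * pi)) \<subseteq> strip \<sigma> \<times> cbox 0 (2 * pi)"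
          using upd_strip[OF z] by auto
        ultimately have "continuous_on (hstrip \<sigma> \<times> cbox 0 (2 * pi)) (\<lambda>p. case (upd z j (fst p), snd p) of (z, x) \<Rightarrow> f' (upd z i (of_real x)) * ?e x)"
          by (rule continuous_on_compose2[OF continuous_on_upd_integrand[OF cf' \<sigma>, of i m]])
        then show "continuous_on (hstrip \<sigma> \<times> cbox 0 (2 * pi)) (\<lambda>(w, x). f' (upd (upd z j w) i (of_real x)) * ?e x)"
          by (simp only: case_prod_unfold fst_conv snd_conv)
      qed (use strip_nth[OF z] convex_hstrip in auto)
      then have "((\<lambda>w. integral (cbox 0 (2 * pi)) (\<lambda>x. f (upd (upd z j w) i (of_real x)) * ?e x)) has_field_derivative
         integral (cbox 0 (2 * pi)) (\<lambda>x. f' (upd z i (of_real x)) * ?e x)) (at (z $ j))"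
        using at_within_open[OF strip_nth[OF z, of j] open_hstrip] by simp
      from DERIV_cdivide[OF this, of "2 * pi"] show ?thesis
        unfolding pcoeff_def fcoeff_def cbox_interval .
    qed
    then show ?thesis using continuous_on_pcoeff[OF cf' \<sigma>, of i m] by blast
  qed
qed

lemma strip_bound_pcoeff:
  fixes f :: "complex ^ 'n::finite \<Rightarrow> complex"
  assumes f: "holo_c1 \<sigma> f" and \<rho>: "0 \<le> \<rho>" "\<rho> < \<sigma>" and M: "strip_bound \<rho> M f"
  shows "strip_bound \<rho> (M * exp (- \<rho> * \<bar>of_int m\<bar>)) (pcoeff i m f)"
  unfolding strip_bound_def pcoeff_def
proof (intro allI impI)
  fix z :: "complex ^ 'n" assume z: "\<forall>j. \<bar>Im (z $ j)\<bar> \<le> \<rho>"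
  then have zs: "z \<in> strip \<sigma>" using \<rho> by (auto simp: strip_def intro: le_less_trans)
  show "norm (fcoeff m (\<lambda>w. f (upd z i w))) \<le> M * exp (- \<rho> * \<bar>of_int m\<bar>)"
  proof (rule fcoeff_bound[OF holo_c1_slice[OF f zs] \<rho>])
    fix w :: complex assume "\<bar>Im w\<bar> \<le> \<rho>"
    then show "norm (f (upd z i w)) \<le> M" using M z unfolding strip_bound_def by (auto simp: upd_nth)
  qed
qed

text \<open>Taking real parts is harmless: in the expansion below, \<open>k\<close> vanishes on the
  coordinates not yet expanded, or its coefficient does, and the expanded coordinates are
  real.\<close>

definition ekz :: "('n::finite \<Rightarrow> int) \<Rightarrow> complex ^ 'n \<Rightarrow> complex" where
  "ekz k z = cis (\<Sum>j\<in>UNIV. of_int (k j) * Re (z $ j))"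

lemma summable_exp_knorm:
  assumes "0 < \<rho>"
  shows "(\<lambda>k::'n::finite \<Rightarrow> int. exp (- \<rho> * knorm k)) summable_on UNIV"
proof (rule nonneg_bdd_above_summable_on)
  show "bdd_above (sum (\<lambda>k::'n \<Rightarrow> int. exp (- \<rho> * knorm k)) ` {F. F \<subseteq> UNIV \<and> finite F})"
    using sum_exp_knorm_le[OF assms] by (intro bdd_aboveI2) auto
qed simp

lemma sum_fun_upd:
  fixes k :: "'n::finite \<Rightarrow> int" and c :: "'n \<Rightarrow> int \<Rightarrow> real"
  shows "(\<Sum>j\<in>UNIV. c j ((k(i := m)) j)) = (\<Sum>j\<in>UNIV - {i}. c j (k j)) + c i m"
  by (subst sum.remove[of UNIV i]) (auto intro!: sum.cong)

text \<open>Induction on the set \<open>I\<close> of coordinates already expanded: the coefficients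
  are functions of the remaining coordinates and vanish unless \<open>k\<close> is supported in
  \<open>I\<close>. The decay in the l^1 norm builds up as a product of one-dimensional decays. Once
  \<open>I\<close> is everything the coefficients are numbers.\<close>

lemma multi_fourier:
  fixes f :: "complex ^ 'n::finite \<Rightarrow> complex"
  assumes \<rho>: "0 < \<rho>" "\<rho> < \<sigma>" and f: "holo_c1 \<sigma> f" and M: "strip_bound \<rho> M f" and I: "finite I"
  shows "\<exists>a :: ('n \<Rightarrow> int) \<Rightarrow> complex ^ 'n \<Rightarrow> complex.
    (\<forall>k. holo_c1 \<sigma> (a k) \<and> strip_bound \<rho> (M * exp (- \<rho> * knorm k)) (a k)) \<and>
    (\<forall>k j. j \<notin> I \<longrightarrow> k j \<noteq> 0 \<longrightarrow> a k = (\<lambda>_. 0)) \<and>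
    (\<forall>k z w. (\<forall>j. j \<notin> I \<longrightarrow> z $ j = w $ j) \<longrightarrow> a k z = a k w) \<and>
    (\<forall>z\<in>strip \<sigma>. (\<forall>j. \<bar>Im (z $ j)\<bar> \<le> \<rho>) \<longrightarrow> (\<forall>j\<in>I. Im (z $ j) = 0) \<longrightarrow> ((\<lambda>k. a k z * ekz k z) has_sum f z) UNIV)"
  using I
proof (induction I rule: finite_induct)
  case empty
  have \<sigma>: "0 < \<sigma>" using \<rho> by simp
  have z0: "holo_c1 \<sigma> (\<lambda>_. 0 :: complex)" for \<sigma> unfolding holo_c1_def
    by (intro conjI allI ballI exI[of _ "\<lambda>_. 0"]) auto
  let ?a = "\<lambda>k::'n \<Rightarrow> int. if k = (\<lambda>_. 0) then f else (\<lambda>_. 0)"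
  have 0: "M \<ge> 0" using M norm_ge_zero order_trans unfolding strip_bound_def
    by (metis Im_complex_of_real abs_zero less_imp_le \<rho>(1) zero_index zero_complex.sel(2))
  have "holo_c1 \<sigma> (?a k) \<and> strip_bound \<rho> (M * exp (- \<rho> * knorm k)) (?a k)" for k
    using f M 0 z0 by (auto simp: strip_bound_def)
  moreover have "((\<lambda>k. ?a k z * ekz k z) has_sum f z) UNIV" for z
    by (rule has_sum_finite_neutralI[of "{\<lambda>_. 0}"]) (auto simp: ekz_def)
  ultimately show ?case by (intro exI[of _ ?a]) (auto simp: vec_eq_iff[symmetric])
next
  case (insert i I)
  then obtain a where a1: "\<And>k. holo_c1 \<sigma> (a k)" "\<And>k. strip_bound \<rho> (M * exp (- \<rho> * knorm k)) (a k)"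
    and a2: "\<And>k j. j \<notin> I \<Longrightarrow> k j \<noteq> 0 \<Longrightarrow> a k = (\<lambda>_. 0)"
    and a3: "\<And>k z w. (\<forall>j. j \<notin> I \<longrightarrow> z $ j = w $ j) \<Longrightarrow> a k z = a k w"
    and a4: "\<And>z. z \<in> strip \<sigma> \<Longrightarrow> (\<forall>j. \<bar>Im (z $ j)\<bar> \<le> \<rho>) \<Longrightarrow> (\<forall>j\<in>I. Im (z $ j) = 0) \<Longrightarrow> ((\<lambda>k. a k z * ekz k z) has_sum f z) UNIV"
    by blast
  have \<sigma>: "0 < \<sigma>" using \<rho> by simp
  \<comment> \<open>The old coefficient belongs to \<open>k\<close> with its \<open>i\<close>-th
    component set to 0; expanding it in coordinate \<open>i\<close> restores that component.\<close>
  define b where "b k = pcoeff i (k i) (a (k(i := 0)))" for k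
  have kn: "knorm k = knorm (k(i := 0)) + \<bar>of_int (k i)\<bar>" for k :: "'n \<Rightarrow> int"
    using sum_fun_upd[of "\<lambda>j m. \<bar>of_int m\<bar>" k i 0] sum_fun_upd[of "\<lambda>j m. \<bar>of_int m\<bar>" k i "k i"] by (simp add: knorm_def)
  have b1: "holo_c1 \<sigma> (b k)" for k unfolding b_def by (rule holo_c1_pcoeff[OF a1(1) \<sigma>])
  have b1': "strip_bound \<rho> (M * exp (- \<rho> * knorm k)) (b k)" for k
  proof -
    have "strip_bound \<rho> (M * exp (- \<rho> * knorm (k(i := 0))) * exp (- \<rho> * \<bar>of_int (k i)\<bar>)) (b k)"
      unfolding b_def using \<rho> by (intro strip_bound_pcoeff[OF a1(1) _ _ a1(2)]) auto
    moreover have "M * exp (- \<rho> * knorm (k(i := 0))) * exp (- \<rho> * \<bar>of_int (k i)\<bar>) = M * exp (- \<rho> * knorm k)"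
      unfolding kn[of k] by (simp only: mult.assoc exp_add[symmetric] distrib_left)
    ultimately show ?thesis by (simp only:)
  qed
  have b2: "b k = (\<lambda>_. 0)" if "j \<notin> insert i I" "k j \<noteq> 0" for k j
    using a2[of j "k(i := 0)"] that by (auto simp: b_def pcoeff_def fcoeff_def)
  have b3: "b k z = b k w" if "\<forall>j. j \<notin> insert i I \<longrightarrow> z $ j = w $ j" for k z w
  proof -
    have "a (k(i := 0)) (upd z i x) = a (k(i := 0)) (upd w i x)" for x
      using that by (intro a3) (auto simp: upd_nth)
    then show ?thesis by (simp add: b_def pcoeff_def)
  qed
  have b4: "((\<lambda>k. b k z * ekz k z) has_sum f z) UNIV"
    if z: "z \<in> strip \<sigma>" "\<forall>j. \<bar>Im (z $ j)\<bar> \<le> \<rho>" "\<forall>j\<in>insert i I. Im (z $ j) = 0" for z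
  proof -
    define S0 where "S0 = {k :: 'n \<Rightarrow> int. k i = 0}"
    define F where "F p = b ((fst p)(i := snd p)) z * ekz ((fst p)(i := snd p)) z" for p :: "('n \<Rightarrow> int) \<times> int"
    have "((\<lambda>k. a k z * ekz k z) has_sum f z) UNIV" using a4 z by auto
    moreover have "a k z * ekz k z = 0" if "k \<notin> S0" for k
      using a2[OF insert.hyps(2), of k] that by (simp add: S0_def)
    ultimately have s0: "((\<lambda>k. a k z * ekz k z) has_sum f z) S0"
      by (subst has_sum_cong_neutral[where T = UNIV and g = "\<lambda>k. a k z * ekz k z"]) auto
    \<comment> \<open>Splits a wave vector into its part off \<open>i\<close> and its
      \<open>i\<close>-th component, so that the new sum is an iterated one with inner sums given by
      \<open>fourier_has_sum\<close>.\<close>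
    have bij: "bij_betw (\<lambda>p. (fst p)(i := snd p)) (S0 \<times> UNIV) UNIV"
      by (rule bij_betwI[where g = "\<lambda>k. (k(i := 0), k i)"]) (auto simp: S0_def fun_eq_iff)
    have inner: "((\<lambda>m. F (k, m)) has_sum a k z * ekz k z) UNIV" if k: "k \<in> S0" for k
    proof -
      have "((\<lambda>m. fcoeff m (\<lambda>w. a k (upd z i w)) * cis (of_int m * Re (z $ i))) has_sum a k (upd z i (of_real (Re (z $ i))))) UNIV"
        by (rule fourier_has_sum[OF holo_c1_slice[OF a1(1) z(1)] \<sigma>])
      moreover have "upd z i (of_real (Re (z $ i))) = z"
      proof -
        have "of_real (Re (z $ i)) = z $ i" using z(3) by (simp add: complex_eq_iff)
        then show ?thesis by simp
      qed
      ultimately have "((\<lambda>m. fcoeff m (\<lambda>w. a k (upd z i w)) * cis (of_int m * Re (z $ i)) * ekz k z) has_sum a k z * ekz k z) UNIV"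
        by (intro has_sum_cmult_left) simp
      moreover have "fcoeff m (\<lambda>w. a k (upd z i w)) * cis (of_int m * Re (z $ i)) * ekz k z = F (k, m)" for m
      proof -
        have ki: "k(i := 0) = k" using k by (auto simp: S0_def)
        have "ekz (k(i := m)) z = cis (of_int m * Re (z $ i)) * ekz k z"
          using sum_fun_upd[of "\<lambda>j m. of_int m * Re (z $ j)" k i m] sum_fun_upd[of "\<lambda>j m. of_int m * Re (z $ j)" k i 0]
          unfolding ekz_def cis_mult ki by (simp add: add.commute)
        then show ?thesis unfolding F_def b_def pcoeff_def using ki by simp
      qed
      ultimately show ?thesis by simp
    qed
    have bb: "norm (b k z * ekz k z) \<le> M * exp (- \<rho> * knorm k)" for k
      using b1'[of k] z(2) by (simp add: strip_bound_def norm_mult ekz_def)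
    have "(\<lambda>k. norm (b k z * ekz k z)) summable_on UNIV"
      by (rule Infinite_Sum.abs_summable_on_comparison_test'[OF summable_on_cmult_right[OF summable_exp_knorm[OF \<rho>(1)]]])
         (use bb in auto)
    then have "(\<lambda>k. b k z * ekz k z) summable_on UNIV" by (rule abs_summable_summable)
    then have Fs: "F summable_on S0 \<times> UNIV"
      unfolding F_def using summable_on_reindex_bij_betw[OF bij, of "\<lambda>k. b k z * ekz k z"] by simp
    have "(F has_sum f z) (S0 \<times> UNIV)"
      by (rule has_sum_SigmaI[OF inner s0 Fs])
    then show ?thesis
      unfolding F_def using has_sum_reindex_bij_betw[OF bij, of "\<lambda>k. b k z * ekz k z"] by simp
  qed
  show ?case
  proof (rule exI[of _ b], intro conjI allI impI ballI)
    fix k :: "'n \<Rightarrow> int"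
    show "holo_c1 \<sigma> (b k)" by (rule b1)
    show "strip_bound \<rho> (M * exp (- \<rho> * knorm k)) (b k)" by (rule b1')
  next
    fix k :: "'n \<Rightarrow> int" and j assume "j \<notin> insert i I" "k j \<noteq> 0" then show "b k = (\<lambda>_. 0)" by (rule b2)
  next
    fix k :: "'n \<Rightarrow> int" and z w :: "complex ^ 'n" assume "\<forall>j. j \<notin> insert i I \<longrightarrow> z $ j = w $ j" then show "b k z = b k w" by (rule b3)
  next
    fix z assume "z \<in> strip \<sigma>" "\<forall>j. \<bar>Im (z $ j)\<bar> \<le> \<rho>" "\<forall>j\<in>insert i I. Im (z $ j) = 0"
    then show "((\<lambda>k. b k z * ekz k z) has_sum f z) UNIV" by (rule b4)
  qed
qed

lemma torus_periodic_int:
  fixes f :: "complex ^ 'n::finite \<Rightarrow> complex"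
  assumes "torus_periodic f"
  shows "f (z + (\<chi> j. of_real (2 * pi * of_int (k j)))) = f z"
proof -
  define e where "e i = ((\<chi> j. if j = i then complex_of_real (2 * pi) else 0) :: complex ^ 'n)" for i
  have e1: "f (z + e i) = f z" for z i using assms by (simp add: torus_periodic_def e_def)
  have en: "f (z + of_nat n *s e i) = f z" for z i n
  proof (induction n arbitrary: z)
    case (Suc n)
    have eq: "z + of_nat (Suc n) *s e i = (z + of_nat n *s e i) + e i" by (simp add: vec_eq_iff algebra_simps)
    show ?case unfolding eq e1 by (rule Suc)
  qed simp
  have ei: "f (z + of_int m *s e i) = f z" for z i m
  proof (cases "0 \<le> m")
    case True
    then show ?thesis using en[of z "nat m" i] by simp
  next
    case False
    have eq: "(z + of_int m *s e i) + of_nat (nat (- m)) *s e i = z"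
      using False by (simp add: vec_eq_iff)
    show ?thesis using en[of "z + of_int m *s e i" "nat (- m)" i] unfolding eq by (rule sym)
  qed
  have "f (z + (\<Sum>i\<in>I. of_int (k i) *s e i)) = f z" if "finite I" for I
    using that
  proof (induction I rule: finite_induct)
    case (insert i I)
    then have eq: "z + (\<Sum>i\<in>insert i I. of_int (k i) *s e i) = (z + (\<Sum>i\<in>I. of_int (k i) *s e i)) + of_int (k i) *s e i"
      by (simp add: add.commute add.left_commute)
    show ?case unfolding eq ei by (rule insert.IH)
  qed simp
  moreover have "(\<Sum>i\<in>UNIV. of_int (k i) *s e i) = (\<chi> j. of_real (2 * pi * of_int (k j)))"
  proof -
    have "(\<Sum>i\<in>UNIV. of_int (k i) *s e i) $ j = of_real (2 * pi * of_int (k j))" for j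
    proof -
      have "(\<Sum>i\<in>UNIV. of_int (k i) *s e i) $ j = (\<Sum>i\<in>UNIV. if i = j then of_real (2 * pi * of_int (k i)) else 0)"
        unfolding sum_component by (intro sum.cong) (auto simp: e_def)
      then show ?thesis by simp
    qed
    then show ?thesis by (simp add: vec_eq_iff)
  qed
  ultimately show ?thesis using finite[of UNIV] by metis
qed

lemma torus_periodic_strip_bound:
  fixes f :: "complex ^ 'n::finite \<Rightarrow> complex"
  assumes per: "torus_periodic f" and cont: "continuous_on (strip \<sigma>) f" and \<rho>: "0 \<le> \<rho>" "\<rho> < \<sigma>"
  shows "\<exists>M. strip_bound \<rho> M f"
proof -
  define K where "K = {z :: complex ^ 'n. \<forall>j. 0 \<le> Re (z $ j) \<and> Re (z $ j) \<le> 2 * pi \<and> \<bar>Im (z $ j)\<bar> \<le> \<rho>}"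
  have "closed K" unfolding K_def
    by (intro closed_Collect_all closed_Collect_conj closed_Collect_le continuous_intros)
  moreover have "bounded K"
  proof (rule boundedI)
    fix z assume z: "z \<in> K"
    have "norm z \<le> (\<Sum>j\<in>UNIV. norm (z $ j))" unfolding norm_vec_def by (rule L2_set_le_sum) simp
    also have "\<dots> \<le> (\<Sum>j\<in>(UNIV::'n set). 2 * pi + \<rho>)"
    proof (rule sum_mono)
      fix j
      have "norm (z $ j) \<le> \<bar>Re (z $ j)\<bar> + \<bar>Im (z $ j)\<bar>" by (rule cmod_le)
      also have "\<dots> \<le> 2 * pi + \<rho>" using z unfolding K_def by (intro add_mono) auto
      finally show "norm (z $ j) \<le> 2 * pi + \<rho>" .
    qed
    finally show "norm z \<le> (\<Sum>j\<in>(UNIV::'n set). 2 * pi + \<rho>)" .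
  qed
  ultimately have "compact K" by (simp add: compact_eq_bounded_closed)
  moreover have "K \<subseteq> strip \<sigma>" using \<rho> by (auto simp: K_def strip_def intro: le_less_trans)
  ultimately have "bounded (f ` K)"
    by (intro compact_imp_bounded compact_continuous_image continuous_on_subset[OF cont])
  then obtain M where M: "\<And>z. z \<in> K \<Longrightarrow> norm (f z) \<le> M" unfolding bounded_iff by auto
  have "norm (f z) \<le> M" if z: "\<forall>j. \<bar>Im (z $ j)\<bar> \<le> \<rho>" for z
  proof -
    define k where "k j = - \<lfloor>Re (z $ j) / (2 * pi)\<rfloor>" for j
    define v where "v = z + (\<chi> j. of_real (2 * pi * of_int (k j)))"
    have "0 \<le> Re (z $ j) + 2 * pi * of_int (k j) \<and> Re (z $ j) + 2 * pi * of_int (k j) \<le> 2 * pi" for j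
    proof -
      define r where "r = real_of_int \<lfloor>Re (z $ j) / (2 * pi)\<rfloor>"
      have p: "0 < 2 * pi" by simp
      have "r \<le> Re (z $ j) / (2 * pi)" "Re (z $ j) / (2 * pi) \<le> r + 1" unfolding r_def by linarith+
      then have "r * (2 * pi) \<le> Re (z $ j)" "Re (z $ j) \<le> (r + 1) * (2 * pi)"
        using pos_le_divide_eq[OF p] pos_divide_le_eq[OF p] by blast+
      moreover have "real_of_int (k j) = - r" by (simp add: k_def r_def)
      ultimately show ?thesis by (simp add: algebra_simps)
    qed
    then have "v \<in> K" using z by (simp add: K_def v_def)
    from M[OF this] show ?thesis unfolding v_def torus_periodic_int[OF per] .
  qed
  then show ?thesis unfolding strip_bound_def by blast
qed

lemma upd_eq_add:
  fixes z :: "complex ^ 'n::finite"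
  shows "upd z i w = z + axis i (w - z $ i)"
  by (simp add: upd_def axis_def vec_eq_iff)

lemma dist_upd: "dist (upd z i (z $ i + w)) (z :: complex ^ 'n::finite) = norm w"
  by (simp add: upd_eq_add dist_norm norm_eq_sqrt_inner inner_axis_axis)

text \<open>Continuity of the partial derivatives is the issue. The Cauchy inequality on a small
  disc bounds the difference of two partial derivatives by the difference of the two slices, which
  is small by uniform continuity of \<open>f\<close>.\<close>

lemma holo_on_imp_holo_c1:
  fixes f :: "complex ^ 'n::finite \<Rightarrow> complex"
  assumes f: "holo_on f (strip \<sigma>)" and per: "torus_periodic f"
  shows "holo_c1 \<sigma> f"
proof -
  have op: "open (strip \<sigma> :: (complex ^ 'n) set)" using f by (simp add: holo_on_def)
  obtain c where c: "\<And>z. z \<in> strip \<sigma> \<Longrightarrow> (f has_derivative (\<lambda>h. \<Sum>i\<in>UNIV. c z $ i * h $ i)) (at z)"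
    using f unfolding holo_on_def by metis
  have cont: "continuous_on (strip \<sigma>) f"
    using c by (intro continuous_at_imp_continuous_on ballI) (rule has_derivative_continuous)
  have der: "((\<lambda>w. f (upd z i w)) has_field_derivative c z $ i) (at (z $ i))" if z: "z \<in> strip \<sigma>" for z i
  proof -
    have bl: "bounded_linear (\<lambda>w. axis i w :: complex ^ 'n)"
      unfolding linear_conv_bounded_linear[symmetric] by (rule linearI) (auto simp: axis_def vec_eq_iff)
    have "((\<lambda>w. z + axis i (w - z $ i)) has_derivative (\<lambda>h. axis i h)) (at (z $ i))"
      by (auto intro!: derivative_eq_intros bounded_linear.has_derivative[OF bl])
    then have u: "((\<lambda>w. upd z i w) has_derivative (\<lambda>h. axis i h)) (at (z $ i))" by (simp add: upd_eq_add)
    have "((\<lambda>w. f (upd z i w)) has_derivative (\<lambda>h. \<Sum>j\<in>UNIV. c z $ j * axis i h $ j)) (at (z $ i))"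
      using has_derivative_compose[OF u, of f "\<lambda>h. \<Sum>j\<in>UNIV. c z $ j * h $ j"] c[OF z] by simp
    moreover have "(\<Sum>j\<in>UNIV. c z $ j * axis i h $ j) = c z $ i * h" for h
    proof -
      have "(\<Sum>j\<in>UNIV. c z $ j * axis i h $ j) = (\<Sum>j\<in>UNIV. if j = i then c z $ i * h else 0)"
        by (intro sum.cong) (auto simp: axis_def)
      then show ?thesis by simp
    qed
    ultimately show ?thesis unfolding has_field_derivative_def by simp
  qed
  have "continuous_on (strip \<sigma>) (\<lambda>z. c z $ i)" for i
  proof (rule continuous_at_imp_continuous_on, rule ballI)
    fix z0 :: "complex ^ 'n" assume z0: "z0 \<in> strip \<sigma>"
    obtain r0 where r0: "0 < r0" "cball z0 r0 \<subseteq> strip \<sigma>" using op z0 open_contains_cball by blast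
    define r where "r = r0 / 2"
    have r: "0 < r" "cball z0 (2 * r) \<subseteq> strip \<sigma>" using r0 by (auto simp: r_def)
    have "uniformly_continuous_on (cball z0 (2 * r)) f"
      by (intro compact_uniformly_continuous continuous_on_subset[OF cont r(2)] compact_cball)
    show "isCont (\<lambda>z. c z $ i) z0"
      unfolding continuous_at_eps_delta
    proof (intro allI impI)
      fix e :: real assume e: "0 < e"
      then have "0 < e / 2 * r" using r by simp
      then obtain d where d: "0 < d" "\<And>x y. x \<in> cball z0 (2 * r) \<Longrightarrow> y \<in> cball z0 (2 * r) \<Longrightarrow> dist y x < d \<Longrightarrow> dist (f y) (f x) < e / 2 * r"
        using \<open>uniformly_continuous_on (cball z0 (2 * r)) f\<close> unfolding uniformly_continuous_on_def by metis
      show "\<exists>d>0. \<forall>z. dist z z0 < d \<longrightarrow> dist (c z $ i) (c z0 $ i) < e"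
      proof (intro exI[of _ "min d r"] conjI allI impI)
        show "0 < min d r" using d r by simp
        fix z assume z: "dist z z0 < min d r"
        \<comment> \<open>Difference of the slices through \<open>z\<close> and \<open>z0\<close>,
          parametrised from a common origin; its derivative at 0 is the difference to be
          estimated.\<close>
        define \<phi> where "\<phi> w = f (upd z i (z $ i + w)) - f (upd z0 i (z0 $ i + w))" for w
        have in1: "upd z i (z $ i + w) \<in> cball z0 (2 * r)" "upd z0 i (z0 $ i + w) \<in> cball z0 (2 * r)" if "norm w \<le> r" for w
        proof -
          have "dist (upd z i (z $ i + w)) z0 \<le> dist (upd z i (z $ i + w)) z + dist z z0" by (rule dist_triangle)
          then have "dist (upd z i (z $ i + w)) z0 \<le> 2 * r" using z that by (simp add: dist_upd)
          then show "upd z i (z $ i + w) \<in> cball z0 (2 * r)" by (simp only: mem_cball dist_commute)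
          show "upd z0 i (z0 $ i + w) \<in> cball z0 (2 * r)"
            using that r(1) dist_upd[of z0 i w] by (simp add: mem_cball dist_commute)
        qed
        have zz: "z \<in> strip \<sigma>" using in1(1)[of 0] r by auto
        have d1: "(\<phi> has_field_derivative c (upd z i (z $ i + w)) $ i - c (upd z0 i (z0 $ i + w)) $ i) (at w)" if w: "norm w \<le> r" for w
        proof -
          have "((\<lambda>v. f (upd z i v)) has_field_derivative c (upd z i (z $ i + w)) $ i) (at (w + z $ i))"
            using der[OF subsetD[OF r(2) in1(1)[OF w]], of i] by (simp add: upd_nth add.commute)
          then have 1: "((\<lambda>v. f (upd z i (v + z $ i))) has_field_derivative c (upd z i (z $ i + w)) $ i) (at w)"
            unfolding DERIV_shift .
          have "((\<lambda>v. f (upd z0 i v)) has_field_derivative c (upd z0 i (z0 $ i + w)) $ i) (at (w + z0 $ i))"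
            using der[OF subsetD[OF r(2) in1(2)[OF w]], of i] by (simp add: upd_nth add.commute)
          then have 2: "((\<lambda>v. f (upd z0 i (v + z0 $ i))) has_field_derivative c (upd z0 i (z0 $ i + w)) $ i) (at w)"
            unfolding DERIV_shift .
          show ?thesis using DERIV_diff[OF 1 2] unfolding \<phi>_def by (simp add: add.commute)
        qed
        have "norm ((deriv ^^ 1) \<phi> 0) \<le> fact 1 * (e / 2 * r) / r ^ 1"
        proof (rule Cauchy_inequality)
          show "\<phi> holomorphic_on ball 0 r"
            unfolding holomorphic_on_def field_differentiable_def
          proof (intro ballI exI)
            fix w :: complex assume "w \<in> ball 0 r"
            then have "norm w \<le> r" by simp
            then show "(\<phi> has_field_derivative c (upd z i (z $ i + w)) $ i - c (upd z0 i (z0 $ i + w)) $ i) (at w within ball 0 r)"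
              by (rule has_field_derivative_at_within[OF d1])
          qed
          show "continuous_on (cball 0 r) \<phi>"
            using d1 by (intro continuous_at_imp_continuous_on ballI) (auto intro: DERIV_isCont)
          fix w :: complex assume "norm (0 - w) = r"
          then have w: "norm w \<le> r" by simp
          have "upd z i (z $ i + w) - upd z0 i (z0 $ i + w) = z - z0" by (simp add: upd_eq_add)
          then have "dist (upd z i (z $ i + w)) (upd z0 i (z0 $ i + w)) < d" using z by (simp add: dist_norm)
          from d(2)[OF in1(2)[OF w] in1(1)[OF w] this]
          show "norm (\<phi> w) \<le> e / 2 * r" by (simp add: \<phi>_def dist_norm)
        qed (use r in auto)
        moreover have "deriv \<phi> 0 = c z $ i - c z0 $ i"
          using DERIV_imp_deriv[OF d1[of 0]] r by simp
        ultimately show "dist (c z $ i) (c z0 $ i) < e" using r e by (simp add: dist_norm)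
      qed
    qed
  qed
  moreover have "f (upd z i (z $ i + 2 * pi)) = f z" for z i
  proof -
    have "upd z i (z $ i + 2 * pi) = z + (\<chi> j. if j = i then complex_of_real (2 * pi) else 0)"
      by (simp add: upd_def vec_eq_iff)
    then show ?thesis using per unfolding torus_periodic_def by simp
  qed
  ultimately show ?thesis unfolding holo_c1_def using cont der by blast
qed

text \<open>The coefficients decay at rate \<sigma>/2; half of this is kept as width \<sigma>/4 and
  the other half makes the weighted sum converge. They do not depend on \<omega>, so one bound
  serves every parameter set.\<close>

theorem qp_of_holo_on:
  fixes f :: "complex ^ 'n::finite \<Rightarrow> complex"
  assumes \<sigma>: "0 < \<sigma>" and f: "holo_on f (strip \<sigma>)" and per: "torus_periodic f"
  shows "\<exists>M. \<forall>E. qp E (\<sigma> / 4) M (\<lambda>\<omega> t. f (cvec (t *\<^sub>R \<omega>)))"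
proof -
  have c1: "holo_c1 \<sigma> f" by (rule holo_on_imp_holo_c1[OF f per])
  define \<rho> where "\<rho> = \<sigma> / 2"
  have \<rho>: "0 < \<rho>" "\<rho> < \<sigma>" using \<sigma> by (auto simp: \<rho>_def)
  obtain M where M: "strip_bound \<rho> M f"
    using torus_periodic_strip_bound[OF per _ _ \<rho>(2)] c1 \<rho> unfolding holo_c1_def by auto
  obtain a where a1: "\<And>k. strip_bound \<rho> (M * exp (- \<rho> * knorm k)) (a k)"
    and a3: "\<And>k z w. a k z = a k w"
    and a4: "\<And>z. z \<in> strip \<sigma> \<Longrightarrow> (\<forall>j. \<bar>Im (z $ j)\<bar> \<le> \<rho>) \<Longrightarrow> (\<forall>j. Im (z $ j) = 0) \<Longrightarrow> ((\<lambda>k. a k z * ekz k z) has_sum f z) UNIV"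
  proof -
    from multi_fourier[OF \<rho> c1 M finite[of UNIV]]
    obtain a :: "('n \<Rightarrow> int) \<Rightarrow> complex ^ 'n \<Rightarrow> complex" where
      a: "(\<forall>k. holo_c1 \<sigma> (a k) \<and> strip_bound \<rho> (M * exp (- \<rho> * knorm k)) (a k)) \<and>
    (\<forall>k j. j \<notin> UNIV \<longrightarrow> k j \<noteq> 0 \<longrightarrow> a k = (\<lambda>_. 0)) \<and>
    (\<forall>k z w. (\<forall>j. j \<notin> UNIV \<longrightarrow> z $ j = w $ j) \<longrightarrow> a k z = a k w) \<and>
    (\<forall>z\<in>strip \<sigma>. (\<forall>j. \<bar>Im (z $ j)\<bar> \<le> \<rho>) \<longrightarrow> (\<forall>j\<in>UNIV. Im (z $ j) = 0) \<longrightarrow> ((\<lambda>k. a k z * ekz k z) has_sum f z) UNIV)"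
      by (rule exE)
    show thesis
    proof (rule that[of a])
      show "strip_bound \<rho> (M * exp (- \<rho> * knorm k)) (a k)" for k by (rule a[THEN conjunct1, rule_format, THEN conjunct2])
      show "a k z = a k w" for k z w by (rule a[THEN conjunct2, THEN conjunct2, THEN conjunct1, rule_format]) simp
      show "((\<lambda>k. a k z * ekz k z) has_sum f z) UNIV"
        if "z \<in> strip \<sigma>" "\<forall>j. \<bar>Im (z $ j)\<bar> \<le> \<rho>" "\<forall>j. Im (z $ j) = 0" for z
        by (rule a[THEN conjunct2, THEN conjunct2, THEN conjunct2, rule_format]) (use that in auto)
    qed
  qed
  have inf: "infinite (UNIV :: ('n \<Rightarrow> int) set)"
  proof
    assume "finite (UNIV :: ('n \<Rightarrow> int) set)"
    then have "finite ((\<lambda>k. k undefined) ` (UNIV :: ('n \<Rightarrow> int) set))" by (rule finite_imageI)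
    moreover have "(\<lambda>k. k undefined) ` (UNIV :: ('n \<Rightarrow> int) set) = UNIV"
      by (rule surjI[of _ "\<lambda>m _. m"]) simp
    ultimately show False using infinite_UNIV_int by simp
  qed
  define \<iota> where "\<iota> = from_nat_into (UNIV :: ('n \<Rightarrow> int) set)"
  have bij: "bij_betw \<iota> UNIV UNIV" unfolding \<iota>_def by (rule bij_betw_from_nat_into[OF _ inf]) simp
  \<comment> \<open>Every coordinate has been expanded, so \<open>a k\<close> is constant and 0 is
    as good an argument as any other.\<close>
  define A where "A k = a k 0" for k
  have A: "norm (A k) \<le> M * exp (- \<rho> * knorm k)" for k
    using a1[of k] \<rho> unfolding strip_bound_def A_def by simp
  have M0: "0 \<le> M" using order_trans[OF norm_ge_zero A[of "\<lambda>_. 0"]] by simp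
  have ee: "M * exp (- \<rho> * knorm k) * exp (\<sigma> / 4 * knorm k) = M * exp (- (\<sigma> / 4) * knorm k)" for k :: "'n \<Rightarrow> int"
    unfolding mult.assoc exp_add[symmetric] \<rho>_def by (simp add: field_simps)
  have hs: "((\<lambda>k::'n \<Rightarrow> int. M * exp (- (\<sigma> / 4) * knorm k)) has_sum (\<Sum>\<^sub>\<infinity>k::'n \<Rightarrow> int. M * exp (- (\<sigma> / 4) * knorm k))) UNIV"
    by (rule has_sum_infsum, rule summable_on_cmult_right, rule summable_exp_knorm) (use \<sigma> in simp)
  then have "((\<lambda>n. M * exp (- (\<sigma> / 4) * knorm (\<iota> n))) has_sum (\<Sum>\<^sub>\<infinity>k::'n \<Rightarrow> int. M * exp (- (\<sigma> / 4) * knorm k))) UNIV"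
    by (simp only: has_sum_reindex_bij_betw[OF bij, of "\<lambda>k. M * exp (- (\<sigma> / 4) * knorm k)"])
  then have sums: "(\<lambda>n. M * exp (- (\<sigma> / 4) * knorm (\<iota> n))) sums (\<Sum>\<^sub>\<infinity>k::'n \<Rightarrow> int. M * exp (- (\<sigma> / 4) * knorm k))"
    by (rule has_sum_imp_sums)
  have "qp E (\<sigma> / 4) (\<Sum>\<^sub>\<infinity>k::'n \<Rightarrow> int. M * exp (- (\<sigma> / 4) * knorm k)) (\<lambda>\<omega> t. f (cvec (t *\<^sub>R \<omega>)))" for E
  proof (rule qpI[where a = "\<lambda>n \<omega>. A (\<iota> n)" and k = \<iota> and m = "\<lambda>n. M * exp (- \<rho> * knorm (\<iota> n))"])
    show "bl E (M * exp (- \<rho> * knorm (\<iota> n))) (\<lambda>\<omega>. A (\<iota> n))" for n by (rule bl_const[OF A])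
    show "summable (\<lambda>n. M * exp (- \<rho> * knorm (\<iota> n)) * exp (\<sigma> / 4 * knorm (\<iota> n)))"
      unfolding ee using sums by (rule sums_summable)
    show "(\<Sum>n. M * exp (- \<rho> * knorm (\<iota> n)) * exp (\<sigma> / 4 * knorm (\<iota> n))) \<le> (\<Sum>\<^sub>\<infinity>k::'n \<Rightarrow> int. M * exp (- (\<sigma> / 4) * knorm k))"
      unfolding ee using sums by (simp add: sums_iff)
    fix \<omega> :: "real ^ 'n" and t
    have "((\<lambda>k. a k (cvec (t *\<^sub>R \<omega>)) * ekz k (cvec (t *\<^sub>R \<omega>))) has_sum f (cvec (t *\<^sub>R \<omega>))) UNIV"
      using \<sigma> \<rho> by (intro a4) (auto simp: cvec_def strip_def)
    moreover have "a k (cvec (t *\<^sub>R \<omega>)) * ekz k (cvec (t *\<^sub>R \<omega>)) = A k * cis (kdot k \<omega> * t)" for k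
    proof -
      have "(\<Sum>j\<in>UNIV. of_int (k j) * Re (cvec (t *\<^sub>R \<omega>) $ j)) = kdot k \<omega> * t"
        unfolding kdot_def sum_distrib_right by (intro sum.cong) (auto simp: cvec_def)
      then show ?thesis unfolding A_def ekz_def using a3[of k "cvec (t *\<^sub>R \<omega>)" 0] by simp
    qed
    ultimately have "((\<lambda>k. A k * cis (kdot k \<omega> * t)) has_sum f (cvec (t *\<^sub>R \<omega>))) UNIV" by simp
    then have "((\<lambda>n. A (\<iota> n) * cis (kdot (\<iota> n) \<omega> * t)) has_sum f (cvec (t *\<^sub>R \<omega>))) UNIV"
      by (simp only: has_sum_reindex_bij_betw[OF bij, of "\<lambda>k. A k * cis (kdot k \<omega> * t)"])
    then have "(\<lambda>n. A (\<iota> n) * cis (kdot (\<iota> n) \<omega> * t)) sums f (cvec (t *\<^sub>R \<omega>))"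
      by (rule has_sum_imp_sums)
    then show "f (cvec (t *\<^sub>R \<omega>)) = (\<Sum>n. A (\<iota> n) * cis (kdot (\<iota> n) \<omega> * t))" by (rule sums_unique)
  qed
  then show ?thesis by blast
qed

section \<open>Extension to the strip\<close>

definition zdot :: "('n::finite \<Rightarrow> int) \<Rightarrow> complex ^ 'n \<Rightarrow> complex" where
  "zdot k z = (\<Sum>j\<in>UNIV. of_int (k j) * z $ j)"

lemma norm_exp_zdot:
  assumes "z \<in> strip s" 
  shows "norm (exp (\<i> * zdot k z)) \<le> exp (s * knorm k)"
proof -
  have "Re (\<i> * zdot k z) = - (\<Sum>j\<in>UNIV. of_int (k j) * Im (z $ j))"
    by (simp add: zdot_def)
  also have "\<dots> \<le> \<bar>\<Sum>j\<in>UNIV. of_int (k j) * Im (z $ j)\<bar>" by (rule abs_ge_minus_self)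
  also have "\<dots> \<le> (\<Sum>j\<in>UNIV. \<bar>of_int (k j)\<bar> * s)"
  proof (rule order_trans[OF sum_abs sum_mono])
    fix j
    have "\<bar>Im (z $ j)\<bar> \<le> s" using assms by (auto simp: strip_def intro: less_imp_le)
    then show "\<bar>of_int (k j) * Im (z $ j)\<bar> \<le> \<bar>of_int (k j)\<bar> * s"
      unfolding abs_mult by (intro mult_left_mono) auto
  qed
  also have "\<dots> = s * knorm k" by (simp add: knorm_def sum_distrib_right[symmetric])
  finally show ?thesis by (simp add: norm_exp_eq_Re)
qed

lemma strip_shift: "z + (\<chi> j. if j = i then complex_of_real (2 * pi) else 0) \<in> strip s \<longleftrightarrow> z \<in> strip s"
proof -
  have "Im ((z + (\<chi> j. if j = i then complex_of_real (2 * pi) else 0)) $ k) = Im (z $ k)" for k by simp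
  then show ?thesis by (simp only: strip_def mem_Collect_eq)
qed

lemma open_strip: "open (strip s :: (complex ^ 'n::finite) set)"
proof -
  have "strip s = (\<Inter>i\<in>UNIV. {z :: complex ^ 'n. \<bar>Im (z $ i)\<bar> < s})"
    by (auto simp: strip_def)
  also have "open \<dots>"
    by (intro open_INT ballI open_Collect_less continuous_intros) auto
  finally show ?thesis .
qed

lemma convex_strip: "convex (strip s :: (complex ^ 'n::finite) set)"
proof -
  have eq: "strip s = (\<Inter>i\<in>UNIV. (\<lambda>z :: complex ^ 'n. z $ i) -` hstrip s)"
    by (auto simp: strip_def hstrip_def)
  have lin: "linear (\<lambda>z :: complex ^ 'n. z $ i)" for i by (rule linearI) auto
  show ?thesis unfolding eq by (intro convex_INT convex_linear_vimage[OF lin] convex_hstrip)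
qed

text \<open>For one fixed \<omega> the phase k . \<omega> t in a chosen expansion is replaced by k .
  \<theta>. The weights exp (s |k|) make the new series converge on the strip.\<close>

lemma qp_extend:
  fixes F :: "real ^ 'n::finite \<Rightarrow> real \<Rightarrow> complex"
  assumes F: "qp E s M F" and w: "\<omega> \<in> E" and s': "0 < s'" "s' < s"
  shows "\<exists>G. holo_on G (strip s') \<and> torus_periodic G \<and> (\<forall>\<theta>. norm (G \<theta>) \<le> M) \<and>
    (\<forall>t. G (cvec (t *\<^sub>R \<omega>)) = F \<omega> t)"
proof -
  obtain a k m where m: "\<And>i. bl E (m i) (a i)" and s: "summable (\<lambda>i. m i * exp (s * knorm (k i)))"
     and M: "(\<Sum>i. m i * exp (s * knorm (k i))) \<le> M"
     and FF: "\<And>\<omega> t. \<omega> \<in> E \<Longrightarrow> F \<omega> t = (\<Sum>i. a i \<omega> * cis (kdot (k i) \<omega> * t))"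
    using F by (rule qpE) (rule that)
  have m0: "0 \<le> m i" for i by (rule bl_nonneg[OF m])
  define g where "g i \<theta> = a i \<omega> * exp (\<i> * zdot (k i) \<theta>)" for i \<theta>
  \<comment> \<open>The default 0 extends the bound by \<open>M\<close> to all \<theta>; periodicity
    persists because real translations preserve the strip.\<close>
  define G where "G \<theta> = (if \<theta> \<in> strip s' then (\<Sum>i. g i \<theta>) else 0)" for \<theta>
  have gb: "norm (g i \<theta>) \<le> m i * exp (s' * knorm (k i))" if "\<theta> \<in> strip s'" for i \<theta>
    unfolding g_def norm_mult using bl_norm[OF m w] norm_exp_zdot[OF that] m0 by (intro mult_mono) auto
  have ss': "m i * exp (s' * knorm (k i)) \<le> m i * exp (s * knorm (k i))" for i
    using m0[of i] s' by (intro mult_left_mono) (auto intro: mult_right_mono)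
  have sg: "summable (\<lambda>i. g i \<theta>)" if "\<theta> \<in> strip s'" for \<theta>
    by (rule summable_comparison_test'[OF s, of 0]) (use order_trans[OF gb[OF that] ss'] in auto)
  have Gb: "norm (G \<theta>) \<le> M" for \<theta>
  proof (cases "\<theta> \<in> strip s'")
    case True
    have "norm (\<Sum>i. g i \<theta>) \<le> (\<Sum>i. m i * exp (s * knorm (k i)))"
      by (rule norm_suminf_le[OF _ s]) (use order_trans[OF gb[OF True] ss'] in auto)
    then show ?thesis using M True by (simp add: G_def)
  qed (use qp_nonneg[OF F] in \<open>simp add: G_def\<close>)
  have per: "torus_periodic G"
    unfolding torus_periodic_def
  proof (intro allI)
    fix z :: "complex ^ 'n" and i
    let ?v = "(\<chi> j. if j = i then complex_of_real (2 * pi) else 0) :: complex ^ 'n"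
    have "zdot l (z + ?v) = zdot l z + of_int (l i) * complex_of_real (2 * pi)" for l
    proof -
      have "zdot l (z + ?v) = zdot l z + (\<Sum>j\<in>UNIV. if j = i then of_int (l i) * complex_of_real (2 * pi) else 0)"
        unfolding zdot_def sum.distrib[symmetric] by (intro sum.cong) (auto simp: algebra_simps)
      then show ?thesis by simp
    qed
    moreover have "exp (\<i> * (x + of_int l * complex_of_real (2 * pi))) = exp (\<i> * x)" for x and l :: int
    proof -
      have "exp (\<i> * (x + of_int l * complex_of_real (2 * pi))) = exp (\<i> * x) * exp (2 * of_int l * pi * \<i>)"
        unfolding exp_add[symmetric] by (simp add: algebra_simps)
      also have "exp (2 * of_int l * pi * \<i>) = 1" using exp_integer_2pi[of "of_int l"] by simp
      finally show ?thesis by simp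
    qed
    ultimately have "g j (z + ?v) = g j z" for j unfolding g_def by simp
    then show "G (z + ?v) = G z" unfolding G_def strip_shift by simp
  qed
  have onflow: "G (cvec (t *\<^sub>R \<omega>)) = F \<omega> t" for t
  proof -
    have "cvec (t *\<^sub>R \<omega>) \<in> strip s'" using s' by (simp add: strip_def cvec_def)
    moreover have "g i (cvec (t *\<^sub>R \<omega>)) = a i \<omega> * cis (kdot (k i) \<omega> * t)" for i
    proof -
      have "zdot (k i) (cvec (t *\<^sub>R \<omega>)) = of_real (kdot (k i) \<omega> * t)"
        unfolding zdot_def kdot_def cvec_def sum_distrib_right of_real_sum by (intro sum.cong) auto
      then show ?thesis unfolding g_def cis_conv_exp by simp
    qed
    ultimately show ?thesis unfolding G_def FF[OF w] by simp
  qed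
  have holo: "holo_on G (strip s')"
    unfolding holo_on_def
  proof (intro conjI ballI open_strip)
    fix z :: "complex ^ 'n" assume z: "z \<in> strip s'"
    define c where "c = (\<chi> j. \<Sum>i. g i z * (\<i> * of_int (k i j)))"
    have kb: "knorm (k i) * exp (s' * knorm (k i)) \<le> exp (s * knorm (k i)) / (s - s')" for i
    proof -
      have "(s - s') * knorm (k i) \<le> exp ((s - s') * knorm (k i))"
        using exp_ge_add_one_self[of "(s - s') * knorm (k i)"] by linarith
      then have "(s - s') * knorm (k i) * exp (s' * knorm (k i)) \<le> exp ((s - s') * knorm (k i)) * exp (s' * knorm (k i))"
        by (intro mult_right_mono) auto
      also have "\<dots> = exp (s * knorm (k i))" by (simp add: algebra_simps flip: exp_add)
      finally show ?thesis using s' by (simp add: field_simps)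
    qed
    have kj: "\<bar>of_int (k i j)\<bar> \<le> knorm (k i)" for i j
      unfolding knorm_def by (rule member_le_sum) auto
    have gk: "norm (g i x * (\<i> * of_int (k i j))) \<le> m i * exp (s * knorm (k i)) / (s - s')" if "x \<in> strip s'" for i j x
    proof -
      have "norm (g i x * (\<i> * of_int (k i j))) \<le> (m i * exp (s' * knorm (k i))) * knorm (k i)"
        unfolding norm_mult using gb[OF that, of i] kj[of i j] m0[of i] by (intro mult_mono) auto
      also have "\<dots> \<le> m i * (exp (s * knorm (k i)) / (s - s'))"
        using mult_left_mono[OF kb[of i] m0[of i]] by (simp add: mult_ac)
      finally show ?thesis by simp
    qed
    have sgk: "summable (\<lambda>i. g i x * (\<i> * of_int (k i j)))" if "x \<in> strip s'" for x j
      by (rule summable_comparison_test'[OF summable_divide[OF s], of 0]) (use gk[OF that] in auto)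
    have "((\<lambda>x. \<Sum>i. g i x) has_derivative (\<lambda>h. \<Sum>i. \<Sum>j\<in>UNIV. g i z * (\<i> * of_int (k i j)) * h $ j)) (at z within strip s')"
    proof (rule has_derivative_suminf_M[OF convex_strip z, where M = "\<lambda>i. of_nat CARD('n) * (m i * exp (s * knorm (k i)) / (s - s'))"])
      fix i and x :: "complex ^ 'n"
      have "((\<lambda>x. zdot (k i) x) has_derivative (\<lambda>h. zdot (k i) h)) (at x within strip s')"
        unfolding zdot_def
        by (intro has_derivative_sum has_derivative_mult_right bounded_linear.has_derivative[OF bounded_linear_vec_nth] has_derivative_ident)
      then have "((\<lambda>x. \<i> * zdot (k i) x) has_derivative (\<lambda>h. \<i> * zdot (k i) h)) (at x within strip s')"
        by (rule has_derivative_mult_right)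
      moreover have "(exp has_derivative (\<lambda>h. h * exp (\<i> * zdot (k i) x))) (at (\<i> * zdot (k i) x))"
      proof -
        have "(*) (exp (\<i> * zdot (k i) x)) = (\<lambda>h. h * exp (\<i> * zdot (k i) x))" by (auto simp: mult.commute)
        then show ?thesis using DERIV_exp[of "\<i> * zdot (k i) x"] unfolding has_field_derivative_def by (simp only:)
      qed
      ultimately have "((\<lambda>x. exp (\<i> * zdot (k i) x)) has_derivative (\<lambda>h. \<i> * zdot (k i) h * exp (\<i> * zdot (k i) x))) (at x within strip s')"
        by (rule has_derivative_compose)
      from has_derivative_mult_right[OF this, of "a i \<omega>"]
      have "(g i has_derivative (\<lambda>h. a i \<omega> * (\<i> * zdot (k i) h * exp (\<i> * zdot (k i) x)))) (at x within strip s')"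
        unfolding g_def .
      moreover have "a i \<omega> * (\<i> * zdot (k i) h * exp (\<i> * zdot (k i) x)) = (\<Sum>j\<in>UNIV. g i x * (\<i> * of_int (k i j)) * h $ j)" for h
        unfolding g_def zdot_def[of _ h] by (simp add: sum_distrib_left sum_distrib_right mult_ac)
      ultimately show "(g i has_derivative (\<lambda>h. \<Sum>j\<in>UNIV. g i x * (\<i> * of_int (k i j)) * h $ j)) (at x within strip s')" by simp
    next
      fix i and x h :: "complex ^ 'n" assume x: "x \<in> strip s'"
      have "norm (\<Sum>j\<in>UNIV. g i x * (\<i> * of_int (k i j)) * h $ j) \<le> (\<Sum>j\<in>(UNIV::'n set). m i * exp (s * knorm (k i)) / (s - s') * norm h)"
      proof (rule sum_norm_le)
        fix j :: 'n
        show "norm (g i x * (\<i> * of_int (k i j)) * h $ j) \<le> m i * exp (s * knorm (k i)) / (s - s') * norm h"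
          unfolding norm_mult[of _ "h $ j"] using gk[OF x, of i j] m0[of i] s'
          by (intro mult_mono) (auto simp: Finite_Cartesian_Product.norm_nth_le)
      qed
      then show "norm (\<Sum>j\<in>UNIV. g i x * (\<i> * of_int (k i j)) * h $ j) \<le> of_nat CARD('n) * (m i * exp (s * knorm (k i)) / (s - s')) * norm h"
        by simp
    qed (use sg s in \<open>auto intro: summable_mult summable_divide\<close>)
    moreover have "(\<Sum>i. \<Sum>j\<in>UNIV. g i z * (\<i> * of_int (k i j)) * h $ j) = (\<Sum>j\<in>UNIV. c $ j * h $ j)" for h
      unfolding c_def vec_lambda_beta using sgk[OF z]
      by (subst suminf_sum) (auto simp: suminf_mult2 intro: summable_mult2)
    ultimately have "((\<lambda>x. \<Sum>i. g i x) has_derivative (\<lambda>h. \<Sum>j\<in>UNIV. c $ j * h $ j)) (at z)"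
      using at_within_open[OF z open_strip] by simp
    then have "(G has_derivative (\<lambda>h. \<Sum>j\<in>UNIV. c $ j * h $ j)) (at z)"
      by (rule has_derivative_transform_within_open[OF _ open_strip z]) (simp add: G_def)
    then show "\<exists>c. (G has_derivative (\<lambda>h. \<Sum>i\<in>UNIV. c $ i * h $ i)) (at z)" by blast
  qed
  show ?thesis using holo per Gb onflow by blast
qed

section \<open>Quadratic Hamiltonians\<close>

definition tomat :: "'m::finite sqmat \<Rightarrow> complex ^ 'm ^ 'm" where
  "tomat A = (\<chi> i j. ent A i j)"

lemma tomat_nth: "tomat A $ i $ j = ent A i j" by (simp add: tomat_def)

lemma tomat_mult: "tomat (A * B) = tomat A ** tomat B"
  by (simp add: tomat_def matrix_matrix_mult_def vec_eq_iff ent_simps)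

lemma tomat_one: "tomat 1 = mat 1"
  by (simp add: tomat_def mat_def vec_eq_iff ent_simps)

lemma tomat_mult_vec: "tomat (A * B) *v x = tomat A *v (tomat B *v x)"
  by (simp add: tomat_mult matrix_vector_mul_assoc)

lemma tomat_add_vec: "tomat (A + B) *v x = tomat A *v x + tomat B *v x"
  by (simp add: tomat_def matrix_vector_mult_def vec_eq_iff ent_simps distrib_right sum.distrib)

lemma tomat_diff_vec: "tomat (A - B) *v x = tomat A *v x - tomat B *v x"
  by (simp add: tomat_def matrix_vector_mult_def vec_eq_iff ent_simps left_diff_distrib sum_subtractf)

lemma norm_tomat_le: "norm (tomat A) \<le> (\<Sum>i\<in>UNIV. \<Sum>j\<in>UNIV. norm (ent A i j))"
proof -
  have "norm (tomat A) \<le> (\<Sum>i\<in>UNIV. norm (tomat A $ i))" unfolding norm_vec_def[of "tomat A"] by (rule L2_set_le_sum) simp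
  also have "\<dots> \<le> (\<Sum>i\<in>UNIV. \<Sum>j\<in>UNIV. norm (tomat A $ i $ j))"
    by (intro sum_mono) (unfold norm_vec_def[of "tomat A $ _"], rule L2_set_le_sum, simp)
  finally show ?thesis by (simp add: tomat_nth)
qed

lemma bounded_linear_tomat: "bounded_linear (tomat :: 'm::finite sqmat \<Rightarrow> _)"
proof (rule bounded_linear_intro[where K = "real CARD('m)"])
  fix A :: "'m sqmat"
  have "(\<Sum>i\<in>UNIV. \<Sum>j\<in>UNIV. norm (ent A i j)) \<le> (\<Sum>i\<in>(UNIV::'m set). norm A)"
    by (intro sum_mono sqmat_row_sum_le_norm)
  then show "norm (tomat A) \<le> norm A * real CARD('m)" using norm_tomat_le[of A] by (simp add: mult.commute)
qed (auto simp: tomat_def vec_eq_iff ent_simps)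

lemma mexp_tomat: "mexp (tomat A) = tomat (exp A)"
proof -
  have p: "matpow (tomat A) k = tomat (A ^ k)" for k
    by (induction k) (simp_all add: tomat_one tomat_mult)
  have "tomat (exp A) = (\<Sum>k. tomat (A ^ k /\<^sub>R fact k))"
    unfolding exp_def by (rule bounded_linear.suminf[OF bounded_linear_tomat summable_exp_generic])
  then show ?thesis unfolding mexp_def p
    by (simp add: linear_scale[OF bounded_linear.linear[OF bounded_linear_tomat]] inverse_eq_divide)
qed

lemma tomat_vec_has_vector_derivative:
  assumes F: "(F has_vector_derivative F') (at t)" and x: "(x has_vector_derivative x') (at t)"
  shows "((\<lambda>t. tomat (F t) *v x t) has_vector_derivative tomat F' *v x t + tomat (F t) *v x') (at t)"
proof -
  have "bounded_bilinear (\<lambda>(A :: 'a sqmat) v. tomat A *v v)"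
  proof
    fix A B :: "'a sqmat" and v w :: "complex ^ 'a" and r :: real
    show "tomat (A + B) *v v = tomat A *v v + tomat B *v v" by (rule tomat_add_vec)
    show "tomat A *v (v + w) = tomat A *v v + tomat A *v w" by (rule matrix_vector_right_distrib)
    show "tomat (r *\<^sub>R A) *v v = r *\<^sub>R (tomat A *v v)"
      by (simp add: tomat_def matrix_vector_mult_def vec_eq_iff ent_simps scaleR_sum_right)
    show "tomat A *v (r *\<^sub>R v) = r *\<^sub>R (tomat A *v v)"
      by (simp add: matrix_vector_mult_def vec_eq_iff scaleR_sum_right)
    have "norm (tomat A *v v) \<le> norm A * norm v * real CARD('a)" for A and v :: "complex ^ 'a"
    proof -
      have "norm (tomat A *v v) \<le> (\<Sum>i\<in>UNIV. norm ((tomat A *v v) $ i))"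
        unfolding norm_vec_def[of "tomat A *v v"] by (rule L2_set_le_sum) simp
      also have "\<dots> \<le> (\<Sum>i\<in>(UNIV::'a set). norm A * norm v)"
      proof (rule sum_mono)
        fix i
        have "norm ((tomat A *v v) $ i) \<le> (\<Sum>j\<in>UNIV. norm (ent A i j) * norm v)"
          unfolding matrix_vector_mult_def vec_lambda_beta tomat_nth
        proof (rule sum_norm_le)
          fix j
          show "norm (ent A i j * v $ j) \<le> norm (ent A i j) * norm v"
            unfolding norm_mult by (intro mult_left_mono Finite_Cartesian_Product.norm_nth_le) simp
        qed
        also have "\<dots> \<le> norm A * norm v"
          unfolding sum_distrib_right[symmetric] by (intro mult_right_mono sqmat_row_sum_le_norm) auto
        finally show "norm ((tomat A *v v) $ i) \<le> norm A * norm v" .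
      qed
      finally show ?thesis by (simp add: mult.commute)
    qed
    then show "\<exists>K. \<forall>A (v :: complex ^ 'a). norm (tomat A *v v) \<le> norm A * norm v * K" by blast
  qed
  from bounded_bilinear.has_vector_derivative[OF this F x]
  show ?thesis by (simp add: add.commute)
qed

text \<open>The matrix of the linear Hamiltonian vector field of the form with coefficients
  \<open>g\<close>. Since \<open>g\<close> need not be symmetric, its symmetrisation
  appears.\<close>

definition hmat :: "(coord \<Rightarrow> coord \<Rightarrow> complex) \<Rightarrow> coord sqmat" where
  "hmat g = Mat (\<lambda>k j. - \<i> * sg k * (g (bar k) j + g j (bar k)))"

lemma ent_hmat: "ent (hmat g) k j = - \<i> * sg k * (g (bar k) j + g j (bar k))" by (simp add: hmat_def)

lemma star_hmat: "star (hmat g) = - hmat g"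
proof (rule sqmat_eqI)
  fix k j
  show "ent (star (hmat g)) k j = ent (- hmat g) k j"
    by (cases j) (simp_all add: ent_star ent_hmat ent_simps algebra_simps)
qed

lemma pderiv_c_quadratic:
  "pderiv_c (\<lambda>z. \<Sum>i\<in>UNIV. \<Sum>j\<in>UNIV. g i j * z $ i * z $ j) z k = (\<Sum>j\<in>UNIV. (g k j + g j k) * z $ j)"
proof -
  let ?u = "\<lambda>w. (\<chi> j. if j = k then w else z $ j) :: phase"
  have d: "((\<lambda>w. ?u w $ i) has_field_derivative (if i = k then 1 else 0)) (at (z $ k))" for i
    by (cases "i = k") (auto intro!: derivative_eq_intros)
  have zk: "?u (z $ k) = z" by (simp add: vec_eq_iff)
  have "((\<lambda>w. \<Sum>i\<in>UNIV. \<Sum>j\<in>UNIV. g i j * (?u w $ i) * (?u w $ j)) has_field_derivative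
     (\<Sum>i\<in>UNIV. \<Sum>j\<in>UNIV. g i j * (if i = k then 1 else 0) * z $ j + g i j * z $ i * (if j = k then 1 else 0))) (at (z $ k))"
  proof (intro DERIV_sum)
    fix i j
    have "((\<lambda>w. g i j * (?u w $ i) * (?u w $ j)) has_field_derivative
      g i j * (if i = k then 1 else 0) * (?u (z $ k) $ j) + (if j = k then 1 else 0) * (g i j * (?u (z $ k) $ i))) (at (z $ k))"
      by (rule DERIV_mult[OF DERIV_cmult[OF d] d])
    then show "((\<lambda>w. g i j * (?u w $ i) * (?u w $ j)) has_field_derivative
      g i j * (if i = k then 1 else 0) * z $ j + g i j * z $ i * (if j = k then 1 else 0)) (at (z $ k))"
      unfolding zk by (simp only: mult.commute[of "if j = k then 1 else 0"])
  qed
  then have "pderiv_c (\<lambda>z. \<Sum>i\<in>UNIV. \<Sum>j\<in>UNIV. g i j * z $ i * z $ j) z k =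
     (\<Sum>i\<in>UNIV. \<Sum>j\<in>UNIV. g i j * (if i = k then 1 else 0) * z $ j + g i j * z $ i * (if j = k then 1 else 0))"
    unfolding pderiv_c_def by (rule DERIV_imp_deriv)
  also have "\<dots> = (\<Sum>i\<in>UNIV. \<Sum>j\<in>UNIV. if i = k then g i j * z $ j else 0) + (\<Sum>i\<in>UNIV. \<Sum>j\<in>UNIV. if j = k then g i j * z $ i else 0)"
    unfolding sum.distrib[symmetric] by (intro sum.cong refl) auto
  also have "(\<Sum>i\<in>UNIV. \<Sum>j\<in>UNIV. if i = k then g i j * z $ j else 0) = (\<Sum>j\<in>UNIV. g k j * z $ j)"
    by (subst sum.swap) simp
  also have "(\<Sum>i\<in>UNIV. \<Sum>j\<in>UNIV. if j = k then g i j * z $ i else 0) = (\<Sum>i\<in>UNIV. g i k * z $ i)"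
    by simp
  finally show ?thesis by (simp add: sum.distrib[symmetric] distrib_right)
qed

lemma ham_field_quadratic:
  "ham_field (\<lambda>z. \<Sum>i\<in>UNIV. \<Sum>j\<in>UNIV. g i j * z $ i * z $ j) z = tomat (hmat g) *v z"
proof -
  have "ham_field (\<lambda>z. \<Sum>i\<in>UNIV. \<Sum>j\<in>UNIV. g i j * z $ i * z $ j) z $ k = (tomat (hmat g) *v z) $ k" for k
  proof -
    have "ham_field (\<lambda>z. \<Sum>i\<in>UNIV. \<Sum>j\<in>UNIV. g i j * z $ i * z $ j) z $ k = - \<i> * sg k * (\<Sum>j\<in>UNIV. (g (bar k) j + g j (bar k)) * z $ j)"
      by (cases k) (simp_all add: ham_field_def pderiv_c_quadratic)
    also have "\<dots> = (tomat (hmat g) *v z) $ k"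
      unfolding matrix_vector_mult_def vec_lambda_beta tomat_nth ent_hmat sum_distrib_left
      by (intro sum.cong refl) (simp only: mult.assoc)
    finally show ?thesis .
  qed
  then show ?thesis by (simp add: vec_eq_iff)
qed

definition gdiag :: "complex \<Rightarrow> complex \<Rightarrow> coord \<Rightarrow> coord \<Rightarrow> complex" where
  "gdiag a b i j = (if i = Xi1 \<and> j = Eta1 then a else if i = Xi2 \<and> j = Eta2 then b else 0)"

lemma sum_coord: "(\<Sum>i\<in>(UNIV :: coord set). f i) = f Xi1 + f Eta1 + f Xi2 + f Eta2"
  by (simp add: UNIV_coord add.assoc)

lemma gdiag_form: "(\<Sum>i\<in>UNIV. \<Sum>j\<in>UNIV. gdiag a b i j * z $ i * z $ j) = a * z $ Xi1 * z $ Eta1 + b * z $ Xi2 * z $ Eta2"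
  by (simp add: sum_coord gdiag_def)

text \<open>The equations \<xi>' = - i \<nu> \<xi> and \<eta>' = i \<nu> \<eta> fix the signs: the
  frequency itself is found at the \<eta> entries.\<close>

fun dlam :: "real \<Rightarrow> real \<Rightarrow> coord \<Rightarrow> real" where
  "dlam a b Xi1 = - a" | "dlam a b Eta1 = a" | "dlam a b Xi2 = - b" | "dlam a b Eta2 = b"

lemma dlam_bar: "dlam a b (bar i) = - dlam a b i" by (cases i) auto

lemma hmat_gdiag: "hmat (gdiag (of_real a) (of_real b)) = Dg (dlam a b)"
proof (rule sqmat_eqI)
  fix i j
  show "ent (hmat (gdiag (of_real a) (of_real b))) i j = ent (Dg (dlam a b)) i j"
    by (cases i; cases j) (simp_all add: ent_hmat ent_Dg gdiag_def)
qed

lemma antisymmetric_dlam: "(\<And>i. l (bar i) = - l i) \<Longrightarrow> dlam (l Eta1) (l Eta2) = l"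
proof
  fix i assume l: "\<And>i. l (bar i) = - l i"
  show "dlam (l Eta1) (l Eta2) i = l i" using l[of Eta1] l[of Eta2] by (cases i) auto
qed

text \<open>Polarisation on the real form \<open>\<eta> = cnj \<xi>\<close>, tested on pairs of vectors supported on
  \<open>{i, bar i}\<close> and \<open>{j, bar j}\<close>.\<close>
lemma real_quadratic_form:
  fixes a :: "coord \<Rightarrow> coord \<Rightarrow> complex"
  assumes real: "\<And>x1 x2. (\<Sum>i\<in>UNIV. \<Sum>j\<in>UNIV. a i j *
     (\<chi> k. case k of Xi1 \<Rightarrow> x1 | Eta1 \<Rightarrow> cnj x1 | Xi2 \<Rightarrow> x2 | Eta2 \<Rightarrow> cnj x2) $ i *
     (\<chi> k. case k of Xi1 \<Rightarrow> x1 | Eta1 \<Rightarrow> cnj x1 | Xi2 \<Rightarrow> x2 | Eta2 \<Rightarrow> cnj x2) $ j) \<in> \<real>"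
  shows "cnj (a i j + a j i) = a (bar i) (bar j) + a (bar j) (bar i)"
proof -
  define b where "b i j = a i j + a j i" for i j
  define q where "q z = (\<Sum>i\<in>UNIV. \<Sum>j\<in>UNIV. a i j * z i * z j)" for z :: "coord \<Rightarrow> complex"
  define B where "B u v = (\<Sum>i\<in>UNIV. \<Sum>j\<in>UNIV. b i j * u i * v j)" for u v :: "coord \<Rightarrow> complex"
  define V where "V = {u :: coord \<Rightarrow> complex. \<forall>i. u (bar i) = cnj (u i)}"
  have qV: "q u \<in> \<real>" if "u \<in> V" for u
  proof -
    have "(\<chi> k. case k of Xi1 \<Rightarrow> u Xi1 | Eta1 \<Rightarrow> cnj (u Xi1) | Xi2 \<Rightarrow> u Xi2 | Eta2 \<Rightarrow> cnj (u Xi2)) $ i = u i" for i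
    proof -
      have "u (bar Xi1) = cnj (u Xi1)" "u (bar Xi2) = cnj (u Xi2)" using that unfolding V_def by blast+
      then have "u Eta1 = cnj (u Xi1)" "u Eta2 = cnj (u Xi2)" by simp_all
      then show ?thesis by (cases i) simp_all
    qed
    then show ?thesis using real[of "u Xi1" "u Xi2"] unfolding q_def by simp
  qed
  have BV: "B u v \<in> \<real>" if "u \<in> V" "v \<in> V" for u v
  proof -
    have "(\<lambda>i. u i + v i) \<in> V" using that by (simp add: V_def)
    then have "q (\<lambda>i. u i + v i) - q u - q v \<in> \<real>" using qV that by (intro Reals_diff) auto
    moreover have "q (\<lambda>i. u i + v i) - q u - q v = B u v"
    proof -
      have "q (\<lambda>i. u i + v i) = q u + q v + (\<Sum>i\<in>UNIV. \<Sum>j\<in>UNIV. a i j * u i * v j) + (\<Sum>i\<in>UNIV. \<Sum>j\<in>UNIV. a i j * v i * u j)"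
        unfolding q_def by (simp add: sum.distrib[symmetric] algebra_simps)
      also have "(\<Sum>i\<in>UNIV. \<Sum>j\<in>UNIV. a i j * v i * u j) = (\<Sum>i\<in>UNIV. \<Sum>j\<in>UNIV. a j i * u i * v j)"
        by (subst sum.swap) (simp add: mult_ac)
      finally show ?thesis unfolding B_def b_def by (simp add: sum.distrib distrib_right)
    qed
    ultimately show ?thesis by simp
  qed
  \<comment> \<open>The vectors of the real form supported on a conjugate pair of coordinates;
    \<open>c\<close> is a free complex parameter.\<close>
  define e where "e i c k = (if k = i then c else if k = bar i then cnj c else 0)" for i k :: coord and c :: complex
  have bi: "bar i \<noteq> i" for i by (cases i) auto
  have eV: "e i c \<in> V" for i c
    unfolding V_def e_def using bi by auto
  have Be: "B (e i c) (e j d) = c * d * b i j + c * cnj d * b i (bar j) + cnj c * d * b (bar i) j + cnj c * cnj d * b (bar i) (bar j)" for c d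
  proof -
    have "(\<Sum>k\<in>UNIV. f k * e j d k) = f j * d + f (bar j) * cnj d" for f j d
    proof -
      have "(\<Sum>k\<in>UNIV. f k * e j d k) = (\<Sum>k\<in>UNIV. (if k = j then f j * d else 0) + (if k = bar j then f (bar j) * cnj d else 0))"
        using bi[of j] by (intro sum.cong) (auto simp: e_def)
      then show ?thesis by (simp add: sum.distrib)
    qed
    note S = this
    have "B (e i c) (e j d) = (\<Sum>k\<in>UNIV. (\<Sum>l\<in>UNIV. b k l * e j d l) * e i c k)"
      unfolding B_def sum_distrib_right by (intro sum.cong refl) (simp only: mult_ac)
    then show ?thesis unfolding S by (simp add: algebra_simps)
  qed
  let ?b = "b i j" and ?p = "b i (bar j)" and ?r = "b (bar i) j" and ?s = "b (bar i) (bar j)"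
  \<comment> \<open>Subtracting the first two of the resulting equations gives Im (b + s) = 0,
    adding the last two gives Re (b - s) = 0, where b and s are the entries at (i, j) and at the
    conjugate indices.\<close>
  have "B (e i 1) (e j 1) \<in> \<real>" "B (e i \<i>) (e j \<i>) \<in> \<real>" "B (e i 1) (e j \<i>) \<in> \<real>" "B (e i \<i>) (e j 1) \<in> \<real>"
    using BV eV by auto
  then have "Im (?b + ?p + ?r + ?s) = 0" "Im (- ?b + ?p + ?r - ?s) = 0"
    "Im (\<i> * ?b - \<i> * ?p + \<i> * ?r - \<i> * ?s) = 0" "Im (\<i> * ?b + \<i> * ?p - \<i> * ?r - \<i> * ?s) = 0"
    unfolding Be complex_is_Real_iff by simp_all
  then have "cnj ?b = ?s" by (simp add: complex_eq_iff)
  then show ?thesis by (simp add: b_def)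
qed

section \<open>Hamiltonian matrices as logarithms of symplectic ones\<close>

lemma hamiltonian_matrix_tomat:
  assumes "star A = - A"
  shows "hamiltonian_matrix (tomat A)"
proof -
  have e: "ent A i j = - (sg i * sg j * ent A (bar j) (bar i))" for i j
    using arg_cong[OF assms, of "\<lambda>X. ent X i j"] by (simp add: ent_star ent_simps)
  have "symp (tomat A *v u) v + symp u (tomat A *v v) = 0" for u v
    unfolding symp_def matrix_vector_mult_def vec_lambda_beta tomat_nth sum_coord
    using e[of Xi1 Xi1] e[of Xi1 Eta1] e[of Xi1 Xi2] e[of Xi1 Eta2]
      e[of Eta1 Xi1] e[of Eta1 Eta1] e[of Eta1 Xi2] e[of Eta1 Eta2]
      e[of Xi2 Xi1] e[of Xi2 Eta1] e[of Xi2 Xi2] e[of Xi2 Eta2]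
      e[of Eta2 Xi1] e[of Eta2 Eta1] e[of Eta2 Xi2] e[of Eta2 Eta2]
    by (simp add: algebra_simps)
  then show ?thesis by (simp add: hamiltonian_matrix_def)
qed

text \<open>The logarithms of \<open>1 + X\<close> and of its inverse \<open>star (1 + X)\<close>
  commute, and the exponential of their sum is 1. By \<open>exp_eq_one_imp_zero\<close> the sum is
  0, provided it is small: |X| <= 1/32 gives |star X| <= 1/8, and each logarithm at most doubles the
  size, 5/16 in all.\<close>

lemma star_lnp_symplectic:
  fixes X :: "coord sqmat"
  assumes X: "norm X \<le> 1/32" and s: "(1 + X) * star (1 + X) = 1" "star (1 + X) * (1 + X) = 1"
  shows "star (lnp X) = - lnp X"
proof -
  have nl: "norm (lnp Y) \<le> 2 * norm Y" if "norm Y \<le> 1/2" for Y :: "coord sqmat"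
  proof -
    have "norm (lnp Y) \<le> (\<Sum>n. norm Y ^ Suc n)"
      unfolding lnp_def by (rule norm_suminf_le[OF norm_lnp_term]) (use geometric_tail_sums[of "norm Y"] that in auto)
    then show ?thesis using geometric_tail_sums[of "norm Y"] that by auto
  qed
  have st: "norm (star X) \<le> 1/8"
  proof -
    have "(\<Sum>j\<in>UNIV. norm (ent (star X) i j)) \<le> (\<Sum>j\<in>(UNIV::coord set). norm X)" for i
      by (intro sum_mono) (auto simp: ent_star norm_mult norm_ent_le)
    then have "norm (star X) \<le> 4 * norm X" unfolding sqmat_norm_le_iff by (simp add: UNIV_coord)
    then show ?thesis using X by simp
  qed
  have sp: "star (Y ^ n) = star Y ^ n" for Y n
    by (induction n) (simp_all add: star_mult power_commutes)
  have sl: "star (lnp X) = lnp (star X)"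
  proof -
    have "star (lnp X) = (\<Sum>k. star (((-1) ^ k / real (Suc k)) *\<^sub>R X ^ Suc k))"
      unfolding lnp_def using X by (intro bounded_linear.suminf[OF bounded_linear_star summable_lnp]) simp
    then show ?thesis unfolding lnp_def star_simps(6) sp .
  qed
  have "(1 + X) * (1 + star X) = (1 + star X) * (1 + X)" using s by simp
  then have "X * star X = star X * X" by (simp add: algebra_simps)
  then have "star X * lnp X = lnp X * star X" using X by (intro lnp_commute) auto
  then have c: "lnp X * lnp (star X) = lnp (star X) * lnp X" using st by (intro lnp_commute) auto
  have "exp (lnp (star X) + lnp X) = exp (lnp (star X)) * exp (lnp X)"
    by (rule exp_add_commuting) (simp add: c)
  also have "\<dots> = (1 + star X) * (1 + X)" using X st by (simp add: exp_lnp)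
  also have "\<dots> = 1" using s(2) by simp
  finally have 1: "exp (lnp (star X) + lnp X) = 1" .
  have "norm (lnp (star X) + lnp X) \<le> norm (lnp (star X)) + norm (lnp X)" by (rule norm_triangle_ineq)
  also have "\<dots> \<le> 1/2" using nl[of X] nl[of "star X"] X st by simp
  finally have "norm (lnp (star X) + lnp X) \<le> 1/2" .
  from exp_eq_one_imp_zero[OF 1 this] show ?thesis unfolding sl by (simp add: eq_neg_iff_add_eq_0)
qed

section \<open>Conjugation to the diagonal Hamiltonian\<close>

lemma freq_box_lipschitz:
  fixes f :: "real ^ 'n::finite \<Rightarrow> real"
  assumes f: "\<And>\<omega>. \<omega> \<in> freq_box \<Longrightarrow> (f has_derivative (\<lambda>v. g \<omega> \<bullet> v)) (at \<omega> within freq_box)"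
    and g: "\<And>\<omega>. \<omega> \<in> freq_box \<Longrightarrow> norm (g \<omega>) \<le> L" and xy: "x \<in> freq_box" "y \<in> freq_box"
  shows "\<bar>f x - f y\<bar> \<le> L * dist x y"
proof -
  have "convex (freq_box :: (real ^ 'n) set)"
  proof -
    have eq: "freq_box = (\<Inter>i\<in>UNIV. (\<lambda>z :: real ^ 'n. z $ i) -` {0<..2*pi})" by (auto simp: freq_box_def)
    have lin: "linear (\<lambda>z :: real ^ 'n. z $ i)" for i by (rule linearI) auto
    show ?thesis unfolding eq by (intro convex_INT convex_linear_vimage[OF lin] convex_real_interval)
  qed
  moreover have "onorm (\<lambda>v. g \<omega> \<bullet> v) \<le> L" if "\<omega> \<in> freq_box" for \<omega>
  proof (rule onorm_bound)
    show "0 \<le> L" using g[OF that] norm_ge_zero order_trans by blast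
    fix v show "norm (g \<omega> \<bullet> v) \<le> L * norm v"
      using norm_cauchy_schwarz[of "g \<omega>" v] Cauchy_Schwarz_ineq2[of "g \<omega>" v] mult_right_mono[OF g[OF that], of "norm v"]
      by simp
  qed
  ultimately have "norm (f x - f y) \<le> L * norm (x - y)"
    using differentiable_bound[of freq_box f "\<lambda>\<omega> v. g \<omega> \<bullet> v" L y x] f xy by (simp add: norm_minus_commute)
  then show ?thesis by (simp add: dist_norm)
qed

text \<open>Up to sign the differences of distinct eigenvalues are 2a, 2b and a + b or a - b; the
  last two are at least |a| - |b| in absolute value.\<close>

lemma dlam_gap:
  assumes "m \<le> 2 * \<bar>a\<bar>" "m \<le> 2 * \<bar>b\<bar>" "m \<le> \<bar>a\<bar> - \<bar>b\<bar>" "i \<noteq> j"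
  shows "m \<le> \<bar>dlam a b j - dlam a b i\<bar>"
  using assms by (cases i; cases j) auto

text \<open>The forward direction is the product rule. For the converse, \<open>star\<close> turns
  the equation of \<open>V\<close> into that of its inverse, so the same product rule applies
  backwards.\<close>

lemma conjugation_iff:
  fixes V :: "real \<Rightarrow> coord sqmat"
  assumes V: "\<And>t. (V has_vector_derivative D * V t - V t * M t) (at t)"
    and inv: "\<And>t. V t * star (V t) = 1" "\<And>t. star (V t) * V t = 1"
    and D: "star D = - D" and M: "\<And>t. star (M t) = - M t"
  shows "(\<forall>t. (x has_vector_derivative tomat (M t) *v x t) (at t)) \<longleftrightarrow>
    (\<forall>t. ((\<lambda>t. tomat (V t) *v x t) has_vector_derivative tomat D *v (tomat (V t) *v x t)) (at t))"
proof (intro iffI allI)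
  fix t assume x: "\<forall>t. (x has_vector_derivative tomat (M t) *v x t) (at t)"
  have "tomat (D * V t - V t * M t) *v x t + tomat (V t) *v (tomat (M t) *v x t) = tomat D *v (tomat (V t) *v x t)"
    by (simp add: tomat_diff_vec tomat_mult_vec)
  then show "((\<lambda>t. tomat (V t) *v x t) has_vector_derivative tomat D *v (tomat (V t) *v x t)) (at t)"
    using tomat_vec_has_vector_derivative[OF V[of t] x[rule_format, of t]] by simp
next
  fix t
  let ?y = "\<lambda>t. tomat (V t) *v x t"
  assume y: "\<forall>t. (?y has_vector_derivative tomat D *v ?y t) (at t)"
  have "star (D * V t - V t * M t) = M t * star (V t) - star (V t) * D" by (simp add: star_mult D M)
  then have "((\<lambda>t. star (V t)) has_vector_derivative M t * star (V t) - star (V t) * D) (at t)"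
    using bounded_linear.has_vector_derivative[OF bounded_linear_star V[of t]] by simp
  from tomat_vec_has_vector_derivative[OF this y[rule_format, of t]]
  have "((\<lambda>t. tomat (star (V t)) *v ?y t) has_vector_derivative tomat (M t) *v (tomat (star (V t)) *v ?y t)) (at t)"
    by (simp add: tomat_diff_vec tomat_mult_vec)
  moreover have "tomat (star (V t)) *v ?y t = x t" for t
    unfolding tomat_mult_vec[symmetric] inv(2) tomat_one by simp
  ultimately show "(x has_vector_derivative tomat (M t) *v x t) (at t)" by simp
qed

text \<open>The logarithm is taken in the quasi-periodic algebra, before the extension, so each
  entry extends by its series. Symplecticity is known only along the line t \<omega>, whereas the
  generator must be Hamiltonian for every \<theta>.\<close>

lemma logarithm_on_strip:
  fixes X :: "real ^ 'n::finite \<Rightarrow> real \<Rightarrow> coord sqmat"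
  assumes X: "qpm E s M X" and w: "\<omega> \<in> E" and s': "0 < s'" "s' < s" and M: "M \<le> 1/32"
    and sym: "\<And>t. (1 + X \<omega> t) * star (1 + X \<omega> t) = 1" "\<And>t. star (1 + X \<omega> t) * (1 + X \<omega> t) = 1"
  shows "\<exists>A :: complex ^ 'n \<Rightarrow> complex ^ coord ^ coord.
    (\<forall>i j. holo_on (\<lambda>\<theta>. A \<theta> $ i $ j) (strip s') \<and> torus_periodic (\<lambda>\<theta>. A \<theta> $ i $ j)) \<and>
    (\<forall>\<theta>. hamiltonian_matrix (A \<theta>)) \<and> (\<forall>\<theta>. norm (A \<theta>) \<le> 8 * M) \<and>
    (\<forall>t. mexp (A (cvec (t *\<^sub>R \<omega>))) = tomat (1 + X \<omega> t))"
proof -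
  have s: "0 \<le> s" using s' by simp
  have q: "qpm E s (2 * M) (\<lambda>\<omega> t. lnp (X \<omega> t))" using M by (intro qpm_lnp[OF X s]) simp
  have "\<exists>G. holo_on G (strip s') \<and> torus_periodic G \<and> (\<forall>\<theta>. norm (G \<theta>) \<le> 2 * M / 4) \<and>
    (\<forall>t. G (cvec (t *\<^sub>R \<omega>)) = ent (lnp (X \<omega> t)) i j)" for i j
    using qp_extend[OF qpmD[OF q, of i j] w s'] by (simp add: UNIV_coord)
  then obtain G where G: "\<And>i j. holo_on (G i j) (strip s')" "\<And>i j. torus_periodic (G i j)"
    "\<And>i j \<theta>. norm (G i j \<theta>) \<le> 2 * M / 4" "\<And>i j t. G i j (cvec (t *\<^sub>R \<omega>)) = ent (lnp (X \<omega> t)) i j"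
    by metis
  \<comment> \<open>Projection onto the Hamiltonian matrices. Along t \<omega> the logarithm is
    already Hamiltonian, so nothing changes there.\<close>
  define B where "B \<theta> = (1/2) *\<^sub>R (Mat (\<lambda>i j. G i j \<theta>) - star (Mat (\<lambda>i j. G i j \<theta>)))" for \<theta>
  have entB: "ent (B \<theta>) i j = (1/2) * G i j \<theta> + (- (1/2) * (sg i * sg j)) * G (bar j) (bar i) \<theta>" for \<theta> i j
    by (simp add: B_def ent_simps ent_star scaleR_conv_of_real[where 'a = complex] algebra_simps)
  have "holo_on (\<lambda>\<theta>. tomat (B \<theta>) $ i $ j) (strip s')" for i j
    unfolding holo_on_def tomat_nth entB
  proof (intro conjI ballI open_strip)
    fix z :: "complex ^ 'n" assume z: "z \<in> strip s'"
    obtain c1 where c1: "(G i j has_derivative (\<lambda>h. \<Sum>l\<in>UNIV. c1 $ l * h $ l)) (at z)" using G(1) z unfolding holo_on_def by blast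
    obtain c2 where c2: "(G (bar j) (bar i) has_derivative (\<lambda>h. \<Sum>l\<in>UNIV. c2 $ l * h $ l)) (at z)" using G(1) z unfolding holo_on_def by blast
    let ?k = "- (1/2) * (sg i * sg j)"
    have "((\<lambda>\<theta>. (1/2) * G i j \<theta> + ?k * G (bar j) (bar i) \<theta>) has_derivative
       (\<lambda>h. (1/2) * (\<Sum>l\<in>UNIV. c1 $ l * h $ l) + ?k * (\<Sum>l\<in>UNIV. c2 $ l * h $ l))) (at z)"
      by (intro has_derivative_add has_derivative_mult_right c1 c2)
    moreover have "(1/2) * (\<Sum>l\<in>UNIV. c1 $ l * h $ l) + ?k * (\<Sum>l\<in>UNIV. c2 $ l * h $ l)
      = (\<Sum>l\<in>UNIV. (\<chi> l. (1/2) * c1 $ l + ?k * c2 $ l) $ l * h $ l)" for h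
      unfolding sum_distrib_left vec_lambda_beta distrib_right sum.distrib by (simp only: mult.assoc)
    ultimately show "\<exists>c. ((\<lambda>\<theta>. (1/2) * G i j \<theta> + ?k * G (bar j) (bar i) \<theta>) has_derivative (\<lambda>h. \<Sum>l\<in>UNIV. c $ l * h $ l)) (at z)"
      by (intro exI[of _ "\<chi> l. (1/2) * c1 $ l + ?k * c2 $ l"]) simp
  qed
  moreover have "torus_periodic (\<lambda>\<theta>. tomat (B \<theta>) $ i $ j)" for i j
    using G(2) unfolding torus_periodic_def tomat_nth entB by simp
  moreover have "hamiltonian_matrix (tomat (B \<theta>))" for \<theta>
    by (rule hamiltonian_matrix_tomat) (simp add: B_def algebra_simps)
  moreover have "norm (tomat (B \<theta>)) \<le> 8 * M" for \<theta>
  proof -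
    have "norm (ent (B \<theta>) i j) \<le> 2 * M / 4" for i j
    proof -
      have "norm (ent (B \<theta>) i j) \<le> norm ((1/2) * G i j \<theta>) + norm ((- (1/2) * (sg i * sg j)) * G (bar j) (bar i) \<theta>)"
        unfolding entB by (rule norm_triangle_ineq)
      also have "\<dots> = (1/2) * norm (G i j \<theta>) + (1/2) * norm (G (bar j) (bar i) \<theta>)" by (simp add: norm_mult)
      also have "\<dots> \<le> 2 * M / 4" using G(3)[of i j \<theta>] G(3)[of "bar j" "bar i" \<theta>] by simp
      finally show ?thesis .
    qed
    then have "(\<Sum>i\<in>UNIV. \<Sum>j\<in>UNIV. norm (ent (B \<theta>) i j)) \<le> (\<Sum>i\<in>(UNIV::coord set). \<Sum>j\<in>(UNIV::coord set). 2 * M / 4)"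
      by (intro sum_mono)
    also have "\<dots> = 8 * M" by (simp add: UNIV_coord)
    finally show ?thesis using norm_tomat_le[of "B \<theta>"] by simp
  qed
  moreover have "mexp (tomat (B (cvec (t *\<^sub>R \<omega>)))) = tomat (1 + X \<omega> t)" for t
  proof -
    have nX: "norm (X \<omega> t) \<le> 1/32" using qpm_bound[OF X s w, of t] M by simp
    have e: "Mat (\<lambda>i j. G i j (cvec (t *\<^sub>R \<omega>))) = lnp (X \<omega> t)"
      by (rule sqmat_eqI) (simp add: G(4))
    have "B (cvec (t *\<^sub>R \<omega>)) = lnp (X \<omega> t)"
      unfolding B_def e star_lnp_symplectic[OF nX sym] by (simp add: scaleR_2[symmetric])
    then show ?thesis using nX by (simp add: mexp_tomat exp_lnp)
  qed
  ultimately show ?thesis by (intro exI[of _ "\<lambda>\<theta>. tomat (B \<theta>)"]) blast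
qed

lemma quadratic_coefficients_qpm:
  fixes a :: "coord \<Rightarrow> coord \<Rightarrow> complex ^ 'n::finite \<Rightarrow> complex"
  assumes \<sigma>: "0 < \<sigma>" and a: "\<And>i j. holo_on (a i j) (strip \<sigma>)" "\<And>i j. torus_periodic (a i j)"
  shows "\<exists>M\<ge>0. \<forall>E. qpm E (\<sigma> / 4) M (\<lambda>\<omega> t. hmat (\<lambda>i j. a i j (cvec (t *\<^sub>R \<omega>))))"
proof -
  have "\<exists>M. \<forall>E. qp E (\<sigma> / 4) M (\<lambda>\<omega> t. a i j (cvec (t *\<^sub>R \<omega>)))" for i j
    by (rule qp_of_holo_on[OF \<sigma> a])
  then obtain Mf where Mf: "\<And>i j E. qp E (\<sigma> / 4) (Mf i j) (\<lambda>\<omega> t. a i j (cvec (t *\<^sub>R \<omega>)))" by metis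
  define S where "S = (\<Sum>i\<in>UNIV. \<Sum>j\<in>UNIV. Mf i j)"
  have M0: "0 \<le> Mf i j" for i j using qp_nonneg[OF Mf] .
  have MS: "Mf i j \<le> S" for i j
  proof -
    have "Mf i j \<le> (\<Sum>j\<in>UNIV. Mf i j)" by (rule member_le_sum) (use M0 in auto)
    also have "\<dots> \<le> S" unfolding S_def by (rule member_le_sum[where f = "\<lambda>i. \<Sum>j\<in>UNIV. Mf i j"]) (use M0 in \<open>auto intro: sum_nonneg\<close>)
    finally show ?thesis .
  qed
  \<comment> \<open>An entry of \<open>hmat\<close> combines two coefficients, each bounded by
    \<open>S\<close>; the remaining factor 4 is the dimension in \<open>qpm\<close>.\<close>
  have "qpm E (\<sigma> / 4) (8 * S) (\<lambda>\<omega> t. hmat (\<lambda>i j. a i j (cvec (t *\<^sub>R \<omega>))))" for E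
    unfolding qpm_def ent_hmat
  proof (intro allI)
    fix k j
    have "qp E (\<sigma> / 4) (1 * (Mf (bar k) j + Mf j (bar k))) (\<lambda>\<omega> t. - \<i> * sg k * (a (bar k) j (cvec (t *\<^sub>R \<omega>)) + a j (bar k) (cvec (t *\<^sub>R \<omega>))))"
      using \<sigma> by (intro qp_cmult qp_add Mf) (auto simp: norm_mult)
    then show "qp E (\<sigma> / 4) (8 * S / real CARD(coord)) (\<lambda>\<omega> t. - \<i> * sg k * (a (bar k) j (cvec (t *\<^sub>R \<omega>)) + a j (bar k) (cvec (t *\<^sub>R \<omega>))))"
      by (rule qp_mono) (use MS[of "bar k" j] MS[of j "bar k"] in \<open>auto simp: UNIV_coord\<close>)
  qed
  moreover have "0 \<le> 8 * S" using M0[of Xi1 Xi1] MS[of Xi1 Xi1] by linarith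
  ultimately show ?thesis by blast
qed

theorem theorem3p5:
  fixes \<nu>1 \<nu>2 :: "real ^ 'n \<Rightarrow> real \<Rightarrow> real"
    and q :: "complex ^ 'n \<Rightarrow> phase \<Rightarrow> complex"
    and \<sigma> c C \<epsilon>0 :: real
  assumes \<sigma>_pos: "\<sigma> > 0" and c_pos: "c > 0" and C_pos: "C > 0" and \<epsilon>0_pos: "\<epsilon>0 > 0"
    and \<nu>1_C1: "\<And>\<epsilon>. \<bar>\<epsilon>\<bar> < \<epsilon>0 \<Longrightarrow> \<exists>g :: real ^ 'n \<Rightarrow> real ^ 'n.
            continuous_on freq_box g \<and>
            (\<forall>\<omega>\<in>freq_box. ((\<lambda>\<omega>'. \<nu>1 \<omega>' \<epsilon>) has_derivative (\<lambda>v. g \<omega> \<bullet> v)) (at \<omega> within freq_box)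
                          \<and> norm (g \<omega>) \<le> C * \<epsilon>\<^sup>2)"
    and \<nu>2_C1: "\<And>\<epsilon>. \<bar>\<epsilon>\<bar> < \<epsilon>0 \<Longrightarrow> \<exists>g :: real ^ 'n \<Rightarrow> real ^ 'n.
            continuous_on freq_box g \<and>
            (\<forall>\<omega>\<in>freq_box. ((\<lambda>\<omega>'. \<nu>2 \<omega>' \<epsilon>) has_derivative (\<lambda>v. g \<omega> \<bullet> v)) (at \<omega> within freq_box)
                          \<and> norm (g \<omega>) \<le> C * \<epsilon>\<^sup>2)"
    and \<nu>1_bnd: "\<And>\<omega> \<epsilon>. \<omega> \<in> freq_box \<Longrightarrow> \<bar>\<epsilon>\<bar> < \<epsilon>0 \<Longrightarrow> c \<le> \<bar>\<nu>1 \<omega> \<epsilon>\<bar> \<and> \<bar>\<nu>1 \<omega> \<epsilon>\<bar> \<le> C"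
    and \<nu>2_bnd: "\<And>\<omega> \<epsilon>. \<omega> \<in> freq_box \<Longrightarrow> \<bar>\<epsilon>\<bar> < \<epsilon>0 \<Longrightarrow>
                   c * \<epsilon>\<^sup>2 \<le> \<bar>\<nu>2 \<omega> \<epsilon>\<bar> \<and> \<bar>\<nu>2 \<omega> \<epsilon>\<bar> \<le> C * \<epsilon>\<^sup>2"
    and q_poly: "\<exists>a :: coord \<Rightarrow> coord \<Rightarrow> complex ^ 'n \<Rightarrow> complex.
            (\<forall>i j. holo_on (a i j) (strip \<sigma>) \<and> torus_periodic (a i j)) \<and>
            (\<forall>\<theta> z. q \<theta> z = (\<Sum>i\<in>UNIV. \<Sum>j\<in>UNIV. a i j \<theta> * z $ i * z $ j))"
    and q_real: "\<And>(\<theta> :: real ^ 'n) x1 x2. q (cvec \<theta>)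
            (\<chi> k. case k of Xi1 \<Rightarrow> x1 | Eta1 \<Rightarrow> cnj x1 | Xi2 \<Rightarrow> x2 | Eta2 \<Rightarrow> cnj x2) \<in> \<real>"
  shows "\<exists>\<epsilon>s C'. \<epsilon>s > 0 \<and> C' > 0 \<and>
     (\<forall>\<epsilon>::real. \<bar>\<epsilon>\<bar> < \<epsilon>s \<longrightarrow>
       (\<exists>E \<subseteq> freq_box. E \<in> sets lebesgue \<and>
          measure lebesgue (freq_box - E) \<le> C' * \<bar>\<epsilon>\<bar> powr (1/9) \<and>
          (\<forall>\<omega>\<in>E. \<exists>(A :: complex ^ 'n \<Rightarrow> complex ^ coord ^ coord) \<sigma>' \<nu>t1 \<nu>t2.
             \<sigma>' > 0 \<and>
             (\<forall>i j. holo_on (\<lambda>\<theta>. A \<theta> $ i $ j) (strip \<sigma>') \<and> torus_periodic (\<lambda>\<theta>. A \<theta> $ i $ j)) \<and>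
             (\<forall>\<theta>. hamiltonian_matrix (A \<theta>)) \<and>
             (\<forall>\<theta>\<in>strip \<sigma>'. norm (A \<theta>) \<le> C' * \<bar>\<epsilon>\<bar>) \<and>
             \<bar>\<nu>t1 - \<nu>1 \<omega> \<epsilon>\<bar> \<le> C' * \<bar>\<epsilon>\<bar> ^ 3 \<and>
             \<bar>\<nu>t2 - \<nu>2 \<omega> \<epsilon>\<bar> \<le> C' * \<bar>\<epsilon>\<bar> ^ 3 \<and>
             (\<forall>x :: real \<Rightarrow> phase.
                ham_solution
                  (\<lambda>t z. complex_of_real (\<nu>1 \<omega> \<epsilon>) * z $ Xi1 * z $ Eta1
                        + complex_of_real (\<nu>2 \<omega> \<epsilon>) * z $ Xi2 * z $ Eta2
                        + complex_of_real (\<epsilon> ^ 3) * q (cvec (t *\<^sub>R \<omega>)) z) x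
                \<longleftrightarrow>
                ham_solution
                  (\<lambda>t z. complex_of_real \<nu>t1 * z $ Xi1 * z $ Eta1
                        + complex_of_real \<nu>t2 * z $ Xi2 * z $ Eta2)
                  (\<lambda>t. mexp (A (cvec (t *\<^sub>R \<omega>))) *v x t)))))"
proof -
  obtain a :: "coord \<Rightarrow> coord \<Rightarrow> complex ^ 'n \<Rightarrow> complex" where
    a: "\<And>i j. holo_on (a i j) (strip \<sigma>)" "\<And>i j. torus_periodic (a i j)"
    and q: "\<And>\<theta> z. q \<theta> z = (\<Sum>i\<in>UNIV. \<Sum>j\<in>UNIV. a i j \<theta> * z $ i * z $ j)"
    using q_poly by blast
  obtain M1 where M1: "0 \<le> M1" "\<And>E. qpm E (\<sigma> / 4) M1 (\<lambda>\<omega> t. hmat (\<lambda>i j. a i j (cvec (t *\<^sub>R \<omega>))))"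
    using quadratic_coefficients_qpm[of \<sigma> a, OF \<sigma>_pos a] by blast
  define q0 where "q0 \<omega> t = hmat (\<lambda>i j. a i j (cvec (t *\<^sub>R \<omega>)))" for \<omega> :: "real ^ 'n" and t
  define s where "s = \<sigma> / 4"
  have s: "0 < s" using \<sigma>_pos by (simp add: s_def)
  have q0s: "star (q0 \<omega> t) = - q0 \<omega> t" for \<omega> t unfolding q0_def by (rule star_hmat)
  have q0c: "cj (q0 \<omega> t) = q0 \<omega> t" for \<omega> t
  proof (rule sqmat_eqI)
    fix k j
    have r: "cnj (a i l (cvec (t *\<^sub>R \<omega>)) + a l i (cvec (t *\<^sub>R \<omega>))) = a (bar i) (bar l) (cvec (t *\<^sub>R \<omega>)) + a (bar l) (bar i) (cvec (t *\<^sub>R \<omega>))" for i l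
      by (rule real_quadratic_form) (use q_real[of "t *\<^sub>R \<omega>"] in \<open>simp only: q\<close>)
    show "ent (cj (q0 \<omega> t)) k j = ent (q0 \<omega> t) k j"
      using r[of k "bar j"] by (simp add: ent_cj q0_def ent_hmat)
  qed
  define K where "K = 16 * (2 + 12 / s) + 1 / c + 2 * (C + 1) / c\<^sup>2"
  define B where "B = (4::real) * 4 ^ (CARD('n) + 1)"
  define Cm where "Cm = 32 * (2 + 24 / s) ^ CARD('n) * (2 * pi + 1) ^ CARD('n)"
  have K0: "0 < K"
  proof -
    have "0 < 16 * (2 + 12 / s)" using s by (intro mult_pos_pos add_pos_pos divide_pos_pos) auto
    moreover have "0 < 1 / c" "0 < 2 * (C + 1) / c\<^sup>2" using c_pos C_pos by (simp_all add: add_pos_pos)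
    ultimately show ?thesis unfolding K_def by linarith
  qed
  have B0: "0 < B" by (simp add: B_def)
  have Cm0: "0 \<le> Cm" unfolding Cm_def using s by (auto simp: add_nonneg_nonneg)
  \<comment> \<open>The summands cover the lost measure, the size of \<open>A\<close> (128 = 8 * 16,
    from the logarithm and the iteration) and the drift of the frequencies; the 1 keeps
    \<open>C'\<close> positive.\<close>
  define C' where "C' = Cm + 128 * K * M1 + 2 * M1 + 1"
  \<comment> \<open>In order: the range of the hypotheses, |\<epsilon>| <= 1, the two smallness
    conditions on \<beta>, the Lipschitz bound for the eigenvalues, the separation of |\<nu>1| from
    |\<nu>2|, and the bound 1/32 under which the logarithm is taken. The added 1 covers
    \<open>M1 = 0\<close>.\<close>
  define \<epsilon>s where "\<epsilon>s = min \<epsilon>0 (min 1 (min (1 / (80 * K * B * M1 + 1)) (min (c / (4 * M1 + 1)) (min (1 / (4 * (C + 1))) (min (c / (C + 2 * c)) (1 / (512 * K * M1 + 1)))))))"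
  have KBM: "0 \<le> 80 * K * B * M1" "0 \<le> 512 * K * M1" using K0 B0 M1(1) by auto
  have es: "0 < \<epsilon>s" 
  proof -
    have "0 < 1 / (80 * K * B * M1 + 1)" "0 < c / (4 * M1 + 1)" "0 < 1 / (4 * (C + 1))" "0 < c / (C + 2 * c)" "0 < 1 / (512 * K * M1 + 1)"
      using KBM M1(1) c_pos C_pos by (simp_all add: add_nonneg_pos add_pos_pos)
    then show ?thesis unfolding \<epsilon>s_def min_less_iff_conj using \<epsilon>0_pos zero_less_one[where 'a = real] by blast
  qed
  have C'0: "0 < C'" unfolding C'_def using Cm0 K0 M1(1) by (simp add: add_nonneg_pos)
  have "\<exists>E \<subseteq> freq_box. E \<in> sets lebesgue \<and>
          measure lebesgue (freq_box - E) \<le> C' * \<bar>\<epsilon>\<bar> powr (1/9) \<and>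
          (\<forall>\<omega>\<in>E. \<exists>(A :: complex ^ 'n \<Rightarrow> complex ^ coord ^ coord) \<sigma>' \<nu>t1 \<nu>t2.
             \<sigma>' > 0 \<and>
             (\<forall>i j. holo_on (\<lambda>\<theta>. A \<theta> $ i $ j) (strip \<sigma>') \<and> torus_periodic (\<lambda>\<theta>. A \<theta> $ i $ j)) \<and>
             (\<forall>\<theta>. hamiltonian_matrix (A \<theta>)) \<and>
             (\<forall>\<theta>\<in>strip \<sigma>'. norm (A \<theta>) \<le> C' * \<bar>\<epsilon>\<bar>) \<and>
             \<bar>\<nu>t1 - \<nu>1 \<omega> \<epsilon>\<bar> \<le> C' * \<bar>\<epsilon>\<bar> ^ 3 \<and>
             \<bar>\<nu>t2 - \<nu>2 \<omega> \<epsilon>\<bar> \<le> C' * \<bar>\<epsilon>\<bar> ^ 3 \<and>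
             (\<forall>x :: real \<Rightarrow> phase.
                ham_solution
                  (\<lambda>t z. complex_of_real (\<nu>1 \<omega> \<epsilon>) * z $ Xi1 * z $ Eta1
                        + complex_of_real (\<nu>2 \<omega> \<epsilon>) * z $ Xi2 * z $ Eta2
                        + complex_of_real (\<epsilon> ^ 3) * q (cvec (t *\<^sub>R \<omega>)) z) x
                \<longleftrightarrow>
                ham_solution
                  (\<lambda>t z. complex_of_real \<nu>t1 * z $ Xi1 * z $ Eta1
                        + complex_of_real \<nu>t2 * z $ Xi2 * z $ Eta2)
                  (\<lambda>t. mexp (A (cvec (t *\<^sub>R \<omega>))) *v x t)))"
    if eps: "\<bar>\<epsilon>\<bar> < \<epsilon>s" for \<epsilon> :: real
  proof (cases "\<epsilon> = 0")
    \<comment> \<open>Here the two Hamiltonians coincide and \<open>A = 0\<close> works for every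
      \<omega>. As \<open>0 powr (1/9)\<close> is 0, no parameter set of positive measure may be
      lost, and the iteration, which needs a positive gap, does not apply.\<close>
    case True
    have m0: "mexp (0 :: complex ^ coord ^ coord) = mat 1"
    proof -
      have "tomat 0 = (0 :: complex ^ coord ^ coord)" by (simp add: tomat_def vec_eq_iff ent_simps)
      then show ?thesis using mexp_tomat[of "0 :: coord sqmat"] by (simp add: tomat_one)
    qed
    have "holo_on (\<lambda>\<theta> :: complex ^ 'n. 0) (strip 1)"
      unfolding holo_on_def by (auto intro!: open_strip exI[of _ 0])
    moreover have "hamiltonian_matrix 0" by (simp add: hamiltonian_matrix_def symp_def)
    ultimately have "\<exists>(A :: complex ^ 'n \<Rightarrow> complex ^ coord ^ coord) \<sigma>' \<nu>t1 \<nu>t2.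
             \<sigma>' > 0 \<and>
             (\<forall>i j. holo_on (\<lambda>\<theta>. A \<theta> $ i $ j) (strip \<sigma>') \<and> torus_periodic (\<lambda>\<theta>. A \<theta> $ i $ j)) \<and>
             (\<forall>\<theta>. hamiltonian_matrix (A \<theta>)) \<and>
             (\<forall>\<theta>\<in>strip \<sigma>'. norm (A \<theta>) \<le> C' * \<bar>\<epsilon>\<bar>) \<and>
             \<bar>\<nu>t1 - \<nu>1 \<omega> \<epsilon>\<bar> \<le> C' * \<bar>\<epsilon>\<bar> ^ 3 \<and>
             \<bar>\<nu>t2 - \<nu>2 \<omega> \<epsilon>\<bar> \<le> C' * \<bar>\<epsilon>\<bar> ^ 3 \<and>
             (\<forall>x :: real \<Rightarrow> phase.
                ham_solution
                  (\<lambda>t z. complex_of_real (\<nu>1 \<omega> \<epsilon>) * z $ Xi1 * z $ Eta1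
                        + complex_of_real (\<nu>2 \<omega> \<epsilon>) * z $ Xi2 * z $ Eta2
                        + complex_of_real (\<epsilon> ^ 3) * q (cvec (t *\<^sub>R \<omega>)) z) x
                \<longleftrightarrow>
                ham_solution
                  (\<lambda>t z. complex_of_real \<nu>t1 * z $ Xi1 * z $ Eta1
                        + complex_of_real \<nu>t2 * z $ Xi2 * z $ Eta2)
                  (\<lambda>t. mexp (A (cvec (t *\<^sub>R \<omega>))) *v x t))" for \<omega>
      using True
      by (intro exI[of _ "\<lambda>_. 0"] exI[of _ 1] exI[of _ "\<nu>1 \<omega> \<epsilon>"] exI[of _ "\<nu>2 \<omega> \<epsilon>"])
         (simp add: m0 torus_periodic_def)
    then show ?thesis
      using True by (intro exI[of _ freq_box] conjI ballI) (simp_all add: freq_box_sets)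
  next
    case False
    \<comment> \<open>The iteration works with a positive parameter; the sign of \<epsilon> survives
      only in the factor \<epsilon>^3 of \<open>Q0\<close>.\<close>
    define e where "e = \<bar>\<epsilon>\<bar>"
    have e0: "0 < e" using False by (simp add: e_def)
    note eps' = eps[unfolded \<epsilon>s_def min_less_iff_conj, folded e_def]
    have e1: "e \<le> 1" "\<bar>\<epsilon>\<bar> < \<epsilon>0" using eps' by (simp_all add: e_def)
    have ee: "e\<^sup>2 = \<epsilon>\<^sup>2" "e ^ 3 = \<bar>\<epsilon>\<bar> ^ 3" by (simp_all add: e_def)
    have e2: "e\<^sup>2 \<le> e" using e0 e1(1) by (simp add: power2_eq_square mult_left_le)
    have lim: "e < 1 / (80 * K * B * M1 + 1)" "e < c / (4 * M1 + 1)" "e < 1 / (4 * (C + 1))" "e < c / (C + 2 * c)" "e < 1 / (512 * K * M1 + 1)"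
      using eps' by blast+
    have b1: "e * (80 * K * B * M1) \<le> 1"
    proof -
      have "e * (80 * K * B * M1 + 1) < 1" using lim(1) KBM by (simp add: pos_less_divide_eq)
      then show ?thesis using e0 by (simp add: distrib_left)
    qed
    have b2: "e * (4 * M1) \<le> c"
    proof -
      have "e * (4 * M1 + 1) < c" using lim(2) M1(1) by (simp add: pos_less_divide_eq)
      then show ?thesis using e0 by (simp add: distrib_left)
    qed
    have b3: "4 * (C + 1) * e\<^sup>2 \<le> 1"
    proof -
      have "e * (4 * (C + 1)) < 1" using lim(3) C_pos by (simp add: pos_less_divide_eq)
      moreover have "4 * (C + 1) * e\<^sup>2 \<le> 4 * (C + 1) * e" using e2 C_pos by (intro mult_left_mono) auto
      ultimately show ?thesis by (simp add: mult.commute)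
    qed
    \<comment> \<open>Makes |\<nu>1| - |\<nu>2| >= c - C e^2 at least 2 c e^2, so that the mixed
      gaps are no smaller than the one between the eigenvalues of the slow pair.\<close>
    have b4: "(C + 2 * c) * e\<^sup>2 \<le> c"
    proof -
      have "e * (C + 2 * c) < c" using lim(4) C_pos c_pos by (simp add: pos_less_divide_eq)
      moreover have "(C + 2 * c) * e\<^sup>2 \<le> (C + 2 * c) * e" using e2 C_pos c_pos by (intro mult_left_mono) auto
      ultimately show ?thesis by (simp add: mult.commute)
    qed
    have b5: "16 * K * (M1 * e) \<le> 1/32"
    proof -
      have "e * (512 * K * M1 + 1) < 1" using lim(5) KBM by (simp add: pos_less_divide_eq)
      then show ?thesis using e0 by (simp add: algebra_simps)
    qed
    define l0 where "l0 \<omega> = dlam (\<nu>1 \<omega> \<epsilon>) (\<nu>2 \<omega> \<epsilon>)" for \<omega>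
    define Q0 where "Q0 \<omega> t = (\<epsilon> ^ 3) *\<^sub>R q0 \<omega> t" for \<omega> t
    have lip1: "\<bar>\<nu>1 x \<epsilon> - \<nu>1 y \<epsilon>\<bar> \<le> C * e\<^sup>2 * dist x y" if "x \<in> freq_box" "y \<in> freq_box" for x y
    proof -
      obtain g where "\<forall>\<omega>\<in>freq_box. ((\<lambda>\<omega>'. \<nu>1 \<omega>' \<epsilon>) has_derivative (\<lambda>v. g \<omega> \<bullet> v)) (at \<omega> within freq_box) \<and> norm (g \<omega>) \<le> C * \<epsilon>\<^sup>2"
        using \<nu>1_C1[OF e1(2)] by blast
      then show ?thesis unfolding ee by (intro freq_box_lipschitz[OF _ _ that]) blast+
    qed
    have lip2: "\<bar>\<nu>2 x \<epsilon> - \<nu>2 y \<epsilon>\<bar> \<le> C * e\<^sup>2 * dist x y" if "x \<in> freq_box" "y \<in> freq_box" for x y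
    proof -
      obtain g where "\<forall>\<omega>\<in>freq_box. ((\<lambda>\<omega>'. \<nu>2 \<omega>' \<epsilon>) has_derivative (\<lambda>v. g \<omega> \<bullet> v)) (at \<omega> within freq_box) \<and> norm (g \<omega>) \<le> C * \<epsilon>\<^sup>2"
        using \<nu>2_C1[OF e1(2)] by blast
      then show ?thesis unfolding ee by (intro freq_box_lipschitz[OF _ _ that]) blast+
    qed
    have l0_lip: "\<bar>l0 x i - l0 y i\<bar> \<le> C * e\<^sup>2 * dist x y" if "x \<in> freq_box" "y \<in> freq_box" for x y i
      using lip1[OF that] lip2[OF that] unfolding l0_def by (cases i) (simp_all add: abs_minus_commute)
    have gap: "2 * c * e\<^sup>2 \<le> \<bar>l0 \<omega> j - l0 \<omega> i\<bar>" if w: "\<omega> \<in> freq_box" and ij: "i \<noteq> j" for \<omega> i j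
    proof -
      have n1: "c \<le> \<bar>\<nu>1 \<omega> \<epsilon>\<bar>" and n2: "c * e\<^sup>2 \<le> \<bar>\<nu>2 \<omega> \<epsilon>\<bar>" "\<bar>\<nu>2 \<omega> \<epsilon>\<bar> \<le> C * e\<^sup>2"
        using \<nu>1_bnd[OF w e1(2)] \<nu>2_bnd[OF w e1(2)] unfolding ee by auto
      have "c * e\<^sup>2 \<le> c * 1" using e2 e1(1) c_pos by (intro mult_left_mono) auto
      moreover have "2 * c * e\<^sup>2 + C * e\<^sup>2 \<le> c" using b4 by (simp add: algebra_simps)
      ultimately have "2 * c * e\<^sup>2 \<le> \<bar>\<nu>1 \<omega> \<epsilon>\<bar> - \<bar>\<nu>2 \<omega> \<epsilon>\<bar>" using n1 n2 by linarith
      then show ?thesis unfolding l0_def using n1 n2 \<open>c * e\<^sup>2 \<le> c * 1\<close> c_pos ij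
        by (intro dlam_gap) auto
    qed
    \<comment> \<open>Of the three powers of e two match the order of the gap, and the third enters
      \<beta>, which is \<open>M1 * e\<close>.\<close>
    have Q0q: "qpm freq_box s (e\<^sup>2 * (M1 * e)) Q0"
    proof -
      have "qpm freq_box s (\<bar>\<epsilon> ^ 3\<bar> * M1) Q0"
        unfolding Q0_def using M1(2)[of freq_box] s by (intro qpm_scaleR) (simp_all add: q0_def s_def)
      moreover have "\<bar>\<epsilon> ^ 3\<bar> * M1 = e\<^sup>2 * (M1 * e)" unfolding e_def power_abs by (simp add: power2_eq_square power3_eq_cube)
      ultimately show ?thesis by simp
    qed
    have Q0s: "star (Q0 \<omega> t) = - Q0 \<omega> t" "cj (Q0 \<omega> t) = Q0 \<omega> t" for \<omega> t
      by (simp_all add: Q0_def q0s q0c)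
    have beta: "0 \<le> M1 * e" "80 * K * B * (M1 * e) \<le> 1" "4 * (M1 * e) \<le> c"
      using M1(1) e0 b1 b2 by (simp_all add: mult_ac)
    have l0_bar: "l0 \<omega> (bar i) = - l0 \<omega> i" for \<omega> i by (simp add: l0_def dlam_bar)
    obtain E X l where E: "E \<subseteq> freq_box" "E \<in> sets lebesgue"
      and meas: "measure lebesgue (freq_box - E) \<le> Cm * e"
      and X: "qpm E (s / 2) (16 * K * (M1 * e)) X"
      and main: "\<And>\<omega>. \<omega> \<in> E \<Longrightarrow> (\<forall>i. \<bar>l \<omega> i - l0 \<omega> i\<bar> \<le> 2 * e\<^sup>2 * (M1 * e)) \<and> (\<forall>i. l \<omega> (bar i) = - l \<omega> i) \<and>
      (\<forall>t. (1 + X \<omega> t) * star (1 + X \<omega> t) = 1 \<and> star (1 + X \<omega> t) * (1 + X \<omega> t) = 1 \<and>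
        ((\<lambda>t. 1 + X \<omega> t) has_vector_derivative
          Dg (l \<omega>) * (1 + X \<omega> t) - (1 + X \<omega> t) * (Dg (l0 \<omega>) + Q0 \<omega> t)) (at t))"
      using kam_iteration[where ?l0.0 = l0 and ?Q0.0 = Q0, OF s c_pos less_imp_le[OF C_pos] e0 e1(1) b3 K_def B_def beta l0_bar l0_lip gap Q0q Q0s(1) Q0s(2)]
      unfolding Cm_def[symmetric] by blast
    \<comment> \<open>The iteration loses only O(e), which for e <= 1 is stronger than the exponent
      1/9.\<close>
    have "measure lebesgue (freq_box - E) \<le> C' * \<bar>\<epsilon>\<bar> powr (1/9)"
    proof -
      have "e = e powr 1" using e0 by simp
      also have "\<dots> \<le> e powr (1/9)" using e0 e1(1) by (intro powr_mono') auto
      finally have "Cm * e \<le> C' * e powr (1/9)"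
        using Cm0 C'0 K0 M1(1) e0 by (intro mult_mono) (auto simp: C'_def)
      then show ?thesis using meas by (simp add: e_def)
    qed
    moreover have "\<exists>(A :: complex ^ 'n \<Rightarrow> complex ^ coord ^ coord) \<sigma>' \<nu>t1 \<nu>t2.
             \<sigma>' > 0 \<and>
             (\<forall>i j. holo_on (\<lambda>\<theta>. A \<theta> $ i $ j) (strip \<sigma>') \<and> torus_periodic (\<lambda>\<theta>. A \<theta> $ i $ j)) \<and>
             (\<forall>\<theta>. hamiltonian_matrix (A \<theta>)) \<and>
             (\<forall>\<theta>\<in>strip \<sigma>'. norm (A \<theta>) \<le> C' * \<bar>\<epsilon>\<bar>) \<and>
             \<bar>\<nu>t1 - \<nu>1 \<omega> \<epsilon>\<bar> \<le> C' * \<bar>\<epsilon>\<bar> ^ 3 \<and>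
             \<bar>\<nu>t2 - \<nu>2 \<omega> \<epsilon>\<bar> \<le> C' * \<bar>\<epsilon>\<bar> ^ 3 \<and>
             (\<forall>x :: real \<Rightarrow> phase.
                ham_solution
                  (\<lambda>t z. complex_of_real (\<nu>1 \<omega> \<epsilon>) * z $ Xi1 * z $ Eta1
                        + complex_of_real (\<nu>2 \<omega> \<epsilon>) * z $ Xi2 * z $ Eta2
                        + complex_of_real (\<epsilon> ^ 3) * q (cvec (t *\<^sub>R \<omega>)) z) x
                \<longleftrightarrow>
                ham_solution
                  (\<lambda>t z. complex_of_real \<nu>t1 * z $ Xi1 * z $ Eta1
                        + complex_of_real \<nu>t2 * z $ Xi2 * z $ Eta2)
                  (\<lambda>t. mexp (A (cvec (t *\<^sub>R \<omega>))) *v x t))" if w: "\<omega> \<in> E" for \<omega>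
    proof -
      have ll: "\<bar>l \<omega> i - l0 \<omega> i\<bar> \<le> C' * \<bar>\<epsilon>\<bar> ^ 3" for i
      proof -
        have "\<bar>l \<omega> i - l0 \<omega> i\<bar> \<le> 2 * e\<^sup>2 * (M1 * e)" using main[OF w] by blast
        also have "\<dots> = (2 * M1) * e ^ 3" by (simp add: power2_eq_square power3_eq_cube)
        also have "\<dots> \<le> C' * e ^ 3" using Cm0 K0 M1(1) e0 by (intro mult_right_mono) (auto simp: C'_def)
        finally show ?thesis by (simp add: e_def)
      qed
      have lb: "l \<omega> (bar i) = - l \<omega> i" for i using main[OF w] by blast
      have V: "((\<lambda>t. 1 + X \<omega> t) has_vector_derivative Dg (l \<omega>) * (1 + X \<omega> t) - (1 + X \<omega> t) * (Dg (l0 \<omega>) + Q0 \<omega> t)) (at t)"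
        and sym: "(1 + X \<omega> t) * star (1 + X \<omega> t) = 1" "star (1 + X \<omega> t) * (1 + X \<omega> t) = 1" for t
        using main[OF w] by blast+
      obtain A :: "complex ^ 'n \<Rightarrow> complex ^ coord ^ coord" where
        A: "\<forall>i j. holo_on (\<lambda>\<theta>. A \<theta> $ i $ j) (strip (s / 4)) \<and> torus_periodic (\<lambda>\<theta>. A \<theta> $ i $ j)"
          "\<forall>\<theta>. hamiltonian_matrix (A \<theta>)" "\<forall>\<theta>. norm (A \<theta>) \<le> 8 * (16 * K * (M1 * e))"
          "\<forall>t. mexp (A (cvec (t *\<^sub>R \<omega>))) = tomat (1 + X \<omega> t)"
        using logarithm_on_strip[OF X w _ _ b5 sym, of "s / 4"] s by auto
      have nA: "norm (A \<theta>) \<le> C' * \<bar>\<epsilon>\<bar>" for \<theta>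
      proof -
        have "norm (A \<theta>) \<le> (128 * K * M1) * e" using A(3) by (simp add: mult_ac)
        also have "\<dots> \<le> C' * e" using Cm0 M1(1) e0 by (intro mult_right_mono) (auto simp: C'_def)
        finally show ?thesis by (simp add: e_def)
      qed
      have Dl0: "star (Dg (l0 \<omega>)) = - Dg (l0 \<omega>)" by (rule star_Dg) (simp add: l0_def dlam_bar)
      have Dl: "star (Dg (l \<omega>)) = - Dg (l \<omega>)" by (rule star_Dg) (rule lb)
      have f1: "ham_field (\<lambda>z. complex_of_real (\<nu>1 \<omega> \<epsilon>) * z $ Xi1 * z $ Eta1
                        + complex_of_real (\<nu>2 \<omega> \<epsilon>) * z $ Xi2 * z $ Eta2
                        + complex_of_real (\<epsilon> ^ 3) * q (cvec (t *\<^sub>R \<omega>)) z) z = tomat (Dg (l0 \<omega>) + Q0 \<omega> t) *v z" for t z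
      proof -
        let ?g = "\<lambda>i j. gdiag (of_real (\<nu>1 \<omega> \<epsilon>)) (of_real (\<nu>2 \<omega> \<epsilon>)) i j + of_real (\<epsilon> ^ 3) * a i j (cvec (t *\<^sub>R \<omega>))"
        have "complex_of_real (\<nu>1 \<omega> \<epsilon>) * z $ Xi1 * z $ Eta1
                        + complex_of_real (\<nu>2 \<omega> \<epsilon>) * z $ Xi2 * z $ Eta2
                        + complex_of_real (\<epsilon> ^ 3) * q (cvec (t *\<^sub>R \<omega>)) z = (\<Sum>i\<in>UNIV. \<Sum>j\<in>UNIV. ?g i j * z $ i * z $ j)" for z
          unfolding gdiag_form[symmetric] q sum_distrib_left distrib_right sum.distrib by (simp only: mult.assoc)
        moreover have "hmat ?g = Dg (l0 \<omega>) + Q0 \<omega> t"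
        proof -
          have "hmat ?g = hmat (gdiag (of_real (\<nu>1 \<omega> \<epsilon>)) (of_real (\<nu>2 \<omega> \<epsilon>))) + Q0 \<omega> t"
            by (rule sqmat_eqI) (simp add: ent_hmat ent_simps Q0_def q0_def scaleR_conv_of_real[where 'a = complex] algebra_simps)
          then show ?thesis by (simp add: hmat_gdiag l0_def)
        qed
        ultimately show ?thesis using ham_field_quadratic[of ?g z] by simp
      qed
      have f2: "ham_field (\<lambda>z. complex_of_real (l \<omega> Eta1) * z $ Xi1 * z $ Eta1
                        + complex_of_real (l \<omega> Eta2) * z $ Xi2 * z $ Eta2) z = tomat (Dg (l \<omega>)) *v z" for z
      proof -
        have "dlam (l \<omega> Eta1) (l \<omega> Eta2) = l \<omega>" by (rule antisymmetric_dlam) (rule lb)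
        then show ?thesis
          using ham_field_quadratic[of "gdiag (of_real (l \<omega> Eta1)) (of_real (l \<omega> Eta2))" z]
          by (simp add: gdiag_form hmat_gdiag)
      qed
      have "star (Dg (l0 \<omega>) + Q0 \<omega> t) = - (Dg (l0 \<omega>) + Q0 \<omega> t)" for t by (simp add: Dl0 Q0s)
      from conjugation_iff[OF V sym Dl this]
      have sol: "ham_solution
                  (\<lambda>t z. complex_of_real (\<nu>1 \<omega> \<epsilon>) * z $ Xi1 * z $ Eta1
                        + complex_of_real (\<nu>2 \<omega> \<epsilon>) * z $ Xi2 * z $ Eta2
                        + complex_of_real (\<epsilon> ^ 3) * q (cvec (t *\<^sub>R \<omega>)) z) x
                \<longleftrightarrow>
                ham_solution
                  (\<lambda>t z. complex_of_real (l \<omega> Eta1) * z $ Xi1 * z $ Eta1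
                        + complex_of_real (l \<omega> Eta2) * z $ Xi2 * z $ Eta2)
                  (\<lambda>t. mexp (A (cvec (t *\<^sub>R \<omega>))) *v x t)" for x
        unfolding ham_solution_def f1 f2 A(4)[rule_format] .
      have n: "\<bar>l \<omega> Eta1 - \<nu>1 \<omega> \<epsilon>\<bar> \<le> C' * \<bar>\<epsilon>\<bar> ^ 3" "\<bar>l \<omega> Eta2 - \<nu>2 \<omega> \<epsilon>\<bar> \<le> C' * \<bar>\<epsilon>\<bar> ^ 3"
        using ll[of Eta1] ll[of Eta2] by (simp_all add: l0_def)
      have s4: "0 < s / 4" using s by simp
      show ?thesis
        by (rule exI[of _ A], rule exI[of _ "s / 4"], rule exI[of _ "l \<omega> Eta1"], rule exI[of _ "l \<omega> Eta2"])
           (intro conjI ballI allI s4 A(1)[rule_format, THEN conjunct1] A(1)[rule_format, THEN conjunct2] A(2)[rule_format] nA n sol)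
    qed
    ultimately show ?thesis using E by blast
  qed
  then show ?thesis using es C'0 by blast
qed

end
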